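(* Let $R$ be an $h$-local domain with at least two different maximal ideals $\mathfrak m_1,\mathfrak m_2$. For $i=1,2$, let $M_i$ be a finitely generated, indecomposable, torsion-free $R_{\mathfrak m_i}$-module with local endomorphism ring and rank $r_i$. Then: (1) for $i=1,2$ there exists a finitely generated, indecomposable, torsion-free $R$-module $X_i$ such that $(X_i)_{\mathfrak m_i}\cong M_i$ and $(X_i)_{\mathfrak m}\cong R_\mathfrak m^{r_i}$ for every maximal ideal $\mathfrak m\neq \mathfrak m_i$; (2) if $r_1$ and $r_2$ are not coprime, then $\mathrm{Add}(X_1\oplus X_2)$ contains modules that are not direct sums of finitely generated modules.
   Context: A commutative domain is $h$-local if every non-zero element lies in only finitely many maximal ideals and every non-zero prime ideal is contained in a unique maximal ideal. A module $M$ over a domain with field of fractions $Q$ is torsion-free if $M\to M\otimes_R Q$ is injective; its rank is $\dim_Q(M\otimes_RQ)$. $\mathrm{Add}(M)$ is the class of modules isomorphic to direct summands of direct sums of copies of $M$. *)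

theory Defs
  imports "HOL-Algebra.Algebra"
begin

definition h_local :: "('a, 'r) ring_scheme \<Rightarrow> bool" where
  "h_local R \<longleftrightarrow> domain R
     \<and> (\<forall>a \<in> carrier R - {\<zero>\<^bsub>R\<^esub>}. finite {m. maximalideal m R \<and> a \<in> m})
     \<and> (\<forall>P. primeideal P R \<and> P \<noteq> {\<zero>\<^bsub>R\<^esub>} \<longrightarrow> (\<exists>!m. maximalideal m R \<and> P \<subseteq> m))"

definition loc_rel :: "('a, 'c, 'm) module_scheme \<Rightarrow> 'a set \<Rightarrow> (('c \<times> 'a) \<times> ('c \<times> 'a)) set" where
  "loc_rel M S = {((x, s), (y, t)). x \<in> carrier M \<and> y \<in> carrier M \<and> s \<in> S \<and> t \<in> S \<and>
      (\<exists>u\<in>S. u \<odot>\<^bsub>M\<^esub> ((t \<odot>\<^bsub>M\<^esub> x) \<ominus>\<^bsub>M\<^esub> (s \<odot>\<^bsub>M\<^esub> y)) = \<zero>\<^bsub>M\<^esub>)}"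

definition loc_class :: "('a, 'c, 'm) module_scheme \<Rightarrow> 'a set \<Rightarrow> 'c \<Rightarrow> 'a \<Rightarrow> ('c \<times> 'a) set" where
  "loc_class M S x s = loc_rel M S `` {(x, s)}"

definition loc_mod :: "('a, 'r) ring_scheme \<Rightarrow> ('a, 'c, 'm) module_scheme \<Rightarrow> 'a set
    \<Rightarrow> (('a \<times> 'a) set, ('c \<times> 'a) set) module" where
  "loc_mod R M S =
    \<lparr>carrier = (carrier M \<times> S) // loc_rel M S,
     monoid.mult = (\<lambda>U V. undefined), one = undefined,
     ring.zero = loc_class M S \<zero>\<^bsub>M\<^esub> \<one>\<^bsub>R\<^esub>,
     ring.add = (\<lambda>U V. let (x, s) = (SOME p. p \<in> U); (y, t) = (SOME p. p \<in> V)
                  in loc_class M S ((t \<odot>\<^bsub>M\<^esub> x) \<oplus>\<^bsub>M\<^esub> (s \<odot>\<^bsub>M\<^esub> y)) (s \<otimes>\<^bsub>R\<^esub> t)),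
     smult = (\<lambda>A U. let (a, u) = (SOME p. p \<in> A); (x, s) = (SOME p. p \<in> U)
                  in loc_class M S (a \<odot>\<^bsub>M\<^esub> x) (u \<otimes>\<^bsub>R\<^esub> s))\<rparr>"

definition ring_as_mod :: "('a, 'r) ring_scheme \<Rightarrow> ('a, 'a) module" where
  "ring_as_mod R = \<lparr>carrier = carrier R, monoid.mult = monoid.mult R, one = \<one>\<^bsub>R\<^esub>,
     ring.zero = \<zero>\<^bsub>R\<^esub>, ring.add = ring.add R, smult = monoid.mult R\<rparr>"

definition loc_ring :: "('a, 'r) ring_scheme \<Rightarrow> 'a set \<Rightarrow> ('a \<times> 'a) set ring" where
  "loc_ring R S =
    \<lparr>carrier = carrier (loc_mod R (ring_as_mod R) S),
     monoid.mult = (\<lambda>A B. let (a, s) = (SOME p. p \<in> A); (b, t) = (SOME p. p \<in> B)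
                  in loc_class (ring_as_mod R) S (a \<otimes>\<^bsub>R\<^esub> b) (s \<otimes>\<^bsub>R\<^esub> t)),
     one = loc_class (ring_as_mod R) S \<one>\<^bsub>R\<^esub> \<one>\<^bsub>R\<^esub>,
     ring.zero = ring.zero (loc_mod R (ring_as_mod R) S),
     ring.add = ring.add (loc_mod R (ring_as_mod R) S)\<rparr>"

abbreviation loc_at :: "('a, 'r) ring_scheme \<Rightarrow> 'a set \<Rightarrow> ('a \<times> 'a) set ring" where
  "loc_at R p \<equiv> loc_ring R (carrier R - p)"

abbreviation mod_loc_at :: "('a, 'r) ring_scheme \<Rightarrow> ('a, 'c, 'm) module_scheme \<Rightarrow> 'a set
    \<Rightarrow> (('a \<times> 'a) set, ('c \<times> 'a) set) module" where
  "mod_loc_at R M p \<equiv> loc_mod R M (carrier R - p)"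

text \<open>Field of fractions Q (R domain) and M \<otimes>_R Q = (R-{0})^{-1} M.\<close>
abbreviation nonzeros :: "('a, 'r) ring_scheme \<Rightarrow> 'a set" where
  "nonzeros R \<equiv> carrier R - {\<zero>\<^bsub>R\<^esub>}"

abbreviation frac_field :: "('a, 'r) ring_scheme \<Rightarrow> ('a \<times> 'a) set ring" where
  "frac_field R \<equiv> loc_ring R (nonzeros R)"

definition span :: "('a, 'r) ring_scheme \<Rightarrow> ('a, 'c, 'm) module_scheme \<Rightarrow> 'c set \<Rightarrow> 'c set" where
  "span R M G = {finsum M (\<lambda>g. c g \<odot>\<^bsub>M\<^esub> g) F | c F. finite F \<and> F \<subseteq> G \<and> c \<in> F \<rightarrow> carrier R}"

definition fin_gen :: "('a, 'r) ring_scheme \<Rightarrow> ('a, 'c, 'm) module_scheme \<Rightarrow> bool" where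
  "fin_gen R M \<longleftrightarrow> (\<exists>G. finite G \<and> G \<subseteq> carrier M \<and> span R M G = carrier M)"

text \<open>Torsion-free: the canonical map M \<rightarrow> M \<otimes>_R Q, x \<mapsto> x/1, is injective.\<close>
definition torsion_free :: "('a, 'r) ring_scheme \<Rightarrow> ('a, 'c, 'm) module_scheme \<Rightarrow> bool" where
  "torsion_free R M \<longleftrightarrow> inj_on (\<lambda>x. loc_class M (nonzeros R) x \<one>\<^bsub>R\<^esub>) (carrier M)"

definition is_basis :: "('k, 'r) ring_scheme \<Rightarrow> ('k, 'v, 'm) module_scheme \<Rightarrow> (nat \<Rightarrow> 'v) \<Rightarrow> nat \<Rightarrow> bool" where
  "is_basis K V b n \<longleftrightarrow> (\<forall>i<n. b i \<in> carrier V)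
     \<and> (\<forall>c. (\<forall>i<n. c i \<in> carrier K) \<longrightarrow> finsum V (\<lambda>i. c i \<odot>\<^bsub>V\<^esub> b i) {..<n} = \<zero>\<^bsub>V\<^esub>
            \<longrightarrow> (\<forall>i<n. c i = \<zero>\<^bsub>K\<^esub>))
     \<and> carrier V = {finsum V (\<lambda>i. c i \<odot>\<^bsub>V\<^esub> b i) {..<n} | c. \<forall>i<n. c i \<in> carrier K}"

definition has_rank :: "('a, 'r) ring_scheme \<Rightarrow> ('a, 'c, 'm) module_scheme \<Rightarrow> nat \<Rightarrow> bool" where
  "has_rank R M r \<longleftrightarrow> (\<exists>b. is_basis (frac_field R) (loc_mod R M (nonzeros R)) b r)"

definition indecomposable :: "('a, 'r) ring_scheme \<Rightarrow> ('a, 'c, 'm) module_scheme \<Rightarrow> bool" where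
  "indecomposable R M \<longleftrightarrow> carrier M \<noteq> {\<zero>\<^bsub>M\<^esub>} \<and>
     (\<forall>A B. submodule A R M \<and> submodule B R M \<and> A \<inter> B = {\<zero>\<^bsub>M\<^esub>}
        \<and> {a \<oplus>\<^bsub>M\<^esub> b | a b. a \<in> A \<and> b \<in> B} = carrier M
        \<longrightarrow> A = {\<zero>\<^bsub>M\<^esub>} \<or> B = {\<zero>\<^bsub>M\<^esub>})"

definition is_linear :: "('a, 'r) ring_scheme \<Rightarrow> ('a, 'c, 'm) module_scheme \<Rightarrow> ('a, 'd, 'n) module_scheme
    \<Rightarrow> ('c \<Rightarrow> 'd) \<Rightarrow> bool" where
  "is_linear R M N f \<longleftrightarrow> f \<in> carrier M \<rightarrow> carrier N
     \<and> (\<forall>x\<in>carrier M. \<forall>y\<in>carrier M. f (x \<oplus>\<^bsub>M\<^esub> y) = f x \<oplus>\<^bsub>N\<^esub> f y)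
     \<and> (\<forall>a\<in>carrier R. \<forall>x\<in>carrier M. f (a \<odot>\<^bsub>M\<^esub> x) = a \<odot>\<^bsub>N\<^esub> f x)"

definition mod_iso :: "('a, 'r) ring_scheme \<Rightarrow> ('a, 'c, 'm) module_scheme \<Rightarrow> ('a, 'd, 'n) module_scheme \<Rightarrow> bool" where
  "mod_iso R M N \<longleftrightarrow> (\<exists>f. is_linear R M N f \<and> bij_betw f (carrier M) (carrier N))"

definition end_ring :: "('a, 'r) ring_scheme \<Rightarrow> ('a, 'c, 'm) module_scheme \<Rightarrow> ('c \<Rightarrow> 'c) ring" where
  "end_ring R M =
    \<lparr>carrier = {f \<in> extensional (carrier M). is_linear R M M f},
     monoid.mult = (\<lambda>f g. compose (carrier M) f g),
     one = (\<lambda>x\<in>carrier M. x),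
     ring.zero = (\<lambda>x\<in>carrier M. \<zero>\<^bsub>M\<^esub>),
     ring.add = (\<lambda>f g. \<lambda>x\<in>carrier M. f x \<oplus>\<^bsub>M\<^esub> g x)\<rparr>"

definition local_ring :: "('a, 'r) ring_scheme \<Rightarrow> bool" where
  "local_ring A \<longleftrightarrow> \<one>\<^bsub>A\<^esub> \<noteq> \<zero>\<^bsub>A\<^esub> \<and>
     (\<forall>a\<in>carrier A. \<forall>b\<in>carrier A. a \<notin> Units A \<and> b \<notin> Units A \<longrightarrow> a \<oplus>\<^bsub>A\<^esub> b \<notin> Units A)"

definition free_mod :: "('a, 'r) ring_scheme \<Rightarrow> nat \<Rightarrow> ('a, nat \<Rightarrow> 'a) module" where
  "free_mod T n =
    \<lparr>carrier = {f. (\<forall>i<n. f i \<in> carrier T) \<and> (\<forall>i\<ge>n. f i = \<zero>\<^bsub>T\<^esub>)},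
     monoid.mult = (\<lambda>f g. undefined), one = undefined,
     ring.zero = (\<lambda>i. \<zero>\<^bsub>T\<^esub>),
     ring.add = (\<lambda>f g i. f i \<oplus>\<^bsub>T\<^esub> g i),
     smult = (\<lambda>a f i. a \<otimes>\<^bsub>T\<^esub> f i)\<rparr>"

definition dsum2 :: "('a, 'c, 'm) module_scheme \<Rightarrow> ('a, 'd, 'n) module_scheme \<Rightarrow> ('a, 'c \<times> 'd) module" where
  "dsum2 M N =
    \<lparr>carrier = carrier M \<times> carrier N,
     monoid.mult = (\<lambda>x y. undefined), one = undefined,
     ring.zero = (\<zero>\<^bsub>M\<^esub>, \<zero>\<^bsub>N\<^esub>),
     ring.add = (\<lambda>(x, y) (x', y'). (x \<oplus>\<^bsub>M\<^esub> x', y \<oplus>\<^bsub>N\<^esub> y')),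
     smult = (\<lambda>a (x, y). (a \<odot>\<^bsub>M\<^esub> x, a \<odot>\<^bsub>N\<^esub> y))\<rparr>"

definition dsum_copies :: "('a, 'c, 'm) module_scheme \<Rightarrow> ('a, nat \<Rightarrow> 'c) module" where
  "dsum_copies M =
    \<lparr>carrier = {f. (\<forall>i. f i \<in> carrier M) \<and> finite {i. f i \<noteq> \<zero>\<^bsub>M\<^esub>}},
     monoid.mult = (\<lambda>f g. undefined), one = undefined,
     ring.zero = (\<lambda>i. \<zero>\<^bsub>M\<^esub>),
     ring.add = (\<lambda>f g i. f i \<oplus>\<^bsub>M\<^esub> g i),
     smult = (\<lambda>a f i. a \<odot>\<^bsub>M\<^esub> f i)\<rparr>"

definition direct_summand :: "('a, 'r) ring_scheme \<Rightarrow> ('a, 'c, 'm) module_scheme \<Rightarrow> 'c set \<Rightarrow> bool" where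
  "direct_summand R M A \<longleftrightarrow> submodule A R M \<and>
     (\<exists>B. submodule B R M \<and> A \<inter> B = {\<zero>\<^bsub>M\<^esub>}
        \<and> {a \<oplus>\<^bsub>M\<^esub> b | a b. a \<in> A \<and> b \<in> B} = carrier M)"

text \<open>N is (isomorphic to) a direct sum of finitely generated modules: N is the internal
direct sum of a family of finitely generated submodules.\<close>
definition dsum_of_fg :: "('a, 'r) ring_scheme \<Rightarrow> ('a, 'c, 'm) module_scheme \<Rightarrow> bool" where
  "dsum_of_fg R N \<longleftrightarrow> (\<exists>Fam.
      (\<forall>A\<in>Fam. submodule A R N \<and> fin_gen R (N\<lparr>carrier := A\<rparr>))
    \<and> (\<forall>F x. finite F \<and> F \<subseteq> Fam \<and> (\<forall>A\<in>F. x A \<in> A) \<and> finsum N x F = \<zero>\<^bsub>N\<^esub>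
           \<longrightarrow> (\<forall>A\<in>F. x A = \<zero>\<^bsub>N\<^esub>))
    \<and> (\<forall>y\<in>carrier N. \<exists>F x. finite F \<and> F \<subseteq> Fam \<and> (\<forall>A\<in>F. x A \<in> A) \<and> y = finsum N x F))"

definition good_lift :: "('a, 'r) ring_scheme \<Rightarrow> 'a set \<Rightarrow> nat
    \<Rightarrow> (('a \<times> 'a) set, 'e, 'k) module_scheme \<Rightarrow> ('a, 'c, 'm) module_scheme \<Rightarrow> bool" where
  "good_lift R mi r Mi L \<longleftrightarrow> module R L \<and> fin_gen R L \<and> indecomposable R L \<and> torsion_free R L
     \<and> mod_iso (loc_at R mi) (mod_loc_at R L mi) Mi
     \<and> (\<forall>m. maximalideal m R \<and> m \<noteq> mi \<longrightarrow>
            mod_iso (loc_at R m) (mod_loc_at R L m) (free_mod (loc_at R m) r))"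

end

(*
  A torsion-free module of rank r over a localisation at m is treated as an R-module on which R - m
  acts bijectively.  For h-local R and d \<noteq> 0, the ideal d R_m \<inter> R lies in no maximal ideal other than m;
  hence, choosing R_m^r \<subseteq> M up to a factor d, the lattice {x \<in> R^r. x \<in> d M} localises to M at m and to a
  free module everywhere else.

  For the second part let N be the submodule of R^(\<omega>) whose coordinates 1, 2, ... fall into blocks of
  length r1 lying in the first lattice, and whose coordinates 0, 1, 2, ... fall into blocks of length r2
  lying in the second one.  So N is R + M1^(\<omega>) at m1, is M2^(\<omega>) at m2, and is free elsewhere.  Truncation
  after a full block factors locally through a power of X1 + X2, and locally solvable conditions of this
  kind are globally solvable, so N is a direct summand of (X1 + X2)^(\<omega>).  If N were a direct sum of
  finitely generated modules P, Krull-Schmidt at m2 would make every rank of P divisible by r2, while at m1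
  each P is M1^a or R + M1^a.  As r1 and r2 are not coprime, the second form is impossible, so R_m1 itself
  would be a summand of a power of M1 and r1 = 1.
*)
theory Submission
  imports Defs
begin

section \<open>Localisation\<close>

text \<open>Hom out of an infinite direct sum does not commute with localisation, so local
  splittings of N cannot be cleared of denominators as they stand. Truncations can, because they
  involve finitely many coordinates. For fixed k consider the scalars a such that multiplication by
  a on the vectors supported below k extends to an endomorphism of N whose image has bounded support
  and which factors through a finite power of X1 + X2. They form an ideal, local truncations show
  that no maximal ideal contains it, so a = 1 occurs; successive differences of the resulting
  endomorphisms then add up to the identity. Hence the proof carries factorisations of maps
  (\<open>facs\<close>), which are closed under sums and composition, rather than isomorphisms.
  Applied to an identity map, \<open>facs\<close> says that a module is a summand of a finite power,
  so Krull-Schmidt enters only through ranks. The extra coordinate 0 shifts the blocks at m1 against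
  those at m2: it is what would force a rank congruent to 1 modulo r1 to be a multiple of
  r2.\<close>

definition mult_set :: "('a, 'r) ring_scheme \<Rightarrow> 'a set \<Rightarrow> bool" where
  "mult_set R S \<longleftrightarrow> S \<subseteq> carrier R \<and> \<one>\<^bsub>R\<^esub> \<in> S \<and> (\<forall>s\<in>S. \<forall>t\<in>S. s \<otimes>\<^bsub>R\<^esub> t \<in> S)"

lemma ring_as_mod_simps [simp]:
  "carrier (ring_as_mod R) = carrier R" "ring.add (ring_as_mod R) = ring.add R"
  "\<zero>\<^bsub>ring_as_mod R\<^esub> = \<zero>\<^bsub>R\<^esub>" "smult (ring_as_mod R) = monoid.mult R"
  by (simp_all add: ring_as_mod_def)

lemma abelian_group_cong:
  assumes "abelian_group G" "carrier H = carrier G" "ring.add H = ring.add G" "\<zero>\<^bsub>H\<^esub> = \<zero>\<^bsub>G\<^esub>"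
  shows "abelian_group H"
proof -
  interpret abelian_group G by fact
  show ?thesis using assms(2-) by (intro abelian_groupI) (auto simp: a_ac intro: l_neg)
qed

lemma (in abelian_group) minus_eq_zero_iff:
  "x \<in> carrier G \<Longrightarrow> y \<in> carrier G \<Longrightarrow> x \<ominus> y = \<zero> \<longleftrightarrow> x = y"
  by (metis add.inv_closed add.inv_equality minus_eq minus_minus r_neg)

lemma module_ring_as_mod:
  assumes "cring R" shows "module R (ring_as_mod R)"
proof -
  interpret cring R by fact
  show ?thesis
    by (intro moduleI abelian_groupI) 
       (auto simp: m_assoc l_distr r_distr a_assoc intro: a_comm l_neg is_cring bexI[of _ "\<ominus>\<^bsub>R\<^esub> x" for x])
qed

locale loc_module = module R M for R (structure) and M (structure) +
  fixes S
  assumes mult_set: "mult_set R S"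
begin

lemma S_carrier: "s \<in> S \<Longrightarrow> s \<in> carrier R" and S_one: "\<one> \<in> S"
  and S_mult: "s \<in> S \<Longrightarrow> t \<in> S \<Longrightarrow> s \<otimes> t \<in> S"
  using mult_set by (auto simp: mult_set_def)

lemmas S_simps [simp] = S_carrier S_one S_mult

text \<open>Distributing u over the difference in \<open>loc_rel\<close> turns the relation into
  cross-multiplication up to a multiplier u, the form in which every later computation with
  fractions takes place.\<close>

lemma rel_iff:
  "((x, s), (y, t)) \<in> loc_rel M S \<longleftrightarrow> x \<in> carrier M \<and> y \<in> carrier M \<and> s \<in> S \<and> t \<in> S \<and>
     (\<exists>u\<in>S. (u \<otimes> t) \<odot>\<^bsub>M\<^esub> x = (u \<otimes> s) \<odot>\<^bsub>M\<^esub> y)"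
proof -
  have "u \<odot>\<^bsub>M\<^esub> (t \<odot>\<^bsub>M\<^esub> x \<ominus>\<^bsub>M\<^esub> s \<odot>\<^bsub>M\<^esub> y) = \<zero>\<^bsub>M\<^esub> \<longleftrightarrow> (u \<otimes> t) \<odot>\<^bsub>M\<^esub> x = (u \<otimes> s) \<odot>\<^bsub>M\<^esub> y"
    if "x \<in> carrier M" "y \<in> carrier M" "s \<in> S" "t \<in> S" "u \<in> S" for u
  proof -
    have "u \<odot>\<^bsub>M\<^esub> (t \<odot>\<^bsub>M\<^esub> x \<ominus>\<^bsub>M\<^esub> s \<odot>\<^bsub>M\<^esub> y) = (u \<otimes> t) \<odot>\<^bsub>M\<^esub> x \<ominus>\<^bsub>M\<^esub> (u \<otimes> s) \<odot>\<^bsub>M\<^esub> y"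
      using that by (simp add: M.minus_eq smult_r_distr smult_r_minus smult_assoc1)
    then show ?thesis using that by (simp add: M.minus_eq_zero_iff)
  qed
  then show ?thesis by (auto simp: loc_rel_def)
qed

lemma rel_equiv: "equiv (carrier M \<times> S) (loc_rel M S)"
proof (rule equivI)
  show "loc_rel M S \<subseteq> (carrier M \<times> S) \<times> carrier M \<times> S" by (auto simp: loc_rel_def)
  show "refl_on (carrier M \<times> S) (loc_rel M S)"
    by (auto simp: refl_on_def rel_iff intro: bexI[of _ \<one>])
  show "sym (loc_rel M S)"
    by (rule symI) (auto simp: rel_iff, metis)
  show "trans (loc_rel M S)"
  proof (rule transI, clarify)
    fix x s y t z r
    assume "((x, s), y, t) \<in> loc_rel M S" "((y, t), z, r) \<in> loc_rel M S"
    then obtain u v where *: "x \<in> carrier M" "y \<in> carrier M" "z \<in> carrier M" "s \<in> S" "t \<in> S" "r \<in> S"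
      "u \<in> S" "v \<in> S"
      and 1: "(u \<otimes> t) \<odot>\<^bsub>M\<^esub> x = (u \<otimes> s) \<odot>\<^bsub>M\<^esub> y" and 2: "(v \<otimes> r) \<odot>\<^bsub>M\<^esub> y = (v \<otimes> t) \<odot>\<^bsub>M\<^esub> z"
      by (auto simp: rel_iff)
    \<comment> \<open>The multiplier for the composed relation is the product of the two given ones
      with the middle denominator t.\<close>
    have "((u \<otimes> v \<otimes> t) \<otimes> r) \<odot>\<^bsub>M\<^esub> x = (v \<otimes> r) \<odot>\<^bsub>M\<^esub> ((u \<otimes> t) \<odot>\<^bsub>M\<^esub> x)"
      using * by (simp add: smult_assoc1[symmetric] m_ac)
    also have "\<dots> = (u \<otimes> s) \<odot>\<^bsub>M\<^esub> ((v \<otimes> r) \<odot>\<^bsub>M\<^esub> y)"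
      using * 1 by (simp add: smult_assoc1[symmetric] m_ac)
    also have "\<dots> = ((u \<otimes> v \<otimes> t) \<otimes> s) \<odot>\<^bsub>M\<^esub> z"
      using * 2 by (simp add: smult_assoc1[symmetric] m_ac)
    finally show "((x, s), z, r) \<in> loc_rel M S" using * by (auto simp: rel_iff)
  qed
qed

lemma class_eq_iff:
  assumes "x \<in> carrier M" "y \<in> carrier M" "s \<in> S" "t \<in> S"
  shows "loc_class M S x s = loc_class M S y t \<longleftrightarrow> (\<exists>u\<in>S. (u \<otimes> t) \<odot>\<^bsub>M\<^esub> x = (u \<otimes> s) \<odot>\<^bsub>M\<^esub> y)"
proof -
  have "loc_class M S x s = loc_class M S y t \<longleftrightarrow> ((x, s), (y, t)) \<in> loc_rel M S"
    unfolding loc_class_def using assms by (intro eq_equiv_class_iff[OF rel_equiv]) auto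
  then show ?thesis using assms by (simp add: rel_iff)
qed

lemma class_eqI:
  assumes "x \<in> carrier M" "y \<in> carrier M" "s \<in> S" "t \<in> S" "t \<odot>\<^bsub>M\<^esub> x = s \<odot>\<^bsub>M\<^esub> y"
  shows "loc_class M S x s = loc_class M S y t"
  using assms by (subst class_eq_iff) (auto intro!: bexI[of _ \<one>])

lemma class_in [simp]:
  "x \<in> carrier M \<Longrightarrow> s \<in> S \<Longrightarrow> loc_class M S x s \<in> carrier (loc_mod R M S)"
  by (auto simp: loc_mod_def loc_class_def intro: quotientI)

lemma class_cases:
  assumes "C \<in> carrier (loc_mod R M S)"
  obtains x s where "x \<in> carrier M" "s \<in> S" "C = loc_class M S x s"
  using assms by (auto simp: loc_mod_def loc_class_def elim!: quotientE)

text \<open>The operations on classes are defined through \<open>SOME\<close>, so of the chosen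
  representative only its membership in the class is known; here that membership is unpacked as an
  equation with a multiplier.\<close>

lemma class_some:
  assumes "x \<in> carrier M" "s \<in> S"
  obtains x' s' u where "(SOME p. p \<in> loc_class M S x s) = (x', s')" "x' \<in> carrier M" "s' \<in> S" "u \<in> S"
    "(u \<otimes> s') \<odot>\<^bsub>M\<^esub> x = (u \<otimes> s) \<odot>\<^bsub>M\<^esub> x'"
proof -
  have "(x, s) \<in> loc_class M S x s"
    unfolding loc_class_def using assms by (intro equiv_class_self[OF rel_equiv]) auto
  then have "(SOME p. p \<in> loc_class M S x s) \<in> loc_class M S x s" by (rule someI)
  then have "((x, s), (SOME p. p \<in> loc_class M S x s)) \<in> loc_rel M S" by (simp add: loc_class_def)
  then show thesis using that by (cases "SOME p. p \<in> loc_class M S x s") (auto simp: rel_iff)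
qed

text \<open>Well-definedness: if u and v witness that the chosen representatives are equivalent to
  the given ones, then u times v witnesses the equality of the two sums.\<close>

lemma class_add:
  assumes "x \<in> carrier M" "s \<in> S" "y \<in> carrier M" "t \<in> S"
  shows "loc_class M S x s \<oplus>\<^bsub>loc_mod R M S\<^esub> loc_class M S y t
     = loc_class M S (t \<odot>\<^bsub>M\<^esub> x \<oplus>\<^bsub>M\<^esub> s \<odot>\<^bsub>M\<^esub> y) (s \<otimes> t)"
proof -
  obtain x' s' u where x': "(SOME p. p \<in> loc_class M S x s) = (x', s')" "x' \<in> carrier M" "s' \<in> S" "u \<in> S"
    and 1: "(u \<otimes> s') \<odot>\<^bsub>M\<^esub> x = (u \<otimes> s) \<odot>\<^bsub>M\<^esub> x'" using class_some[OF assms(1,2)] .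
  obtain y' t' v where y': "(SOME p. p \<in> loc_class M S y t) = (y', t')" "y' \<in> carrier M" "t' \<in> S" "v \<in> S"
    and 2: "(v \<otimes> t') \<odot>\<^bsub>M\<^esub> y = (v \<otimes> t) \<odot>\<^bsub>M\<^esub> y'" using class_some[OF assms(3,4)] .
  have "(u \<otimes> v \<otimes> (s \<otimes> t)) \<odot>\<^bsub>M\<^esub> (t' \<odot>\<^bsub>M\<^esub> x' \<oplus>\<^bsub>M\<^esub> s' \<odot>\<^bsub>M\<^esub> y')
     = (v \<otimes> t \<otimes> t') \<odot>\<^bsub>M\<^esub> ((u \<otimes> s) \<odot>\<^bsub>M\<^esub> x') \<oplus>\<^bsub>M\<^esub> (u \<otimes> s \<otimes> s') \<odot>\<^bsub>M\<^esub> ((v \<otimes> t) \<odot>\<^bsub>M\<^esub> y')"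
    using assms x' y' by (simp add: smult_r_distr smult_assoc1[symmetric] m_ac)
  also have "\<dots> = (u \<otimes> v \<otimes> (s' \<otimes> t')) \<odot>\<^bsub>M\<^esub> (t \<odot>\<^bsub>M\<^esub> x \<oplus>\<^bsub>M\<^esub> s \<odot>\<^bsub>M\<^esub> y)"
    unfolding 1[symmetric] 2[symmetric]
    using assms x' y' by (simp add: smult_r_distr smult_assoc1[symmetric] m_ac)
  finally have "loc_class M S (t' \<odot>\<^bsub>M\<^esub> x' \<oplus>\<^bsub>M\<^esub> s' \<odot>\<^bsub>M\<^esub> y') (s' \<otimes> t') = 
     loc_class M S (t \<odot>\<^bsub>M\<^esub> x \<oplus>\<^bsub>M\<^esub> s \<odot>\<^bsub>M\<^esub> y) (s \<otimes> t)"
    using assms x' y' by (subst class_eq_iff) (auto intro!: bexI[of _ "u \<otimes> v"])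
  then show ?thesis by (simp add: loc_mod_def x' y')
qed

end

lemma loc_ring_simps:
  "carrier (loc_ring R S) = carrier (loc_mod R (ring_as_mod R) S)"
  "ring.add (loc_ring R S) = ring.add (loc_mod R (ring_as_mod R) S)"
  "\<zero>\<^bsub>loc_ring R S\<^esub> = loc_class (ring_as_mod R) S \<zero>\<^bsub>R\<^esub> \<one>\<^bsub>R\<^esub>"
  "\<one>\<^bsub>loc_ring R S\<^esub> = loc_class (ring_as_mod R) S \<one>\<^bsub>R\<^esub> \<one>\<^bsub>R\<^esub>"
  by (simp_all add: loc_ring_def loc_mod_def)

lemma loc_mod_zero: "\<zero>\<^bsub>loc_mod R M S\<^esub> = loc_class M S \<zero>\<^bsub>M\<^esub> \<one>\<^bsub>R\<^esub>"
  by (simp add: loc_mod_def)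

section \<open>Ring and module structure of the localisation\<close>

context loc_module
begin

text \<open>\<open>loc_ring\<close> has the same carrier and addition as the localisation of the
  base ring regarded as a module, so facts about classes in the module carry over to
  fractions.\<close>

sublocale RR: loc_module R "ring_as_mod R" S
  by (intro loc_module.intro module_ring_as_mod loc_module_axioms.intro mult_set) (rule is_cring)

abbreviation (input) frac where "frac \<equiv> loc_class (ring_as_mod R) S"

lemma class_smult:
  assumes "a \<in> carrier R" "s \<in> S" "y \<in> carrier M" "t \<in> S"
  shows "frac a s \<odot>\<^bsub>loc_mod R M S\<^esub> loc_class M S y t = loc_class M S (a \<odot>\<^bsub>M\<^esub> y) (s \<otimes> t)"
proof -
  obtain x' s' u where x': "(SOME p. p \<in> frac a s) = (x', s')" "x' \<in> carrier R" "s' \<in> S" "u \<in> S"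
    and 1: "(u \<otimes> s') \<otimes> a = (u \<otimes> s) \<otimes> x'" using RR.class_some[of a s] assms by auto
  obtain y' t' v where y': "(SOME p. p \<in> loc_class M S y t) = (y', t')" "y' \<in> carrier M" "t' \<in> S" "v \<in> S"
    and 2: "(v \<otimes> t') \<odot>\<^bsub>M\<^esub> y = (v \<otimes> t) \<odot>\<^bsub>M\<^esub> y'" using class_some[OF assms(3,4)] .
  have "(u \<otimes> v \<otimes> (s \<otimes> t)) \<odot>\<^bsub>M\<^esub> (x' \<odot>\<^bsub>M\<^esub> y') = ((u \<otimes> s) \<otimes> x') \<odot>\<^bsub>M\<^esub> ((v \<otimes> t) \<odot>\<^bsub>M\<^esub> y')"
    using assms x' y' by (simp add: smult_assoc1[symmetric] m_ac)
  also have "\<dots> = (u \<otimes> v \<otimes> (s' \<otimes> t')) \<odot>\<^bsub>M\<^esub> (a \<odot>\<^bsub>M\<^esub> y)"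
    unfolding 1[symmetric] 2[symmetric] using assms x' y' by (simp add: smult_assoc1[symmetric] m_ac)
  finally have "loc_class M S (x' \<odot>\<^bsub>M\<^esub> y') (s' \<otimes> t') = loc_class M S (a \<odot>\<^bsub>M\<^esub> y) (s \<otimes> t)"
    using assms x' y' by (subst class_eq_iff) (auto intro!: bexI[of _ "u \<otimes> v"])
  then show ?thesis by (simp add: loc_mod_def x' y')
qed

lemma frac_mult:
  assumes "a \<in> carrier R" "s \<in> S" "b \<in> carrier R" "t \<in> S"
  shows "frac a s \<otimes>\<^bsub>loc_ring R S\<^esub> frac b t = frac (a \<otimes> b) (s \<otimes> t)"
proof -
  have "frac a s \<otimes>\<^bsub>loc_ring R S\<^esub> frac b t = frac a s \<odot>\<^bsub>loc_mod R (ring_as_mod R) S\<^esub> frac b t"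
    by (simp add: loc_ring_def loc_mod_def)
  also have "\<dots> = frac (a \<otimes> b) (s \<otimes> t)"
    using loc_module.class_smult[OF RR.loc_module_axioms, of a s b t] assms by simp
  finally show ?thesis .
qed

lemma frac_add:
  assumes "a \<in> carrier R" "s \<in> S" "b \<in> carrier R" "t \<in> S"
  shows "frac a s \<oplus>\<^bsub>loc_ring R S\<^esub> frac b t = frac (t \<otimes> a \<oplus> s \<otimes> b) (s \<otimes> t)"
  using RR.class_add[of a s b t] assms by (simp add: loc_ring_simps)

lemma loc_abelian_group: "abelian_group (loc_mod R M S)"
proof (rule abelian_groupI)
  let ?L = "loc_mod R M S"
  fix A assume "A \<in> carrier ?L"
  then obtain x s where A: "x \<in> carrier M" "s \<in> S" "A = loc_class M S x s" by (rule class_cases)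
  show "\<zero>\<^bsub>?L\<^esub> \<oplus>\<^bsub>?L\<^esub> A = A" using A by (simp add: loc_mod_zero class_add)
  show "\<exists>B\<in>carrier ?L. B \<oplus>\<^bsub>?L\<^esub> A = \<zero>\<^bsub>?L\<^esub>"
  proof
    show "loc_class M S (\<ominus>\<^bsub>M\<^esub> x) s \<in> carrier ?L" using A by simp
    have "s \<odot>\<^bsub>M\<^esub> (\<ominus>\<^bsub>M\<^esub> x) \<oplus>\<^bsub>M\<^esub> s \<odot>\<^bsub>M\<^esub> x = \<zero>\<^bsub>M\<^esub>"
      using A by (simp add: smult_r_minus M.l_neg)
    then show "loc_class M S (\<ominus>\<^bsub>M\<^esub> x) s \<oplus>\<^bsub>?L\<^esub> A = \<zero>\<^bsub>?L\<^esub>"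
      using A by (simp add: class_add loc_mod_zero) (intro class_eqI; simp)
  qed
  fix B assume "B \<in> carrier ?L"
  then obtain y t where B: "y \<in> carrier M" "t \<in> S" "B = loc_class M S y t" by (rule class_cases)
  show "A \<oplus>\<^bsub>?L\<^esub> B \<in> carrier ?L" using A B by (simp add: class_add)
  show "A \<oplus>\<^bsub>?L\<^esub> B = B \<oplus>\<^bsub>?L\<^esub> A" using A B by (simp add: class_add m_comm M.a_comm)
  fix C assume "C \<in> carrier ?L"
  then obtain z r where C: "z \<in> carrier M" "r \<in> S" "C = loc_class M S z r" by (rule class_cases)
  show "A \<oplus>\<^bsub>?L\<^esub> B \<oplus>\<^bsub>?L\<^esub> C = A \<oplus>\<^bsub>?L\<^esub> (B \<oplus>\<^bsub>?L\<^esub> C)"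
    using A B C by (simp add: class_add smult_r_distr smult_assoc1[symmetric] m_ac M.a_ac)
qed (simp add: loc_mod_zero)

lemma loc_cring: "cring (loc_ring R S)"
proof (rule cringI)
  let ?L = "loc_ring R S"
  show "abelian_group ?L"
    by (rule abelian_group_cong[OF loc_module.loc_abelian_group[OF RR.loc_module_axioms]]) (simp_all add: loc_ring_simps loc_mod_zero)
  show "Group.comm_monoid ?L"
  proof (rule comm_monoidI)
    fix A assume "A \<in> carrier ?L"
    then obtain x s where A: "x \<in> carrier R" "s \<in> S" "A = frac x s" 
      by (metis RR.class_cases loc_ring_simps(1) ring_as_mod_simps(1))
    show "\<one>\<^bsub>?L\<^esub> \<otimes>\<^bsub>?L\<^esub> A = A" using A by (simp add: loc_ring_simps frac_mult)
    fix B assume "B \<in> carrier ?L"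
    then obtain y t where B: "y \<in> carrier R" "t \<in> S" "B = frac y t"
      by (metis RR.class_cases loc_ring_simps(1) ring_as_mod_simps(1))
    show "A \<otimes>\<^bsub>?L\<^esub> B \<in> carrier ?L" using A B RR.class_in by (simp add: loc_ring_simps(1) frac_mult)
    show "A \<otimes>\<^bsub>?L\<^esub> B = B \<otimes>\<^bsub>?L\<^esub> A" using A B by (simp add: frac_mult m_comm)
    fix C assume "C \<in> carrier ?L"
    then obtain z r where C: "z \<in> carrier R" "r \<in> S" "C = frac z r"
      by (metis RR.class_cases loc_ring_simps(1) ring_as_mod_simps(1))
    show "A \<otimes>\<^bsub>?L\<^esub> B \<otimes>\<^bsub>?L\<^esub> C = A \<otimes>\<^bsub>?L\<^esub> (B \<otimes>\<^bsub>?L\<^esub> C)"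
      using A B C by (simp add: frac_mult m_ac)
  qed (use RR.class_in[of \<one> \<one>] in \<open>simp add: loc_ring_simps\<close>)
  fix A B C assume "A \<in> carrier ?L" "B \<in> carrier ?L" "C \<in> carrier ?L"
  then obtain x s y t z r where *: "x \<in> carrier R" "s \<in> S" "A = frac x s" "y \<in> carrier R" "t \<in> S" "B = frac y t"
     "z \<in> carrier R" "r \<in> S" "C = frac z r"
    by (metis RR.class_cases loc_ring_simps(1) ring_as_mod_simps(1))
  show "(A \<oplus>\<^bsub>?L\<^esub> B) \<otimes>\<^bsub>?L\<^esub> C = A \<otimes>\<^bsub>?L\<^esub> C \<oplus>\<^bsub>?L\<^esub> B \<otimes>\<^bsub>?L\<^esub> C"
    using * by (simp add: frac_mult frac_add) (intro RR.class_eqI; simp add: r_distr m_ac)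
qed

lemma loc_module: "module (loc_ring R S) (loc_mod R M S)"
proof (rule moduleI[OF loc_cring loc_abelian_group])
  let ?L = "loc_ring R S" and ?V = "loc_mod R M S"
  fix A P assume "A \<in> carrier ?L" "P \<in> carrier ?V"
  then obtain a s x t where A: "a \<in> carrier R" "s \<in> S" "A = frac a s" "x \<in> carrier M" "t \<in> S" "P = loc_class M S x t"
    by (metis class_cases RR.class_cases loc_ring_simps(1) ring_as_mod_simps(1))
  show "A \<odot>\<^bsub>?V\<^esub> P \<in> carrier ?V" using A by (simp add: class_smult)
  fix B assume "B \<in> carrier ?L"
  then obtain b r where B: "b \<in> carrier R" "r \<in> S" "B = frac b r"
    by (metis RR.class_cases loc_ring_simps(1) ring_as_mod_simps(1))
  show "(A \<oplus>\<^bsub>?L\<^esub> B) \<odot>\<^bsub>?V\<^esub> P = A \<odot>\<^bsub>?V\<^esub> P \<oplus>\<^bsub>?V\<^esub> B \<odot>\<^bsub>?V\<^esub> P"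
    using A B by (simp add: class_smult frac_add class_add) 
      (intro class_eqI; simp add: smult_r_distr smult_l_distr smult_assoc1[symmetric] m_ac)
  show "(A \<otimes>\<^bsub>?L\<^esub> B) \<odot>\<^bsub>?V\<^esub> P = A \<odot>\<^bsub>?V\<^esub> (B \<odot>\<^bsub>?V\<^esub> P)"
    using A B by (simp add: class_smult frac_mult smult_assoc1 m_ac)
next
  let ?L = "loc_ring R S" and ?V = "loc_mod R M S"
  fix A P Q assume "A \<in> carrier ?L" "P \<in> carrier ?V" "Q \<in> carrier ?V"
  then obtain a s x t y r where A: "a \<in> carrier R" "s \<in> S" "A = frac a s" "x \<in> carrier M" "t \<in> S" "P = loc_class M S x t"
     "y \<in> carrier M" "r \<in> S" "Q = loc_class M S y r"
    by (metis class_cases RR.class_cases loc_ring_simps(1) ring_as_mod_simps(1))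
  then show "A \<odot>\<^bsub>?V\<^esub> (P \<oplus>\<^bsub>?V\<^esub> Q) = A \<odot>\<^bsub>?V\<^esub> P \<oplus>\<^bsub>?V\<^esub> A \<odot>\<^bsub>?V\<^esub> Q"
    by (simp add: class_smult class_add) 
      (intro class_eqI; simp add: smult_r_distr smult_assoc1[symmetric] m_ac)
next
  fix P assume "P \<in> carrier (loc_mod R M S)"
  then show "\<one>\<^bsub>loc_ring R S\<^esub> \<odot>\<^bsub>loc_mod R M S\<^esub> P = P"
    by (elim class_cases) (simp add: class_smult loc_ring_simps)
qed

end

section \<open>Linear maps\<close>

lemma linI:
  assumes "\<And>x. x \<in> carrier M \<Longrightarrow> f x \<in> carrier N"
    "\<And>x y. x \<in> carrier M \<Longrightarrow> y \<in> carrier M \<Longrightarrow> f (x \<oplus>\<^bsub>M\<^esub> y) = f x \<oplus>\<^bsub>N\<^esub> f y"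
    "\<And>a x. a \<in> carrier R \<Longrightarrow> x \<in> carrier M \<Longrightarrow> f (a \<odot>\<^bsub>M\<^esub> x) = a \<odot>\<^bsub>N\<^esub> f x"
  shows "is_linear R M N f"
  using assms by (auto simp: is_linear_def)

lemma lin_closed: "is_linear R M N f \<Longrightarrow> x \<in> carrier M \<Longrightarrow> f x \<in> carrier N"
  and lin_add: "is_linear R M N f \<Longrightarrow> x \<in> carrier M \<Longrightarrow> y \<in> carrier M \<Longrightarrow> f (x \<oplus>\<^bsub>M\<^esub> y) = f x \<oplus>\<^bsub>N\<^esub> f y"
  and lin_smult: "is_linear R M N f \<Longrightarrow> a \<in> carrier R \<Longrightarrow> x \<in> carrier M \<Longrightarrow> f (a \<odot>\<^bsub>M\<^esub> x) = a \<odot>\<^bsub>N\<^esub> f x"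
  by (auto simp: is_linear_def)

lemma (in module) neg_smult: "x \<in> carrier M \<Longrightarrow> \<ominus>\<^bsub>M\<^esub> x = (\<ominus> \<one>) \<odot>\<^bsub>M\<^esub> x"
  by (simp add: smult_l_minus)

lemma lin_zero:
  assumes "module R M" "module R N" "is_linear R M N f"
  shows "f \<zero>\<^bsub>M\<^esub> = \<zero>\<^bsub>N\<^esub>"
proof -
  interpret M: module R M by fact
  interpret N: module R N by fact
  have "f \<zero>\<^bsub>M\<^esub> = f (\<zero>\<^bsub>R\<^esub> \<odot>\<^bsub>M\<^esub> \<zero>\<^bsub>M\<^esub>)" by simp
  also have "\<dots> = \<zero>\<^bsub>N\<^esub>"
    using lin_smult[OF assms(3), of "\<zero>\<^bsub>R\<^esub>" "\<zero>\<^bsub>M\<^esub>"] lin_closed[OF assms(3), of "\<zero>\<^bsub>M\<^esub>"] by simp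
  finally show ?thesis .
qed

lemma lin_minus:
  assumes "module R M" "module R N" "is_linear R M N f" "x \<in> carrier M" "y \<in> carrier M"
  shows "f (x \<ominus>\<^bsub>M\<^esub> y) = f x \<ominus>\<^bsub>N\<^esub> f y"
proof -
  interpret M: module R M by fact
  interpret N: module R N by fact
  show ?thesis
    using assms(3-5) 
    by (simp add: M.minus_eq N.minus_eq M.neg_smult N.neg_smult lin_add[OF assms(3)] lin_smult[OF assms(3)] lin_closed)
qed

lemma lin_inj_iff:
  assumes "module R M" "module R N" "is_linear R M N f"
  shows "inj_on f (carrier M) \<longleftrightarrow> (\<forall>x\<in>carrier M. f x = \<zero>\<^bsub>N\<^esub> \<longrightarrow> x = \<zero>\<^bsub>M\<^esub>)"
proof -
  interpret M: module R M by fact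
  interpret N: module R N by fact
  show ?thesis
  proof
    assume "inj_on f (carrier M)"
    then show "\<forall>x\<in>carrier M. f x = \<zero>\<^bsub>N\<^esub> \<longrightarrow> x = \<zero>\<^bsub>M\<^esub>"
      using lin_zero[OF assms] by (metis M.zero_closed inj_onD)
  next
    assume *: "\<forall>x\<in>carrier M. f x = \<zero>\<^bsub>N\<^esub> \<longrightarrow> x = \<zero>\<^bsub>M\<^esub>"
    show "inj_on f (carrier M)"
    proof (rule inj_onI)
      fix x y assume "x \<in> carrier M" "y \<in> carrier M" "f x = f y"
      then have "f (x \<ominus>\<^bsub>M\<^esub> y) = \<zero>\<^bsub>N\<^esub>"
        using lin_closed[OF assms(3)] by (simp add: lin_minus[OF assms] N.minus_eq_zero_iff)
      then show "x = y" using * \<open>x \<in> _\<close> \<open>y \<in> _\<close> M.minus_eq_zero_iff by blast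
    qed
  qed
qed

lemma lin_comp: "is_linear R U V f \<Longrightarrow> is_linear R V W g \<Longrightarrow> is_linear R U W (\<lambda>x. g (f x))"
  by (auto simp: is_linear_def Pi_iff)

lemma lin_id: "is_linear R U U (\<lambda>x. x)"
  by (auto simp: is_linear_def)

lemma lin_plus:
  assumes "module R V" "is_linear R U V f" "is_linear R U V g"
  shows "is_linear R U V (\<lambda>x. f x \<oplus>\<^bsub>V\<^esub> g x)"
proof -
  interpret V: module R V by fact
  show ?thesis using lin_closed[OF assms(2)] lin_closed[OF assms(3)]
    by (intro linI) (simp_all add: lin_add[OF assms(2)] lin_add[OF assms(3)] lin_smult[OF assms(2)] 
        lin_smult[OF assms(3)] V.smult_r_distr V.a_ac)
qed

lemma lin_scale:
  assumes "module R V" "is_linear R U V f" "a \<in> carrier R"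
  shows "is_linear R U V (\<lambda>x. a \<odot>\<^bsub>V\<^esub> f x)"
proof -
  interpret V: module R V by fact
  show ?thesis using lin_closed[OF assms(2)] assms(3)
    by (intro linI) (simp_all add: lin_add[OF assms(2)] lin_smult[OF assms(2)] 
        V.smult_r_distr V.smult_assoc1[symmetric] V.m_comm)
qed

lemma lin_diff:
  assumes "module R V" "is_linear R U V f" "is_linear R U V g"
  shows "is_linear R U V (\<lambda>x. f x \<ominus>\<^bsub>V\<^esub> g x)"
proof -
  interpret V: module R V by fact
  have "is_linear R U V (\<lambda>x. f x \<oplus>\<^bsub>V\<^esub> (\<ominus>\<^bsub>R\<^esub> \<one>\<^bsub>R\<^esub>) \<odot>\<^bsub>V\<^esub> g x)"
    by (intro lin_plus lin_scale assms) simp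
  then show ?thesis
    using lin_closed[OF assms(3)] unfolding is_linear_def Pi_iff
    by (auto simp: V.minus_eq V.neg_smult lin_add[OF assms(3)] lin_smult[OF assms(3)])
qed

lemma lin_const_zero:
  assumes "module R V" shows "is_linear R U V (\<lambda>x. \<zero>\<^bsub>V\<^esub>)"
proof -
  interpret V: module R V by fact
  show ?thesis by (intro linI) simp_all
qed

lemma lin_finsum:
  assumes "module R M" "module R N" "is_linear R M N f" "finite A" "h \<in> A \<rightarrow> carrier M"
  shows "f (finsum M h A) = finsum N (\<lambda>i. f (h i)) A"
proof -
  interpret M: module R M by fact
  interpret N: module R N by fact
  show ?thesis using assms(4,5)
  proof (induction)
    case (insert x F)
    then show ?case using lin_closed[OF assms(3)]
      by (simp add: Pi_iff lin_add[OF assms(3)])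
  qed (simp add: lin_zero[OF assms(1-3)])
qed

lemma lin_inv_into:
  assumes "module R M" "is_linear R M N f" "bij_betw f (carrier M) (carrier N)"
  shows "is_linear R N M (inv_into (carrier M) f)"
proof -
  interpret M: module R M by fact
  let ?g = "inv_into (carrier M) f"
  have g: "?g y \<in> carrier M" "f (?g y) = y" if "y \<in> carrier N" for y
    using assms(3) that by (auto simp: bij_betw_def inv_into_into f_inv_into_f)
  have gf: "?g y = x" if "f x = y" "x \<in> carrier M" for x y
    using assms(3) that by (auto simp: bij_betw_def)
  show ?thesis
    by (intro linI gf) (simp_all add: g lin_add[OF assms(2)] lin_smult[OF assms(2)])
qed

lemma lin_sub_dom: "is_linear R W V f \<Longrightarrow> C \<subseteq> carrier W \<Longrightarrow> is_linear R (W\<lparr>carrier := C\<rparr>) V f"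
  by (auto simp: is_linear_def Pi_iff subset_iff)

lemma lin_sub_cod: "is_linear R U V f \<Longrightarrow> (\<And>x. x \<in> carrier U \<Longrightarrow> f x \<in> C) \<Longrightarrow> is_linear R U (V\<lparr>carrier := C\<rparr>) f"
  by (auto simp: is_linear_def)

lemma lin_sub_codD: "is_linear R U (V\<lparr>carrier := C\<rparr>) f \<Longrightarrow> C \<subseteq> carrier V \<Longrightarrow> is_linear R U V f"
  by (auto simp: is_linear_def)

lemma lin_cong:
  assumes "module R U" "is_linear R U V f" "\<And>x. x \<in> carrier U \<Longrightarrow> g x = f x"
  shows "is_linear R U V g"
proof -
  interpret module R U by fact
  show ?thesis using assms(2,3) by (intro linI) (simp_all add: lin_closed lin_add lin_smult)
qed

section \<open>Submodules and finite generation\<close>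

text \<open>Closure under negation comes from scaling by -1.\<close>

lemma submodI:
  assumes "module R M" "H \<subseteq> carrier M" "\<zero>\<^bsub>M\<^esub> \<in> H" "\<And>a b. \<lbrakk>a \<in> H ; b \<in> H\<rbrakk> \<Longrightarrow> a \<oplus>\<^bsub>M\<^esub> b \<in> H"
   "\<And>a x. \<lbrakk>a \<in> carrier R; x \<in> H\<rbrakk> \<Longrightarrow> a \<odot>\<^bsub>M\<^esub> x \<in> H"
  shows "submodule H R M"
proof -
  interpret M: module R M by fact
  show ?thesis
    by (rule M.submoduleI) (use assms in \<open>auto simp: M.neg_smult subset_iff\<close>)
qed

lemma submodD:
  assumes "module R M" "submodule H R M"
  shows "x \<in> H \<Longrightarrow> x \<in> carrier M" "\<zero>\<^bsub>M\<^esub> \<in> H" "\<And>a b. \<lbrakk>a \<in> H ; b \<in> H\<rbrakk> \<Longrightarrow> a \<oplus>\<^bsub>M\<^esub> b \<in> H"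
   "\<And>a x. \<lbrakk>a \<in> carrier R; x \<in> H\<rbrakk> \<Longrightarrow> a \<odot>\<^bsub>M\<^esub> x \<in> H" "\<And>a b. \<lbrakk>a \<in> H ; b \<in> H\<rbrakk> \<Longrightarrow> a \<ominus>\<^bsub>M\<^esub> b \<in> H"
proof -
  interpret M: module R M by fact
  interpret submodule H R M by fact
  show 1: "x \<in> H \<Longrightarrow> x \<in> carrier M" "\<zero>\<^bsub>M\<^esub> \<in> H" "\<And>a b. \<lbrakk>a \<in> H ; b \<in> H\<rbrakk> \<Longrightarrow> a \<oplus>\<^bsub>M\<^esub> b \<in> H"
   "\<And>a x. \<lbrakk>a \<in> carrier R; x \<in> H\<rbrakk> \<Longrightarrow> a \<odot>\<^bsub>M\<^esub> x \<in> H"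
    using M.submoduleE[OF assms(2)] subgroup.one_closed[OF submodule.axioms(1)[OF assms(2)]] by auto
  show "\<And>a b. \<lbrakk>a \<in> H ; b \<in> H\<rbrakk> \<Longrightarrow> a \<ominus>\<^bsub>M\<^esub> b \<in> H"
    using M.submoduleE[OF assms(2)] by (simp add: M.minus_eq)
qed

lemma submod_module: "module R M \<Longrightarrow> submodule H R M \<Longrightarrow> module R (M\<lparr>carrier := H\<rparr>)"
  by (rule submodule.submodule_is_module)

lemma submod_finsum:
  assumes "module R M" "submodule H R M" "finite A" "h \<in> A \<rightarrow> H"
  shows "finsum M h A \<in> H"
proof -
  interpret M: module R M by fact
  note H = submodD[OF assms(1,2)]
  show ?thesis using assms(3,4) 
    by (induction) (auto simp: H Pi_iff)
qed

lemma span_submodule: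
  assumes "module R M" "G \<subseteq> carrier M"
  shows "submodule (span R M G) R M" "G \<subseteq> span R M G"
proof -
  interpret M: module R M by fact
  have GM: "g \<in> G \<Longrightarrow> g \<in> carrier M" for g using assms by auto
  have memI: "finsum M (\<lambda>g. c g \<odot>\<^bsub>M\<^esub> g) F \<in> span R M G" if "finite F" "F \<subseteq> G" "c \<in> F \<rightarrow> carrier R" for c F
    using that by (auto simp: span_def)
  have sub: "finsum M (\<lambda>g. c g \<odot>\<^bsub>M\<^esub> g) F \<in> carrier M" if "F \<subseteq> G" "c \<in> F \<rightarrow> carrier R" for c F
    using that by (intro M.finsum_closed) (auto simp: Pi_iff GM subset_iff)
  show "submodule (span R M G) R M"
  proof (rule submodI[OF assms(1)])
    show "span R M G \<subseteq> carrier M" using sub by (auto simp: span_def)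
    show "\<zero>\<^bsub>M\<^esub> \<in> span R M G" using memI[of "{}" "\<lambda>_. \<zero>\<^bsub>R\<^esub>"] by simp
  next
    fix a b assume "a \<in> span R M G" "b \<in> span R M G"
    then obtain c F d E where 1: "finite F" "F \<subseteq> G" "c \<in> F \<rightarrow> carrier R" "a = finsum M (\<lambda>g. c g \<odot>\<^bsub>M\<^esub> g) F"
      and 2: "finite E" "E \<subseteq> G" "d \<in> E \<rightarrow> carrier R" "b = finsum M (\<lambda>g. d g \<odot>\<^bsub>M\<^esub> g) E"
      by (auto simp: span_def)
    \<comment> \<open>To add two combinations, both are first rewritten over the union of their
      index sets, with coefficient zero outside the original one.\<close>
    have ext: "finsum M (\<lambda>g. c g \<odot>\<^bsub>M\<^esub> g) F = finsum M (\<lambda>g. (if g \<in> F then c g else \<zero>\<^bsub>R\<^esub>) \<odot>\<^bsub>M\<^esub> g) (F \<union> E)"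
      if "finite F" "finite E" "F \<subseteq> G" "E \<subseteq> G" "c \<in> F \<rightarrow> carrier R" for c F E
    proof (rule M.add.finprod_mono_neutral_cong_left)
      show "\<And>i. i \<in> F \<Longrightarrow> c i \<odot>\<^bsub>M\<^esub> i = (if i \<in> F then c i else \<zero>\<^bsub>R\<^esub>) \<odot>\<^bsub>M\<^esub> i" by simp
    qed (use that GM in \<open>auto simp: subset_iff Pi_iff\<close>)
    let ?c = "\<lambda>g. if g \<in> F then c g else \<zero>\<^bsub>R\<^esub>" and ?d = "\<lambda>g. if g \<in> E then d g else \<zero>\<^bsub>R\<^esub>"
    have "a \<oplus>\<^bsub>M\<^esub> b = finsum M (\<lambda>g. ?c g \<odot>\<^bsub>M\<^esub> g \<oplus>\<^bsub>M\<^esub> ?d g \<odot>\<^bsub>M\<^esub> g) (F \<union> E)"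
      using ext[of F E c] ext[of E F d] 1 2 GM
      by (subst M.finsum_addf) (auto simp: Pi_iff subset_iff Un_commute)
    also have "\<dots> = finsum M (\<lambda>g. (?c g \<oplus>\<^bsub>R\<^esub> ?d g) \<odot>\<^bsub>M\<^esub> g) (F \<union> E)"
      using 1 2 GM by (intro M.finsum_cong') (auto simp: Pi_iff subset_iff M.smult_l_distr)
    also have "\<dots> \<in> span R M G"
      by (rule memI[of "F \<union> E" "\<lambda>g. ?c g \<oplus>\<^bsub>R\<^esub> ?d g"]) (use 1 2 in \<open>auto simp: Pi_iff\<close>)
    finally show "a \<oplus>\<^bsub>M\<^esub> b \<in> span R M G" .
  next
    fix r a assume r: "r \<in> carrier R" and "a \<in> span R M G"
    then obtain c F where 1: "finite F" "F \<subseteq> G" "c \<in> F \<rightarrow> carrier R" "a = finsum M (\<lambda>g. c g \<odot>\<^bsub>M\<^esub> g) F"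
      by (auto simp: span_def)
    have "r \<odot>\<^bsub>M\<^esub> a = finsum M (\<lambda>g. r \<odot>\<^bsub>M\<^esub> (c g \<odot>\<^bsub>M\<^esub> g)) F"
      using 1 GM r by (simp add: Pi_iff subset_iff M.finsum_smult_ldistr)
    also have "\<dots> = finsum M (\<lambda>g. (r \<otimes>\<^bsub>R\<^esub> c g) \<odot>\<^bsub>M\<^esub> g) F"
      using 1 GM r by (intro M.finsum_cong') (auto simp: Pi_iff subset_iff M.smult_assoc1)
    also have "\<dots> \<in> span R M G"
      by (rule memI[of F "\<lambda>g. r \<otimes>\<^bsub>R\<^esub> c g"]) (use 1 r in \<open>auto simp: Pi_iff\<close>)
    finally show "r \<odot>\<^bsub>M\<^esub> a \<in> span R M G" .
  qed
  show "G \<subseteq> span R M G"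
  proof
    fix g assume g: "g \<in> G"
    have "finsum M (\<lambda>g. \<one>\<^bsub>R\<^esub> \<odot>\<^bsub>M\<^esub> g) {g} \<in> span R M G" using g by (intro memI) auto
    then show "g \<in> span R M G" using g GM by (simp add: M.finsum_insert)
  qed
qed

lemma span_least:
  assumes "module R M" "submodule H R M" "G \<subseteq> H"
  shows "span R M G \<subseteq> H"
  using assms by (auto simp: span_def intro!: submod_finsum submodD(4) simp: Pi_iff subset_iff)

text \<open>The span is the least submodule above the generators. In this form finite generation is
  used by exhibiting one submodule that contains the generators, without handling linear
  combinations.\<close>

lemma fin_gen_iff:
  assumes "module R M"
  shows "fin_gen R M \<longleftrightarrow> (\<exists>G. finite G \<and> G \<subseteq> carrier M \<and> (\<forall>H. submodule H R M \<and> G \<subseteq> H \<longrightarrow> H = carrier M))"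
proof
  assume "fin_gen R M"
  then obtain G where G: "finite G" "G \<subseteq> carrier M" "span R M G = carrier M" by (auto simp: fin_gen_def)
  then show "\<exists>G. finite G \<and> G \<subseteq> carrier M \<and> (\<forall>H. submodule H R M \<and> G \<subseteq> H \<longrightarrow> H = carrier M)"
    using span_least[OF assms] submodD(1)[OF assms] by (intro exI[of _ G]) blast
next
  assume "\<exists>G. finite G \<and> G \<subseteq> carrier M \<and> (\<forall>H. submodule H R M \<and> G \<subseteq> H \<longrightarrow> H = carrier M)"
  then obtain G where G: "finite G" "G \<subseteq> carrier M" "\<And>H. submodule H R M \<Longrightarrow> G \<subseteq> H \<Longrightarrow> H = carrier M" by blast
  have "span R M G = carrier M" by (rule G(3)[OF span_submodule[OF assms G(2)]])
  with G(1,2) show "fin_gen R M" unfolding fin_gen_def by blast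
qed

lemma fin_genE:
  assumes "module R M" "fin_gen R M"
  obtains G where "finite G" "G \<subseteq> carrier M" "\<forall>H. submodule H R M \<longrightarrow> G \<subseteq> H \<longrightarrow> H = carrier M"
  using assms(2) unfolding fin_gen_iff[OF assms(1)] imp_conjL by (elim exE conjE) (rule that)

lemma lin_vimage_submodule:
  assumes "module R M" "module R N" "is_linear R M N f" "submodule H R N"
  shows "submodule {x \<in> carrier M. f x \<in> H} R M"
proof -
  interpret M: module R M by fact
  note H = submodD[OF assms(2,4)]
  show ?thesis
    by (intro submodI[OF assms(1)]) (auto simp: lin_zero[OF assms(1-3)] H lin_add[OF assms(3)] lin_smult[OF assms(3)])
qed

lemma lin_image_submodule:
  assumes "module R M" "module R N" "is_linear R M N f" "submodule H R M"
  shows "submodule (f ` H) R N"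
proof -
  interpret M: module R M by fact
  note H = submodD[OF assms(1,4)]
  have "a \<oplus>\<^bsub>N\<^esub> b \<in> f ` H" if "a \<in> f ` H" "b \<in> f ` H" for a b
  proof -
    from that obtain x y where "x \<in> H" "y \<in> H" "a = f x" "b = f y" by auto
    then have "a \<oplus>\<^bsub>N\<^esub> b = f (x \<oplus>\<^bsub>M\<^esub> y)" using H by (simp add: lin_add[OF assms(3)])
    then show ?thesis using \<open>x \<in> H\<close> \<open>y \<in> H\<close> H by blast
  qed
  moreover have "a \<odot>\<^bsub>N\<^esub> b \<in> f ` H" if "a \<in> carrier R" "b \<in> f ` H" for a b
  proof -
    from that obtain y where "y \<in> H" "b = f y" by auto
    then have "a \<odot>\<^bsub>N\<^esub> b = f (a \<odot>\<^bsub>M\<^esub> y)" using H that by (simp add: lin_smult[OF assms(3)])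
    then show ?thesis using \<open>y \<in> H\<close> H that by blast
  qed
  ultimately show ?thesis
    using H lin_closed[OF assms(3)] lin_zero[OF assms(1-3)] 
    by (intro submodI[OF assms(2)]) (auto intro: image_eqI[of _ f "\<zero>\<^bsub>M\<^esub>"])
qed

text \<open>The preimage of a submodule containing the images of the generators is a submodule
  containing the generators.\<close>

lemma fin_gen_image:
  assumes "module R M" "module R N" "is_linear R M N f" "f ` carrier M = carrier N" "fin_gen R M"
  shows "fin_gen R N"
proof -
  obtain G where G': "finite G" "G \<subseteq> carrier M" "\<forall>H. submodule H R M \<longrightarrow> G \<subseteq> H \<longrightarrow> H = carrier M"
    by (rule fin_genE[OF assms(1,5)])
  note G = G'(1,2) G'(3)[rule_format]
  show ?thesis unfolding fin_gen_iff[OF assms(2)]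
  proof (intro exI[of _ "f ` G"] conjI allI impI)
    show "finite (f ` G)" "f ` G \<subseteq> carrier N" using G lin_closed[OF assms(3)] by auto
    fix H assume H: "submodule H R N \<and> f ` G \<subseteq> H"
    have "{x \<in> carrier M. f x \<in> H} = carrier M"
      by (rule G(3), rule lin_vimage_submodule[OF assms(1-3)]) (use H G(2) in auto)
    then have "\<forall>x\<in>carrier M. f x \<in> H" by (metis (no_types, lifting) mem_Collect_eq)
    then have "carrier N \<subseteq> H" unfolding assms(4)[symmetric] by (simp add: image_subset_iff)
    moreover have "H \<subseteq> carrier N" using H submodD(1)[OF assms(2)] by blast
    ultimately show "H = carrier N" by blast
  qed
qed

section \<open>Standard modules\<close>

lemma free_mod_simps [simp]:
  "carrier (free_mod T n) = {f. (\<forall>i<n. f i \<in> carrier T) \<and> (\<forall>i\<ge>n. f i = \<zero>\<^bsub>T\<^esub>)}"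
  "\<zero>\<^bsub>free_mod T n\<^esub> = (\<lambda>i. \<zero>\<^bsub>T\<^esub>)"
  "f \<oplus>\<^bsub>free_mod T n\<^esub> g = (\<lambda>i. f i \<oplus>\<^bsub>T\<^esub> g i)"
  "a \<odot>\<^bsub>free_mod T n\<^esub> f = (\<lambda>i. a \<otimes>\<^bsub>T\<^esub> f i)"
  by (simp_all add: free_mod_def)

lemma dsum2_simps [simp]:
  "carrier (dsum2 M N) = carrier M \<times> carrier N"
  "\<zero>\<^bsub>dsum2 M N\<^esub> = (\<zero>\<^bsub>M\<^esub>, \<zero>\<^bsub>N\<^esub>)"
  "p \<oplus>\<^bsub>dsum2 M N\<^esub> q = (fst p \<oplus>\<^bsub>M\<^esub> fst q, snd p \<oplus>\<^bsub>N\<^esub> snd q)"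
  "a \<odot>\<^bsub>dsum2 M N\<^esub> p = (a \<odot>\<^bsub>M\<^esub> fst p, a \<odot>\<^bsub>N\<^esub> snd p)"
  by (simp_all add: dsum2_def split: prod.splits)

lemma dsum_copies_simps [simp]:
  "carrier (dsum_copies M) = {f. (\<forall>i. f i \<in> carrier M) \<and> finite {i. f i \<noteq> \<zero>\<^bsub>M\<^esub>}}"
  "\<zero>\<^bsub>dsum_copies M\<^esub> = (\<lambda>i. \<zero>\<^bsub>M\<^esub>)"
  "f \<oplus>\<^bsub>dsum_copies M\<^esub> g = (\<lambda>i. f i \<oplus>\<^bsub>M\<^esub> g i)"
  "a \<odot>\<^bsub>dsum_copies M\<^esub> f = (\<lambda>i. a \<odot>\<^bsub>M\<^esub> f i)"
  by (simp_all add: dsum_copies_def)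

lemma free_memI: "(\<And>i. i < n \<Longrightarrow> f i \<in> carrier R) \<Longrightarrow> (\<And>i. i \<ge> n \<Longrightarrow> f i = \<zero>\<^bsub>R\<^esub>) \<Longrightarrow> f \<in> carrier (free_mod R n)"
  by simp

lemma (in cring) free_memD: "f \<in> carrier (free_mod R n) \<Longrightarrow> f i \<in> carrier R"
  by (cases "i < n") auto

lemma (in cring) module_free: "module R (free_mod R n)"
proof (rule moduleI)
  have c: "\<forall>i. f i \<in> carrier R" if "f \<in> carrier (free_mod R n)" for f
    using free_memD[OF that] by blast
  show "abelian_group (free_mod R n)"
  proof (rule abelian_groupI)
    fix f assume f: "f \<in> carrier (free_mod R n)"
    show "\<exists>g\<in>carrier (free_mod R n). g \<oplus>\<^bsub>free_mod R n\<^esub> f = \<zero>\<^bsub>free_mod R n\<^esub>"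
      using f c[OF f] by (intro bexI[of _ "\<lambda>i. \<ominus> f i"]) (simp_all add: l_neg)
    show "\<zero>\<^bsub>free_mod R n\<^esub> \<oplus>\<^bsub>free_mod R n\<^esub> f = f" using c[OF f] by simp
    fix g assume g: "g \<in> carrier (free_mod R n)"
    show "f \<oplus>\<^bsub>free_mod R n\<^esub> g \<in> carrier (free_mod R n)" using f g by simp
    show "f \<oplus>\<^bsub>free_mod R n\<^esub> g = g \<oplus>\<^bsub>free_mod R n\<^esub> f" using c[OF f] c[OF g] by (simp add: a_comm)
    fix h assume h: "h \<in> carrier (free_mod R n)"
    show "f \<oplus>\<^bsub>free_mod R n\<^esub> g \<oplus>\<^bsub>free_mod R n\<^esub> h = f \<oplus>\<^bsub>free_mod R n\<^esub> (g \<oplus>\<^bsub>free_mod R n\<^esub> h)"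
      using c[OF f] c[OF g] c[OF h] by (simp add: a_assoc)
  qed simp
  fix a f assume a: "a \<in> carrier R" and f: "f \<in> carrier (free_mod R n)"
  show "a \<odot>\<^bsub>free_mod R n\<^esub> f \<in> carrier (free_mod R n)" using a f by simp
  fix b assume b: "b \<in> carrier R"
  show "(a \<oplus> b) \<odot>\<^bsub>free_mod R n\<^esub> f = a \<odot>\<^bsub>free_mod R n\<^esub> f \<oplus>\<^bsub>free_mod R n\<^esub> b \<odot>\<^bsub>free_mod R n\<^esub> f"
    using a b c[OF f] by (simp add: l_distr)
  show "(a \<otimes> b) \<odot>\<^bsub>free_mod R n\<^esub> f = a \<odot>\<^bsub>free_mod R n\<^esub> (b \<odot>\<^bsub>free_mod R n\<^esub> f)"
    using a b c[OF f] by (simp add: m_assoc)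
next
  fix a f g assume a: "a \<in> carrier R" and f: "f \<in> carrier (free_mod R n)" and g: "g \<in> carrier (free_mod R n)"
  show "a \<odot>\<^bsub>free_mod R n\<^esub> (f \<oplus>\<^bsub>free_mod R n\<^esub> g) = a \<odot>\<^bsub>free_mod R n\<^esub> f \<oplus>\<^bsub>free_mod R n\<^esub> a \<odot>\<^bsub>free_mod R n\<^esub> g"
    using a free_memD[OF f] free_memD[OF g] by (simp add: r_distr)
next
  fix f assume f: "f \<in> carrier (free_mod R n)"
  show "\<one> \<odot>\<^bsub>free_mod R n\<^esub> f = f" using free_memD[OF f] by simp
qed (rule is_cring)

lemma module_dsum2:
  assumes "module R M" "module R N" shows "module R (dsum2 M N)"
proof -
  interpret M: module R M by fact
  interpret N: module R N by fact
  show ?thesis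
  proof (rule moduleI[OF M.is_cring])
    show "abelian_group (dsum2 M N)"
    proof (rule abelian_groupI)
      fix f assume f: "f \<in> carrier (dsum2 M N)"
      then show "\<exists>g\<in>carrier (dsum2 M N). g \<oplus>\<^bsub>dsum2 M N\<^esub> f = \<zero>\<^bsub>dsum2 M N\<^esub>"
        by (intro bexI[of _ "(\<ominus>\<^bsub>M\<^esub> fst f, \<ominus>\<^bsub>N\<^esub> snd f)"]) (auto simp: M.l_neg N.l_neg)
    next
      fix f g assume "f \<in> carrier (dsum2 M N)" "g \<in> carrier (dsum2 M N)"
      then show "f \<oplus>\<^bsub>dsum2 M N\<^esub> g = g \<oplus>\<^bsub>dsum2 M N\<^esub> f" by (auto simp: M.a_comm N.a_comm)
    qed (auto simp: M.a_assoc N.a_assoc)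
  qed (auto simp: M.smult_l_distr N.smult_l_distr M.smult_r_distr N.smult_r_distr M.smult_assoc1 N.smult_assoc1)
qed

lemma module_dsum_copies:
  assumes "module R M" shows "module R (dsum_copies M)"
proof -
  interpret M: module R M by fact
  have m: "f \<oplus>\<^bsub>dsum_copies M\<^esub> g \<in> carrier (dsum_copies M)"
    if "f \<in> carrier (dsum_copies M)" "g \<in> carrier (dsum_copies M)" for f g
  proof -
    have "{i. f i \<oplus>\<^bsub>M\<^esub> g i \<noteq> \<zero>\<^bsub>M\<^esub>} \<subseteq> {i. f i \<noteq> \<zero>\<^bsub>M\<^esub>} \<union> {i. g i \<noteq> \<zero>\<^bsub>M\<^esub>}" by auto
    then have "finite {i. f i \<oplus>\<^bsub>M\<^esub> g i \<noteq> \<zero>\<^bsub>M\<^esub>}"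
      by (rule finite_subset) (use that in simp)
    then show ?thesis using that by simp
  qed
  have s: "a \<odot>\<^bsub>dsum_copies M\<^esub> f \<in> carrier (dsum_copies M)"
    if "a \<in> carrier R" "f \<in> carrier (dsum_copies M)" for a f
  proof -
    have "{i. a \<odot>\<^bsub>M\<^esub> f i \<noteq> \<zero>\<^bsub>M\<^esub>} \<subseteq> {i. f i \<noteq> \<zero>\<^bsub>M\<^esub>}" using that by auto
    then have "finite {i. a \<odot>\<^bsub>M\<^esub> f i \<noteq> \<zero>\<^bsub>M\<^esub>}"
      by (rule finite_subset) (use that in simp)
    then show ?thesis using that by simp
  qed
  show ?thesis
  proof (rule moduleI[OF M.is_cring])
    show "abelian_group (dsum_copies M)"
    proof (rule abelian_groupI)
      fix f assume f: "f \<in> carrier (dsum_copies M)"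
      have "(\<ominus>\<^bsub>R\<^esub> \<one>\<^bsub>R\<^esub>) \<odot>\<^bsub>dsum_copies M\<^esub> f \<in> carrier (dsum_copies M)" using f by (intro s) auto
      then show "\<exists>g\<in>carrier (dsum_copies M). g \<oplus>\<^bsub>dsum_copies M\<^esub> f = \<zero>\<^bsub>dsum_copies M\<^esub>"
        by (rule bexI[rotated]) (use f in \<open>simp add: M.neg_smult[symmetric] M.l_neg\<close>)
    next
      fix f g h assume "f \<in> carrier (dsum_copies M)" "g \<in> carrier (dsum_copies M)" "h \<in> carrier (dsum_copies M)"
      then show "f \<oplus>\<^bsub>dsum_copies M\<^esub> g \<oplus>\<^bsub>dsum_copies M\<^esub> h = f \<oplus>\<^bsub>dsum_copies M\<^esub> (g \<oplus>\<^bsub>dsum_copies M\<^esub> h)"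
        by (simp add: M.a_assoc)
    next
      fix f g assume "f \<in> carrier (dsum_copies M)" "g \<in> carrier (dsum_copies M)"
      then show "f \<oplus>\<^bsub>dsum_copies M\<^esub> g = g \<oplus>\<^bsub>dsum_copies M\<^esub> f" by (simp add: M.a_comm)
    qed (simp_all only: m, simp_all)
  qed (simp_all only: s, simp_all add: M.smult_l_distr M.smult_r_distr M.smult_assoc1)
qed

section \<open>Dense embeddings\<close>

text \<open>A dense embedding. If in addition \<open>W\<close> is \<open>divisible\<close>, this
  characterises \<open>W\<close> as the localisation of a torsion-free \<open>U\<close> without
  mentioning classes of fractions. Divisibility is kept apart so that the same notion, taken with
  all nonzero scalars, also expresses that a free module has full rank in \<open>W\<close>.\<close>

definition loc_map ::
  "('a, 'r) ring_scheme \<Rightarrow> 'a set \<Rightarrow> ('a, 'c, 'm) module_scheme \<Rightarrow> ('a, 'd, 'n) module_scheme \<Rightarrow> ('c \<Rightarrow> 'd) \<Rightarrow> bool"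
  where "loc_map R S U W f \<longleftrightarrow> is_linear R U W f \<and> inj_on f (carrier U) \<and>
     (\<forall>w\<in>carrier W. \<exists>s\<in>S. \<exists>u\<in>carrier U. s \<odot>\<^bsub>W\<^esub> w = f u)"

text \<open>Bijectivity of the action of S is exactly what makes an R-module a module over the
  localised ring; it combines unique division with the absence of S-torsion.\<close>

definition divisible :: "('a, 'r) ring_scheme \<Rightarrow> 'a set \<Rightarrow> ('a, 'c, 'm) module_scheme \<Rightarrow> bool" where
  "divisible R S W \<longleftrightarrow> (\<forall>s\<in>S. bij_betw (\<lambda>x. s \<odot>\<^bsub>W\<^esub> x) (carrier W) (carrier W))"

definition tfree :: "('a, 'r) ring_scheme \<Rightarrow> ('a, 'c, 'm) module_scheme \<Rightarrow> bool" where
  "tfree R W \<longleftrightarrow> (\<forall>a\<in>carrier R. \<forall>x\<in>carrier W. a \<odot>\<^bsub>W\<^esub> x = \<zero>\<^bsub>W\<^esub> \<longrightarrow> a = \<zero>\<^bsub>R\<^esub> \<or> x = \<zero>\<^bsub>W\<^esub>)"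

text \<open>Rank without the field of fractions: a free submodule of rank n with torsion quotient.
  For torsion-free modules it is obtained from the rank of the generic fibre in
  \<open>has_rk_of_has_rank\<close>.\<close>

definition has_rk :: "('a, 'r) ring_scheme \<Rightarrow> ('a, 'c, 'm) module_scheme \<Rightarrow> nat \<Rightarrow> bool" where
  "has_rk R W n \<longleftrightarrow> (\<exists>b. loc_map R (nonzeros R) (free_mod R n) W b)"

lemma (in module) smult_comm:
  "a \<in> carrier R \<Longrightarrow> b \<in> carrier R \<Longrightarrow> x \<in> carrier M \<Longrightarrow> a \<odot>\<^bsub>M\<^esub> (b \<odot>\<^bsub>M\<^esub> x) = b \<odot>\<^bsub>M\<^esub> (a \<odot>\<^bsub>M\<^esub> x)"
  by (metis R.m_comm smult_assoc1)

lemma loc_mapD: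
  assumes "loc_map R S U W f"
  shows "is_linear R U W f" "inj_on f (carrier U)" "\<And>w. w \<in> carrier W \<Longrightarrow> \<exists>s\<in>S. \<exists>u\<in>carrier U. s \<odot>\<^bsub>W\<^esub> w = f u"
  using assms by (auto simp: loc_map_def)

lemma mult_setD:
  assumes "mult_set R S"
  shows "s \<in> S \<Longrightarrow> s \<in> carrier R" "\<one>\<^bsub>R\<^esub> \<in> S" "s \<in> S \<Longrightarrow> t \<in> S \<Longrightarrow> s \<otimes>\<^bsub>R\<^esub> t \<in> S"
  using assms by (auto simp: mult_set_def)

lemma divisibleD:
  assumes "divisible R S W" "s \<in> S"
  shows "x \<in> carrier W \<Longrightarrow> y \<in> carrier W \<Longrightarrow> s \<odot>\<^bsub>W\<^esub> x = s \<odot>\<^bsub>W\<^esub> y \<Longrightarrow> x = y"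
    "y \<in> carrier W \<Longrightarrow> \<exists>x\<in>carrier W. s \<odot>\<^bsub>W\<^esub> x = y"
proof -
  have *: "bij_betw (\<lambda>x. s \<odot>\<^bsub>W\<^esub> x) (carrier W) (carrier W)" using assms by (auto simp: divisible_def)
  show "x \<in> carrier W \<Longrightarrow> y \<in> carrier W \<Longrightarrow> s \<odot>\<^bsub>W\<^esub> x = s \<odot>\<^bsub>W\<^esub> y \<Longrightarrow> x = y"
    using bij_betw_imp_inj_on[OF *] by (auto dest: inj_onD)
  show "y \<in> carrier W \<Longrightarrow> \<exists>x\<in>carrier W. s \<odot>\<^bsub>W\<^esub> x = y"
    using bij_betw_imp_surj_on[OF *] by (metis (no_types, lifting) imageE)
qed

lemma divisibleI:
  assumes "module R W" "\<And>s. s \<in> S \<Longrightarrow> s \<in> carrier R"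
   "\<And>s x. s \<in> S \<Longrightarrow> x \<in> carrier W \<Longrightarrow> s \<odot>\<^bsub>W\<^esub> x = \<zero>\<^bsub>W\<^esub> \<Longrightarrow> x = \<zero>\<^bsub>W\<^esub>"
   "\<And>s y. s \<in> S \<Longrightarrow> y \<in> carrier W \<Longrightarrow> \<exists>x\<in>carrier W. s \<odot>\<^bsub>W\<^esub> x = y"
  shows "divisible R S W"
  unfolding divisible_def
proof
  fix s assume s: "s \<in> S"
  interpret W: module R W by fact
  have sc: "s \<in> carrier R" using assms(2) s .
  have lin: "is_linear R W W (\<lambda>x. s \<odot>\<^bsub>W\<^esub> x)" using lin_scale[OF assms(1) lin_id sc] .
  have "inj_on (\<lambda>x. s \<odot>\<^bsub>W\<^esub> x) (carrier W)"
    unfolding lin_inj_iff[OF assms(1,1) lin] using assms(3)[OF s] by blast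
  moreover have "(\<lambda>x. s \<odot>\<^bsub>W\<^esub> x) ` carrier W = carrier W"
    using assms(4)[OF s] lin_closed[OF lin] by (force simp: image_iff)
  ultimately show "bij_betw (\<lambda>x. s \<odot>\<^bsub>W\<^esub> x) (carrier W) (carrier W)" by (simp add: bij_betw_def)
qed

lemma tfreeD:
  "tfree R W \<Longrightarrow> a \<in> carrier R \<Longrightarrow> a \<noteq> \<zero>\<^bsub>R\<^esub> \<Longrightarrow> x \<in> carrier W \<Longrightarrow> a \<odot>\<^bsub>W\<^esub> x = \<zero>\<^bsub>W\<^esub> \<Longrightarrow> x = \<zero>\<^bsub>W\<^esub>"
  by (auto simp: tfree_def)

lemma tfree_cancel:
  assumes "module R W" "tfree R W" "a \<in> carrier R" "a \<noteq> \<zero>\<^bsub>R\<^esub>" "x \<in> carrier W" "y \<in> carrier W" "a \<odot>\<^bsub>W\<^esub> x = a \<odot>\<^bsub>W\<^esub> y"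
  shows "x = y"
proof -
  interpret W: module R W by fact
  have lin: "is_linear R W W (\<lambda>x. a \<odot>\<^bsub>W\<^esub> x)" using lin_scale[OF assms(1) lin_id assms(3)] .
  have "inj_on (\<lambda>x. a \<odot>\<^bsub>W\<^esub> x) (carrier W)"
    unfolding lin_inj_iff[OF assms(1,1) lin] using tfreeD[OF assms(2,3,4)] by blast
  then show ?thesis using assms by (auto dest: inj_onD)
qed

lemma tfree_inj:
  assumes "module R U" "module R W" "is_linear R U W f" "inj_on f (carrier U)" "tfree R W"
  shows "tfree R U"
  unfolding tfree_def
proof (intro ballI impI)
  interpret U: module R U by fact
  interpret W: module R W by fact
  fix a x assume *: "a \<in> carrier R" "x \<in> carrier U" "a \<odot>\<^bsub>U\<^esub> x = \<zero>\<^bsub>U\<^esub>"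
  then have "a \<odot>\<^bsub>W\<^esub> f x = \<zero>\<^bsub>W\<^esub>"
    using lin_smult[OF assms(3), of a x] lin_zero[OF assms(1-3)] by simp
  then have "a = \<zero>\<^bsub>R\<^esub> \<or> f x = \<zero>\<^bsub>W\<^esub>" using assms(5) * lin_closed[OF assms(3)] by (auto simp: tfree_def)
  then show "a = \<zero>\<^bsub>R\<^esub> \<or> x = \<zero>\<^bsub>U\<^esub>" using * assms(4) unfolding lin_inj_iff[OF assms(1-3)] by blast
qed

text \<open>Induction on the finite set, multiplying denominators. Stability is asked for on both
  sides because \<open>R\<close> carries no commutativity assumption here.\<close>

lemma common_denominator:
  assumes "mult_set R S" "finite G" "\<And>g. g \<in> G \<Longrightarrow> \<exists>s\<in>S. P s g"
    "\<And>s t g. s \<in> S \<Longrightarrow> t \<in> S \<Longrightarrow> g \<in> G \<Longrightarrow> P s g \<Longrightarrow> P (t \<otimes>\<^bsub>R\<^esub> s) g"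
    "\<And>s t g. s \<in> S \<Longrightarrow> t \<in> S \<Longrightarrow> g \<in> G \<Longrightarrow> P s g \<Longrightarrow> P (s \<otimes>\<^bsub>R\<^esub> t) g"
  shows "\<exists>s\<in>S. \<forall>g\<in>G. P s g"
  using assms(2-)
proof (induction)
  case empty
  then show ?case using mult_setD(2)[OF assms(1)] by blast
next
  case (insert g G)
  have "\<exists>s\<in>S. \<forall>g\<in>G. P s g" by (rule insert.IH) (use insert.prems in blast)+
  then obtain s t where st: "s \<in> S" "t \<in> S" "\<forall>g\<in>G. P s g" "P t g" using insert.prems(1)[of g] by blast
  have "P (s \<otimes>\<^bsub>R\<^esub> t) h" if "h \<in> insert g G" for h
    using that insert.prems(2)[of t s g] insert.prems(3)[of s t h] st by blast
  then show ?case using mult_setD(3)[OF assms(1) st(1,2)] by blast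
qed

text \<open>Hom out of a finitely generated module commutes with localisation: finitely many
  generators have one common denominator s, and s times \<open>f\<close> then takes all of
  \<open>L\<close> into the copy of \<open>U\<close>. Injectivity of \<open>i\<close> makes the
  lifted map linear.\<close>

lemma lift_fin_gen:
  assumes L: "module R L" and U: "module R U" and V: "module R V" and S: "mult_set R S"
    and fg: "fin_gen R L" and f: "is_linear R L V f" and i: "is_linear R U V i" "inj_on i (carrier U)"
    and den: "\<And>x. x \<in> carrier L \<Longrightarrow> \<exists>s\<in>S. \<exists>u\<in>carrier U. s \<odot>\<^bsub>V\<^esub> f x = i u"
  shows "\<exists>s\<in>S. \<exists>g. is_linear R L U g \<and> (\<forall>x\<in>carrier L. i (g x) = s \<odot>\<^bsub>V\<^esub> f x)"
proof -
  interpret L: module R L by fact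
  interpret U: module R U by fact
  interpret V: module R V by fact
  note fc = lin_closed[OF f] and Sc = mult_setD(1)[OF S]
  obtain G where G': "finite G" "G \<subseteq> carrier L" "\<forall>H. submodule H R L \<longrightarrow> G \<subseteq> H \<longrightarrow> H = carrier L"
    by (rule fin_genE[OF L fg])
  note G = G'(1,2) G'(3)[rule_format]
  have 1: "\<exists>u\<in>carrier U. (t \<otimes>\<^bsub>R\<^esub> s) \<odot>\<^bsub>V\<^esub> f g = i u"
    if h: "\<exists>u\<in>carrier U. s \<odot>\<^bsub>V\<^esub> f g = i u" "s \<in> S" "t \<in> S" "g \<in> G" for s t g
  proof -
    obtain u where u: "u \<in> carrier U" "s \<odot>\<^bsub>V\<^esub> f g = i u" using h(1) by blast
    have c: "s \<in> carrier R" "t \<in> carrier R" "f g \<in> carrier V" using h(2-4) Sc fc G(2) by blast+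
    have "(t \<otimes>\<^bsub>R\<^esub> s) \<odot>\<^bsub>V\<^esub> f g = i (t \<odot>\<^bsub>U\<^esub> u)" using c u by (simp add: V.smult_assoc1 lin_smult[OF i(1)])
    then show ?thesis using c u by blast
  qed
  have "\<exists>s\<in>S. \<forall>g\<in>G. \<exists>u\<in>carrier U. s \<odot>\<^bsub>V\<^esub> f g = i u"
  proof (rule common_denominator[OF S G(1)])
    show "\<exists>s\<in>S. \<exists>u\<in>carrier U. s \<odot>\<^bsub>V\<^esub> f g = i u" if "g \<in> G" for g using den that G(2) by blast
    show "\<exists>u\<in>carrier U. (t \<otimes>\<^bsub>R\<^esub> s) \<odot>\<^bsub>V\<^esub> f g = i u" if "s \<in> S" "t \<in> S" "g \<in> G" "\<exists>u\<in>carrier U. s \<odot>\<^bsub>V\<^esub> f g = i u" for s t g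
      using 1 that by blast
    show "\<exists>u\<in>carrier U. (s \<otimes>\<^bsub>R\<^esub> t) \<odot>\<^bsub>V\<^esub> f g = i u" if "s \<in> S" "t \<in> S" "g \<in> G" "\<exists>u\<in>carrier U. s \<odot>\<^bsub>V\<^esub> f g = i u" for s t g
      using 1[of s g t] that Sc L.m_comm[of s t] by auto
  qed
  then obtain s where s: "s \<in> S" "\<And>g. g \<in> G \<Longrightarrow> \<exists>u\<in>carrier U. s \<odot>\<^bsub>V\<^esub> f g = i u" by blast
  have lin: "is_linear R L V (\<lambda>x. s \<odot>\<^bsub>V\<^esub> f x)" by (rule lin_scale[OF V f Sc[OF s(1)]])
  \<comment> \<open>The elements that s times \<open>f\<close> sends into the image of
    \<open>U\<close> form a submodule containing the generators.\<close>
  have "{x \<in> carrier L. s \<odot>\<^bsub>V\<^esub> f x \<in> i ` carrier U} = carrier L"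
  proof (rule G(3))
    show "submodule {x \<in> carrier L. s \<odot>\<^bsub>V\<^esub> f x \<in> i ` carrier U} R L"
      by (intro lin_vimage_submodule[OF L V lin] lin_image_submodule[OF U V i(1)] U.carrier_is_submodule)
    show "G \<subseteq> {x \<in> carrier L. s \<odot>\<^bsub>V\<^esub> f x \<in> i ` carrier U}" using s(2) G(2) by auto
  qed
  then have "\<forall>x\<in>carrier L. \<exists>u. u \<in> carrier U \<and> i u = s \<odot>\<^bsub>V\<^esub> f x" by (auto simp: image_iff set_eq_iff eq_commute)
  then obtain g where g: "\<And>x. x \<in> carrier L \<Longrightarrow> g x \<in> carrier U" "\<And>x. x \<in> carrier L \<Longrightarrow> i (g x) = s \<odot>\<^bsub>V\<^esub> f x"
    by metis
  have "is_linear R L U g"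
  proof (rule linI)
    fix x y assume "x \<in> carrier L" "y \<in> carrier L"
    then show "g (x \<oplus>\<^bsub>L\<^esub> y) = g x \<oplus>\<^bsub>U\<^esub> g y"
      by (intro inj_onD[OF i(2)]) (simp_all add: g lin_add[OF i(1)] lin_add[OF lin])
  next
    fix a x assume "a \<in> carrier R" "x \<in> carrier L"
    then show "g (a \<odot>\<^bsub>L\<^esub> x) = a \<odot>\<^bsub>U\<^esub> g x"
      by (intro inj_onD[OF i(2)]) (simp_all add: g lin_smult[OF i(1)] lin_smult[OF lin])
  qed (rule g)
  then show ?thesis using s(1) g(2) by blast
qed

text \<open>Universal property of localisation. The value at w is the v with s v = f u for a
  presentation s w = p u; divisibility provides v, and two presentations are compared by
  cross-multiplying, using that \<open>p\<close> is injective, and cancelling s in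
  \<open>V\<close>.\<close>

lemma extend_loc_map:
  assumes U: "module R U" and W: "module R W" and V: "module R V" and S: "mult_set R S"
    and p: "loc_map R S U W p" and V_div: "divisible R S V" and f: "is_linear R U V f"
  shows "\<exists>g. is_linear R W V g \<and> (\<forall>u\<in>carrier U. g (p u) = f u)"
proof -
  interpret U: module R U by fact
  interpret W: module R W by fact
  interpret V: module R V by fact
  note p = loc_mapD[OF p]
  note Sc = mult_setD(1)[OF S] and fc = lin_closed[OF f] and pc = lin_closed[OF p(1)]
  note canc = divisibleD(1)[OF V_div]
  have key: "\<exists>v\<in>carrier V. \<forall>s\<in>S. \<forall>u\<in>carrier U. s \<odot>\<^bsub>W\<^esub> w = p u \<longrightarrow> s \<odot>\<^bsub>V\<^esub> v = f u" if w: "w \<in> carrier W" for w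
  proof -
    obtain s u where s: "s \<in> S" "u \<in> carrier U" "s \<odot>\<^bsub>W\<^esub> w = p u" using p(3)[OF w] by blast
    obtain v where v: "v \<in> carrier V" "s \<odot>\<^bsub>V\<^esub> v = f u" using divisibleD(2)[OF V_div s(1)] fc s(2) by blast
    have "t \<odot>\<^bsub>V\<^esub> v = f u'" if t: "t \<in> S" "u' \<in> carrier U" "t \<odot>\<^bsub>W\<^esub> w = p u'" for t u'
    proof (rule canc[OF s(1)])
      have c: "s \<in> carrier R" "t \<in> carrier R" using s t Sc by blast+
      have "p (t \<odot>\<^bsub>U\<^esub> u) = t \<odot>\<^bsub>W\<^esub> (s \<odot>\<^bsub>W\<^esub> w)" by (simp only: s(3) lin_smult[OF p(1) c(2) s(2)])
      also have "\<dots> = s \<odot>\<^bsub>W\<^esub> (t \<odot>\<^bsub>W\<^esub> w)" by (rule W.smult_comm[OF c(2,1) w])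
      also have "\<dots> = p (s \<odot>\<^bsub>U\<^esub> u')" by (simp only: t(3) lin_smult[OF p(1) c(1) t(2)])
      finally have *: "t \<odot>\<^bsub>U\<^esub> u = s \<odot>\<^bsub>U\<^esub> u'" by (rule inj_onD[OF p(2)]) (use s t c in simp_all)
      have "s \<odot>\<^bsub>V\<^esub> (t \<odot>\<^bsub>V\<^esub> v) = t \<odot>\<^bsub>V\<^esub> f u" unfolding v(2)[symmetric] by (rule V.smult_comm[OF c v(1)])
      also have "\<dots> = f (s \<odot>\<^bsub>U\<^esub> u')" by (simp only: lin_smult[OF f c(2) s(2), symmetric] *)
      finally show "s \<odot>\<^bsub>V\<^esub> (t \<odot>\<^bsub>V\<^esub> v) = s \<odot>\<^bsub>V\<^esub> f u'" by (simp only: lin_smult[OF f c(1) t(2)])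
    qed (use v Sc[OF t(1)] fc[OF t(2)] in auto)
    then show ?thesis using v(1) by blast
  qed
  have "\<forall>w\<in>carrier W. \<exists>v. v \<in> carrier V \<and> (\<forall>s\<in>S. \<forall>u\<in>carrier U. s \<odot>\<^bsub>W\<^esub> w = p u \<longrightarrow> s \<odot>\<^bsub>V\<^esub> v = f u)"
    using key by blast
  from bchoice[OF this] obtain g where "\<forall>w\<in>carrier W. g w \<in> carrier V \<and> (\<forall>s\<in>S. \<forall>u\<in>carrier U. s \<odot>\<^bsub>W\<^esub> w = p u \<longrightarrow> s \<odot>\<^bsub>V\<^esub> g w = f u)"
    by blast
  then have gc: "\<And>w. w \<in> carrier W \<Longrightarrow> g w \<in> carrier V"
    and g: "\<And>w s u. w \<in> carrier W \<Longrightarrow> s \<in> S \<Longrightarrow> u \<in> carrier U \<Longrightarrow> s \<odot>\<^bsub>W\<^esub> w = p u \<Longrightarrow> s \<odot>\<^bsub>V\<^esub> g w = f u"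
    by blast+
  have "is_linear R W V g"
  proof (rule linI[OF gc])
    fix x y assume x: "x \<in> carrier W" "y \<in> carrier W"
    obtain s u t u' where s: "s \<in> S" "u \<in> carrier U" "s \<odot>\<^bsub>W\<^esub> x = p u" "t \<in> S" "u' \<in> carrier U" "t \<odot>\<^bsub>W\<^esub> y = p u'"
      using p(3)[OF x(1)] p(3)[OF x(2)] by blast
    have c: "s \<in> carrier R" "t \<in> carrier R" using s Sc by blast+
    have "(s \<otimes>\<^bsub>R\<^esub> t) \<odot>\<^bsub>W\<^esub> (x \<oplus>\<^bsub>W\<^esub> y) = t \<odot>\<^bsub>W\<^esub> (s \<odot>\<^bsub>W\<^esub> x) \<oplus>\<^bsub>W\<^esub> s \<odot>\<^bsub>W\<^esub> (t \<odot>\<^bsub>W\<^esub> y)"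
      using x c by (simp add: W.smult_assoc1 W.smult_r_distr W.smult_comm[of s t])
    also have "\<dots> = p (t \<odot>\<^bsub>U\<^esub> u \<oplus>\<^bsub>U\<^esub> s \<odot>\<^bsub>U\<^esub> u')" using s(2,5) c
      by (simp add: s(3,6) lin_smult[OF p(1)] lin_add[OF p(1)])
    finally have "(s \<otimes>\<^bsub>R\<^esub> t) \<odot>\<^bsub>V\<^esub> g (x \<oplus>\<^bsub>W\<^esub> y) = f (t \<odot>\<^bsub>U\<^esub> u \<oplus>\<^bsub>U\<^esub> s \<odot>\<^bsub>U\<^esub> u')"
      by (intro g) (use s(2,5) c x mult_setD(3)[OF S s(1,4)] in simp_all)
    also have "\<dots> = t \<odot>\<^bsub>V\<^esub> (s \<odot>\<^bsub>V\<^esub> g x) \<oplus>\<^bsub>V\<^esub> s \<odot>\<^bsub>V\<^esub> (t \<odot>\<^bsub>V\<^esub> g y)"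
      using s(2,5) c by (simp add: g[OF x(1) s(1-3)] g[OF x(2) s(4-6)] lin_smult[OF f] lin_add[OF f])
    also have "\<dots> = (s \<otimes>\<^bsub>R\<^esub> t) \<odot>\<^bsub>V\<^esub> (g x \<oplus>\<^bsub>V\<^esub> g y)"
      using gc[OF x(1)] gc[OF x(2)] c by (simp add: V.smult_assoc1 V.smult_r_distr V.smult_comm[of s t])
    finally show "g (x \<oplus>\<^bsub>W\<^esub> y) = g x \<oplus>\<^bsub>V\<^esub> g y"
      by (rule canc[OF mult_setD(3)[OF S s(1,4)], rotated -1]) (use x gc[OF x(1)] gc[OF x(2)] gc[OF W.a_closed[OF x]] in simp_all)
  next
    fix a x assume a: "a \<in> carrier R" and x: "x \<in> carrier W"
    obtain s u where s: "s \<in> S" "u \<in> carrier U" "s \<odot>\<^bsub>W\<^esub> x = p u" using p(3)[OF x] by blast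
    have c: "s \<in> carrier R" using s Sc by blast
    have "s \<odot>\<^bsub>W\<^esub> (a \<odot>\<^bsub>W\<^esub> x) = a \<odot>\<^bsub>W\<^esub> (s \<odot>\<^bsub>W\<^esub> x)" by (rule W.smult_comm[OF c a x])
    also have "\<dots> = p (a \<odot>\<^bsub>U\<^esub> u)" by (simp only: s(3) lin_smult[OF p(1) a s(2)])
    finally have "s \<odot>\<^bsub>V\<^esub> g (a \<odot>\<^bsub>W\<^esub> x) = f (a \<odot>\<^bsub>U\<^esub> u)" by (intro g) (use s(1,2) a x in simp_all)
    also have "\<dots> = a \<odot>\<^bsub>V\<^esub> (s \<odot>\<^bsub>V\<^esub> g x)" by (simp only: g[OF x s] lin_smult[OF f a s(2)])
    also have "\<dots> = s \<odot>\<^bsub>V\<^esub> (a \<odot>\<^bsub>V\<^esub> g x)" by (rule V.smult_comm[OF a c gc[OF x]])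
    finally show "g (a \<odot>\<^bsub>W\<^esub> x) = a \<odot>\<^bsub>V\<^esub> g x"
      by (rule canc[OF s(1), rotated -1]) (use x gc[OF x] a gc[OF W.smult_closed[OF a x]] in simp_all)
  qed
  moreover have "g (p u) = f u" if "u \<in> carrier U" for u
    using g[OF pc[OF that] mult_setD(2)[OF S] that] that fc[OF that] gc[OF pc[OF that]] pc[OF that] by simp
  ultimately show ?thesis by blast
qed

text \<open>Some s moves w into the image of \<open>p\<close>, where the two maps agree, and s can
  be cancelled in \<open>V\<close>.\<close>

lemma loc_map_unique:
  assumes W: "module R W" and V: "module R V" and p: "loc_map R S U W p" and V_div: "divisible R S V"
    and S: "mult_set R S"
    and f: "is_linear R W V f" and g: "is_linear R W V g" and eq: "\<And>u. u \<in> carrier U \<Longrightarrow> f (p u) = g (p u)"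
    and w: "w \<in> carrier W"
  shows "f w = g w"
proof -
  obtain s u where s: "s \<in> S" "u \<in> carrier U" "s \<odot>\<^bsub>W\<^esub> w = p u" using loc_mapD(3)[OF p w] by blast
  have sc: "s \<in> carrier R" using mult_setD(1)[OF S s(1)] .
  have "s \<odot>\<^bsub>V\<^esub> f w = s \<odot>\<^bsub>V\<^esub> g w"
    using lin_smult[OF f sc w] lin_smult[OF g sc w] s eq by simp
  then show ?thesis by (rule divisibleD(1)[OF V_div s(1) lin_closed[OF f w] lin_closed[OF g w]])
qed

section \<open>Rank over a domain\<close>

definition unit_vec :: "('a, 'r) ring_scheme \<Rightarrow> nat \<Rightarrow> nat \<Rightarrow> 'a" where
  "unit_vec R i = (\<lambda>j. if j = i then \<one>\<^bsub>R\<^esub> else \<zero>\<^bsub>R\<^esub>)"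

lemma (in cring) free_gen:
  assumes "submodule H R (free_mod R n)" "\<And>i. i < n \<Longrightarrow> unit_vec R i \<in> H"
  shows "H = carrier (free_mod R n)"
proof -
  interpret F: module R "free_mod R n" by (rule module_free)
  note H = submodD[OF module_free assms(1)]
  have "f \<in> H" if "f \<in> carrier (free_mod R n)" for f
  proof -
    \<comment> \<open>Prefixes of f are shown to lie in H by adding one scaled unit vector at a
      time.\<close>
    have "k \<le> n \<Longrightarrow> (\<lambda>j. if j < k then f j else \<zero>) \<in> H" for k
    proof (induction k)
      case 0 then show ?case using H(2) by simp
    next
      case (Suc k)
      have "f k \<in> carrier R" using that Suc by auto
      have "f k \<odot>\<^bsub>free_mod R n\<^esub> unit_vec R k \<in> H" using Suc assms(2)[of k] that by (intro H(4)) auto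
      then have *: "(\<lambda>j. if j < k then f j else \<zero>) \<oplus>\<^bsub>free_mod R n\<^esub> (f k \<odot>\<^bsub>free_mod R n\<^esub> unit_vec R k) \<in> H"
        using Suc H(3) by simp
      have "(\<lambda>j. if j < k then f j else \<zero>) \<oplus>\<^bsub>free_mod R n\<^esub> (f k \<odot>\<^bsub>free_mod R n\<^esub> unit_vec R k)
          = (\<lambda>j. if j < Suc k then f j else \<zero>)"
        using that Suc(2) by (auto simp: fun_eq_iff unit_vec_def less_Suc_eq)
      then show ?case using * by simp
    qed
    from this[of n] have "(\<lambda>j. if j < n then f j else \<zero>) \<in> H" by simp
    also have "(\<lambda>j. if j < n then f j else \<zero>) = f" using that by (auto simp: fun_eq_iff)
    finally show ?thesis .
  qed
  then show ?thesis using H(1) by blast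
qed

lemma (in cring) unit_vec_in: "i < n \<Longrightarrow> unit_vec R i \<in> carrier (free_mod R n)"
  by (auto simp: unit_vec_def)

lemma (in cring) free_fin_gen: "fin_gen R (free_mod R n)"
  unfolding fin_gen_iff[OF module_free]
proof (intro exI[of _ "unit_vec R ` {..<n}"] conjI allI impI)
  fix H assume "submodule H R (free_mod R n) \<and> unit_vec R ` {..<n} \<subseteq> H"
  then show "H = carrier (free_mod R n)" by (intro free_gen) auto
qed (use unit_vec_in in auto)

lemma (in domain) free_tfree: "tfree R (free_mod R n)"
  unfolding tfree_def
proof (intro ballI impI)
  fix a f assume *: "a \<in> carrier R" "f \<in> carrier (free_mod R n)" "a \<odot>\<^bsub>free_mod R n\<^esub> f = \<zero>\<^bsub>free_mod R n\<^esub>"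
  show "a = \<zero> \<or> f = \<zero>\<^bsub>free_mod R n\<^esub>"
  proof (rule disjCI)
    assume a: "f \<noteq> \<zero>\<^bsub>free_mod R n\<^esub>"
    then obtain i where i: "f i \<noteq> \<zero>" by auto
    have "a \<otimes> f i = \<zero>" using *(3) by (simp add: fun_eq_iff)
    then show "a = \<zero>" using i *(1) free_memD[OF *(2)] integral by blast
  qed
qed

text \<open>Fraction-free elimination. Let l be the last coordinate of f. If l vanishes, f already
  maps into rank n. Otherwise a unit vector e with l e nonzero serves as pivot, and x maps to (l e)
  x - (l x) e, which embeds a free module of rank m - 1 in the kernel of l; both ranks drop by
  one.\<close>

lemma (in domain) free_inj_le:
  "is_linear R (free_mod R m) (free_mod R n) f \<Longrightarrow> inj_on f (carrier (free_mod R m)) \<Longrightarrow> m \<le> n"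
proof (induction n arbitrary: m f)
  case 0
  note f = 0(1)
  show ?case
  proof (rule ccontr)
    assume "\<not> m \<le> 0"
    then have u: "unit_vec R 0 \<in> carrier (free_mod R m)" by (intro unit_vec_in) simp
    have "f (unit_vec R 0) = \<zero>\<^bsub>free_mod R 0\<^esub>" using lin_closed[OF f u] by (simp add: fun_eq_iff)
    then have "unit_vec R 0 = \<zero>\<^bsub>free_mod R m\<^esub>"
      using 0(2) u unfolding lin_inj_iff[OF module_free module_free f] by blast
    then have "unit_vec R 0 0 = \<zero>" by simp
    then show False by (simp add: unit_vec_def)
  qed
next
  case (Suc n)
  note f = Suc.prems(1)
  interpret F: module R "free_mod R m" by (rule module_free)
  interpret G: module R "free_mod R (Suc n)" by (rule module_free)
  have inj: "x = \<zero>\<^bsub>free_mod R m\<^esub>" if "x \<in> carrier (free_mod R m)" "f x = \<zero>\<^bsub>free_mod R (Suc n)\<^esub>" for x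
    using Suc.prems(2) that unfolding lin_inj_iff[OF module_free module_free f] by blast
  define l where "l = (\<lambda>x. f x n)"
  have l: "is_linear R (free_mod R m) (ring_as_mod R) l"
    unfolding l_def
  proof (rule linI)
    fix x assume "x \<in> carrier (free_mod R m)"
    then show "f x n \<in> carrier (ring_as_mod R)" using lin_closed[OF f] by auto
  next
    fix x y assume "x \<in> carrier (free_mod R m)" "y \<in> carrier (free_mod R m)"
    then show "f (x \<oplus>\<^bsub>free_mod R m\<^esub> y) n = f x n \<oplus>\<^bsub>ring_as_mod R\<^esub> f y n"
      using lin_add[OF f, of x y] by simp
  next
    fix a x assume "a \<in> carrier R" "x \<in> carrier (free_mod R m)"
    then show "f (a \<odot>\<^bsub>free_mod R m\<^esub> x) n = a \<odot>\<^bsub>ring_as_mod R\<^esub> f x n"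
      using lin_smult[OF f, of a x] by simp
  qed
  have RM: "module R (ring_as_mod R)" by (rule module_ring_as_mod) (rule is_cring)
  show ?case
  proof (cases "\<exists>p<m. l (unit_vec R p) \<noteq> \<zero>")
    case False
    \<comment> \<open>A functional that vanishes on all unit vectors has the whole free module as
      its kernel.\<close>
    have "{x \<in> carrier (free_mod R m). l x \<in> {\<zero>\<^bsub>ring_as_mod R\<^esub>}} = carrier (free_mod R m)"
    proof (rule free_gen)
      show "submodule {x \<in> carrier (free_mod R m). l x \<in> {\<zero>\<^bsub>ring_as_mod R\<^esub>}} R (free_mod R m)"
        by (rule lin_vimage_submodule[OF module_free RM l]) (rule submodI[OF RM], auto)
    qed (use False unit_vec_in in auto)
    then have l0: "f x n = \<zero>" if "x \<in> carrier (free_mod R m)" for x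
      using that unfolding l_def ring_as_mod_simps by blast
    have "f x \<in> carrier (free_mod R n)" if "x \<in> carrier (free_mod R m)" for x
      using lin_closed[OF f that] l0[OF that]
      by simp (metis le_less_Suc_eq less_SucI linorder_not_le)
    then have "is_linear R (free_mod R m) (free_mod R n) f"
      using f by (auto simp: is_linear_def)
    from Suc.IH[OF this Suc.prems(2)] show ?thesis by simp
  next
    case True
    then obtain p where p: "p < m" "l (unit_vec R p) \<noteq> \<zero>" by blast
    obtain k where m: "m = Suc k" using p by (cases m) auto
    define e where "e = unit_vec R p"
    have e: "e \<in> carrier (free_mod R m)" unfolding e_def using p by (intro unit_vec_in)
    \<comment> \<open>The embedding that inserts a zero at the pivot position p.\<close>
    define h where "h = (\<lambda>x j. if j < p then x j else if j = p then \<zero> else x (j - 1))"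
    have hc: "h x \<in> carrier (free_mod R m)" if "x \<in> carrier (free_mod R k)" for x
    proof (rule free_memI)
      show "h x i \<in> carrier R" for i using free_memD[OF that] by (simp add: h_def)
      show "h x i = \<zero>" if "i \<ge> m" for i using that p m \<open>x \<in> _\<close> by (auto simp: h_def)
    qed
    have h: "is_linear R (free_mod R k) (free_mod R m) h"
      by (rule linI[OF hc]) (auto simp: h_def fun_eq_iff)
    \<comment> \<open>The elimination map; applying l gives (l e)(l (h x)) - (l (h x))(l e) =
      0.\<close>
    define g where "g = (\<lambda>x. l e \<odot>\<^bsub>free_mod R m\<^esub> h x \<ominus>\<^bsub>free_mod R m\<^esub> l (h x) \<odot>\<^bsub>free_mod R m\<^esub> e)"
    have lc: "x \<in> carrier (free_mod R m) \<Longrightarrow> l x \<in> carrier R" for x using lin_closed[OF l] by simp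
    have "is_linear R (free_mod R k) (free_mod R m) (\<lambda>x. l (h x) \<odot>\<^bsub>free_mod R m\<^esub> e)"
    proof (rule linI)
      fix x y assume x: "x \<in> carrier (free_mod R k)" and y: "y \<in> carrier (free_mod R k)"
      show "l (h (x \<oplus>\<^bsub>free_mod R k\<^esub> y)) \<odot>\<^bsub>free_mod R m\<^esub> e 
         = l (h x) \<odot>\<^bsub>free_mod R m\<^esub> e \<oplus>\<^bsub>free_mod R m\<^esub> l (h y) \<odot>\<^bsub>free_mod R m\<^esub> e"
        unfolding lin_add[OF h x y] lin_add[OF l hc[OF x] hc[OF y]] ring_as_mod_simps
        using lc[OF hc[OF x]] lc[OF hc[OF y]] e by (intro F.smult_l_distr)
    next
      fix a x assume a: "a \<in> carrier R" and x: "x \<in> carrier (free_mod R k)"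
      show "l (h (a \<odot>\<^bsub>free_mod R k\<^esub> x)) \<odot>\<^bsub>free_mod R m\<^esub> e = a \<odot>\<^bsub>free_mod R m\<^esub> (l (h x) \<odot>\<^bsub>free_mod R m\<^esub> e)"
        unfolding lin_smult[OF h a x] lin_smult[OF l a hc[OF x]] ring_as_mod_simps
        using a lc[OF hc[OF x]] e by (intro F.smult_assoc1)
    qed (use e lc[OF hc] in \<open>intro F.smult_closed\<close>)
    then have g: "is_linear R (free_mod R k) (free_mod R m) g"
      unfolding g_def by (intro lin_diff lin_scale module_free h lc[OF e])
    have fg: "is_linear R (free_mod R k) (free_mod R (Suc n)) (\<lambda>x. f (g x))" by (rule lin_comp[OF g f])
    have lg: "l (g x) = \<zero>" if x: "x \<in> carrier (free_mod R k)" for x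
    proof -
      have "l (g x) = l e \<otimes> l (h x) \<ominus>\<^bsub>ring_as_mod R\<^esub> l (h x) \<otimes> l e"
        unfolding g_def using lin_minus[OF module_free RM l F.smult_closed[OF lc[OF e] hc[OF x]] F.smult_closed[OF lc[OF hc[OF x]] e]]
          lin_smult[OF l lc[OF e] hc[OF x]] lin_smult[OF l lc[OF hc[OF x]] e] by simp
      also have "\<dots> = \<zero>\<^bsub>ring_as_mod R\<^esub>" 
        using module.axioms(2)[OF RM] lc[OF e] lc[OF hc[OF x]] m_comm
        by (subst abelian_group.minus_eq_zero_iff) auto
      finally show ?thesis by simp
    qed
    have "f (g x) \<in> carrier (free_mod R n)" if "x \<in> carrier (free_mod R k)" for x
      using lin_closed[OF fg that] lg[OF that] unfolding l_def
      by simp (metis le_less_Suc_eq less_SucI linorder_not_le)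
    then have fg': "is_linear R (free_mod R k) (free_mod R n) (\<lambda>x. f (g x))"
      using fg by (auto simp: is_linear_def)
    moreover have "inj_on (\<lambda>x. f (g x)) (carrier (free_mod R k))"
      unfolding lin_inj_iff[OF module_free module_free fg']
    proof (intro ballI impI)
      fix x assume x: "x \<in> carrier (free_mod R k)" and "f (g x) = \<zero>\<^bsub>free_mod R n\<^esub>"
      then have "g x = \<zero>\<^bsub>free_mod R m\<^esub>" using inj lin_closed[OF g] by simp
      then have gx: "l e \<odot>\<^bsub>free_mod R m\<^esub> h x = l (h x) \<odot>\<^bsub>free_mod R m\<^esub> e"
        unfolding g_def by (subst (asm) F.M.minus_eq_zero_iff) (use lc[OF e] hc[OF x] e lc[OF hc[OF x]] in \<open>auto intro!: F.smult_closed simp del: free_mod_simps\<close>)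
      \<comment> \<open>Away from the pivot the e-term has coordinate zero, so l e, which is
        nonzero, can be cancelled. The entries of x are exactly the entries of h x at positions
        other than p.\<close>
      have hx: "h x j = \<zero>" if "j \<noteq> p" for j
      proof -
        have "l e \<otimes> h x j = \<zero>" using fun_cong[OF gx, of j] that lc[OF hc[OF x]]
          by (simp add: e_def unit_vec_def)
        then show ?thesis using integral[OF _ lc[OF e] free_memD[OF hc[OF x]]] p by (auto simp: e_def)
      qed
      have "x j = \<zero>" for j
      proof (cases "j < p")
        case True then show ?thesis using hx[of j] by (simp add: h_def)
      next
        case False then show ?thesis using hx[of "Suc j"] by (simp add: h_def)
      qed
      then show "x = \<zero>\<^bsub>free_mod R k\<^esub>" by (simp add: fun_eq_iff)
    qed
    ultimately have "k \<le> n" by (rule Suc.IH)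
    then show ?thesis using m by simp
  qed
qed

lemma (in domain) mult_set_nonzeros: "mult_set R (nonzeros R)"
  using integral by (auto simp: mult_set_def)

text \<open>One scalar s clears the denominators of the free submodule of \<open>W\<close> and moves
  it into \<open>U\<close>. Multiplication by s is injective because \<open>W\<close> is
  torsion-free, so no rank is lost.\<close>

lemma (in domain) rk_transfer:
  assumes U: "module R U" and W: "module R W" and S: "mult_set R S" "\<zero> \<notin> S"
    and p: "loc_map R S U W p" and rk: "has_rk R W n" and tf: "tfree R W"
  shows "has_rk R U n"
proof -
  interpret U: module R U by fact
  interpret W: module R W by fact
  obtain b where b: "loc_map R (nonzeros R) (free_mod R n) W b" using rk by (auto simp: has_rk_def)
  note p = loc_mapD[OF p] and b = loc_mapD[OF b]
  have Sc: "s \<in> carrier R" "s \<noteq> \<zero>" if "s \<in> S" for s using mult_setD(1)[OF S(1) that] S(2) that by auto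
  obtain s g where s: "s \<in> S" and g: "is_linear R (free_mod R n) U g" "\<And>x. x \<in> carrier (free_mod R n) \<Longrightarrow> p (g x) = s \<odot>\<^bsub>W\<^esub> b x"
    using lift_fin_gen[OF module_free U W S(1) free_fin_gen b(1) p(1,2)] p(3) lin_closed[OF b(1)] by blast
  have "loc_map R (nonzeros R) (free_mod R n) U g"
    unfolding loc_map_def
  proof (intro conjI ballI g)
    show "inj_on g (carrier (free_mod R n))"
    proof (rule inj_onI)
      fix x y assume xy: "x \<in> carrier (free_mod R n)" "y \<in> carrier (free_mod R n)" "g x = g y"
      then have "s \<odot>\<^bsub>W\<^esub> b x = s \<odot>\<^bsub>W\<^esub> b y" using g(2)[of x] g(2)[of y] by simp
      then have "b x = b y" by (rule tfree_cancel[OF W tf Sc[OF s] lin_closed[OF b(1) xy(1)] lin_closed[OF b(1) xy(2)]])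
      then show "x = y" by (rule inj_onD[OF b(2) _ xy(1,2)])
    qed
    fix u assume u: "u \<in> carrier U"
    obtain c x where c: "c \<in> nonzeros R" "x \<in> carrier (free_mod R n)" "c \<odot>\<^bsub>W\<^esub> p u = b x"
      using b(3)[OF lin_closed[OF p(1) u]] by blast
    have "p ((s \<otimes> c) \<odot>\<^bsub>U\<^esub> u) = s \<odot>\<^bsub>W\<^esub> (c \<odot>\<^bsub>W\<^esub> p u)"
      using u c Sc[OF s] lin_closed[OF p(1) u] by (simp add: lin_smult[OF p(1)] W.smult_assoc1)
    also have "\<dots> = p (g x)" using c g(2) by simp
    finally have "(s \<otimes> c) \<odot>\<^bsub>U\<^esub> u = g x"
      using u c(1) Sc[OF s] lin_closed[OF g(1) c(2)] by (intro inj_onD[OF p(2)]) auto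
    moreover have "s \<otimes> c \<in> nonzeros R" using Sc[OF s] c(1) integral by auto
    ultimately show "\<exists>s\<in>nonzeros R. \<exists>v\<in>carrier (free_mod R n). s \<odot>\<^bsub>U\<^esub> u = g v" using c(2) by blast
  qed
  then show ?thesis by (auto simp: has_rk_def)
qed

text \<open>After scaling by one nonzero element the first free submodule maps injectively into the
  second, and \<open>free_inj_le\<close> compares their ranks.\<close>

lemma (in domain) rk_le:
  assumes W: "module R W" and "has_rk R W m" "has_rk R W n"
  shows "m \<le> n"
proof -
  interpret W: module R W by fact
  obtain b c where "loc_map R (nonzeros R) (free_mod R m) W b" "loc_map R (nonzeros R) (free_mod R n) W c"
    using assms by (auto simp: has_rk_def)
  note b = loc_mapD[OF this(1)] and c = loc_mapD[OF this(2)]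
  obtain s g where s: "s \<in> nonzeros R" and g: "is_linear R (free_mod R m) (free_mod R n) g" 
     "\<And>x. x \<in> carrier (free_mod R m) \<Longrightarrow> c (g x) = s \<odot>\<^bsub>W\<^esub> b x"
    using lift_fin_gen[OF module_free module_free W mult_set_nonzeros free_fin_gen b(1) c(1,2)] c(3) lin_closed[OF b(1)] by blast
  have "inj_on g (carrier (free_mod R m))"
  proof (rule inj_onI)
    fix x y assume xy: "x \<in> carrier (free_mod R m)" "y \<in> carrier (free_mod R m)" "g x = g y"
    then have "s \<odot>\<^bsub>W\<^esub> b x = s \<odot>\<^bsub>W\<^esub> b y" using g(2)[of x] g(2)[of y] by simp
    then have *: "b (s \<odot>\<^bsub>free_mod R m\<^esub> x) = b (s \<odot>\<^bsub>free_mod R m\<^esub> y)"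
      using s lin_smult[OF b(1) _ xy(1), of s] lin_smult[OF b(1) _ xy(2), of s] by simp
    have "s \<odot>\<^bsub>free_mod R m\<^esub> x = s \<odot>\<^bsub>free_mod R m\<^esub> y"
      using inj_on_eq_iff[OF b(2) module.smult_closed[OF module_free _ xy(1), of s] module.smult_closed[OF module_free _ xy(2), of s]]
        s * by blast
    then show "x = y" by (rule tfree_cancel[OF module_free free_tfree _ _ xy(1,2), rotated -1]) (use s in blast)+
  qed
  then show ?thesis by (rule free_inj_le[OF g(1)])
qed

lemma (in domain) rk_unique:
  "module R W \<Longrightarrow> has_rk R W m \<Longrightarrow> has_rk R W n \<Longrightarrow> m = n"
  using rk_le by (metis le_antisym)

section \<open>Modules over a localisation, seen as modules over the base ring\<close>

text \<open>Restriction of scalars along the canonical map a -> a/1 from R to its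
  localisation.\<close>

definition res_mod ::
  "('a, 'r) ring_scheme \<Rightarrow> 'a set \<Rightarrow> (('a \<times> 'a) set, 'c, 'm) module_scheme \<Rightarrow> ('a, 'c) module" where
  "res_mod R S M = \<lparr>carrier = carrier M, monoid.mult = (\<lambda>x y. undefined), one = undefined,
     ring.zero = \<zero>\<^bsub>M\<^esub>, ring.add = ring.add M,
     smult = (\<lambda>a x. loc_class (ring_as_mod R) S a \<one>\<^bsub>R\<^esub> \<odot>\<^bsub>M\<^esub> x)\<rparr>"

lemma res_mod_simps [simp]:
  "carrier (res_mod R S M) = carrier M" "\<zero>\<^bsub>res_mod R S M\<^esub> = \<zero>\<^bsub>M\<^esub>"
  "x \<oplus>\<^bsub>res_mod R S M\<^esub> y = x \<oplus>\<^bsub>M\<^esub> y"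
  "a \<odot>\<^bsub>res_mod R S M\<^esub> x = loc_class (ring_as_mod R) S a \<one>\<^bsub>R\<^esub> \<odot>\<^bsub>M\<^esub> x"
  by (simp_all add: res_mod_def)

locale loc_base = domain R for R (structure) + fixes S
  assumes S: "mult_set R S" and zero_notin: "\<zero> \<notin> S"
begin

sublocale B: loc_module R "ring_as_mod R" S
  by (intro loc_module.intro module_ring_as_mod loc_module_axioms.intro S is_cring)

abbreviation (input) frac where "frac \<equiv> loc_class (ring_as_mod R) S"
abbreviation (input) A where "A \<equiv> loc_ring R S"

lemma S_nz: "s \<in> S \<Longrightarrow> s \<in> carrier R" "s \<in> S \<Longrightarrow> s \<noteq> \<zero>"
  using zero_notin mult_setD(1)[OF S] by auto

lemma cring_A: "cring A" by (rule B.loc_cring)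

lemma A_cases: assumes "c \<in> carrier A" obtains a s where "a \<in> carrier R" "s \<in> S" "c = frac a s"
  using assms B.class_cases by (auto simp: loc_ring_simps)

lemma frac_in [simp]: "a \<in> carrier R \<Longrightarrow> s \<in> S \<Longrightarrow> frac a s \<in> carrier A"
  using B.class_in[of a s] by (simp add: loc_ring_simps)

lemma frac_eq_iff:
  assumes "a \<in> carrier R" "b \<in> carrier R" "s \<in> S" "t \<in> S"
  shows "frac a s = frac b t \<longleftrightarrow> t \<otimes> a = s \<otimes> b"
proof
  assume "frac a s = frac b t"
  then obtain u where u: "u \<in> S" "(u \<otimes> t) \<otimes> a = (u \<otimes> s) \<otimes> b"
    using B.class_eq_iff[of a b s t] assms by auto
  then have "u \<otimes> (t \<otimes> a) = u \<otimes> (s \<otimes> b)" using assms S_nz(1) by (simp add: m_assoc)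
  then show "t \<otimes> a = s \<otimes> b"
    using m_lcancel[of u "t \<otimes> a" "s \<otimes> b"] S_nz[OF u(1)] assms S_nz(1)[OF assms(3)] S_nz(1)[OF assms(4)] by simp
next
  assume "t \<otimes> a = s \<otimes> b" then show "frac a s = frac b t"
    using B.class_eqI[of a b s t] assms by simp
qed

lemma frac_zero_iff: "a \<in> carrier R \<Longrightarrow> s \<in> S \<Longrightarrow> frac a s = \<zero>\<^bsub>A\<^esub> \<longleftrightarrow> a = \<zero>"
  using frac_eq_iff[of a \<zero> s \<one>] mult_setD(2)[OF S] S_nz(1)[of s] by (simp add: loc_ring_simps)

lemma frac_mult: "a \<in> carrier R \<Longrightarrow> s \<in> S \<Longrightarrow> b \<in> carrier R \<Longrightarrow> t \<in> S \<Longrightarrow> frac a s \<otimes>\<^bsub>A\<^esub> frac b t = frac (a \<otimes> b) (s \<otimes> t)"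
  using B.frac_mult[of a s b t] .

lemma frac_add1: "a \<in> carrier R \<Longrightarrow> b \<in> carrier R \<Longrightarrow> frac a \<one> \<oplus>\<^bsub>A\<^esub> frac b \<one> = frac (a \<oplus> b) \<one>"
  using B.frac_add[of a \<one> b \<one>] mult_setD(2)[OF S] by simp

lemma frac_mult1: "a \<in> carrier R \<Longrightarrow> b \<in> carrier R \<Longrightarrow> frac a \<one> \<otimes>\<^bsub>A\<^esub> frac b \<one> = frac (a \<otimes> b) \<one>"
  using frac_mult[of a \<one> b \<one>] mult_setD(2)[OF S] by simp

lemma frac_one: "\<one>\<^bsub>A\<^esub> = frac \<one> \<one>" and frac_zero: "\<zero>\<^bsub>A\<^esub> = frac \<zero> \<one>"
  by (simp_all add: loc_ring_simps)

lemma frac_cancel: "a \<in> carrier R \<Longrightarrow> s \<in> S \<Longrightarrow> frac s \<one> \<otimes>\<^bsub>A\<^esub> frac a s = frac a \<one>"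
  using mult_setD(2)[OF S] S_nz(1)[of s] by (simp add: frac_mult frac_eq_iff m_ac)

lemma domain_A: "domain A"
proof -
  interpret A: cring A by (rule cring_A)
  show ?thesis
  proof (rule domainI)
    show "cring A" by (rule cring_A)
    show "\<one>\<^bsub>A\<^esub> \<noteq> \<zero>\<^bsub>A\<^esub>" unfolding frac_one using frac_zero_iff[of \<one> \<one>] mult_setD(2)[OF S] by simp
    fix c d assume cd: "c \<otimes>\<^bsub>A\<^esub> d = \<zero>\<^bsub>A\<^esub>" and "c \<in> carrier A" "d \<in> carrier A"
    then obtain a s b t where *: "a \<in> carrier R" "s \<in> S" "c = frac a s" "b \<in> carrier R" "t \<in> S" "d = frac b t"
      by (metis A_cases)
    then have "a \<otimes> b = \<zero>" using cd mult_setD(3)[OF S *(2,5)] by (simp add: frac_mult frac_zero_iff)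
    then show "c = \<zero>\<^bsub>A\<^esub> \<or> d = \<zero>\<^bsub>A\<^esub>" using * integral by (auto simp: frac_zero_iff)
  qed
qed

lemma module_res:
  assumes "module A M" shows "module R (res_mod R S M)"
proof -
  interpret M: module A M by fact
  have 1: "\<one> \<in> S" by (rule mult_setD(2)[OF S])
  show ?thesis
  proof (rule moduleI[OF is_cring])
    show "abelian_group (res_mod R S M)"
      by (rule abelian_group_cong[OF M.M.abelian_group_axioms]) (simp_all add: res_mod_def)
  qed (use 1 in \<open>simp_all add: frac_add1[symmetric] frac_mult1[symmetric] M.smult_l_distr M.smult_r_distr M.smult_assoc1 frac_one[symmetric]\<close>)
qed

lemma res_divisible:
  assumes "module A M" shows "divisible R S (res_mod R S M)"
proof -
  interpret M: module A M by fact
  have 1: "\<one> \<in> S" by (rule mult_setD(2)[OF S])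
  have inv: "frac \<one> s \<odot>\<^bsub>M\<^esub> (frac s \<one> \<odot>\<^bsub>M\<^esub> x) = x" "frac s \<one> \<odot>\<^bsub>M\<^esub> (frac \<one> s \<odot>\<^bsub>M\<^esub> x) = x" 
    if "s \<in> S" "x \<in> carrier M" for s x
  proof -
    have "frac s \<one> \<otimes>\<^bsub>A\<^esub> frac \<one> s = \<one>\<^bsub>A\<^esub>" using that by (simp add: frac_cancel frac_one)
    moreover have "frac \<one> s \<otimes>\<^bsub>A\<^esub> frac s \<one> = frac s \<one> \<otimes>\<^bsub>A\<^esub> frac \<one> s"
      using that S_nz(1) 1 by (intro M.m_comm) simp_all
    ultimately show "frac \<one> s \<odot>\<^bsub>M\<^esub> (frac s \<one> \<odot>\<^bsub>M\<^esub> x) = x" "frac s \<one> \<odot>\<^bsub>M\<^esub> (frac \<one> s \<odot>\<^bsub>M\<^esub> x) = x"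
      using that S_nz(1)[OF that(1)] 1 by (simp_all add: M.smult_assoc1[symmetric])
  qed
  show ?thesis
  proof (rule divisibleI[OF module_res[OF assms] S_nz(1)])
    fix s x assume "s \<in> S" "x \<in> carrier (res_mod R S M)" "s \<odot>\<^bsub>res_mod R S M\<^esub> x = \<zero>\<^bsub>res_mod R S M\<^esub>"
    then show "x = \<zero>\<^bsub>res_mod R S M\<^esub>" using inv(1)[of s x] by simp
  next
    fix s y assume "s \<in> S" "y \<in> carrier (res_mod R S M)"
    then show "\<exists>x\<in>carrier (res_mod R S M). s \<odot>\<^bsub>res_mod R S M\<^esub> x = y"
      using inv(2)[of s y] by (intro bexI[of _ "frac \<one> s \<odot>\<^bsub>M\<^esub> y"]) simp_all
  qed simp
qed

lemma res_frac_smult: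
  assumes "module A M" "a \<in> carrier R" "s \<in> S" "x \<in> carrier M"
  shows "frac s \<one> \<odot>\<^bsub>M\<^esub> (frac a s \<odot>\<^bsub>M\<^esub> x) = frac a \<one> \<odot>\<^bsub>M\<^esub> x"
proof -
  interpret M: module A M by fact
  show ?thesis using assms(2-4) S_nz(1)[OF assms(3)] mult_setD(2)[OF S]
    by (simp add: M.smult_assoc1[symmetric] frac_cancel)
qed

text \<open>For c = a/s one has s f(c x) = f(a x) = a f(x) = s (c f(x)), and s acts injectively. So
  maps between modules over the localisation can be handled over R throughout.\<close>

lemma res_linD:
  assumes M: "module A M" and N: "module A N" and f: "is_linear R (res_mod R S M) (res_mod R S N) f"
  shows "is_linear A M N f"
proof (rule linI)
  interpret M: module A M by fact
  interpret N: module A N by fact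
  note fc = lin_closed[OF f, unfolded res_mod_simps]
  show "f x \<in> carrier N" if "x \<in> carrier M" for x using fc[OF that] .
  show "f (x \<oplus>\<^bsub>M\<^esub> y) = f x \<oplus>\<^bsub>N\<^esub> f y" if "x \<in> carrier M" "y \<in> carrier M" for x y
    using lin_add[OF f, of x y] that by simp
  fix c x assume "c \<in> carrier A" and x: "x \<in> carrier M"
  then obtain a s where c: "a \<in> carrier R" "s \<in> S" "c = frac a s" by (metis A_cases)
  have cx: "c \<odot>\<^bsub>M\<^esub> x \<in> carrier M" using \<open>c \<in> _\<close> x by simp
  have "s \<odot>\<^bsub>res_mod R S N\<^esub> f (c \<odot>\<^bsub>M\<^esub> x) = f (s \<odot>\<^bsub>res_mod R S M\<^esub> (c \<odot>\<^bsub>M\<^esub> x))"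
    using lin_smult[OF f S_nz(1)[OF c(2)], of "c \<odot>\<^bsub>M\<^esub> x"] cx by simp
  also have "\<dots> = f (a \<odot>\<^bsub>res_mod R S M\<^esub> x)" using res_frac_smult[OF M c(1,2) x] c(3) by simp
  also have "\<dots> = a \<odot>\<^bsub>res_mod R S N\<^esub> f x" using lin_smult[OF f c(1), of x] x by simp
  also have "\<dots> = s \<odot>\<^bsub>res_mod R S N\<^esub> (c \<odot>\<^bsub>N\<^esub> f x)" using res_frac_smult[OF N c(1,2) fc[OF x]] c(3) by simp
  finally show "f (c \<odot>\<^bsub>M\<^esub> x) = c \<odot>\<^bsub>N\<^esub> f x"
    by (rule divisibleD(1)[OF res_divisible[OF N] c(2), rotated -1]) 
      (use fc[OF cx] N.smult_closed[OF \<open>c \<in> carrier A\<close> fc[OF x]] in simp_all)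
qed

lemma res_linI:
  assumes "is_linear A M N f" shows "is_linear R (res_mod R S M) (res_mod R S N) f"
  using mult_setD(2)[OF S]
  by (intro linI) (simp_all add: lin_closed[OF assms] lin_add[OF assms] lin_smult[OF assms])

lemma canonical_lin:
  assumes "module R U"
  shows "is_linear R U (res_mod R S (loc_mod R U S)) (\<lambda>x. loc_class U S x \<one>)"
proof -
  interpret U: loc_module R U S by (intro loc_module.intro assms loc_module_axioms.intro S)
  have 1: "\<one> \<in> S" by (rule mult_setD(2)[OF S])
  show ?thesis
  proof (rule linI)
    fix x y assume "x \<in> carrier U" "y \<in> carrier U"
    then show "loc_class U S (x \<oplus>\<^bsub>U\<^esub> y) \<one> = loc_class U S x \<one> \<oplus>\<^bsub>res_mod R S (loc_mod R U S)\<^esub> loc_class U S y \<one>"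
      using U.class_add[OF _ 1 _ 1, of x y] by simp
  next
    fix a x assume "a \<in> carrier R" "x \<in> carrier U"
    then show "loc_class U S (a \<odot>\<^bsub>U\<^esub> x) \<one> = a \<odot>\<^bsub>res_mod R S (loc_mod R U S)\<^esub> loc_class U S x \<one>"
      using U.class_smult[OF _ 1 _ 1, of a x] by simp
  qed (use U.class_in[OF _ 1] in simp)
qed

text \<open>The canonical map into the module of fractions extends along \<open>p\<close> to a map g
  on \<open>M\<close>. An element killed by g is S-torsion and hence zero, and u/s is the image of
  (1/s) p u; the required isomorphism is the inverse of g.\<close>

lemma mod_iso_of_loc_map:
  assumes U: "module R U" and M: "module A M" and p: "loc_map R S U (res_mod R S M) p"
  shows "mod_iso A (loc_mod R U S) M"
proof -
  interpret U: loc_module R U S by (intro loc_module.intro U loc_module_axioms.intro S)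
  interpret M: module A M by fact
  interpret L: module A "loc_mod R U S" by (rule U.loc_module)
  let ?V = "res_mod R S (loc_mod R U S)"
  note RM = module_res[OF M] and RV = module_res[OF U.loc_module]
  obtain g where g: "is_linear R (res_mod R S M) ?V g" "\<And>u. u \<in> carrier U \<Longrightarrow> g (p u) = loc_class U S u \<one>"
    using extend_loc_map[OF U RM RV S p res_divisible[OF U.loc_module] canonical_lin[OF U]] by blast
  note gA = res_linD[OF M U.loc_module g(1)]
  note p = loc_mapD[OF p, unfolded res_mod_simps]
  have "inj_on g (carrier M)"
    unfolding lin_inj_iff[OF M U.loc_module gA]
  proof (intro ballI impI)
    fix y assume y: "y \<in> carrier M" and gy: "g y = \<zero>\<^bsub>loc_mod R U S\<^esub>"
    obtain s u where s: "s \<in> S" "u \<in> carrier U" "frac s \<one> \<odot>\<^bsub>M\<^esub> y = p u" using p(3)[OF y] by blast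
    have sc: "frac s \<one> \<in> carrier A" using s S_nz by simp
    have "loc_class U S u \<one> = g (frac s \<one> \<odot>\<^bsub>M\<^esub> y)" using s g(2) by simp
    also have "\<dots> = \<zero>\<^bsub>loc_mod R U S\<^esub>" using lin_smult[OF gA sc y] gy sc by simp
    finally have "\<exists>t\<in>S. (t \<otimes> \<one>) \<odot>\<^bsub>U\<^esub> u = (t \<otimes> \<one>) \<odot>\<^bsub>U\<^esub> \<zero>\<^bsub>U\<^esub>"
      unfolding loc_mod_zero using U.class_eq_iff[of u "\<zero>\<^bsub>U\<^esub>" \<one> \<one>] s by simp
    then obtain t where t: "t \<in> S" "t \<odot>\<^bsub>U\<^esub> u = \<zero>\<^bsub>U\<^esub>" by auto
    have "t \<odot>\<^bsub>res_mod R S M\<^esub> p u = \<zero>\<^bsub>res_mod R S M\<^esub>"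
      using lin_smult[OF p(1) S_nz(1)[OF t(1)] s(2)] lin_zero[OF U RM p(1)] t by simp
    also have "\<dots> = t \<odot>\<^bsub>res_mod R S M\<^esub> \<zero>\<^bsub>res_mod R S M\<^esub>"
      using module.smult_r_null[OF RM S_nz(1)[OF t(1)]] by simp
    finally have "p u = \<zero>\<^bsub>res_mod R S M\<^esub>"
      by (rule divisibleD(1)[OF res_divisible[OF M] t(1), rotated -1]) (use lin_closed[OF p(1) s(2)] in simp_all)
    then have "s \<odot>\<^bsub>res_mod R S M\<^esub> y = s \<odot>\<^bsub>res_mod R S M\<^esub> \<zero>\<^bsub>res_mod R S M\<^esub>"
      using s module.smult_r_null[OF RM S_nz(1)[OF s(1)]] by simp
    then show "y = \<zero>\<^bsub>M\<^esub>"
      using divisibleD(1)[OF res_divisible[OF M] s(1), of y "\<zero>\<^bsub>M\<^esub>"] y by simp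
  qed
  moreover have "g ` carrier M = carrier (loc_mod R U S)"
  proof (intro subset_antisym subsetI)
    fix C assume "C \<in> carrier (loc_mod R U S)"
    then obtain u s where u: "u \<in> carrier U" "s \<in> S" "C = loc_class U S u s" by (rule U.class_cases)
    have pu: "p u \<in> carrier M" using lin_closed[OF p(1) u(1)] by simp
    have "C = frac \<one> s \<odot>\<^bsub>loc_mod R U S\<^esub> g (p u)" using u g(2) by (simp add: U.class_smult S_nz)
    also have "\<dots> = g (frac \<one> s \<odot>\<^bsub>M\<^esub> p u)" using u pu by (subst lin_smult[OF gA]) simp_all
    finally show "C \<in> g ` carrier M" by (rule image_eqI[OF _ M.smult_closed[OF _ pu]]) (use u(2) in simp)
  qed (use lin_closed[OF gA] in auto)
  ultimately have "bij_betw g (carrier M) (carrier (loc_mod R U S))" by (simp add: bij_betw_def)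
  then show ?thesis
    unfolding mod_iso_def using lin_inv_into[OF M gA] bij_betw_inv_into by blast
qed

text \<open>The map u -> u/1 followed by the isomorphism. Torsion-freeness is what makes u -> u/1
  injective.\<close>

lemma loc_map_of_mod_iso:
  assumes U: "module R U" and M: "module A M" and tf: "tfree R U" and iso: "mod_iso A (loc_mod R U S) M"
  shows "\<exists>p. loc_map R S U (res_mod R S M) p"
proof -
  interpret U: loc_module R U S by (intro loc_module.intro U loc_module_axioms.intro S)
  interpret M: module A M by fact
  obtain f where f: "is_linear A (loc_mod R U S) M f" "bij_betw f (carrier (loc_mod R U S)) (carrier M)"
    using iso by (auto simp: mod_iso_def)
  let ?p = "\<lambda>x. f (loc_class U S x \<one>)"
  have "loc_map R S U (res_mod R S M) ?p" unfolding loc_map_def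
  proof (intro conjI ballI)
    show "is_linear R U (res_mod R S M) ?p" by (rule lin_comp[OF canonical_lin[OF U] res_linI[OF f(1)]])
    show "inj_on ?p (carrier U)"
    proof (rule inj_onI)
      fix x y assume xy: "x \<in> carrier U" "y \<in> carrier U" "?p x = ?p y"
      then have "loc_class U S x \<one> = loc_class U S y \<one>"
        using inj_onD[OF bij_betw_imp_inj_on[OF f(2)]] by simp
      then obtain u where u: "u \<in> S" "(u \<otimes> \<one>) \<odot>\<^bsub>U\<^esub> x = (u \<otimes> \<one>) \<odot>\<^bsub>U\<^esub> y"
        using U.class_eq_iff[OF xy(1,2), of \<one> \<one>] by auto
      then have "u \<odot>\<^bsub>U\<^esub> x = u \<odot>\<^bsub>U\<^esub> y" using S_nz(1) by simp
      then show "x = y" by (rule tfree_cancel[OF U tf S_nz[OF u(1)] xy(1,2)])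
    qed
    fix w assume w: "w \<in> carrier (res_mod R S M)"
    then obtain C where C: "C \<in> carrier (loc_mod R U S)" "w = f C"
      using bij_betw_imp_surj_on[OF f(2)] by auto
    then obtain u s where u: "u \<in> carrier U" "s \<in> S" "C = loc_class U S u s" by (metis U.class_cases)
    have "frac s \<one> \<odot>\<^bsub>M\<^esub> f C = f (frac s \<one> \<odot>\<^bsub>loc_mod R U S\<^esub> C)"
      using lin_smult[OF f(1) _ C(1), of "frac s \<one>"] u S_nz by simp
    also have "frac s \<one> \<odot>\<^bsub>loc_mod R U S\<^esub> C = loc_class U S u \<one>"
      unfolding u(3) using u(1,2) S_nz(1)[OF u(2)] by (simp add: U.class_smult) (intro U.class_eqI, auto)
    finally show "\<exists>s\<in>S. \<exists>u\<in>carrier U. s \<odot>\<^bsub>res_mod R S M\<^esub> w = f (loc_class U S u \<one>)"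
      using u C by auto
  qed
  then show ?thesis by blast
qed

text \<open>Closure under division by S is all that an R-submodule lacks to be a submodule over the
  localisation.\<close>

lemma res_submoduleI:
  assumes M: "module A M" and H: "submodule H R (res_mod R S M)"
    and cl: "\<And>s x. s \<in> S \<Longrightarrow> x \<in> carrier M \<Longrightarrow> s \<odot>\<^bsub>res_mod R S M\<^esub> x \<in> H \<Longrightarrow> x \<in> H"
  shows "submodule H A M"
proof (rule submodI[OF M])
  interpret M: module A M by fact
  note H = submodD[OF module_res[OF M] H]
  show "H \<subseteq> carrier M" using H(1) by auto
  show "\<zero>\<^bsub>M\<^esub> \<in> H" using H(2) by simp
  show "x \<oplus>\<^bsub>M\<^esub> y \<in> H" if "x \<in> H" "y \<in> H" for x y using H(3)[OF that] by simp
  fix c x assume c: "c \<in> carrier A" and x: "x \<in> H"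
  obtain a s where c': "a \<in> carrier R" "s \<in> S" "c = frac a s" using c by (metis A_cases)
  have xM: "x \<in> carrier M" using H(1)[OF x] by simp
  have "s \<odot>\<^bsub>res_mod R S M\<^esub> (c \<odot>\<^bsub>M\<^esub> x) = a \<odot>\<^bsub>res_mod R S M\<^esub> x"
    using res_frac_smult[OF M c'(1,2) xM] c'(3) by simp
  also have "\<dots> \<in> H" by (rule H(4)[OF c'(1) x])
  finally show "c \<odot>\<^bsub>M\<^esub> x \<in> H" by (rule cl[OF c'(2) M.smult_closed[OF c xM]])
qed

text \<open>A finitely generated module over the localisation is in general not finitely generated
  over R. Restricting the test to submodules closed under division by S keeps the same generators
  and stays over R.\<close>

lemma fin_gen_res:
  assumes M: "module A M" and fg: "fin_gen A M"
  shows "\<exists>G. finite G \<and> G \<subseteq> carrier M \<and> (\<forall>H. submodule H R (res_mod R S M) \<and> G \<subseteq> H \<and>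
     (\<forall>s\<in>S. \<forall>x\<in>carrier M. s \<odot>\<^bsub>res_mod R S M\<^esub> x \<in> H \<longrightarrow> x \<in> H) \<longrightarrow> H = carrier M)"
proof -
  interpret M: module A M by fact
  obtain G where G': "finite G" "G \<subseteq> carrier M" "\<forall>H. submodule H A M \<longrightarrow> G \<subseteq> H \<longrightarrow> H = carrier M"
    by (rule fin_genE[OF M fg])
  note G = G'(1,2) G'(3)[rule_format]
  have "H = carrier M" if sub: "submodule H R (res_mod R S M)" and GH: "G \<subseteq> H"
    and cl: "\<forall>s\<in>S. \<forall>x\<in>carrier M. s \<odot>\<^bsub>res_mod R S M\<^esub> x \<in> H \<longrightarrow> x \<in> H" for H
  proof (rule G(3)[OF _ GH])
    show "submodule H A M" by (rule res_submoduleI[OF M sub]) (use cl in blast)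
  qed
  then show ?thesis using G(1,2) by blast
qed

end

lemma (in domain) torsion_free_iff:
  assumes M: "module R M"
  shows "torsion_free R M \<longleftrightarrow> tfree R M"
proof -
  interpret M: loc_module R M "nonzeros R" by (intro loc_module.intro M loc_module_axioms.intro mult_set_nonzeros)
  have eq: "loc_class M (nonzeros R) x \<one> = loc_class M (nonzeros R) y \<one> \<longleftrightarrow> (\<exists>u\<in>nonzeros R. u \<odot>\<^bsub>M\<^esub> x = u \<odot>\<^bsub>M\<^esub> y)"
    if "x \<in> carrier M" "y \<in> carrier M" for x y
    using M.class_eq_iff[OF that, of \<one> \<one>] by auto
  show ?thesis
  proof
    assume tf: "torsion_free R M"
    show "tfree R M" unfolding tfree_def
    proof (intro ballI impI)
      fix a x assume *: "a \<in> carrier R" "x \<in> carrier M" "a \<odot>\<^bsub>M\<^esub> x = \<zero>\<^bsub>M\<^esub>"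
      show "a = \<zero> \<or> x = \<zero>\<^bsub>M\<^esub>"
      proof (cases "a = \<zero>")
        case False
        then have "\<exists>u\<in>nonzeros R. u \<odot>\<^bsub>M\<^esub> x = u \<odot>\<^bsub>M\<^esub> \<zero>\<^bsub>M\<^esub>" using * by (intro bexI[of _ a]) auto
        then have "loc_class M (nonzeros R) x \<one> = loc_class M (nonzeros R) \<zero>\<^bsub>M\<^esub> \<one>" using * by (subst eq) auto
        then have "x = \<zero>\<^bsub>M\<^esub>" by (rule inj_onD[OF tf[unfolded torsion_free_def]]) (use * in simp_all)
        then show ?thesis by simp
      qed simp
    qed
  next
    assume "tfree R M"
    then show "torsion_free R M" unfolding torsion_free_def
      using eq tfree_cancel[OF M] by (intro inj_onI) (metis DiffE insertI1)
  qed
qed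

lemma (in loc_base) tfree_res:
  assumes "module A M" "tfree A M"
  shows "tfree R (res_mod R S M)"
  unfolding tfree_def
proof (intro ballI impI)
  fix a x assume *: "a \<in> carrier R" "x \<in> carrier (res_mod R S M)" "a \<odot>\<^bsub>res_mod R S M\<^esub> x = \<zero>\<^bsub>res_mod R S M\<^esub>"
  then have "frac a \<one> = \<zero>\<^bsub>A\<^esub> \<or> x = \<zero>\<^bsub>M\<^esub>"
    using assms(2) frac_in[OF *(1) mult_setD(2)[OF S]] by (simp add: tfree_def)
  then show "a = \<zero> \<or> x = \<zero>\<^bsub>res_mod R S M\<^esub>"
    using frac_zero_iff[OF *(1) mult_setD(2)[OF S]] by simp
qed

lemma lincomb_lin:
  assumes M: "module R M" and x: "\<And>i. i < n \<Longrightarrow> x i \<in> carrier M"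
  shows "is_linear R (free_mod R n) M (\<lambda>z. finsum M (\<lambda>i. z i \<odot>\<^bsub>M\<^esub> x i) {..<n})"
proof -
  interpret M: module R M by fact
  show ?thesis
  proof (rule linI)
    fix z assume z: "z \<in> carrier (free_mod R n)"
    note zc = M.R.free_memD[OF z]
    show "finsum M (\<lambda>i. z i \<odot>\<^bsub>M\<^esub> x i) {..<n} \<in> carrier M" using zc x by (intro M.finsum_closed) auto
    fix w assume w: "w \<in> carrier (free_mod R n)"
    note wc = M.R.free_memD[OF w]
    have "finsum M (\<lambda>i. (z \<oplus>\<^bsub>free_mod R n\<^esub> w) i \<odot>\<^bsub>M\<^esub> x i) {..<n} = finsum M (\<lambda>i. z i \<odot>\<^bsub>M\<^esub> x i \<oplus>\<^bsub>M\<^esub> w i \<odot>\<^bsub>M\<^esub> x i) {..<n}"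
      using zc wc x by (intro M.finsum_cong') (auto simp: M.smult_l_distr)
    also have "\<dots> = finsum M (\<lambda>i. z i \<odot>\<^bsub>M\<^esub> x i) {..<n} \<oplus>\<^bsub>M\<^esub> finsum M (\<lambda>i. w i \<odot>\<^bsub>M\<^esub> x i) {..<n}"
      using zc wc x by (intro M.finsum_addf) auto
    finally show "finsum M (\<lambda>i. (z \<oplus>\<^bsub>free_mod R n\<^esub> w) i \<odot>\<^bsub>M\<^esub> x i) {..<n} = finsum M (\<lambda>i. z i \<odot>\<^bsub>M\<^esub> x i) {..<n} \<oplus>\<^bsub>M\<^esub> finsum M (\<lambda>i. w i \<odot>\<^bsub>M\<^esub> x i) {..<n}" .
  next
    fix a z assume a: "a \<in> carrier R" and z: "z \<in> carrier (free_mod R n)"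
    note zc = M.R.free_memD[OF z]
    have "finsum M (\<lambda>i. (a \<odot>\<^bsub>free_mod R n\<^esub> z) i \<odot>\<^bsub>M\<^esub> x i) {..<n} = finsum M (\<lambda>i. a \<odot>\<^bsub>M\<^esub> (z i \<odot>\<^bsub>M\<^esub> x i)) {..<n}"
      using zc a x by (intro M.finsum_cong') (auto simp: M.smult_assoc1)
    also have "\<dots> = a \<odot>\<^bsub>M\<^esub> finsum M (\<lambda>i. z i \<odot>\<^bsub>M\<^esub> x i) {..<n}"
      using zc a x by (intro M.finsum_smult_ldistr[symmetric]) auto
    finally show "finsum M (\<lambda>i. (a \<odot>\<^bsub>free_mod R n\<^esub> z) i \<odot>\<^bsub>M\<^esub> x i) {..<n} = a \<odot>\<^bsub>M\<^esub> finsum M (\<lambda>i. z i \<odot>\<^bsub>M\<^esub> x i) {..<n}" .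
  qed
qed

section \<open>From bases of the generic fibre to ranks\<close>

text \<open>The basis of the generic fibre consists of fractions x_i/s_i. The numerators x_i span a
  free submodule of \<open>M\<close>, and clearing denominators in the coordinates of y/1 shows that
  a nonzero multiple of y lies in it.\<close>

lemma (in domain) has_rk_of_has_rank:
  assumes M: "module R M" and tf: "tfree R M" and rk: "has_rank R M r"
  shows "has_rk R M r"
proof -
  interpret L: loc_base R "nonzeros R"
    by (intro loc_base.intro loc_base_axioms.intro mult_set_nonzeros) (use domain_axioms in auto)
  interpret M: loc_module R M "nonzeros R" by (intro loc_module.intro M loc_module_axioms.intro mult_set_nonzeros)
  let ?S = "nonzeros R" and ?V = "loc_mod R M (nonzeros R)"
  have one: "\<one> \<in> ?S" by simp
  obtain b where b: "is_basis (frac_field R) ?V b r" using rk by (auto simp: has_rank_def)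
  interpret V: module "frac_field R" ?V by (rule M.loc_module)
  have ind: "\<And>c. (\<forall>i<r. c i \<in> carrier (frac_field R)) \<Longrightarrow> finsum ?V (\<lambda>i. c i \<odot>\<^bsub>?V\<^esub> b i) {..<r} = \<zero>\<^bsub>?V\<^esub> \<Longrightarrow>
      \<forall>i<r. c i = \<zero>\<^bsub>frac_field R\<^esub>"
    using b unfolding is_basis_def by blast
  have gen: "carrier ?V = {finsum ?V (\<lambda>i. c i \<odot>\<^bsub>?V\<^esub> b i) {..<r} | c. \<forall>i<r. c i \<in> carrier (frac_field R)}"
    using b unfolding is_basis_def by blast
  have "\<exists>x s. x \<in> carrier M \<and> s \<in> ?S \<and> b i = loc_class M ?S x s" if "i < r" for i
  proof -
    have "b i \<in> carrier ?V" using b that by (auto simp: is_basis_def)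
    then show ?thesis by (metis M.class_cases)
  qed
  then obtain x s where xs: "\<And>i. i < r \<Longrightarrow> x i \<in> carrier M" "\<And>i. i < r \<Longrightarrow> s i \<in> ?S"
     "\<And>i. i < r \<Longrightarrow> b i = loc_class M ?S (x i) (s i)" by metis
  define be where "be = (\<lambda>z. finsum M (\<lambda>i. z i \<odot>\<^bsub>M\<^esub> x i) {..<r})"
  have be: "is_linear R (free_mod R r) M be" unfolding be_def by (rule lincomb_lin[OF M xs(1)])
  have sc: "s i \<in> carrier R" if "i < r" for i using xs(2)[OF that] by simp
  have can: "is_linear R M (res_mod R ?S ?V) (\<lambda>y. loc_class M ?S y \<one>)" by (rule L.canonical_lin[OF M])
  \<comment> \<open>A \<open>finsum\<close> is tied to its module record, so the sums over the
    restricted and the original fibre are identified by induction on the length.\<close>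
  have fs: "finsum (res_mod R ?S ?V) h {..<r} = finsum ?V h {..<r}" if "h \<in> {..<r} \<rightarrow> carrier ?V" for h
  proof -
    interpret W: module R "res_mod R ?S ?V" by (rule L.module_res[OF M.loc_module])
    have "k \<le> r \<Longrightarrow> finsum (res_mod R ?S ?V) h {..<k} = finsum ?V h {..<k}" for k
    proof (induction k)
      case 0 show ?case by simp
    next
      case (Suc k)
      have h: "h j \<in> carrier ?V" if "j \<le> k" for j using \<open>h \<in> _\<close> that Suc.prems by auto
      have "finsum (res_mod R ?S ?V) h {..<Suc k} = h k \<oplus>\<^bsub>?V\<^esub> finsum (res_mod R ?S ?V) h {..<k}"
        unfolding lessThan_Suc using h by (subst W.finsum_insert) auto
      also have "\<dots> = finsum ?V h {..<Suc k}" 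
        unfolding lessThan_Suc using h Suc by (subst V.finsum_insert) auto
      finally show ?case .
    qed
    then show ?thesis by simp
  qed
  have be_class: "loc_class M ?S (be z) \<one> = finsum ?V (\<lambda>i. loc_class M ?S (z i \<odot>\<^bsub>M\<^esub> x i) \<one>) {..<r}"
    if z: "z \<in> carrier (free_mod R r)" for z
  proof -
    have zx: "z i \<odot>\<^bsub>M\<^esub> x i \<in> carrier M" if "i < r" for i using free_memD[OF z] xs(1)[OF that] by simp
    show ?thesis unfolding be_def
      by (subst lin_finsum[OF M L.module_res[OF M.loc_module] can]) (use zx one in \<open>auto intro!: fs\<close>)
  qed
  have class0: "loc_class M ?S y \<one> = \<zero>\<^bsub>?V\<^esub> \<longleftrightarrow> y = \<zero>\<^bsub>M\<^esub>" if "y \<in> carrier M" for y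
  proof -
    have "inj_on (\<lambda>x. loc_class M ?S x \<one>) (carrier M)"
      using tf torsion_free_iff[OF M] by (simp add: torsion_free_def)
    then show ?thesis unfolding loc_mod_zero using that by (auto dest: inj_onD)
  qed
  have "loc_map R ?S (free_mod R r) M be" unfolding loc_map_def
  proof (intro conjI ballI be)
    show "inj_on be (carrier (free_mod R r))"
      unfolding lin_inj_iff[OF module_free M be]
    proof (intro ballI impI)
      fix z assume z: "z \<in> carrier (free_mod R r)" and b0: "be z = \<zero>\<^bsub>M\<^esub>"
      note zc = free_memD[OF z]
      \<comment> \<open>The factor s_i cancels the denominator of b_i, so the combination of the
        basis with these coefficients is the class of the sum of z_i x_i.\<close>
      let ?c = "\<lambda>i. L.frac (z i \<otimes> s i) \<one>"
      have trm: "?c i \<odot>\<^bsub>?V\<^esub> b i = loc_class M ?S (z i \<odot>\<^bsub>M\<^esub> x i) \<one>" if "i < r" for i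
      proof -
        have "?c i \<odot>\<^bsub>?V\<^esub> b i = loc_class M ?S ((z i \<otimes> s i) \<odot>\<^bsub>M\<^esub> x i) (\<one> \<otimes> s i)"
          unfolding xs(3)[OF that] using zc sc[OF that] xs[OF that] by (intro M.class_smult) auto
        also have "\<dots> = loc_class M ?S (z i \<odot>\<^bsub>M\<^esub> x i) \<one>"
          using zc sc[OF that] xs[OF that] by (intro M.class_eqI) (auto simp: M.smult_assoc1[symmetric] m_comm)
        finally show ?thesis .
      qed
      have "finsum ?V (\<lambda>i. ?c i \<odot>\<^bsub>?V\<^esub> b i) {..<r} = finsum ?V (\<lambda>i. loc_class M ?S (z i \<odot>\<^bsub>M\<^esub> x i) \<one>) {..<r}"
        using trm zc xs(1) one by (intro V.finsum_cong') (auto intro!: M.class_in)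
      also have "\<dots> = \<zero>\<^bsub>?V\<^esub>" using be_class[OF z] b0 class0[of "\<zero>\<^bsub>M\<^esub>"] by simp
      finally have "\<forall>i<r. ?c i = \<zero>\<^bsub>frac_field R\<^esub>"
        by (rule ind[rotated]) (use zc sc one L.frac_in in \<open>meson m_closed\<close>)
      then have "z i \<otimes> s i = \<zero>" if "i < r" for i
        using that L.frac_zero_iff[OF m_closed[OF zc[of i] sc[OF that]] one] by simp
      then have "z i = \<zero>" if "i < r" for i using integral[OF _ zc sc[OF that], of i] xs(2)[OF that] that by auto
      moreover have "z i = \<zero>" if "\<not> i < r" for i using z that by simp
      ultimately have "\<And>i. z i = \<zero>" by blast
      then show "z = \<zero>\<^bsub>free_mod R r\<^esub>" by (simp add: fun_eq_iff)
    qed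
    fix y assume y: "y \<in> carrier M"
    have "loc_class M ?S y \<one> \<in> carrier ?V" by (rule M.class_in[OF y one])
    then obtain c where c: "\<And>i. i < r \<Longrightarrow> c i \<in> carrier (frac_field R)" 
      and yc: "loc_class M ?S y \<one> = finsum ?V (\<lambda>i. c i \<odot>\<^bsub>?V\<^esub> b i) {..<r}"
      unfolding gen by blast
    let ?P = "\<lambda>D i. \<exists>z\<in>carrier R. L.frac D \<one> \<odot>\<^bsub>?V\<^esub> (c i \<odot>\<^bsub>?V\<^esub> b i) = loc_class M ?S (z \<odot>\<^bsub>M\<^esub> x i) \<one>"
    have mulP: "?P (t \<otimes> D) i" if D: "D \<in> ?S" "t \<in> ?S" "i < r" "?P D i" for D t i
    proof -
      obtain z where z: "z \<in> carrier R" "L.frac D \<one> \<odot>\<^bsub>?V\<^esub> (c i \<odot>\<^bsub>?V\<^esub> b i) = loc_class M ?S (z \<odot>\<^bsub>M\<^esub> x i) \<one>" using D(4) by blast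
      have bi: "b i \<in> carrier ?V" using xs(1,2)[OF D(3)] unfolding xs(3)[OF D(3)] by simp
      have "L.frac (t \<otimes> D) \<one> = L.frac t \<one> \<otimes>\<^bsub>frac_field R\<^esub> L.frac D \<one>" using D by (simp add: L.frac_mult1)
      then have "L.frac (t \<otimes> D) \<one> \<odot>\<^bsub>?V\<^esub> (c i \<odot>\<^bsub>?V\<^esub> b i) = L.frac t \<one> \<odot>\<^bsub>?V\<^esub> (L.frac D \<one> \<odot>\<^bsub>?V\<^esub> (c i \<odot>\<^bsub>?V\<^esub> b i))"
        using D c[OF D(3)] bi one by (simp add: V.smult_assoc1)
      also have "\<dots> = L.frac t \<one> \<odot>\<^bsub>?V\<^esub> loc_class M ?S (z \<odot>\<^bsub>M\<^esub> x i) \<one>" by (simp only: z(2))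
      also have "\<dots> = loc_class M ?S ((t \<otimes> z) \<odot>\<^bsub>M\<^esub> x i) \<one>"
        using D z(1) xs(1)[OF D(3)] M.class_smult[of t \<one> "z \<odot>\<^bsub>M\<^esub> x i" \<one>] by (simp add: M.smult_assoc1)
      finally show ?thesis using z(1) D(2) by blast
    qed
    have "\<exists>D\<in>?S. \<forall>i\<in>{..<r}. ?P D i"
    proof (rule common_denominator[OF mult_set_nonzeros])
      fix i assume "i \<in> {..<r}" then have i: "i < r" by simp
      obtain p q where pq: "p \<in> carrier R" "q \<in> ?S" "c i = L.frac p q" using c[OF i] by (metis L.A_cases)
      have q: "q \<in> carrier R" using pq by simp
      have qs: "q \<otimes> s i \<in> ?S" using pq(2) xs(2)[OF i] mult_setD(3)[OF mult_set_nonzeros] by blast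
      \<comment> \<open>The scalar q s_i clears both the denominator q of the coefficient and the
        denominator s_i of the basis vector.\<close>
      have "L.frac (q \<otimes> s i) \<one> \<odot>\<^bsub>?V\<^esub> (c i \<odot>\<^bsub>?V\<^esub> b i) = loc_class M ?S ((q \<otimes> s i) \<odot>\<^bsub>M\<^esub> (p \<odot>\<^bsub>M\<^esub> x i)) (\<one> \<otimes> (q \<otimes> s i))"
        unfolding pq(3) xs(3)[OF i] using pq xs[OF i] qs q sc[OF i] by (simp add: M.class_smult del: Diff_iff)
      also have "\<dots> = loc_class M ?S (p \<odot>\<^bsub>M\<^esub> x i) \<one>"
        using pq(1) q sc[OF i] xs(1)[OF i] qs one by (intro M.class_eqI) (auto simp: M.smult_assoc1[symmetric])
      finally show "\<exists>D\<in>?S. ?P D i" using qs pq(1) by blast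
    next
      fix D t i assume "D \<in> ?S" "t \<in> ?S" "i \<in> {..<r}" "?P D i"
      then show "?P (t \<otimes> D) i" using mulP by blast
    next
      fix D t i assume *: "D \<in> ?S" "t \<in> ?S" "i \<in> {..<r}" "?P D i"
      have "?P (t \<otimes> D) i" using mulP[of D t i] * by blast
      moreover have "t \<otimes> D = D \<otimes> t" using * by (intro m_comm) auto
      ultimately show "?P (D \<otimes> t) i" by simp
    qed simp
    then obtain D where D: "D \<in> ?S" "\<And>i. i < r \<Longrightarrow> ?P D i" by blast
    then have "\<forall>i. \<exists>z. i < r \<longrightarrow> z \<in> carrier R \<and> L.frac D \<one> \<odot>\<^bsub>?V\<^esub> (c i \<odot>\<^bsub>?V\<^esub> b i) = loc_class M ?S (z \<odot>\<^bsub>M\<^esub> x i) \<one>"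
      by blast
    from choice[OF this] obtain z where z: "\<And>i. i < r \<Longrightarrow> z i \<in> carrier R"
      "\<And>i. i < r \<Longrightarrow> L.frac D \<one> \<odot>\<^bsub>?V\<^esub> (c i \<odot>\<^bsub>?V\<^esub> b i) = loc_class M ?S (z i \<odot>\<^bsub>M\<^esub> x i) \<one>" by blast
    define w where "w = (\<lambda>i. if i < r then z i else \<zero>)"
    have w: "w \<in> carrier (free_mod R r)" unfolding w_def using z(1) by (intro free_memI) auto
    have Dc: "D \<in> carrier R" using D(1) by simp
    have bc: "c i \<odot>\<^bsub>?V\<^esub> b i \<in> carrier ?V" if "i < r" for i
      using c[OF that] xs(1,2)[OF that] unfolding xs(3)[OF that] by (intro V.smult_closed) auto
    have "loc_class M ?S (D \<odot>\<^bsub>M\<^esub> y) \<one> = L.frac D \<one> \<odot>\<^bsub>?V\<^esub> loc_class M ?S y \<one>"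
      using M.class_smult[OF Dc one y one] by simp
    also have "\<dots> = finsum ?V (\<lambda>i. L.frac D \<one> \<odot>\<^bsub>?V\<^esub> (c i \<odot>\<^bsub>?V\<^esub> b i)) {..<r}"
      unfolding yc using bc L.frac_in[OF Dc one] by (intro V.finsum_smult_ldistr) auto
    also have "\<dots> = finsum ?V (\<lambda>i. loc_class M ?S (w i \<odot>\<^bsub>M\<^esub> x i) \<one>) {..<r}"
      using z xs(1) one by (intro V.finsum_cong') (auto simp: w_def intro!: M.class_in)
    also have "\<dots> = loc_class M ?S (be w) \<one>" by (rule be_class[OF w, symmetric])
    finally have "D \<odot>\<^bsub>M\<^esub> y = be w"
      using tf torsion_free_iff[OF M] y Dc lin_closed[OF be w] unfolding torsion_free_def by (auto dest: inj_onD)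
    then show "\<exists>s\<in>?S. \<exists>u\<in>carrier (free_mod R r). s \<odot>\<^bsub>M\<^esub> y = be u" using D(1) w by blast
  qed
  then show ?thesis by (auto simp: has_rk_def)
qed

context loc_base
begin

text \<open>A vector has finitely many entries, so one D makes all of them integral; beyond n both
  sides are zero.\<close>

lemma frac_denom:
  assumes "w \<in> carrier (free_mod A n)"
  shows "\<exists>D\<in>S. \<exists>z\<in>carrier (free_mod R n). (\<lambda>i. frac D \<one> \<otimes>\<^bsub>A\<^esub> w i) = (\<lambda>i. frac (z i) \<one>)"
proof -
  interpret A: domain A by (rule domain_A)
  have one: "\<one> \<in> S" by (rule mult_setD(2)[OF S])
  let ?P = "\<lambda>D i. \<exists>z\<in>carrier R. frac D \<one> \<otimes>\<^bsub>A\<^esub> w i = frac z \<one>"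
  note wc = A.free_memD[OF assms]
  have mulP: "?P (t \<otimes> D) i" if D: "D \<in> S" "t \<in> S" "?P D i" for D t i
  proof -
    obtain z where z: "z \<in> carrier R" "frac D \<one> \<otimes>\<^bsub>A\<^esub> w i = frac z \<one>" using D(3) by blast
    have c: "D \<in> carrier R" "t \<in> carrier R" using D S_nz by blast+
    have "frac (t \<otimes> D) \<one> \<otimes>\<^bsub>A\<^esub> w i = frac t \<one> \<otimes>\<^bsub>A\<^esub> (frac D \<one> \<otimes>\<^bsub>A\<^esub> w i)"
      using c one wc by (simp add: frac_mult1[symmetric] A.m_assoc)
    also have "\<dots> = frac (t \<otimes> z) \<one>" unfolding z(2) using c z(1) by (simp add: frac_mult1)
    finally show ?thesis using c z(1) by blast
  qed
  have "\<exists>D\<in>S. \<forall>i\<in>{..<n}. ?P D i"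
  proof (rule common_denominator[OF S])
    fix i
    obtain p q where pq: "p \<in> carrier R" "q \<in> S" "w i = frac p q" using wc[of i] by (metis A_cases)
    then show "\<exists>D\<in>S. ?P D i" by (intro bexI[of _ q] bexI[of _ p]) (simp_all add: frac_cancel)
  next
    fix D t i assume "D \<in> S" "t \<in> S" "i \<in> {..<n}" "?P D i"
    then show "?P (t \<otimes> D) i" using mulP by blast
  next
    fix D t i assume *: "D \<in> S" "t \<in> S" "i \<in> {..<n}" "?P D i"
    have "?P (t \<otimes> D) i" using mulP[of D t i] * by blast
    moreover have "t \<otimes> D = D \<otimes> t" using * S_nz by (intro m_comm) auto
    ultimately show "?P (D \<otimes> t) i" by simp
  qed simp
  then obtain D where D: "D \<in> S" "\<And>i. i < n \<Longrightarrow> ?P D i" by blast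
  then have "\<forall>i. \<exists>z. i < n \<longrightarrow> z \<in> carrier R \<and> frac D \<one> \<otimes>\<^bsub>A\<^esub> w i = frac z \<one>" by blast
  from choice[OF this] obtain z where z: "\<And>i. i < n \<Longrightarrow> z i \<in> carrier R"
    "\<And>i. i < n \<Longrightarrow> frac D \<one> \<otimes>\<^bsub>A\<^esub> w i = frac (z i) \<one>" by blast
  have "frac D \<one> \<otimes>\<^bsub>A\<^esub> w i = frac (if i < n then z i else \<zero>) \<one>" for i
  proof (cases "i < n")
    case False
    then have "w i = \<zero>\<^bsub>A\<^esub>" using assms by simp
    then show ?thesis using False S_nz(1)[OF D(1)] one by (simp add: frac_zero[symmetric])
  qed (use z in simp)
  moreover have "(\<lambda>i. if i < n then z i else \<zero>) \<in> carrier (free_mod R n)" using z by (intro free_memI) auto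
  ultimately show ?thesis using D(1) by (intro bexI[of _ D] bexI[of _ "\<lambda>i. if i < n then z i else \<zero>"]) auto
qed

lemma frac_free_lin: "is_linear R (free_mod R n) (res_mod R S (free_mod A n)) (\<lambda>z i. frac (z i) \<one>)"
proof (rule linI)
  have one: "\<one> \<in> S" by (rule mult_setD(2)[OF S])
  fix z assume z: "z \<in> carrier (free_mod R n)"
  note zc = free_memD[OF z]
  show "(\<lambda>i. frac (z i) \<one>) \<in> carrier (res_mod R S (free_mod A n))"
    using z zc one by (simp add: frac_zero)
  show "(\<lambda>i. frac ((a \<odot>\<^bsub>free_mod R n\<^esub> z) i) \<one>) = a \<odot>\<^bsub>res_mod R S (free_mod A n)\<^esub> (\<lambda>i. frac (z i) \<one>)"
    if "a \<in> carrier R" for a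
    using that zc by (simp add: frac_mult1)
  fix w assume w: "w \<in> carrier (free_mod R n)"
  show "(\<lambda>i. frac ((z \<oplus>\<^bsub>free_mod R n\<^esub> w) i) \<one>) = (\<lambda>i. frac (z i) \<one>) \<oplus>\<^bsub>res_mod R S (free_mod A n)\<^esub> (\<lambda>i. frac (w i) \<one>)"
    using zc free_memD[OF w] by (simp add: frac_add1)
qed

lemma frac_free_loc_map: "loc_map R S (free_mod R n) (res_mod R S (free_mod A n)) (\<lambda>z i. frac (z i) \<one>)"
  unfolding loc_map_def
proof (intro conjI ballI frac_free_lin)
  have one: "\<one> \<in> S" by (rule mult_setD(2)[OF S])
  show "inj_on (\<lambda>z i. frac (z i) \<one>) (carrier (free_mod R n))"
  proof (rule inj_onI)
    fix x y assume xy: "x \<in> carrier (free_mod R n)" "y \<in> carrier (free_mod R n)" "(\<lambda>i. frac (x i) \<one>) = (\<lambda>i. frac (y i) \<one>)"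
    then have "frac (x i) \<one> = frac (y i) \<one>" for i by (simp add: fun_eq_iff)
    then show "x = y"
      using frac_eq_iff[OF free_memD[OF xy(1)] free_memD[OF xy(2)] one one] free_memD[OF xy(1)] free_memD[OF xy(2)]
      by (simp add: fun_eq_iff)
  qed
  fix w assume "w \<in> carrier (res_mod R S (free_mod A n))"
  then have w: "w \<in> carrier (free_mod A n)" by simp
  obtain D z where "D \<in> S" "z \<in> carrier (free_mod R n)" "(\<lambda>i. frac D \<one> \<otimes>\<^bsub>A\<^esub> w i) = (\<lambda>i. frac (z i) \<one>)"
    using frac_denom[OF w] by blast
  then show "\<exists>s\<in>S. \<exists>u\<in>carrier (free_mod R n). s \<odot>\<^bsub>res_mod R S (free_mod A n)\<^esub> w = (\<lambda>i. frac (u i) \<one>)"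
    by (intro bexI[of _ D] bexI[of _ z]) simp_all
qed

text \<open>The embedding of the free module over the localisation is restricted to R^n. If c y = b
  w with c = a/s and D clears the denominators of w, then (D a) y = s D (c y) lies in the image, and
  D a is nonzero.\<close>

lemma has_rk_res:
  assumes M: "module A M" and rk: "has_rk A M n"
  shows "has_rk R (res_mod R S M) n"
proof -
  interpret A: domain A by (rule domain_A)
  interpret M: module A M by fact
  obtain b where b: "loc_map A (nonzeros A) (free_mod A n) M b" using rk by (auto simp: has_rk_def)
  note b = loc_mapD[OF b] and j = loc_mapD[OF frac_free_loc_map[of n]]
  have one: "\<one> \<in> S" by (rule mult_setD(2)[OF S])
  let ?g = "\<lambda>z. b (\<lambda>i. frac (z i) \<one>)"
  have jc: "(\<lambda>i. frac (z i) \<one>) \<in> carrier (free_mod A n)" if "z \<in> carrier (free_mod R n)" for z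
    using lin_closed[OF j(1) that] by simp
  have g: "is_linear R (free_mod R n) (res_mod R S M) ?g" by (rule lin_comp[OF j(1) res_linI[OF b(1)]])
  have "loc_map R (nonzeros R) (free_mod R n) (res_mod R S M) ?g" unfolding loc_map_def
  proof (intro conjI ballI g)
    show "inj_on ?g (carrier (free_mod R n))"
    proof (rule inj_onI)
      fix x y assume xy: "x \<in> carrier (free_mod R n)" "y \<in> carrier (free_mod R n)" "?g x = ?g y"
      then have "(\<lambda>i. frac (x i) \<one>) = (\<lambda>i. frac (y i) \<one>)" by (intro inj_onD[OF b(2) _ jc jc])
      then show "x = y" by (rule inj_onD[OF j(2) _ xy(1,2)])
    qed
    fix y assume "y \<in> carrier (res_mod R S M)"
    then have y: "y \<in> carrier M" by simp
    obtain c w where c: "c \<in> nonzeros A" "w \<in> carrier (free_mod A n)" "c \<odot>\<^bsub>M\<^esub> y = b w" using b(3)[OF y] by blast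
    obtain a s where as: "a \<in> carrier R" "s \<in> S" "c = frac a s" using c(1) by (metis A_cases DiffD1)
    have a0: "a \<noteq> \<zero>" using c(1) as frac_zero_iff[OF as(1,2)] by auto
    obtain D z where D: "D \<in> S" "z \<in> carrier (free_mod R n)" "(\<lambda>i. frac D \<one> \<otimes>\<^bsub>A\<^esub> w i) = (\<lambda>i. frac (z i) \<one>)"
      using frac_denom[OF c(2)] by blast
    have sc: "s \<in> carrier R" "D \<in> carrier R" "D \<noteq> \<zero>" using as D S_nz by blast+
    have fc: "frac s \<one> \<in> carrier A" "frac D \<one> \<in> carrier A" "c \<in> carrier A" using sc one c by auto
    have Da: "D \<otimes> a \<in> nonzeros R" using sc a0 as(1) integral by auto
    have "frac (D \<otimes> a) \<one> = frac s \<one> \<otimes>\<^bsub>A\<^esub> (frac D \<one> \<otimes>\<^bsub>A\<^esub> c)"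
      using as sc one fc frac_cancel[OF as(1,2)] frac_mult1[OF sc(2) as(1)] A.m_lcomm[OF fc(1,2,3)] by simp
    then have "(D \<otimes> a) \<odot>\<^bsub>res_mod R S M\<^esub> y = frac s \<one> \<odot>\<^bsub>M\<^esub> (frac D \<one> \<odot>\<^bsub>M\<^esub> (c \<odot>\<^bsub>M\<^esub> y))"
      using fc y by (simp add: M.smult_assoc1)
    also have "\<dots> = frac s \<one> \<odot>\<^bsub>M\<^esub> b (frac D \<one> \<odot>\<^bsub>free_mod A n\<^esub> w)" using lin_smult[OF b(1) fc(2) c(2)] c(3) by simp
    also have "\<dots> = frac s \<one> \<odot>\<^bsub>M\<^esub> ?g z" using D(3) by simp
    also have "\<dots> = ?g (s \<odot>\<^bsub>free_mod R n\<^esub> z)" using lin_smult[OF g sc(1) D(2)] by simp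
    finally have "(D \<otimes> a) \<odot>\<^bsub>res_mod R S M\<^esub> y = ?g (s \<odot>\<^bsub>free_mod R n\<^esub> z)" .
    moreover have "s \<odot>\<^bsub>free_mod R n\<^esub> z \<in> carrier (free_mod R n)" by (rule module.smult_closed[OF module_free sc(1) D(2)])
    ultimately show "\<exists>s\<in>nonzeros R. \<exists>u\<in>carrier (free_mod R n). s \<odot>\<^bsub>res_mod R S M\<^esub> y = ?g u" using Da by blast
  qed
  then show ?thesis by (auto simp: has_rk_def)
qed

end

section \<open>Local endomorphism rings\<close>

text \<open>The one property of a local endomorphism ring that the argument uses: f or 1 - f is
  invertible. Stated through bijectivity, it passes to the restriction of scalars without comparing
  endomorphism rings.\<close>

definition local_end :: "('a, 'r) ring_scheme \<Rightarrow> ('a, 'c, 'm) module_scheme \<Rightarrow> bool" where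
  "local_end R M \<longleftrightarrow> (\<forall>f. is_linear R M M f \<longrightarrow>
     bij_betw f (carrier M) (carrier M) \<or> bij_betw (\<lambda>x. x \<ominus>\<^bsub>M\<^esub> f x) (carrier M) (carrier M))"

text \<open>In a local ring f + (1 - f) = 1 cannot be a sum of two non-units. Elements of
  \<open>end_ring\<close> are extensional, so maps are cut down to the carrier before units are
  translated into bijections.\<close>

lemma local_end_of_local_ring:
  assumes M: "module R M" and loc: "local_ring (end_ring R M)"
  shows "local_end R M"
  unfolding local_end_def
proof (intro allI impI)
  interpret M: module R M by fact
  let ?E = "end_ring R M"
  have mem: "(\<lambda>x\<in>carrier M. f x) \<in> carrier ?E" if "is_linear R M M f" for f
    using lin_cong[OF M that, of "\<lambda>x\<in>carrier M. f x"] by (simp add: end_ring_def)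
  have bij: "bij_betw f (carrier M) (carrier M)" if "f \<in> Units ?E" for f
  proof -
    obtain g where g: "g \<in> carrier ?E" "f \<in> carrier ?E" "g \<otimes>\<^bsub>?E\<^esub> f = \<one>\<^bsub>?E\<^esub>" "f \<otimes>\<^bsub>?E\<^esub> g = \<one>\<^bsub>?E\<^esub>"
      using \<open>f \<in> Units ?E\<close> by (auto simp: Units_def)
    have lin: "is_linear R M M f" "is_linear R M M g" using g by (auto simp: end_ring_def)
    have "g (f x) = x" "f (g x) = x" if "x \<in> carrier M" for x
      using fun_cong[OF g(3), of x] fun_cong[OF g(4), of x] that by (auto simp: end_ring_def compose_def)
    then show ?thesis using lin by (intro bij_betw_byWitness[where f' = g]) (auto simp: lin_closed)
  qed
  fix f assume f: "is_linear R M M f"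
  let ?f = "\<lambda>x\<in>carrier M. f x" and ?g = "\<lambda>x\<in>carrier M. x \<ominus>\<^bsub>M\<^esub> f x"
  have g: "is_linear R M M (\<lambda>x. x \<ominus>\<^bsub>M\<^esub> f x)" by (rule lin_diff[OF M lin_id f])
  have "?f \<oplus>\<^bsub>?E\<^esub> ?g = \<one>\<^bsub>?E\<^esub>"
    using lin_closed[OF f] by (auto simp: end_ring_def fun_eq_iff M.minus_eq M.a_lcomm M.r_neg)
  moreover have "\<one>\<^bsub>?E\<^esub> \<in> Units ?E"
  proof -
    have "\<one>\<^bsub>?E\<^esub> \<in> carrier ?E" using mem[OF lin_id] by (simp add: end_ring_def)
    moreover have "\<one>\<^bsub>?E\<^esub> \<otimes>\<^bsub>?E\<^esub> \<one>\<^bsub>?E\<^esub> = \<one>\<^bsub>?E\<^esub>" by (auto simp: end_ring_def compose_def)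
    ultimately show ?thesis unfolding Units_def by blast
  qed
  ultimately have "?f \<oplus>\<^bsub>?E\<^esub> ?g \<in> Units ?E" by simp
  moreover have "?f \<notin> Units ?E \<Longrightarrow> ?g \<notin> Units ?E \<Longrightarrow> ?f \<oplus>\<^bsub>?E\<^esub> ?g \<notin> Units ?E"
    using loc unfolding local_ring_def using mem[OF f] mem[OF g] by blast
  ultimately have "?f \<in> Units ?E \<or> ?g \<in> Units ?E" by argo
  then have "bij_betw ?f (carrier M) (carrier M) \<or> bij_betw ?g (carrier M) (carrier M)"
    using bij[of ?f] bij[of ?g] by argo
  moreover have "bij_betw ?f (carrier M) (carrier M) \<longleftrightarrow> bij_betw f (carrier M) (carrier M)"
    by (rule bij_betw_cong) simp
  moreover have "bij_betw ?g (carrier M) (carrier M) \<longleftrightarrow> bij_betw (\<lambda>x. x \<ominus>\<^bsub>M\<^esub> f x) (carrier M) (carrier M)"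
    by (rule bij_betw_cong) simp
  ultimately show "bij_betw f (carrier M) (carrier M) \<or> bij_betw (\<lambda>x. x \<ominus>\<^bsub>M\<^esub> f x) (carrier M) (carrier M)"
    by argo
qed

lemma (in loc_base) local_end_res:
  assumes M: "module A M" and loc: "local_end A M"
  shows "local_end R (res_mod R S M)"
  unfolding local_end_def
proof (intro allI impI)
  interpret M: module A M by fact
  fix f assume f: "is_linear R (res_mod R S M) (res_mod R S M) f"
  note fA = res_linD[OF M M f]
  \<comment> \<open>The two subtractions belong to different records; they are compared by adding
    and subtracting f x.\<close>
  have eq: "x \<ominus>\<^bsub>res_mod R S M\<^esub> f x = x \<ominus>\<^bsub>M\<^esub> f x" if x: "x \<in> carrier M" for x
  proof -
    interpret RM: module R "res_mod R S M" by (rule module_res[OF M])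
    have c: "f x \<in> carrier M" by (rule lin_closed[OF fA x])
    have "x \<ominus>\<^bsub>M\<^esub> f x = (x \<ominus>\<^bsub>M\<^esub> f x) \<oplus>\<^bsub>res_mod R S M\<^esub> (f x \<oplus>\<^bsub>res_mod R S M\<^esub> \<ominus>\<^bsub>res_mod R S M\<^esub> f x)"
      using c x RM.r_neg[of "f x"] RM.r_zero[of "x \<ominus>\<^bsub>M\<^esub> f x"] by simp
    also have "\<dots> = ((x \<ominus>\<^bsub>M\<^esub> f x) \<oplus>\<^bsub>M\<^esub> f x) \<oplus>\<^bsub>res_mod R S M\<^esub> \<ominus>\<^bsub>res_mod R S M\<^esub> f x"
      using c x RM.a_assoc[of "x \<ominus>\<^bsub>M\<^esub> f x" "f x" "\<ominus>\<^bsub>res_mod R S M\<^esub> f x"] RM.a_inv_closed[of "f x"] by simp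
    also have "(x \<ominus>\<^bsub>M\<^esub> f x) \<oplus>\<^bsub>M\<^esub> f x = x" using c x by (simp add: M.minus_eq M.a_assoc M.l_neg)
    finally show ?thesis by (simp add: RM.minus_eq)
  qed
  have "bij_betw f (carrier M) (carrier M) \<or> bij_betw (\<lambda>x. x \<ominus>\<^bsub>M\<^esub> f x) (carrier M) (carrier M)"
    using loc fA by (auto simp: local_end_def)
  moreover have "bij_betw (\<lambda>x. x \<ominus>\<^bsub>M\<^esub> f x) (carrier M) (carrier M) \<longleftrightarrow>
      bij_betw (\<lambda>x. x \<ominus>\<^bsub>res_mod R S M\<^esub> f x) (carrier M) (carrier M)"
    by (rule bij_betw_cong) (simp only: eq)
  ultimately show "bij_betw f (carrier (res_mod R S M)) (carrier (res_mod R S M)) \<or>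
    bij_betw (\<lambda>x. x \<ominus>\<^bsub>res_mod R S M\<^esub> f x) (carrier (res_mod R S M)) (carrier (res_mod R S M))"
    by simp
qed

section \<open>Maps factoring through finite powers of a module\<close>

text \<open>Being a sum of k composites U -> Z -> V amounts to factoring through the k-fold power of
  \<open>Z\<close>, but no such power has to be built. For the identity map it says that the module
  is a summand of this power.\<close>

primrec facs :: "nat \<Rightarrow> ('a, 'r) ring_scheme \<Rightarrow> ('a, 'c, 'm) module_scheme \<Rightarrow> ('a, 'd, 'n) module_scheme \<Rightarrow>
    ('a, 'e, 'k) module_scheme \<Rightarrow> ('d \<Rightarrow> 'e) \<Rightarrow> bool" where
  "facs 0 R Z U V f \<longleftrightarrow> (\<forall>x\<in>carrier U. f x = \<zero>\<^bsub>V\<^esub>)"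
| "facs (Suc k) R Z U V f \<longleftrightarrow> (\<exists>g u v. facs k R Z U V g \<and> is_linear R U Z v \<and> is_linear R Z V u \<and>
      (\<forall>x\<in>carrier U. f x = g x \<oplus>\<^bsub>V\<^esub> u (v x)))"

lemma facs_closed:
  assumes "module R V"
  shows "facs k R Z U V f \<Longrightarrow> x \<in> carrier U \<Longrightarrow> f x \<in> carrier V"
proof (induction k arbitrary: f)
  case 0
  interpret V: module R V by fact
  show ?case using 0 by simp
next
  case (Suc k)
  interpret V: module R V by fact
  obtain g u v where *: "facs k R Z U V g" "is_linear R U Z v" "is_linear R Z V u" "\<forall>x\<in>carrier U. f x = g x \<oplus>\<^bsub>V\<^esub> u (v x)"
    using Suc.prems(1) by auto
  have "g x \<in> carrier V" by (rule Suc.IH[OF *(1) Suc.prems(2)])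
  moreover have "u (v x) \<in> carrier V" by (rule lin_closed[OF *(3) lin_closed[OF *(2) Suc.prems(2)]])
  ultimately show ?case using *(4) Suc.prems(2) by simp
qed

lemma facs_cong:
  assumes f: "facs k R Z U V f" and eq: "\<And>x. x \<in> carrier U \<Longrightarrow> h x = f x"
  shows "facs k R Z U V h"
proof (cases k)
  case 0
  then show ?thesis using f eq by simp
next
  case (Suc n)
  then obtain g u v where *: "facs n R Z U V g" "is_linear R U Z v" "is_linear R Z V u" "\<forall>x\<in>carrier U. f x = g x \<oplus>\<^bsub>V\<^esub> u (v x)"
    using f by auto
  then have "\<forall>x\<in>carrier U. h x = g x \<oplus>\<^bsub>V\<^esub> u (v x)" using eq by simp
  then show ?thesis unfolding Suc facs.simps(2) using *(1-3) by blast
qed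

text \<open>Together with \<open>facs_add\<close>, this makes the maps that factor through finite
  powers of \<open>Z\<close> a two-sided ideal of linear maps.\<close>

lemma facs_comp:
  assumes V: "module R V" and V': "module R V'" and g: "is_linear R V V' g" and h: "is_linear R U' U h"
  shows "facs k R Z U V f \<Longrightarrow> facs k R Z U' V' (\<lambda>x. g (f (h x)))"
proof (induction k arbitrary: f)
  case 0
  then show ?case using lin_closed[OF h] lin_zero[OF V V' g] by simp
next
  case (Suc k)
  obtain f' u v where *: "facs k R Z U V f'" "is_linear R U Z v" "is_linear R Z V u" "\<And>x. x \<in> carrier U \<Longrightarrow> f x = f' x \<oplus>\<^bsub>V\<^esub> u (v x)"
    using Suc.prems by auto
  have "facs k R Z U' V' (\<lambda>x. g (f' (h x)))" by (rule Suc.IH[OF *(1)])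
  moreover have "is_linear R U' Z (\<lambda>x. v (h x))" by (rule lin_comp[OF h *(2)])
  moreover have "is_linear R Z V' (\<lambda>x. g (u x))" by (rule lin_comp[OF *(3) g])
  moreover have "\<forall>x\<in>carrier U'. g (f (h x)) = g (f' (h x)) \<oplus>\<^bsub>V'\<^esub> g (u (v (h x)))"
  proof
    fix x assume "x \<in> carrier U'"
    then have hx: "h x \<in> carrier U" by (rule lin_closed[OF h])
    show "g (f (h x)) = g (f' (h x)) \<oplus>\<^bsub>V'\<^esub> g (u (v (h x)))"
      unfolding *(4)[OF hx] 
      by (rule lin_add[OF g facs_closed[OF V *(1) hx] lin_closed[OF *(3) lin_closed[OF *(2) hx]]])
  qed
  ultimately show ?case unfolding facs.simps(2) by blast
qed

lemma facs_single:
  assumes V: "module R V" and v: "is_linear R U Z v" and u: "is_linear R Z V u"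
  shows "facs 1 R Z U V (\<lambda>x. u (v x))"
proof -
  interpret V: module R V by fact
  have "\<forall>x\<in>carrier U. u (v x) = \<zero>\<^bsub>V\<^esub> \<oplus>\<^bsub>V\<^esub> u (v x)"
    using lin_closed[OF u lin_closed[OF v]] by simp
  moreover have "facs 0 R Z U V (\<lambda>x. \<zero>\<^bsub>V\<^esub>)" by simp
  ultimately show ?thesis unfolding One_nat_def facs.simps(2) using u v by blast
qed

lemma facs_add:
  assumes V: "module R V" and f: "facs k R Z U V f"
  shows "facs l R Z U V g \<Longrightarrow> facs (k + l) R Z U V (\<lambda>x. f x \<oplus>\<^bsub>V\<^esub> g x)"
proof (induction l arbitrary: g)
  case 0
  interpret V: module R V by fact
  show ?case using facs_cong[OF f, of "\<lambda>x. f x \<oplus>\<^bsub>V\<^esub> g x"] 0 facs_closed[OF V f] by simp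
next
  case (Suc l)
  interpret V: module R V by fact
  obtain f' u v where *: "facs l R Z U V f'" "is_linear R U Z v" "is_linear R Z V u" "\<And>x. x \<in> carrier U \<Longrightarrow> g x = f' x \<oplus>\<^bsub>V\<^esub> u (v x)"
    using Suc.prems by auto
  have "\<forall>x\<in>carrier U. f x \<oplus>\<^bsub>V\<^esub> g x = (f x \<oplus>\<^bsub>V\<^esub> f' x) \<oplus>\<^bsub>V\<^esub> u (v x)"
    using *(4) facs_closed[OF V f] facs_closed[OF V *(1)] lin_closed[OF *(3) lin_closed[OF *(2)]]
    by (simp add: V.a_assoc)
  then show ?case using Suc.IH[OF *(1)] *(2,3) unfolding add_Suc_right facs.simps(2) by blast
qed

lemma facs_finsum:
  assumes V: "module R V" and "finite F" and "\<And>P. P \<in> F \<Longrightarrow> \<exists>k. facs k R Z U V (f P)"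
  shows "\<exists>k. facs k R Z U V (\<lambda>x. finsum V (\<lambda>P. f P x) F)"
  using assms(2,3)
proof (induction)
  case empty
  interpret V: module R V by fact
  show ?case by (intro exI[of _ 0]) simp
next
  case (insert P F)
  interpret V: module R V by fact
  obtain k where k: "facs k R Z U V (\<lambda>x. finsum V (\<lambda>P. f P x) F)" using insert by auto
  obtain l where l: "facs l R Z U V (f P)" using insert.prems by auto
  have c: "f B x \<in> carrier V" if "B \<in> insert P F" "x \<in> carrier U" for B x
    using insert.prems[OF that(1)] facs_closed[OF V _ that(2)] by blast
  have "facs (l + k) R Z U V (\<lambda>x. finsum V (\<lambda>P. f P x) (insert P F))"
    by (rule facs_cong[OF facs_add[OF V l k]]) (use c insert.hyps in \<open>auto intro!: V.finsum_insert\<close>)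
  then show ?case by blast
qed

section \<open>Splitting off a summand with local endomorphism ring\<close>

lemma (in domain) rk_add:
  assumes W: "module R W" and U: "module R U" and M: "module R M"
    and i: "is_linear R U W i" and j: "is_linear R M W j"
    and inj: "\<And>x y. x \<in> carrier U \<Longrightarrow> y \<in> carrier M \<Longrightarrow> i x \<oplus>\<^bsub>W\<^esub> j y = \<zero>\<^bsub>W\<^esub> \<Longrightarrow> x = \<zero>\<^bsub>U\<^esub> \<and> y = \<zero>\<^bsub>M\<^esub>"
    and surj: "\<And>w. w \<in> carrier W \<Longrightarrow> \<exists>x\<in>carrier U. \<exists>y\<in>carrier M. w = i x \<oplus>\<^bsub>W\<^esub> j y"
    and rU: "has_rk R U n" and rM: "has_rk R M r"
  shows "has_rk R W (n + r)"
proof -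
  interpret W: module R W by fact
  interpret U: module R U by fact
  interpret M: module R M by fact
  obtain b c where "loc_map R (nonzeros R) (free_mod R n) U b" "loc_map R (nonzeros R) (free_mod R r) M c"
    using rU rM by (auto simp: has_rk_def)
  note b = loc_mapD[OF this(1)] and c = loc_mapD[OF this(2)]
  let ?F = "free_mod R (n + r)"
  define p where "p = (\<lambda>(z::nat \<Rightarrow> 'a) k. if k < n then z k else \<zero>)"
  define q where "q = (\<lambda>(z::nat \<Rightarrow> 'a) k. z (n + k))"
  have pl: "is_linear R ?F (free_mod R n) p"
    by (rule linI) (auto simp: p_def fun_eq_iff)
  have ql: "is_linear R ?F (free_mod R r) q"
    by (rule linI) (auto simp: q_def fun_eq_iff)
  let ?g = "\<lambda>z. i (b (p z)) \<oplus>\<^bsub>W\<^esub> j (c (q z))"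
  have g: "is_linear R ?F W ?g"
    by (intro lin_plus[OF W] lin_comp[OF lin_comp[OF pl b(1)] i] lin_comp[OF lin_comp[OF ql c(1)] j])
  have "loc_map R (nonzeros R) ?F W ?g" unfolding loc_map_def
  proof (intro conjI ballI g)
    show "inj_on ?g (carrier ?F)"
      unfolding lin_inj_iff[OF module_free W g]
    proof (intro ballI impI)
      fix z assume z: "z \<in> carrier ?F" and "?g z = \<zero>\<^bsub>W\<^esub>"
      note pz = lin_closed[OF pl z] and qz = lin_closed[OF ql z]
      have *: "b (p z) = \<zero>\<^bsub>U\<^esub>" "c (q z) = \<zero>\<^bsub>M\<^esub>"
        using inj[OF lin_closed[OF b(1) pz] lin_closed[OF c(1) qz] \<open>?g z = _\<close>] by simp_all
      have "p z = \<zero>\<^bsub>free_mod R n\<^esub>" using b(2) * pz unfolding lin_inj_iff[OF module_free U b(1)] by blast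
      then have 1: "z k = \<zero>" if "k < n" for k using that by (simp add: p_def fun_eq_iff) metis
      have "q z = \<zero>\<^bsub>free_mod R r\<^esub>" using c(2) * qz unfolding lin_inj_iff[OF module_free M c(1)] by blast
      then have 2: "z (n + k) = \<zero>" for k by (simp add: q_def fun_eq_iff)
      have "z k = \<zero>" for k
        using 1[of k] 2[of "k - n"] by (cases "k < n") simp_all
      then show "z = \<zero>\<^bsub>?F\<^esub>" by (simp add: fun_eq_iff)
    qed
    fix w assume "w \<in> carrier W"
    then obtain x y where xy: "x \<in> carrier U" "y \<in> carrier M" "w = i x \<oplus>\<^bsub>W\<^esub> j y" using surj by blast
    obtain s x' where s: "s \<in> nonzeros R" "x' \<in> carrier (free_mod R n)" "s \<odot>\<^bsub>U\<^esub> x = b x'" using b(3)[OF xy(1)] by blast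
    obtain t y' where t: "t \<in> nonzeros R" "y' \<in> carrier (free_mod R r)" "t \<odot>\<^bsub>M\<^esub> y = c y'" using c(3)[OF xy(2)] by blast
    have sc: "s \<in> carrier R" "t \<in> carrier R" using s t by auto
    \<comment> \<open>With s x and t y integral, the common multiple s t w has first part t (s x)
      and second part s (t y).\<close>
    define z where "z = (\<lambda>k. if k < n then t \<otimes> x' k else s \<otimes> y' (k - n))"
    have z: "z \<in> carrier ?F" using s t by (intro free_memI) (auto simp: z_def)
    have pz: "p z = t \<odot>\<^bsub>free_mod R n\<^esub> x'" using s t by (auto simp: p_def z_def fun_eq_iff)
    have qz: "q z = s \<odot>\<^bsub>free_mod R r\<^esub> y'" by (auto simp: q_def z_def fun_eq_iff)
    have "?g z = i (t \<odot>\<^bsub>U\<^esub> (s \<odot>\<^bsub>U\<^esub> x)) \<oplus>\<^bsub>W\<^esub> j (s \<odot>\<^bsub>M\<^esub> (t \<odot>\<^bsub>M\<^esub> y))"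
      unfolding pz qz lin_smult[OF b(1) sc(2) s(2)] lin_smult[OF c(1) sc(1) t(2)] s(3) t(3) ..
    also have "\<dots> = (s \<otimes> t) \<odot>\<^bsub>W\<^esub> w"
      using sc xy lin_closed[OF i xy(1)] lin_closed[OF j xy(2)]
      by (simp add: lin_smult[OF i] lin_smult[OF j] W.smult_assoc1 W.smult_r_distr W.smult_comm[of t s])
    finally have "(s \<otimes> t) \<odot>\<^bsub>W\<^esub> w = ?g z" ..
    then show "\<exists>s\<in>nonzeros R. \<exists>u\<in>carrier ?F. s \<odot>\<^bsub>W\<^esub> w = ?g u"
      using z mult_setD(3)[OF mult_set_nonzeros s(1) t(1)] by blast
  qed
  then show ?thesis by (auto simp: has_rk_def)
qed

text \<open>If the endomorphism \<open>v \<circ> u\<close> of \<open>M\<close> is invertible, then \<open>M\<close> is a summand of \<open>W\<close> with complement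
  the kernel of \<open>v\<close>; otherwise \<open>1 - v \<circ> u\<close> is, and the summand \<open>u \<circ> v\<close> of the identity can be eliminated.\<close>

lemma (in domain) peel:
  assumes W: "module R W" and Y: "module R Y" and M: "module R M" and loc: "local_end R M"
    and g: "facs k R Y W W g" and v: "is_linear R W M v" and u: "is_linear R M W u"
    and id: "\<And>x. x \<in> carrier W \<Longrightarrow> x = g x \<oplus>\<^bsub>W\<^esub> u (v x)"
  shows "facs k R Y W W (\<lambda>x. x) \<or> (\<exists>C. submodule C R W \<and> facs k R Y (W\<lparr>carrier := C\<rparr>) (W\<lparr>carrier := C\<rparr>) (\<lambda>x. x) \<and>
     (\<forall>n r. has_rk R (W\<lparr>carrier := C\<rparr>) n \<longrightarrow> has_rk R M r \<longrightarrow> has_rk R W (n + r)))"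
proof -
  interpret W: module R W by fact
  interpret M: module R M by fact
  let ?h = "\<lambda>m. v (u m)"
  have h: "is_linear R M M ?h" by (rule lin_comp[OF u v])
  have h1: "is_linear R M M (\<lambda>m. m \<ominus>\<^bsub>M\<^esub> ?h m)" by (rule lin_diff[OF M lin_id h])
  note vc = lin_closed[OF v] and uc = lin_closed[OF u] and gc = facs_closed[OF W g]
  consider "bij_betw ?h (carrier M) (carrier M)" | "bij_betw (\<lambda>m. m \<ominus>\<^bsub>M\<^esub> ?h m) (carrier M) (carrier M)"
    using loc h by (auto simp: local_end_def)
  then show ?thesis
  proof cases
    case 2
    define w where "w = inv_into (carrier M) (\<lambda>m. m \<ominus>\<^bsub>M\<^esub> ?h m)"
    have wl: "is_linear R M M w" unfolding w_def by (rule lin_inv_into[OF M h1 2])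
    \<comment> \<open>Applying v to x = g x + u (v x) gives (1 - v u)(v x) = v (g x), and w is the
      inverse of 1 - v u.\<close>
    have eq: "v x = w (v (g x))" if x: "x \<in> carrier W" for x
    proof -
      have "v x = v (g x) \<oplus>\<^bsub>M\<^esub> ?h (v x)"
        using id[OF x] lin_add[OF v gc[OF x] uc[OF vc[OF x]]] by simp
      then have "v x \<ominus>\<^bsub>M\<^esub> ?h (v x) = v (g x)"
        using vc[OF x] vc[OF gc[OF x]] vc[OF uc[OF vc[OF x]]] M.M.minus_eq M.M.add.inv_solve_right' by metis
      from inv_into_f_eq[OF bij_betw_imp_inj_on[OF 2] vc[OF x] this] show ?thesis unfolding w_def by simp
    qed
    \<comment> \<open>Composing g with 1 + u w v gives g + u w v g = g + u v, the identity; the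
      number of factors stays k.\<close>
    have G: "is_linear R W W (\<lambda>y. y \<oplus>\<^bsub>W\<^esub> u (w (v y)))"
      by (intro lin_plus[OF W lin_id] lin_comp[OF lin_comp[OF v wl] u])
    have "facs k R Y W W (\<lambda>x. x)"
    proof (rule facs_cong[OF facs_comp[OF W W G lin_id g]])
      fix x assume x: "x \<in> carrier W"
      show "x = g x \<oplus>\<^bsub>W\<^esub> u (w (v (g x)))" using id[OF x] unfolding eq[OF x, symmetric] .
    qed
    then show ?thesis ..
  next
    case 1
    define w where "w = inv_into (carrier M) ?h"
    have wl: "is_linear R M M w" unfolding w_def by (rule lin_inv_into[OF M h 1])
    have hw: "v (u (w m)) = m" if "m \<in> carrier M" for m
      unfolding w_def using f_inv_into_f[of m ?h "carrier M"] bij_betw_imp_surj_on[OF 1] that by simp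
    have hinj: "m = \<zero>\<^bsub>M\<^esub>" if "m \<in> carrier M" "v (u m) = \<zero>\<^bsub>M\<^esub>" for m
      using bij_betw_imp_inj_on[OF 1] that unfolding lin_inj_iff[OF M M h] by blast
    define C where "C = {x \<in> carrier W. v x \<in> {\<zero>\<^bsub>M\<^esub>}}"
    have C: "submodule C R W" unfolding C_def
      by (rule lin_vimage_submodule[OF W M v]) (rule submodI[OF M], auto)
    note CW = submod_module[OF W C]
    have CsubW: "C \<subseteq> carrier W" by (auto simp: C_def)
    let ?C = "W\<lparr>carrier := C\<rparr>"
    \<comment> \<open>The projection onto the kernel of v along the image of u, with w the inverse
      of v u.\<close>
    define rho where "rho = (\<lambda>x. x \<ominus>\<^bsub>W\<^esub> u (w (v x)))"
    have rho0: "is_linear R W W rho" unfolding rho_def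
      by (intro lin_diff[OF W lin_id] lin_comp[OF lin_comp[OF v wl] u])
    have rhoC: "rho x \<in> C" if x: "x \<in> carrier W" for x
    proof -
      note wc = lin_closed[OF wl vc[OF x]]
      have "v (rho x) = v x \<ominus>\<^bsub>M\<^esub> v (u (w (v x)))" unfolding rho_def by (rule lin_minus[OF W M v x uc[OF wc]])
      also have "\<dots> = \<zero>\<^bsub>M\<^esub>" unfolding hw[OF vc[OF x]] using vc[OF x] by (simp add: M.minus_eq_zero_iff)
      finally show ?thesis using lin_closed[OF rho0 x] by (simp add: C_def)
    qed
    have rho: "is_linear R W ?C rho" by (rule lin_sub_cod[OF rho0 rhoC])
    have uw0: "u (w (v x)) = \<zero>\<^bsub>W\<^esub>" if "x \<in> C" for x
      using that lin_zero[OF M M wl] lin_zero[OF M W u] by (simp add: C_def)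
    have rho_id: "rho x = x" if "x \<in> C" for x
      using that CsubW uw0[OF that] by (auto simp: rho_def W.M.minus_eq)
    \<comment> \<open>On the kernel of v the term u v vanishes, so the remaining k factors alone
      give the identity there.\<close>
    have gC: "x = g x" if "x \<in> C" for x
    proof -
      have x: "x \<in> carrier W" using that CsubW by auto
      have "u (v x) = \<zero>\<^bsub>W\<^esub>" using that lin_zero[OF M W u] by (simp add: C_def)
      then show ?thesis using id[OF x] gc[OF x] by simp
    qed
    have incl: "is_linear R ?C W (\<lambda>x. x)" by (rule lin_sub_dom[OF lin_id CsubW])
    have f: "facs k R Y ?C ?C (\<lambda>x. x)"
    proof (rule facs_cong[OF facs_comp[OF W CW rho incl g]])
      fix x assume "x \<in> carrier ?C"
      then have "x \<in> C" by simp
      then show "x = rho (g x)" using gC rho_id by simp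
    qed
    have "has_rk R W (n + r)" if rk: "has_rk R ?C n" "has_rk R M r" for n r
    proof (rule rk_add[OF W CW M incl u _ _ rk])
      fix x y assume x: "x \<in> carrier ?C" and y: "y \<in> carrier M" and 0: "x \<oplus>\<^bsub>W\<^esub> u y = \<zero>\<^bsub>W\<^esub>"
      have xW: "x \<in> carrier W" using x CsubW by auto
      have "v x \<oplus>\<^bsub>M\<^esub> v (u y) = \<zero>\<^bsub>M\<^esub>" using lin_add[OF v xW uc[OF y]] 0 lin_zero[OF W M v] by simp
      then have "v (u y) = \<zero>\<^bsub>M\<^esub>" using x vc[OF uc[OF y]] by (simp add: C_def)
      then have y0: "y = \<zero>\<^bsub>M\<^esub>" by (rule hinj[OF y])
      then have "x = \<zero>\<^bsub>W\<^esub>" using 0 lin_zero[OF M W u] xW by simp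
      then show "x = \<zero>\<^bsub>?C\<^esub> \<and> y = \<zero>\<^bsub>M\<^esub>" using y0 by simp
    next
      fix x assume x: "x \<in> carrier W"
      note wc = lin_closed[OF wl vc[OF x]]
      have "x = rho x \<oplus>\<^bsub>W\<^esub> u (w (v x))" unfolding rho_def
        using x uc[OF wc] by (simp add: W.M.minus_eq W.M.a_assoc W.M.l_neg)
      then show "\<exists>y\<in>carrier ?C. \<exists>m\<in>carrier M. x = y \<oplus>\<^bsub>W\<^esub> u m" using rhoC[OF x] wc by auto
    qed
    then show ?thesis using C f by blast
  qed
qed

lemma (in domain) rk_zero:
  assumes W: "module R W" and "\<And>x. x \<in> carrier W \<Longrightarrow> x = \<zero>\<^bsub>W\<^esub>"
  shows "has_rk R W 0"
proof -
  interpret W: module R W by fact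
  have "loc_map R (nonzeros R) (free_mod R 0) W (\<lambda>x. \<zero>\<^bsub>W\<^esub>)"
    unfolding loc_map_def
  proof (intro conjI ballI lin_const_zero W)
    show "inj_on (\<lambda>x. \<zero>\<^bsub>W\<^esub>) (carrier (free_mod R 0))" by (auto intro!: inj_onI simp: fun_eq_iff)
    fix w assume "w \<in> carrier W"
    then have "w = \<zero>\<^bsub>W\<^esub>" by (rule assms(2))
    then show "\<exists>s\<in>nonzeros R. \<exists>u\<in>carrier (free_mod R 0). s \<odot>\<^bsub>W\<^esub> w = \<zero>\<^bsub>W\<^esub>"
      by (intro bexI[of _ \<one>] bexI[of _ "\<lambda>_. \<zero>"]) auto
  qed
  then show ?thesis by (auto simp: has_rk_def)
qed

text \<open>Each application of \<open>peel\<close> removes one of the k factors, at the cost of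
  splitting off at most one copy of \<open>M\<close>, of rank r. This is the part of Krull-Schmidt
  that concerns ranks.\<close>

lemma (in domain) summand_rk:
  assumes M: "module R M" and loc: "local_end R M" and rk: "has_rk R M r"
  shows "module R W \<Longrightarrow> facs k R M W W (\<lambda>x. x) \<Longrightarrow> \<exists>d. has_rk R W (d * r)"
proof (induction k arbitrary: W)
  case 0
  then have "has_rk R W 0" by (intro rk_zero) auto
  then show ?case by (intro exI[of _ 0]) simp
next
  case (Suc k)
  obtain g u v where *: "facs k R M W W g" "is_linear R W M v" "is_linear R M W u" "\<And>x. x \<in> carrier W \<Longrightarrow> x = g x \<oplus>\<^bsub>W\<^esub> u (v x)"
    using Suc.prems(2) by auto
  have "facs k R M W W (\<lambda>x. x) \<or> (\<exists>C. submodule C R W \<and> facs k R M (W\<lparr>carrier := C\<rparr>) (W\<lparr>carrier := C\<rparr>) (\<lambda>x. x) \<and>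
     (\<forall>n r. has_rk R (W\<lparr>carrier := C\<rparr>) n \<longrightarrow> has_rk R M r \<longrightarrow> has_rk R W (n + r)))"
    by (rule peel[OF Suc.prems(1) M M loc *(1-3)]) (rule *(4))
  then show ?case
  proof (elim disjE exE conjE)
    assume "facs k R M W W (\<lambda>x. x)"
    then show ?thesis by (rule Suc.IH[OF Suc.prems(1)])
  next
    fix C assume C: "submodule C R W" "facs k R M (W\<lparr>carrier := C\<rparr>) (W\<lparr>carrier := C\<rparr>) (\<lambda>x. x)"
      and r: "\<forall>n r. has_rk R (W\<lparr>carrier := C\<rparr>) n \<longrightarrow> has_rk R M r \<longrightarrow> has_rk R W (n + r)"
    obtain d where "has_rk R (W\<lparr>carrier := C\<rparr>) (d * r)"
      using Suc.IH[OF submod_module[OF Suc.prems(1) C(1)] C(2)] by blast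
    then have "has_rk R W (d * r + r)" using r rk by blast
    then show ?thesis by (intro exI[of _ "Suc d"]) (simp add: add.commute)
  qed
qed

section \<open>An obstruction to decomposing into finitely generated modules\<close>

text \<open>The component of y in B is read off from any finite representation of y. That the result
  is the same for every representation follows from independence, applied to a difference of two of
  them.\<close>

lemma dsum_projections:
  assumes A: "module R A"
    and sub: "\<And>B. B \<in> Fam \<Longrightarrow> submodule B R A"
    and ind: "\<And>F x. finite F \<Longrightarrow> F \<subseteq> Fam \<Longrightarrow> (\<forall>B\<in>F. x B \<in> B) \<Longrightarrow> finsum A x F = \<zero>\<^bsub>A\<^esub> \<Longrightarrow> (\<forall>B\<in>F. x B = \<zero>\<^bsub>A\<^esub>)"
    and gen: "\<And>y. y \<in> carrier A \<Longrightarrow> \<exists>F x. finite F \<and> F \<subseteq> Fam \<and> (\<forall>B\<in>F. x B \<in> B) \<and> y = finsum A x F"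
  shows "\<exists>p. (\<forall>B\<in>Fam. is_linear R A A (p B) \<and> (\<forall>y\<in>carrier A. p B y \<in> B) \<and> (\<forall>y\<in>B. p B y = y)) \<and>
     (\<forall>y\<in>carrier A. \<exists>F. finite F \<and> F \<subseteq> Fam \<and> y = finsum A (\<lambda>B. p B y) F)"
proof -
  interpret A: module R A by fact
  \<comment> \<open>The graph of the projection to B, as a relation: z is the B-component in some
    finite representation of y, and zero if B does not occur in it.\<close>
  define D where "D = (\<lambda>B y z. \<exists>F x. finite F \<and> F \<subseteq> Fam \<and> (\<forall>C\<in>F. x C \<in> C) \<and> y = finsum A x F \<and>
     z = (if B \<in> F then x B else \<zero>\<^bsub>A\<^esub>))"
  have inA: "z \<in> carrier A" if "B \<in> Fam" "z \<in> B" for B z using submodD(1)[OF A sub[OF that(1)] that(2)] .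
  have zB: "\<zero>\<^bsub>A\<^esub> \<in> B" if "B \<in> Fam" for B using submodD(2)[OF A sub[OF that]] .
  have DB: "z \<in> B" if "D B y z" "B \<in> Fam" for B y z
    using that(1) zB[OF that(2)] unfolding D_def by auto
  \<comment> \<open>Two representations are extended by zero to the union of their families;
    linearity of the relation then gives both uniqueness and linearity of the projection.\<close>
  have D_lin: "D B (y \<oplus>\<^bsub>A\<^esub> a \<odot>\<^bsub>A\<^esub> y') (z \<oplus>\<^bsub>A\<^esub> a \<odot>\<^bsub>A\<^esub> z')"
    if "D B y z" "D B y' z'" and a: "a \<in> carrier R" for B y z y' z' a
  proof -
    obtain F x where F: "finite F" "F \<subseteq> Fam" "\<forall>C\<in>F. x C \<in> C" "y = finsum A x F" "z = (if B \<in> F then x B else \<zero>\<^bsub>A\<^esub>)"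
      using \<open>D B y z\<close> unfolding D_def by blast
    obtain F' x' where F': "finite F'" "F' \<subseteq> Fam" "\<forall>C\<in>F'. x' C \<in> C" "y' = finsum A x' F'" "z' = (if B \<in> F' then x' B else \<zero>\<^bsub>A\<^esub>)"
      using \<open>D B y' z'\<close> unfolding D_def by blast
    define e where "e = (\<lambda>C. if C \<in> F then x C else \<zero>\<^bsub>A\<^esub>)"
    define e' where "e' = (\<lambda>C. if C \<in> F' then x' C else \<zero>\<^bsub>A\<^esub>)"
    have eC: "e C \<in> C" "e' C \<in> C" "e C \<in> carrier A" "e' C \<in> carrier A" if "C \<in> F \<union> F'" for C
    proof -
      have C: "C \<in> Fam" using that F(2) F'(2) by auto
      show "e C \<in> C" "e' C \<in> C" using F(3) F'(3) zB[OF C] by (auto simp: e_def e'_def)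
      then show "e C \<in> carrier A" "e' C \<in> carrier A" using inA[OF C] by auto
    qed
    have y: "y = finsum A e (F \<union> F')"
      unfolding F(4) by (rule A.add.finprod_mono_neutral_cong_left) (use F(1) F'(1) eC(3) in \<open>auto simp: e_def\<close>)
    have y': "y' = finsum A e' (F \<union> F')"
      unfolding F'(4) by (rule A.add.finprod_mono_neutral_cong_left) (use F(1) F'(1) eC(4) in \<open>auto simp: e'_def\<close>)
    have fin: "finite (F \<union> F')" using F(1) F'(1) by simp
    have "y \<oplus>\<^bsub>A\<^esub> a \<odot>\<^bsub>A\<^esub> y' = finsum A (\<lambda>C. e C \<oplus>\<^bsub>A\<^esub> a \<odot>\<^bsub>A\<^esub> e' C) (F \<union> F')"
      unfolding y y' using eC(3,4) a fin by (simp add: A.finsum_smult_ldistr A.finsum_addf Pi_iff)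
    moreover have "\<forall>C\<in>F \<union> F'. e C \<oplus>\<^bsub>A\<^esub> a \<odot>\<^bsub>A\<^esub> e' C \<in> C"
    proof
      fix C assume C: "C \<in> F \<union> F'"
      then have "C \<in> Fam" using F(2) F'(2) by auto
      note S = submodD[OF A sub[OF this]]
      show "e C \<oplus>\<^bsub>A\<^esub> a \<odot>\<^bsub>A\<^esub> e' C \<in> C" by (intro S(3) S(4) eC a C)
    qed
    moreover have "z \<oplus>\<^bsub>A\<^esub> a \<odot>\<^bsub>A\<^esub> z' = (if B \<in> F \<union> F' then e B \<oplus>\<^bsub>A\<^esub> a \<odot>\<^bsub>A\<^esub> e' B else \<zero>\<^bsub>A\<^esub>)"
      using F(5) F'(5) a by (auto simp: e_def e'_def)
    moreover have "F \<union> F' \<subseteq> Fam" using F(2) F'(2) by auto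
    ultimately show ?thesis unfolding D_def using fin 
      by (intro exI[of _ "F \<union> F'"] exI[of _ "\<lambda>C. e C \<oplus>\<^bsub>A\<^esub> a \<odot>\<^bsub>A\<^esub> e' C"]) simp
  qed
  have DA: "z \<in> carrier A" if "D B y z" "B \<in> Fam" for B y z using inA[OF that(2) DB[OF that]] .
  have D0: "z = \<zero>\<^bsub>A\<^esub>" if "D B \<zero>\<^bsub>A\<^esub> z" for B z
  proof -
    obtain F x where F: "finite F" "F \<subseteq> Fam" "\<forall>C\<in>F. x C \<in> C" "\<zero>\<^bsub>A\<^esub> = finsum A x F" "z = (if B \<in> F then x B else \<zero>\<^bsub>A\<^esub>)"
      using \<open>D B _ z\<close> unfolding D_def by blast
    then have "\<forall>C\<in>F. x C = \<zero>\<^bsub>A\<^esub>" by (intro ind) simp_all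
    then show ?thesis using F(5) by auto
  qed
  have D_fun: "z = z'" if "D B y z" "D B y z'" "B \<in> Fam" "y \<in> carrier A" for B y z z'
  proof -
    have "D B (y \<oplus>\<^bsub>A\<^esub> (\<ominus>\<^bsub>R\<^esub> \<one>\<^bsub>R\<^esub>) \<odot>\<^bsub>A\<^esub> y) (z \<oplus>\<^bsub>A\<^esub> (\<ominus>\<^bsub>R\<^esub> \<one>\<^bsub>R\<^esub>) \<odot>\<^bsub>A\<^esub> z')"
      by (rule D_lin[OF that(1,2)]) simp
    also have "y \<oplus>\<^bsub>A\<^esub> (\<ominus>\<^bsub>R\<^esub> \<one>\<^bsub>R\<^esub>) \<odot>\<^bsub>A\<^esub> y = \<zero>\<^bsub>A\<^esub>" using that(4) by (simp add: A.neg_smult[symmetric] A.M.r_neg)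
    finally have "z \<oplus>\<^bsub>A\<^esub> (\<ominus>\<^bsub>R\<^esub> \<one>\<^bsub>R\<^esub>) \<odot>\<^bsub>A\<^esub> z' = \<zero>\<^bsub>A\<^esub>" by (rule D0)
    then have "z \<ominus>\<^bsub>A\<^esub> z' = \<zero>\<^bsub>A\<^esub>" using DA[OF that(2,3)] by (simp add: A.M.minus_eq A.neg_smult)
    then show ?thesis using A.minus_eq_zero_iff DA[OF that(1,3)] DA[OF that(2,3)] by simp
  qed
  have ex: "\<exists>z. D B y z" if "y \<in> carrier A" for B y
    using gen[OF that] unfolding D_def by blast
  define p where "p = (\<lambda>B y. SOME z. D B y z)"
  have pD: "D B y (p B y)" if "y \<in> carrier A" for B y
    unfolding p_def by (rule someI_ex[OF ex[OF that]])
  have pI: "p B y = z" if "D B y z" "B \<in> Fam" "y \<in> carrier A" for B y z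
    by (rule D_fun[OF pD[OF that(3)] that])
  have D00: "D B \<zero>\<^bsub>A\<^esub> \<zero>\<^bsub>A\<^esub>" for B unfolding D_def by (intro exI[of _ "{}"]) simp
  show ?thesis
  proof (intro exI[of _ p] conjI ballI)
    fix B assume B: "B \<in> Fam"
    show "is_linear R A A (p B)"
    proof (rule linI)
      fix y assume y: "y \<in> carrier A"
      note py = DA[OF pD[OF y] B]
      show "p B y \<in> carrier A" by (rule py)
      show "p B (y \<oplus>\<^bsub>A\<^esub> y') = p B y \<oplus>\<^bsub>A\<^esub> p B y'" if y': "y' \<in> carrier A" for y'
      proof (rule pI[OF _ B A.a_closed[OF y y']])
        have "D B (y \<oplus>\<^bsub>A\<^esub> \<one>\<^bsub>R\<^esub> \<odot>\<^bsub>A\<^esub> y') (p B y \<oplus>\<^bsub>A\<^esub> \<one>\<^bsub>R\<^esub> \<odot>\<^bsub>A\<^esub> p B y')"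
          by (rule D_lin[OF pD[OF y] pD[OF y']]) simp
        then show "D B (y \<oplus>\<^bsub>A\<^esub> y') (p B y \<oplus>\<^bsub>A\<^esub> p B y')"
          using y' DA[OF pD[OF y'] B] by simp
      qed
      show "p B (a \<odot>\<^bsub>A\<^esub> y) = a \<odot>\<^bsub>A\<^esub> p B y" if a: "a \<in> carrier R" for a
      proof (rule pI[OF _ B A.smult_closed[OF a y]])
        show "D B (a \<odot>\<^bsub>A\<^esub> y) (a \<odot>\<^bsub>A\<^esub> p B y)"
          using D_lin[OF D00[of B] pD[OF y, of B] a] a y py by simp
      qed
    qed
    show "p B y \<in> B" if "y \<in> carrier A" for y by (rule DB[OF pD[OF that] B])
    show "p B y = y" if "y \<in> B" for y
    proof (rule pI[OF _ B inA[OF B that]])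
      show "D B y y" unfolding D_def
        by (intro exI[of _ "{B}"] exI[of _ "\<lambda>_. y"]) (use B that inA[OF B that] in simp)
    qed
  next
    fix y assume y: "y \<in> carrier A"
    obtain F x where F: "finite F" "F \<subseteq> Fam" "\<forall>B\<in>F. x B \<in> B" "y = finsum A x F" using gen[OF y] by blast
    have px: "p B y = x B" if "B \<in> F" for B
    proof (rule pI[OF _ _ y])
      show "D B y (x B)" unfolding D_def using F that by (intro exI[of _ F] exI[of _ x]) simp
    qed (use that F(2) in auto)
    have xc: "x \<in> F \<rightarrow> carrier A"
    proof
      fix B assume "B \<in> F"
      then show "x B \<in> carrier A" using inA[of B "x B"] F(2,3) by blast
    qed
    have "finsum A (\<lambda>B. p B y) F = finsum A x F" by (rule A.finsum_cong'[OF refl xc px])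
    then have "y = finsum A (\<lambda>B. p B y) F" using F(4) by simp
    then show "\<exists>F. finite F \<and> F \<subseteq> Fam \<and> y = finsum A (\<lambda>B. p B y) F" using F(1,2) by blast
  qed
qed

text \<open>Summands survive localisation: the extension of f is again idempotent, and its image is
  the localisation of the image of f, which allows ranks of summands of \<open>A\<close> to be
  computed inside \<open>W\<close>.\<close>

lemma extend_idempotent:
  assumes A: "module R A" and W: "module R W" and S: "mult_set R S"
    and p: "loc_map R S A W p" and div: "divisible R S W"
    and f: "is_linear R A A f" and idem: "\<And>y. y \<in> carrier A \<Longrightarrow> f (f y) = f y"
  shows "\<exists>e. is_linear R W W e \<and> (\<forall>y\<in>carrier A. e (p y) = p (f y)) \<and> (\<forall>w\<in>carrier W. e (e w) = e w) \<and>
     submodule (e ` carrier W) R W \<and> loc_map R S (A\<lparr>carrier := f ` carrier A\<rparr>) (W\<lparr>carrier := e ` carrier W\<rparr>) p"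
proof -
  interpret W: module R W by fact
  interpret A: module R A by fact
  note p' = loc_mapD[OF p]
  obtain e where e: "is_linear R W W e" "\<forall>y\<in>carrier A. e (p y) = p (f y)"
    using extend_loc_map[OF A W W S p div lin_comp[OF f p'(1)]] by blast
  \<comment> \<open>Both sides agree on the dense image of \<open>A\<close>, and maps into a
    divisible module are determined there.\<close>
  have idem': "e (e w) = e w" if "w \<in> carrier W" for w
    by (rule loc_map_unique[OF W W p div S lin_comp[OF e(1) e(1)] e(1) _ that])
      (simp add: e(2) idem lin_closed[OF f])
  have sub: "submodule (e ` carrier W) R W"
    by (rule lin_image_submodule[OF W W e(1) W.carrier_is_submodule])
  have "loc_map R S (A\<lparr>carrier := f ` carrier A\<rparr>) (W\<lparr>carrier := e ` carrier W\<rparr>) p"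
    unfolding loc_map_def
  proof (intro conjI ballI)
    have fA: "f ` carrier A \<subseteq> carrier A" using lin_closed[OF f] by auto
    show "is_linear R (A\<lparr>carrier := f ` carrier A\<rparr>) (W\<lparr>carrier := e ` carrier W\<rparr>) p"
    proof (rule lin_sub_cod[OF lin_sub_dom[OF p'(1) fA]])
      fix x assume "x \<in> carrier (A\<lparr>carrier := f ` carrier A\<rparr>)"
      then obtain y where y: "y \<in> carrier A" "x = f y" by auto
      then have "p x = e (p y)" using e(2) by simp
      then show "p x \<in> e ` carrier W" using lin_closed[OF p'(1) y(1)] by simp
    qed
    show "inj_on p (carrier (A\<lparr>carrier := f ` carrier A\<rparr>))"
      using inj_on_subset[OF p'(2) fA] by simp
    fix w assume "w \<in> carrier (W\<lparr>carrier := e ` carrier W\<rparr>)"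
    then obtain w0 where w0: "w0 \<in> carrier W" "w = e w0" by auto
    obtain s u where s: "s \<in> S" "u \<in> carrier A" "s \<odot>\<^bsub>W\<^esub> w0 = p u" using p'(3)[OF w0(1)] by blast
    have "s \<odot>\<^bsub>W\<^esub> w = e (s \<odot>\<^bsub>W\<^esub> w0)" using lin_smult[OF e(1) mult_setD(1)[OF S s(1)] w0(1)] w0(2) by simp
    also have "\<dots> = p (f u)" using s e(2) by simp
    finally show "\<exists>s\<in>S. \<exists>u\<in>carrier (A\<lparr>carrier := f ` carrier A\<rparr>). s \<odot>\<^bsub>W\<lparr>carrier := e ` carrier W\<rparr>\<^esub> w = p u"
      using s by auto
  qed
  then show ?thesis using e idem' sub by blast
qed

section \<open>Truncation and finite support in countable direct sums\<close>

definition trunc :: "('a, 'c, 'm) module_scheme \<Rightarrow> nat \<Rightarrow> (nat \<Rightarrow> 'c) \<Rightarrow> nat \<Rightarrow> 'c" where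
  "trunc M n w = (\<lambda>j. if j < n then w j else \<zero>\<^bsub>M\<^esub>)"

lemma coord_lin: "is_linear R (dsum_copies M) M (\<lambda>w. w j)"
  by (rule linI) auto

lemma copies_single_lin:
  assumes M: "module R M"
  shows "is_linear R M (dsum_copies M) (\<lambda>x i. if i = j then x else \<zero>\<^bsub>M\<^esub>)"
proof -
  interpret M: module R M by fact
  show ?thesis
  proof (rule linI)
    fix x assume x: "x \<in> carrier M"
    have "finite {i. (if i = j then x else \<zero>\<^bsub>M\<^esub>) \<noteq> \<zero>\<^bsub>M\<^esub>}"
      by (rule finite_subset[of _ "{j}"]) auto
    then show "(\<lambda>i. if i = j then x else \<zero>\<^bsub>M\<^esub>) \<in> carrier (dsum_copies M)" using x by simp
  qed (auto simp: fun_eq_iff)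
qed

lemma trunc_facs:
  assumes M: "module R M"
  shows "facs n R M (dsum_copies M) (dsum_copies M) (trunc M n)"
proof (induction n)
  case 0
  then show ?case by (simp add: trunc_def)
next
  case (Suc n)
  interpret M: module R M by fact
  have "\<forall>w\<in>carrier (dsum_copies M). trunc M (Suc n) w = trunc M n w \<oplus>\<^bsub>dsum_copies M\<^esub> (\<lambda>i. if i = n then w n else \<zero>\<^bsub>M\<^esub>)"
    by (auto simp: trunc_def fun_eq_iff less_Suc_eq)
  then show ?case unfolding facs.simps(2)
    using Suc coord_lin[of R M n] copies_single_lin[OF M, of n] by blast
qed

text \<open>Vectors supported below n form a submodule; n is chosen above the supports of the images
  of finitely many generators.\<close>

lemma fin_gen_bounded:
  assumes B: "module R B" and M: "module R M" and fg: "fin_gen R B" and q: "is_linear R B (dsum_copies M) q"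
  shows "\<exists>n. \<forall>y\<in>carrier B. \<forall>j\<ge>n. q y j = \<zero>\<^bsub>M\<^esub>"
proof -
  interpret M: module R M by fact
  obtain G where G': "finite G" "G \<subseteq> carrier B" "\<forall>H. submodule H R B \<longrightarrow> G \<subseteq> H \<longrightarrow> H = carrier B"
    by (rule fin_genE[OF B fg])
  note G = G'(1,2) G'(3)[rule_format]
  have "finite (\<Union>g\<in>G. {i. q g i \<noteq> \<zero>\<^bsub>M\<^esub>})"
    using G(1) lin_closed[OF q] G(2) by auto
  then obtain n where n: "\<And>g i. g \<in> G \<Longrightarrow> q g i \<noteq> \<zero>\<^bsub>M\<^esub> \<Longrightarrow> i < n"
    unfolding finite_nat_set_iff_bounded by blast
  let ?T = "{w \<in> carrier (dsum_copies M). \<forall>j\<ge>n. w j = \<zero>\<^bsub>M\<^esub>}"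
  have DM: "module R (dsum_copies M)" by (rule module_dsum_copies[OF M])
  interpret DM: module R "dsum_copies M" by (rule DM)
  have "submodule ?T R (dsum_copies M)"
  proof (rule submodI[OF DM])
    fix a b assume "a \<in> ?T" "b \<in> ?T"
    then show "a \<oplus>\<^bsub>dsum_copies M\<^esub> b \<in> ?T" using DM.a_closed[of a b] by simp
  next
    fix a b assume "a \<in> carrier R" "b \<in> ?T"
    then show "a \<odot>\<^bsub>dsum_copies M\<^esub> b \<in> ?T" using DM.smult_closed[of a b] by simp
  qed auto
  from lin_vimage_submodule[OF B DM q this]
  have "{x \<in> carrier B. q x \<in> ?T} = carrier B"
  proof (rule G(3))
    show "G \<subseteq> {x \<in> carrier B. q x \<in> ?T}"
    proof
      fix g assume g: "g \<in> G"
      then have gB: "g \<in> carrier B" using G(2) by auto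
      have "\<forall>j\<ge>n. q g j = \<zero>\<^bsub>M\<^esub>" using n[OF g] by (meson not_le)
      then show "g \<in> {x \<in> carrier B. q x \<in> ?T}" using gB lin_closed[OF q gB] by simp
    qed
  qed
  then have "\<forall>x\<in>carrier B. q x \<in> ?T" by (metis (no_types, lifting) mem_Collect_eq)
  then show ?thesis by (intro exI[of _ n]) simp
qed

lemma divisible_dsum_copies:
  assumes M: "module R M" and div: "divisible R S M" and S: "mult_set R S"
  shows "divisible R S (dsum_copies M)"
proof (rule divisibleI[OF module_dsum_copies[OF M] mult_setD(1)[OF S]])
  interpret M: module R M by fact
  fix s x assume s: "s \<in> S" and x: "x \<in> carrier (dsum_copies M)" and "s \<odot>\<^bsub>dsum_copies M\<^esub> x = \<zero>\<^bsub>dsum_copies M\<^esub>"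
  then have "s \<odot>\<^bsub>M\<^esub> x i = s \<odot>\<^bsub>M\<^esub> \<zero>\<^bsub>M\<^esub>" for i using mult_setD(1)[OF S s] by (simp add: fun_eq_iff)
  then have "x i = \<zero>\<^bsub>M\<^esub>" for i using divisibleD(1)[OF div s, of "x i" "\<zero>\<^bsub>M\<^esub>"] x by simp
  then show "x = \<zero>\<^bsub>dsum_copies M\<^esub>" by (simp add: fun_eq_iff)
next
  interpret M: module R M by fact
  fix s y assume s: "s \<in> S" and y: "y \<in> carrier (dsum_copies M)"
  have sc: "s \<in> carrier R" by (rule mult_setD(1)[OF S s])
  have "\<exists>x. x \<in> carrier M \<and> s \<odot>\<^bsub>M\<^esub> x = y i" for i using divisibleD(2)[OF div s, of "y i"] y by auto
  then obtain x where x: "\<And>i. x i \<in> carrier M" "\<And>i. s \<odot>\<^bsub>M\<^esub> x i = y i" by metis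
  have "x i = \<zero>\<^bsub>M\<^esub>" if "y i = \<zero>\<^bsub>M\<^esub>" for i
    using divisibleD(1)[OF div s x(1)[of i], of "\<zero>\<^bsub>M\<^esub>"] x(2)[of i] that sc by simp
  then have "{i. x i \<noteq> \<zero>\<^bsub>M\<^esub>} \<subseteq> {i. y i \<noteq> \<zero>\<^bsub>M\<^esub>}" by auto
  then have "finite {i. x i \<noteq> \<zero>\<^bsub>M\<^esub>}" by (rule finite_subset) (use y in simp)
  then show "\<exists>x\<in>carrier (dsum_copies M). s \<odot>\<^bsub>dsum_copies M\<^esub> x = y"
    using x by (intro bexI[of _ x]) simp_all
qed

lemma divisible_dsum2:
  assumes M: "module R M" and N: "module R N" and div: "divisible R S M" "divisible R S N" and S: "mult_set R S"
  shows "divisible R S (dsum2 M N)"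
proof (rule divisibleI[OF module_dsum2[OF M N] mult_setD(1)[OF S]])
  interpret M: module R M by fact
  interpret N: module R N by fact
  fix s x assume s: "s \<in> S" and x: "x \<in> carrier (dsum2 M N)" and *: "s \<odot>\<^bsub>dsum2 M N\<^esub> x = \<zero>\<^bsub>dsum2 M N\<^esub>"
  then have "s \<odot>\<^bsub>M\<^esub> fst x = s \<odot>\<^bsub>M\<^esub> \<zero>\<^bsub>M\<^esub>" "s \<odot>\<^bsub>N\<^esub> snd x = s \<odot>\<^bsub>N\<^esub> \<zero>\<^bsub>N\<^esub>" using mult_setD(1)[OF S s] by simp_all
  then have "fst x = \<zero>\<^bsub>M\<^esub>" "snd x = \<zero>\<^bsub>N\<^esub>"
    using divisibleD(1)[OF div(1) s, of "fst x" "\<zero>\<^bsub>M\<^esub>"] divisibleD(1)[OF div(2) s, of "snd x" "\<zero>\<^bsub>N\<^esub>"] x by auto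
  then show "x = \<zero>\<^bsub>dsum2 M N\<^esub>" by (simp add: prod_eq_iff)
next
  fix s y assume s: "s \<in> S" and y: "y \<in> carrier (dsum2 M N)"
  obtain a b where "a \<in> carrier M" "s \<odot>\<^bsub>M\<^esub> a = fst y" "b \<in> carrier N" "s \<odot>\<^bsub>N\<^esub> b = snd y"
    using divisibleD(2)[OF div(1) s, of "fst y"] divisibleD(2)[OF div(2) s, of "snd y"] y by auto
  then show "\<exists>x\<in>carrier (dsum2 M N). s \<odot>\<^bsub>dsum2 M N\<^esub> x = y"
    by (intro bexI[of _ "(a, b)"]) simp_all
qed

lemma tfree_dsum_copies: "tfree R M \<Longrightarrow> tfree R (dsum_copies M)"
  unfolding tfree_def
proof (intro ballI impI)
  fix a x assume tf: "\<forall>a\<in>carrier R. \<forall>x\<in>carrier M. a \<odot>\<^bsub>M\<^esub> x = \<zero>\<^bsub>M\<^esub> \<longrightarrow> a = \<zero>\<^bsub>R\<^esub> \<or> x = \<zero>\<^bsub>M\<^esub>"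
    and a: "a \<in> carrier R" and x: "x \<in> carrier (dsum_copies M)" and 0: "a \<odot>\<^bsub>dsum_copies M\<^esub> x = \<zero>\<^bsub>dsum_copies M\<^esub>"
  have "a = \<zero>\<^bsub>R\<^esub> \<or> x i = \<zero>\<^bsub>M\<^esub>" for i using tf a x fun_cong[OF 0, of i] by simp
  then show "a = \<zero>\<^bsub>R\<^esub> \<or> x = \<zero>\<^bsub>dsum_copies M\<^esub>" by (cases "a = \<zero>\<^bsub>R\<^esub>") (simp_all add: fun_eq_iff)
qed

lemma tfree_dsum2: "tfree R M \<Longrightarrow> tfree R N \<Longrightarrow> tfree R (dsum2 M N)"
  unfolding tfree_def by (force simp: prod_eq_iff)

text \<open>\<open>K\<close> stands for the local ring at the first maximal ideal: it has rank one
  and \<open>e0\<close> generates it up to S1. The localisations enter only through the dense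
  embeddings \<open>p1\<close> and \<open>p2\<close>, so both ranks of a member of the family are
  ranks of the same R-module and can be equated.\<close>

theorem (in domain) not_dsum_of_fg:
  assumes A: "module R A" and tfA: "tfree R A"
    and S1: "mult_set R S1" "\<zero> \<notin> S1" and S2: "mult_set R S2" "\<zero> \<notin> S2"
    and M1: "module R M1" "divisible R S1 M1" "tfree R M1" "local_end R M1" "has_rk R M1 r1"
    and K: "module R K" "divisible R S1 K" "tfree R K" "local_end R K" "has_rk R K 1"
    and gen: "e0 \<in> carrier K" "\<And>x. x \<in> carrier K \<Longrightarrow> \<exists>s\<in>S1. \<exists>a\<in>carrier R. s \<odot>\<^bsub>K\<^esub> x = a \<odot>\<^bsub>K\<^esub> e0"
    and M2: "module R M2" "divisible R S2 M2" "tfree R M2" "local_end R M2" "has_rk R M2 r2"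
    and p1: "loc_map R S1 A (dsum2 K (dsum_copies M1)) p1"
    and p2: "loc_map R S2 A (dsum_copies M2) p2"
    and cop: "\<not> coprime r1 r2"
  shows "\<not> dsum_of_fg R A"
proof
  assume "dsum_of_fg R A"
  then obtain Fam where Fam: "\<forall>A'\<in>Fam. submodule A' R A \<and> fin_gen R (A\<lparr>carrier := A'\<rparr>)"
    and ind: "\<forall>F x. finite F \<and> F \<subseteq> Fam \<and> (\<forall>A'\<in>F. x A' \<in> A') \<and> finsum A x F = \<zero>\<^bsub>A\<^esub> \<longrightarrow> (\<forall>A'\<in>F. x A' = \<zero>\<^bsub>A\<^esub>)"
    and gn: "\<forall>y\<in>carrier A. \<exists>F x. finite F \<and> F \<subseteq> Fam \<and> (\<forall>A'\<in>F. x A' \<in> A') \<and> y = finsum A x F"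
    unfolding dsum_of_fg_def by (elim exE conjE)
  have "\<exists>p. (\<forall>B\<in>Fam. is_linear R A A (p B) \<and> (\<forall>y\<in>carrier A. p B y \<in> B) \<and> (\<forall>y\<in>B. p B y = y)) \<and>
     (\<forall>y\<in>carrier A. \<exists>F. finite F \<and> F \<subseteq> Fam \<and> y = finsum A (\<lambda>B. p B y) F)"
  proof (rule dsum_projections[OF A])
    show "submodule B R A" if "B \<in> Fam" for B using Fam that by blast
    show "\<forall>B\<in>F. x B = \<zero>\<^bsub>A\<^esub>" if "finite F" "F \<subseteq> Fam" "\<forall>B\<in>F. x B \<in> B" "finsum A x F = \<zero>\<^bsub>A\<^esub>" for F x
      using ind that by blast
    show "\<exists>F x. finite F \<and> F \<subseteq> Fam \<and> (\<forall>B\<in>F. x B \<in> B) \<and> y = finsum A x F" if "y \<in> carrier A" for y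
      using gn that by blast
  qed
  then obtain p where p: "\<And>B. B \<in> Fam \<Longrightarrow> is_linear R A A (p B)" "\<And>B y. B \<in> Fam \<Longrightarrow> y \<in> carrier A \<Longrightarrow> p B y \<in> B"
      "\<And>B y. B \<in> Fam \<Longrightarrow> y \<in> B \<Longrightarrow> p B y = y"
    and psum: "\<And>y. y \<in> carrier A \<Longrightarrow> \<exists>F. finite F \<and> F \<subseteq> Fam \<and> y = finsum A (\<lambda>B. p B y) F"
    by (elim exE conjE) (rule that, blast+)
  interpret A: module R A by fact
  interpret M1: module R M1 by (rule M1)
  interpret K: module R K by (rule K)
  let ?D1 = "dsum_copies M1" and ?W2 = "dsum_copies M2"
  let ?W1 = "dsum2 K ?D1"
  have D1: "module R ?D1" by (rule module_dsum_copies[OF M1(1)])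
  have W1: "module R ?W1" by (rule module_dsum2[OF K(1) D1])
  have W2: "module R ?W2" by (rule module_dsum_copies[OF M2(1)])
  interpret W1: module R ?W1 by (rule W1)
  interpret D1: module R ?D1 by (rule D1)
  have div1: "divisible R S1 ?W1" by (rule divisible_dsum2[OF K(1) D1 K(2) divisible_dsum_copies[OF M1(1,2) S1(1)] S1(1)])
  have div2: "divisible R S2 ?W2" by (rule divisible_dsum_copies[OF M2(1,2) S2(1)])
  have tf1: "tfree R ?W1" by (rule tfree_dsum2[OF K(3) tfree_dsum_copies[OF M1(3)]])
  have tf2: "tfree R ?W2" by (rule tfree_dsum_copies[OF M2(3)])
  note p1' = loc_mapD[OF p1] and p2' = loc_mapD[OF p2]
  have BA: "submodule B R A" "fin_gen R (A\<lparr>carrier := B\<rparr>)" if "B \<in> Fam" for B using Fam that by blast+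
  have idem: "p B (p B y) = p B y" if "B \<in> Fam" "y \<in> carrier A" for B y using p(3)[OF that(1) p(2)[OF that]] .
  have img: "p B ` carrier A = B" if B: "B \<in> Fam" for B
  proof (intro subset_antisym subsetI)
    fix x assume x: "x \<in> B"
    then have "x \<in> carrier A" by (rule submodD(1)[OF A BA(1)[OF B]])
    then show "x \<in> p B ` carrier A" using p(3)[OF B x] by (intro image_eqI[of _ _ x]) simp_all
  qed (use p(2)[OF B] in auto)
  have fst_lin: "is_linear R ?W1 K fst" by (rule linI) auto
  have snd_lin: "is_linear R ?W1 ?D1 snd" by (rule linI) auto
  have inK: "is_linear R K ?W1 (\<lambda>x. (x, \<zero>\<^bsub>?D1\<^esub>))"
  proof (rule linI)
    show "(x, \<zero>\<^bsub>?D1\<^esub>) \<in> carrier ?W1" if "x \<in> carrier K" for x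
      using that D1.zero_closed unfolding dsum2_simps(1) by blast
  qed simp_all
  have inD: "is_linear R ?D1 ?W1 (\<lambda>w. (\<zero>\<^bsub>K\<^esub>, w))" by (rule linI) auto
  \<comment> \<open>A finitely generated member has bounded support in the power of M2, so
    truncation acts as the identity on its localisation E. Hence E is a summand of a finite power of
    M2.\<close>
  have rank2: "\<exists>d. has_rk R (A\<lparr>carrier := B\<rparr>) (d * r2)" if B: "B \<in> Fam" for B
  proof -
    obtain e where e: "is_linear R ?W2 ?W2 e" "\<forall>y\<in>carrier A. e (p2 y) = p2 (p B y)" "\<forall>w\<in>carrier ?W2. e (e w) = e w"
      "submodule (e ` carrier ?W2) R ?W2" "loc_map R S2 (A\<lparr>carrier := p B ` carrier A\<rparr>) (?W2\<lparr>carrier := e ` carrier ?W2\<rparr>) p2"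
      using extend_idempotent[OF A W2 S2(1) p2 div2 p(1)[OF B] idem[OF B]] by blast
    let ?E = "?W2\<lparr>carrier := e ` carrier ?W2\<rparr>" and ?B = "A\<lparr>carrier := B\<rparr>"
    note E = submod_module[OF W2 e(4)] and BM = submod_module[OF A BA(1)[OF B]]
    have lm: "loc_map R S2 ?B ?E p2" using e(5) unfolding img[OF B] .
    have sub: "e ` carrier ?W2 \<subseteq> carrier ?W2" using lin_closed[OF e(1)] by blast
    have incl: "is_linear R ?E ?W2 (\<lambda>x. x)" by (rule lin_sub_dom[OF lin_id sub])
    have BsubA: "B \<subseteq> carrier A" using submodD(1)[OF A BA(1)[OF B]] by blast
    obtain n where n: "\<forall>y\<in>carrier ?B. \<forall>j\<ge>n. p2 y j = \<zero>\<^bsub>M2\<^esub>"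
      using fin_gen_bounded[OF BM M2(1) BA(2)[OF B] lin_sub_dom[OF p2'(1) BsubA]] by blast
    \<comment> \<open>Boundedness passes from B to its localisation because the scalar s moving w
      into B acts injectively on M2.\<close>
    have tr: "trunc M2 n w = w" if w: "w \<in> carrier ?E" for w
    proof -
      obtain s u where s: "s \<in> S2" "u \<in> carrier ?B" "s \<odot>\<^bsub>?E\<^esub> w = p2 u" using loc_mapD(3)[OF lm w] by blast
      have sc: "s \<in> carrier R" by (rule mult_setD(1)[OF S2(1) s(1)])
      have wW: "w \<in> carrier ?W2" using w sub by auto
      have "w j = \<zero>\<^bsub>M2\<^esub>" if "j \<ge> n" for j
      proof -
        have "s \<odot>\<^bsub>M2\<^esub> w j = s \<odot>\<^bsub>M2\<^esub> \<zero>\<^bsub>M2\<^esub>"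
          using fun_cong[OF s(3), of j] n s(2) that module.smult_r_null[OF M2(1) sc] by simp
        then show ?thesis by (rule divisibleD(1)[OF M2(2) s(1), rotated -1])
          (use wW abelian_groupE(2)[OF module.axioms(2)[OF M2(1)]] in simp_all)
      qed
      then show ?thesis by (auto simp: trunc_def fun_eq_iff)
    qed
    have "facs n R M2 ?E ?E (\<lambda>x. x)"
    proof (rule facs_cong[OF facs_comp[OF W2 E lin_sub_cod[OF e(1)] incl trunc_facs[OF M2(1), of n]]])
      fix x assume x: "x \<in> carrier ?E"
      then have "e x = x" using e(3) by auto
      then show "x = e (trunc M2 n x)" using tr[OF x] by simp
    qed simp
    then obtain d where "has_rk R ?E (d * r2)" using summand_rk[OF M2(1,4,5) E] by blast
    then have "has_rk R ?B (d * r2)"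
      using rk_transfer[OF BM E S2 lm _ tfree_inj[OF E W2 incl _ tf2]] by simp
    then show ?thesis ..
  qed
  \<comment> \<open>The same argument on the other side, where the first component contributes one
    more factor, through \<open>K\<close>. The aim is to remove it, so that each projection factors
    through powers of M1 alone.\<close>
  have key: "\<exists>e k. is_linear R ?W1 ?W1 e \<and> (\<forall>y\<in>carrier A. e (p1 y) = p1 (p B y)) \<and> facs k R M1 ?W1 ?W1 e" if B: "B \<in> Fam" for B
  proof -
    obtain e where e: "is_linear R ?W1 ?W1 e" "\<forall>y\<in>carrier A. e (p1 y) = p1 (p B y)" "\<forall>w\<in>carrier ?W1. e (e w) = e w"
      "submodule (e ` carrier ?W1) R ?W1" "loc_map R S1 (A\<lparr>carrier := p B ` carrier A\<rparr>) (?W1\<lparr>carrier := e ` carrier ?W1\<rparr>) p1"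
      using extend_idempotent[OF A W1 S1(1) p1 div1 p(1)[OF B] idem[OF B]] by blast
    let ?E = "?W1\<lparr>carrier := e ` carrier ?W1\<rparr>" and ?B = "A\<lparr>carrier := B\<rparr>"
    note E = submod_module[OF W1 e(4)] and BM = submod_module[OF A BA(1)[OF B]]
    have lm: "loc_map R S1 ?B ?E p1" using e(5) unfolding img[OF B] .
    have sub: "e ` carrier ?W1 \<subseteq> carrier ?W1" using lin_closed[OF e(1)] by blast
    have incl: "is_linear R ?E ?W1 (\<lambda>x. x)" by (rule lin_sub_dom[OF lin_id sub])
    have eE: "is_linear R ?W1 ?E e" by (rule lin_sub_cod[OF e(1)]) simp
    have BsubA: "B \<subseteq> carrier A" using submodD(1)[OF A BA(1)[OF B]] by blast
    have "is_linear R ?B ?D1 (\<lambda>y. snd (p1 y))"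
      by (rule lin_comp[OF lin_sub_dom[OF p1'(1) BsubA] snd_lin])
    then obtain n where n: "\<forall>y\<in>carrier ?B. \<forall>j\<ge>n. snd (p1 y) j = \<zero>\<^bsub>M1\<^esub>"
      using fin_gen_bounded[OF BM M1(1) BA(2)[OF B]] by blast
    have tr: "trunc M1 n (snd w) = snd w" if w: "w \<in> carrier ?E" for w
    proof -
      obtain s u where s: "s \<in> S1" "u \<in> carrier ?B" "s \<odot>\<^bsub>?E\<^esub> w = p1 u" using loc_mapD(3)[OF lm w] by blast
      have sc: "s \<in> carrier R" by (rule mult_setD(1)[OF S1(1) s(1)])
      have wW: "snd w \<in> carrier ?D1" using w sub by auto
      have su: "(\<lambda>i. s \<odot>\<^bsub>M1\<^esub> snd w i) = snd (p1 u)" using arg_cong[OF s(3), of snd] by simp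
      have "snd w j = \<zero>\<^bsub>M1\<^esub>" if "j \<ge> n" for j
      proof -
        have "s \<odot>\<^bsub>M1\<^esub> snd w j = s \<odot>\<^bsub>M1\<^esub> \<zero>\<^bsub>M1\<^esub>"
          using fun_cong[OF su, of j] n s(2) that sc by simp
        then show ?thesis by (rule divisibleD(1)[OF M1(2) s(1), rotated -1]) (use wW in simp_all)
      qed
      then show ?thesis by (auto simp: trunc_def fun_eq_iff)
    qed
    let ?g = "\<lambda>w. e (\<zero>\<^bsub>K\<^esub>, trunc M1 n (snd w))" and ?u = "\<lambda>x. e (x, \<zero>\<^bsub>?D1\<^esub>)" and ?v = "fst"
    have g: "facs n R M1 ?E ?E ?g"
      by (rule facs_comp[OF D1 E lin_comp[OF inD eE] lin_comp[OF incl snd_lin] trunc_facs[OF M1(1), of n]])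
    have v: "is_linear R ?E K ?v" by (rule lin_comp[OF incl fst_lin])
    have u: "is_linear R K ?E ?u" by (rule lin_comp[OF inK eE])
    \<comment> \<open>The first component of w passes through \<open>K\<close>, the second through a
      finite truncation.\<close>
    have id: "w = ?g w \<oplus>\<^bsub>?E\<^esub> ?u (?v w)" if w: "w \<in> carrier ?E" for w
    proof -
      have wW: "fst w \<in> carrier K" "snd w \<in> carrier ?D1" using w sub by auto
      have ew: "e w = w" using w e(3) by auto
      have "?g w \<oplus>\<^bsub>?E\<^esub> ?u (?v w) = e (\<zero>\<^bsub>K\<^esub>, snd w) \<oplus>\<^bsub>?W1\<^esub> e (fst w, \<zero>\<^bsub>?D1\<^esub>)"
        unfolding tr[OF w] by simp
      also have "\<dots> = e ((\<zero>\<^bsub>K\<^esub>, snd w) \<oplus>\<^bsub>?W1\<^esub> (fst w, \<zero>\<^bsub>?D1\<^esub>))"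
        by (rule lin_add[OF e(1) lin_closed[OF inD wW(2)] lin_closed[OF inK wW(1)], symmetric])
      also have "(\<zero>\<^bsub>K\<^esub>, snd w) \<oplus>\<^bsub>?W1\<^esub> (fst w, \<zero>\<^bsub>?D1\<^esub>) = w"
        using wW(1) D1.r_zero[OF wW(2)] by (simp add: prod_eq_iff del: dsum_copies_simps)
      finally show ?thesis using ew by simp
    qed
    have pe: "facs n R M1 ?E ?E (\<lambda>x. x) \<or> (\<exists>C. submodule C R ?E \<and> facs n R M1 (?E\<lparr>carrier := C\<rparr>) (?E\<lparr>carrier := C\<rparr>) (\<lambda>x. x) \<and>
     (\<forall>n r. has_rk R (?E\<lparr>carrier := C\<rparr>) n \<longrightarrow> has_rk R K r \<longrightarrow> has_rk R ?E (n + r)))"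
      by (rule peel[OF E M1(1) K(1,4) g v u id])
    have "facs n R M1 ?E ?E (\<lambda>x. x)"
    proof (rule ccontr)
      assume "\<not> facs n R M1 ?E ?E (\<lambda>x. x)"
      with pe obtain C where C: "submodule C R ?E" "facs n R M1 (?E\<lparr>carrier := C\<rparr>) (?E\<lparr>carrier := C\<rparr>) (\<lambda>x. x)"
        "\<forall>n r. has_rk R (?E\<lparr>carrier := C\<rparr>) n \<longrightarrow> has_rk R K r \<longrightarrow> has_rk R ?E (n + r)" by blast
      obtain a where "has_rk R (?E\<lparr>carrier := C\<rparr>) (a * r1)"
        using summand_rk[OF M1(1,4,5) submod_module[OF E C(1)] C(2)] by blast
      then have "has_rk R ?E (a * r1 + 1)" using C(3) K(5) by blast
      then have "has_rk R ?B (a * r1 + 1)"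
        using rk_transfer[OF BM E S1 lm _ tfree_inj[OF E W1 incl _ tf1]] by simp
      moreover obtain d where "has_rk R ?B (d * r2)" using rank2[OF B] by blast
      ultimately have "a * r1 + 1 = d * r2" by (rule rk_unique[OF BM])
      \<comment> \<open>The gcd divides both a r1 and d r2, hence their difference 1; so splitting
        off a copy of \<open>K\<close> contradicts the failure of coprimality.\<close>
      then have "gcd r1 r2 dvd 1"
        by (metis dvd_add_right_iff dvd_mult gcd_dvd1 gcd_dvd2)
      then show False using cop by (simp add: coprime_iff_gcd_eq_1)
    qed
    then have "facs n R M1 ?W1 ?W1 (\<lambda>w. e w)"
      by (rule facs_comp[OF E W1 incl eE])
    then show ?thesis using e(1,2) by blast
  qed
  obtain e where e: "\<And>B. B \<in> Fam \<Longrightarrow> is_linear R ?W1 ?W1 (e B)" 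
     "\<And>B y. B \<in> Fam \<Longrightarrow> y \<in> carrier A \<Longrightarrow> e B (p1 y) = p1 (p B y)" 
     "\<And>B. B \<in> Fam \<Longrightarrow> \<exists>k. facs k R M1 ?W1 ?W1 (e B)"
    using bchoice[of Fam "\<lambda>B e. \<exists>k. is_linear R ?W1 ?W1 e \<and> (\<forall>y\<in>carrier A. e (p1 y) = p1 (p B y)) \<and> facs k R M1 ?W1 ?W1 e"]
      key by metis
  have e0W: "(e0, \<zero>\<^bsub>?D1\<^esub>) \<in> carrier ?W1" by (rule lin_closed[OF inK gen(1)])
  \<comment> \<open>Some multiple of e0 comes from an element y of \<open>A\<close>, and y has
    components in only finitely many members.\<close>
  obtain s y where s: "s \<in> S1" "y \<in> carrier A" "s \<odot>\<^bsub>?W1\<^esub> (e0, \<zero>\<^bsub>?D1\<^esub>) = p1 y" using p1'(3)[OF e0W] by blast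
  have sc: "s \<in> carrier R" by (rule mult_setD(1)[OF S1(1) s(1)])
  obtain F where F: "finite F" "F \<subseteq> Fam" "y = finsum A (\<lambda>B. p B y) F" using psum[OF s(2)] by blast
  \<comment> \<open>The sum of the extended projections to these members factors through a power of
    M1 and fixes the image of y.\<close>
  define h where "h = (\<lambda>w. finsum ?W1 (\<lambda>B. e B w) F)"
  have hf: "\<exists>k. facs k R M1 ?W1 ?W1 h" unfolding h_def
    by (rule facs_finsum[OF W1 F(1)]) (use e(3) F(2) in blast)
  have ec: "e B w \<in> carrier ?W1" if "B \<in> F" "w \<in> carrier ?W1" for B w
    using lin_closed[OF e(1) that(2)] that(1) F(2) by blast
  have h_smult: "h (a \<odot>\<^bsub>?W1\<^esub> w) = a \<odot>\<^bsub>?W1\<^esub> h w" if "a \<in> carrier R" "w \<in> carrier ?W1" for a w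
  proof -
    have "h (a \<odot>\<^bsub>?W1\<^esub> w) = finsum ?W1 (\<lambda>B. a \<odot>\<^bsub>?W1\<^esub> e B w) F" unfolding h_def
    proof (rule W1.finsum_cong'[OF refl])
      show "(\<lambda>B. a \<odot>\<^bsub>?W1\<^esub> e B w) \<in> F \<rightarrow> carrier ?W1" using ec[OF _ that(2)] that(1) W1.smult_closed by blast
      show "e B (a \<odot>\<^bsub>?W1\<^esub> w) = a \<odot>\<^bsub>?W1\<^esub> e B w" if "B \<in> F" for B
        using lin_smult[OF e(1) \<open>a \<in> carrier R\<close> \<open>w \<in> carrier ?W1\<close>] that F(2) by blast
    qed
    also have "\<dots> = a \<odot>\<^bsub>?W1\<^esub> h w" unfolding h_def
      by (rule W1.finsum_smult_ldistr[OF F(1) that(1), symmetric]) (use ec[OF _ that(2)] in blast)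
    finally show ?thesis .
  qed
  have hp: "h (p1 y) = p1 y"
  proof -
    have pc: "(\<lambda>B. p B y) \<in> F \<rightarrow> carrier A" using lin_closed[OF p(1) s(2)] F(2) by blast
    have "h (p1 y) = finsum ?W1 (\<lambda>B. p1 (p B y)) F" unfolding h_def
    proof (rule W1.finsum_cong'[OF refl])
      show "(\<lambda>B. p1 (p B y)) \<in> F \<rightarrow> carrier ?W1" using lin_closed[OF p1'(1)] pc by blast
      show "e B (p1 y) = p1 (p B y)" if "B \<in> F" for B using e(2)[OF _ s(2)] that F(2) by blast
    qed
    also have "\<dots> = p1 (finsum A (\<lambda>B. p B y) F)" by (rule lin_finsum[OF A W1 p1'(1) F(1) pc, symmetric])
    finally show ?thesis using F(3) by simp
  qed
  have hc: "h w \<in> carrier ?W1" if "w \<in> carrier ?W1" for w using hf facs_closed[OF W1 _ that] by blast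
  \<comment> \<open>The image of y is s times e0, and s acts injectively.\<close>
  have he0: "h (e0, \<zero>\<^bsub>?D1\<^esub>) = (e0, \<zero>\<^bsub>?D1\<^esub>)"
  proof (rule divisibleD(1)[OF div1 s(1) hc[OF e0W] e0W])
    show "s \<odot>\<^bsub>?W1\<^esub> h (e0, \<zero>\<^bsub>?D1\<^esub>) = s \<odot>\<^bsub>?W1\<^esub> (e0, \<zero>\<^bsub>?D1\<^esub>)"
      unfolding h_smult[OF sc e0W, symmetric] s(3) hp ..
  qed
  \<comment> \<open>Every element of \<open>K\<close> is a fraction of e0, so the composite K -> W1
    -> W1 -> K through h is the identity and \<open>K\<close> becomes a summand of a power of
    M1.\<close>
  have hK: "x = fst (h (x, \<zero>\<^bsub>?D1\<^esub>))" if x: "x \<in> carrier K" for x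
  proof -
    have xW: "(x, \<zero>\<^bsub>?D1\<^esub>) \<in> carrier ?W1" by (rule lin_closed[OF inK x])
    obtain t a where t: "t \<in> S1" "a \<in> carrier R" "t \<odot>\<^bsub>K\<^esub> x = a \<odot>\<^bsub>K\<^esub> e0" using gen(2)[OF x] by blast
    have tc: "t \<in> carrier R" by (rule mult_setD(1)[OF S1(1) t(1)])
    have "t \<odot>\<^bsub>?W1\<^esub> (x, \<zero>\<^bsub>?D1\<^esub>) = a \<odot>\<^bsub>?W1\<^esub> (e0, \<zero>\<^bsub>?D1\<^esub>)"
      unfolding lin_smult[OF inK tc x, symmetric] lin_smult[OF inK t(2) gen(1), symmetric] t(3) ..
    then have "t \<odot>\<^bsub>?W1\<^esub> h (x, \<zero>\<^bsub>?D1\<^esub>) = a \<odot>\<^bsub>?W1\<^esub> (e0, \<zero>\<^bsub>?D1\<^esub>)"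
      using h_smult[OF tc xW] h_smult[OF t(2) e0W] he0 by simp
    then have "t \<odot>\<^bsub>K\<^esub> x = t \<odot>\<^bsub>K\<^esub> fst (h (x, \<zero>\<^bsub>?D1\<^esub>))" using t(3) by (simp add: prod_eq_iff)
    then show ?thesis by (rule divisibleD(1)[OF K(2) t(1) x lin_closed[OF fst_lin hc[OF xW]]])
  qed
  obtain k where "facs k R M1 ?W1 ?W1 h" using hf by blast
  from facs_comp[OF W1 K(1) fst_lin inK this]
  have "facs k R M1 K K (\<lambda>x. fst (h (x, \<zero>\<^bsub>?D1\<^esub>)))" .
  then have "facs k R M1 K K (\<lambda>x. x)" by (rule facs_cong) (rule hK)
  then obtain d where "has_rk R K (d * r1)" using summand_rk[OF M1(1,4,5) K(1)] by blast
  \<comment> \<open>Rank one leaves only r1 = 1, which is coprime to every number.\<close>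
  then have "d * r1 = 1" using rk_unique[OF K(1) _ K(5)] by blast
  then show False using cop by simp
qed

section \<open>h-local domains\<close>

text \<open>Zorn's lemma for ideals avoiding T. With T = {1} it produces maximal ideals, with T
  multiplicatively closed it produces primes.\<close>

lemma (in cring) exists_maximal_disjoint:
  assumes "ideal I R" "I \<inter> T = {}"
  shows "\<exists>P. ideal P R \<and> I \<subseteq> P \<and> P \<inter> T = {} \<and> (\<forall>J. ideal J R \<longrightarrow> P \<subseteq> J \<longrightarrow> J \<inter> T = {} \<longrightarrow> J = P)"
proof -
  let ?F = "{J. ideal J R \<and> I \<subseteq> J \<and> J \<inter> T = {}}"
  have "\<exists>P\<in>?F. \<forall>J\<in>?F. P \<subseteq> J \<longrightarrow> J = P"
  proof (rule subset_Zorn_nonempty)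
    show "?F \<noteq> {}" using assms by blast
    fix C assume C: "C \<noteq> {}" "subset.chain ?F C"
    then have "subset.chain {J. ideal J R} C" unfolding pred_on.chain_def by blast
    then have "ideal (\<Union>C) R" using chain_Union_is_ideal[of C] C(1) by simp
    moreover have "I \<subseteq> \<Union>C" using C unfolding pred_on.chain_def by blast
    moreover have "\<Union>C \<inter> T = {}" using C unfolding pred_on.chain_def by blast
    ultimately show "\<Union>C \<in> ?F" by blast
  qed
  then obtain P where P: "P \<in> ?F" and max: "\<forall>J\<in>?F. P \<subseteq> J \<longrightarrow> J = P" by (rule bexE)
  show ?thesis
  proof (intro exI[of _ P] conjI allI impI)
    fix J assume J: "ideal J R" "P \<subseteq> J" "J \<inter> T = {}"
    have "I \<subseteq> J" using P J(2) by auto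
    then have "J \<in> ?F" using J(1,3) by simp
    then show "J = P" using max J(2) by simp
  qed (use P in simp_all)
qed

lemma (in cring) exists_maximalideal:
  assumes "ideal I R" "\<one> \<notin> I"
  shows "\<exists>m. maximalideal m R \<and> I \<subseteq> m"
proof -
  obtain P where P: "ideal P R" "I \<subseteq> P" "P \<inter> {\<one>} = {}" "\<forall>J. ideal J R \<longrightarrow> P \<subseteq> J \<longrightarrow> J \<inter> {\<one>} = {} \<longrightarrow> J = P"
    using exists_maximal_disjoint[OF assms(1), of "{\<one>}"] assms(2) by blast
  have "maximalideal P R"
  proof (rule maximalidealI[OF P(1)])
    show "carrier R \<noteq> P" using P(3) one_closed by blast
    fix J assume J: "ideal J R" "P \<subseteq> J" "J \<subseteq> carrier R"
    show "J = P \<or> J = carrier R"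
    proof (cases "\<one> \<in> J")
      case True
      then show ?thesis using ideal.one_imp_carrier[OF J(1)] by blast
    next
      case False
      then show ?thesis using P(4) J by blast
    qed
  qed
  then show ?thesis using P(2) by blast
qed

text \<open>An ideal maximal among those disjoint from a multiplicative set is prime.\<close>

lemma (in cring) exists_primeideal_disjoint:
  assumes "ideal I R" "I \<inter> T = {}" and T: "mult_set R T"
  shows "\<exists>P. primeideal P R \<and> I \<subseteq> P \<and> P \<inter> T = {}"
proof -
  obtain P where P: "ideal P R" "I \<subseteq> P" "P \<inter> T = {}" "\<And>J. ideal J R \<Longrightarrow> P \<subseteq> J \<Longrightarrow> J \<inter> T = {} \<Longrightarrow> J = P"
    using exists_maximal_disjoint[OF assms(1,2)] by blast
  interpret P: ideal P R by (rule P(1))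
  have "primeideal P R"
  proof (rule primeidealI[OF P(1) is_cring])
    show "carrier R \<noteq> P" using P(3) mult_setD(2)[OF T] one_closed by blast
    \<comment> \<open>Otherwise the strictly larger ideal P + (a) would still avoid T.\<close>
    have ex: "\<exists>q\<in>P. \<exists>r\<in>carrier R. q \<oplus> r \<otimes> a \<in> T" if a: "a \<in> carrier R" "a \<notin> P" for a
    proof (rule ccontr)
      assume no: "\<not> ?thesis"
      let ?J = "P <+>\<^bsub>R\<^esub> PIdl a"
      have J: "ideal ?J R" by (rule add_ideals[OF P(1) cgenideal_ideal[OF a(1)]])
      have mem: "x \<in> ?J \<longleftrightarrow> (\<exists>q\<in>P. \<exists>r\<in>carrier R. x = q \<oplus> r \<otimes> a)" for x
        unfolding set_add_def set_mult_def cgenideal_def by auto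
      have "P \<subseteq> ?J"
      proof
        fix q assume q: "q \<in> P"
        then have "q = q \<oplus> \<zero> \<otimes> a" using a P.Icarr by simp
        then show "q \<in> ?J" unfolding mem using q zero_closed by blast
      qed
      moreover have "?J \<inter> T = {}"
      proof (rule equals0I)
        fix x assume x: "x \<in> ?J \<inter> T"
        then have "x \<in> ?J" by simp
        then obtain q r where "q \<in> P" "r \<in> carrier R" "x = q \<oplus> r \<otimes> a" unfolding mem by blast
        then show False using no x by blast
      qed
      ultimately have "?J = P" by (rule P(4)[OF J])
      moreover have "a = \<zero> \<oplus> \<one> \<otimes> a" using a by simp
      then have "a \<in> ?J" unfolding mem using P.zero_closed one_closed by blast
      ultimately show False using a by simp
    qed
    fix a b assume ab: "a \<in> carrier R" "b \<in> carrier R" "a \<otimes> b \<in> P"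
    show "a \<in> P \<or> b \<in> P"
    proof (rule ccontr)
      assume "\<not> (a \<in> P \<or> b \<in> P)"
      then obtain q r q' r' where q: "q \<in> P" "r \<in> carrier R" "q \<oplus> r \<otimes> a \<in> T" and q': "q' \<in> P" "r' \<in> carrier R" "q' \<oplus> r' \<otimes> b \<in> T"
        using ex[OF ab(1)] ex[OF ab(2)] by blast
      have c: "q \<in> carrier R" "q' \<in> carrier R" using q q' P.Icarr by blast+
      \<comment> \<open>After expansion each term contains q, q' or a b, so a product of two
        elements of T would lie in P.\<close>
      have "(q \<oplus> r \<otimes> a) \<otimes> (q' \<oplus> r' \<otimes> b) = q \<otimes> (q' \<oplus> r' \<otimes> b) \<oplus> (r \<otimes> a \<otimes> q' \<oplus> r \<otimes> r' \<otimes> (a \<otimes> b))"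
        using c q(2) q'(2) ab(1,2) by (simp add: l_distr r_distr m_ac)
      also have "\<dots> \<in> P"
      proof (intro P.a_closed)
        show "q \<otimes> (q' \<oplus> r' \<otimes> b) \<in> P" using P.I_r_closed[OF q(1)] c q'(2) ab by simp
        show "r \<otimes> a \<otimes> q' \<in> P" using P.I_l_closed[OF q'(1)] q(2) ab by simp
        show "r \<otimes> r' \<otimes> (a \<otimes> b) \<in> P" using P.I_l_closed[OF ab(3)] q(2) q'(2) by simp
      qed
      finally show False using P(3) mult_setD(3)[OF T q(3) q'(3)] by blast
    qed
  qed
  then show ?thesis using P(2,3) by blast
qed

lemma (in cring) mult_set_compl:
  assumes "maximalideal m R"
  shows "mult_set R (carrier R - m)" "\<zero> \<notin> carrier R - m"
proof -
  interpret m: primeideal m R by (rule maximalideal_prime[OF assms])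
  have "\<one> \<notin> m" using m.one_imp_carrier m.I_notcarr by blast
  then show "mult_set R (carrier R - m)" unfolding mult_set_def using m.I_prime by auto
  show "\<zero> \<notin> carrier R - m" by simp
qed

text \<open>If no product s t is a multiple of d, then (d) avoids the multiplicative set of all such
  products, and a prime above (d) avoiding it lies in both m and n, against h-locality. Read as t =
  d (r/s), the conclusion says that t lies in d R_m and not in n.\<close>

lemma (in domain) h_local_comaximal:
  assumes h: "h_local R" and m: "maximalideal m R" and n: "maximalideal n R" and "m \<noteq> n"
    and d: "d \<in> carrier R" "d \<noteq> \<zero>"
  shows "\<exists>s\<in>carrier R - m. \<exists>t\<in>carrier R - n. \<exists>r\<in>carrier R. s \<otimes> t = r \<otimes> d"
proof (rule ccontr)
  assume no: "\<not> ?thesis"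
  let ?S = "carrier R - m" and ?T = "carrier R - n"
  define Q where "Q = {s \<otimes> t | s t. s \<in> ?S \<and> t \<in> ?T}"
  note S = mult_setD[OF mult_set_compl(1)[OF m]] and T = mult_setD[OF mult_set_compl(1)[OF n]]
  have memQ: "s \<otimes> t \<in> Q" if "s \<in> ?S" "t \<in> ?T" for s t using that unfolding Q_def by blast
  have "mult_set R Q" unfolding mult_set_def
  proof (intro conjI ballI)
    show "Q \<subseteq> carrier R" by (auto simp: Q_def)
    show "\<one> \<in> Q" using memQ[OF S(2) T(2)] by simp
    fix x y assume "x \<in> Q" "y \<in> Q"
    then obtain s t s' t' where *: "s \<in> ?S" "t \<in> ?T" "x = s \<otimes> t" "s' \<in> ?S" "t' \<in> ?T" "y = s' \<otimes> t'"
      unfolding Q_def by blast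
    have "x \<otimes> y = (s \<otimes> s') \<otimes> (t \<otimes> t')" using * by (simp add: m_ac)
    also have "\<dots> \<in> Q" by (rule memQ[OF S(3)[OF *(1,4)] T(3)[OF *(2,5)]])
    finally show "x \<otimes> y \<in> Q" .
  qed
  moreover have "PIdl d \<inter> Q = {}"
  proof (rule ccontr)
    assume "PIdl d \<inter> Q \<noteq> {}"
    then obtain x where x: "x \<in> PIdl d" "x \<in> Q" by blast
    obtain s t where st: "s \<in> ?S" "t \<in> ?T" "x = s \<otimes> t" using x(2) unfolding Q_def by blast
    obtain r where r: "r \<in> carrier R" "x = r \<otimes> d" using x(1) unfolding cgenideal_def by blast
    have "s \<otimes> t = r \<otimes> d" using st(3) r(2) by simp
    then have "\<exists>s\<in>?S. \<exists>t\<in>?T. \<exists>r\<in>carrier R. s \<otimes> t = r \<otimes> d"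
      using st(1,2) r(1) by (intro bexI)
    then show False using no by (rule notE[rotated])
  qed
  ultimately obtain P where P: "primeideal P R" "PIdl d \<subseteq> P" "P \<inter> Q = {}"
    using exists_primeideal_disjoint[OF cgenideal_ideal[OF d(1)]] by blast
  have dP: "d \<in> P" using P(2) cgenideal_self[OF d(1)] by blast
  have PR: "P \<subseteq> carrier R" using ideal.Icarr[OF primeideal.axioms(1)[OF P(1)]] by blast
  have "P \<subseteq> m"
  proof
    fix x assume x: "x \<in> P"
    show "x \<in> m"
    proof (rule ccontr)
      assume "x \<notin> m"
      then have "x \<otimes> \<one> \<in> Q" using x PR by (intro memQ T(2)) auto
      moreover have "x \<otimes> \<one> = x" using x PR by auto
      ultimately show False using x P(3) by auto
    qed
  qed
  moreover have "P \<subseteq> n"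
  proof
    fix x assume x: "x \<in> P"
    show "x \<in> n"
    proof (rule ccontr)
      assume "x \<notin> n"
      then have "\<one> \<otimes> x \<in> Q" using x PR by (intro memQ S(2)) auto
      moreover have "\<one> \<otimes> x = x" using x PR by auto
      ultimately show False using x P(3) by auto
    qed
  qed
  moreover have "P \<noteq> {\<zero>}" using dP d(2) by blast
  then have "\<exists>!m. maximalideal m R \<and> P \<subseteq> m" using h P(1) unfolding h_local_def by blast
  ultimately show False using m n \<open>m \<noteq> n\<close> by blast
qed

text \<open>The scalars that move x into H form an ideal contained in no maximal ideal, so 1 is
  among them.\<close>

lemma mem_if_locally_mem:
  assumes L: "module R L" and H: "submodule H R L" and x: "x \<in> carrier L"
    and loc: "\<And>m. maximalideal m R \<Longrightarrow> \<exists>s\<in>carrier R - m. s \<odot>\<^bsub>L\<^esub> x \<in> H"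
  shows "x \<in> H"
proof -
  interpret L: module R L by fact
  note H = submodD[OF L H]
  let ?I = "{a \<in> carrier R. a \<odot>\<^bsub>L\<^esub> x \<in> H}"
  have "ideal ?I R"
  proof (rule idealI[OF L.R.ring_axioms])
    show "subgroup ?I (add_monoid R)"
    proof
      show "?I \<subseteq> carrier (add_monoid R)" by auto
      show "\<one>\<^bsub>add_monoid R\<^esub> \<in> ?I" using x H(2) by simp
      show "a \<otimes>\<^bsub>add_monoid R\<^esub> b \<in> ?I" if "a \<in> ?I" "b \<in> ?I" for a b
        using that x H(3)[of "a \<odot>\<^bsub>L\<^esub> x" "b \<odot>\<^bsub>L\<^esub> x"] by (simp add: L.smult_l_distr)
      show "inv\<^bsub>add_monoid R\<^esub> a \<in> ?I" if "a \<in> ?I" for a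
      proof -
        have a: "a \<in> carrier R" "a \<odot>\<^bsub>L\<^esub> x \<in> H" using that by auto
        have "\<ominus>\<^bsub>R\<^esub> a \<odot>\<^bsub>L\<^esub> x = (\<ominus>\<^bsub>R\<^esub> \<one>\<^bsub>R\<^esub>) \<odot>\<^bsub>L\<^esub> (a \<odot>\<^bsub>L\<^esub> x)"
          using a x by (simp add: L.neg_smult[symmetric] L.smult_l_minus)
        also have "\<dots> \<in> H" by (rule H(4)[OF _ a(2)]) simp
        finally show ?thesis using a by (simp add: a_inv_def[symmetric])
      qed
    qed
    show "b \<otimes>\<^bsub>R\<^esub> a \<in> ?I" "a \<otimes>\<^bsub>R\<^esub> b \<in> ?I" if "a \<in> ?I" "b \<in> carrier R" for a b
    proof -
      have a: "a \<in> carrier R" "a \<odot>\<^bsub>L\<^esub> x \<in> H" using that by auto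
      have "(b \<otimes>\<^bsub>R\<^esub> a) \<odot>\<^bsub>L\<^esub> x \<in> H" using L.smult_assoc1[OF that(2) a(1) x] H(4)[OF that(2) a(2)] by simp
      then show "b \<otimes>\<^bsub>R\<^esub> a \<in> ?I" "a \<otimes>\<^bsub>R\<^esub> b \<in> ?I" using a(1) that(2) L.m_comm[OF a(1) that(2)] by simp_all
    qed
  qed
  moreover have "\<not> ?I \<subseteq> m" if "maximalideal m R" for m using loc[OF that] by blast
  ultimately have "\<one>\<^bsub>R\<^esub> \<in> ?I" using L.exists_maximalideal by blast
  then show ?thesis using x by simp
qed

section \<open>Saturations along dense embeddings\<close>

lemma loc_map_trans:
  assumes V: "module R V" and W: "module R W" and S: "mult_set R S" and f: "loc_map R S U V f" and g: "loc_map R S V W g"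
  shows "loc_map R S U W (\<lambda>x. g (f x))"
  unfolding loc_map_def
proof (intro conjI ballI)
  interpret W: module R W by fact
  note f = loc_mapD[OF f] and g = loc_mapD[OF g]
  show "is_linear R U W (\<lambda>x. g (f x))" by (rule lin_comp[OF f(1) g(1)])
  show "inj_on (\<lambda>x. g (f x)) (carrier U)"
  proof (rule inj_onI)
    fix x y assume xy: "x \<in> carrier U" "y \<in> carrier U" "g (f x) = g (f y)"
    have "f x = f y" by (rule inj_onD[OF g(2) xy(3) lin_closed[OF f(1) xy(1)] lin_closed[OF f(1) xy(2)]])
    then show "x = y" by (rule inj_onD[OF f(2) _ xy(1,2)])
  qed
  fix w assume w: "w \<in> carrier W"
  obtain s v where s: "s \<in> S" "v \<in> carrier V" "s \<odot>\<^bsub>W\<^esub> w = g v" using g(3)[OF w] by blast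
  obtain t u where t: "t \<in> S" "u \<in> carrier U" "t \<odot>\<^bsub>V\<^esub> v = f u" using f(3)[OF s(2)] by blast
  note sc = mult_setD(1)[OF S s(1)] and tc = mult_setD(1)[OF S t(1)]
  have "(t \<otimes>\<^bsub>R\<^esub> s) \<odot>\<^bsub>W\<^esub> w = g (f u)"
    unfolding W.smult_assoc1[OF tc sc w] s(3) lin_smult[OF g(1) tc s(2), symmetric] t(3) ..
  then show "\<exists>s\<in>S. \<exists>u\<in>carrier U. s \<odot>\<^bsub>W\<^esub> w = g (f u)" using mult_setD(3)[OF S t(1) s(1)] t(2) by blast
qed

lemma loc_map_bij:
  assumes W: "module R W" and S: "mult_set R S" and f: "is_linear R U W f" "bij_betw f (carrier U) (carrier W)"
  shows "loc_map R S U W f"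
  unfolding loc_map_def
proof (intro conjI ballI f(1) bij_betw_imp_inj_on[OF f(2)])
  interpret W: module R W by fact
  fix w assume w: "w \<in> carrier W"
  then obtain u where "u \<in> carrier U" "w = f u" using bij_betw_imp_surj_on[OF f(2)] by blast
  then show "\<exists>s\<in>S. \<exists>u\<in>carrier U. s \<odot>\<^bsub>W\<^esub> w = f u"
    using mult_setD(2)[OF S] w by (intro bexI[of _ "\<one>\<^bsub>R\<^esub>"] bexI[of _ u]) simp_all
qed

lemma loc_map_dense_sub:
  assumes V: "module R V" and H: "submodule H R V" and dense: "\<And>v. v \<in> carrier V \<Longrightarrow> \<exists>s\<in>S. s \<odot>\<^bsub>V\<^esub> v \<in> H"
  shows "loc_map R S (V\<lparr>carrier := H\<rparr>) V (\<lambda>x. x)"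
  unfolding loc_map_def
proof (intro conjI ballI)
  have "H \<subseteq> carrier V" using submodD(1)[OF V H] by blast
  then show "is_linear R (V\<lparr>carrier := H\<rparr>) V (\<lambda>x. x)" by (rule lin_sub_dom[OF lin_id])
  show "inj_on (\<lambda>x. x) (carrier (V\<lparr>carrier := H\<rparr>))" by simp
  fix w assume "w \<in> carrier V"
  then show "\<exists>s\<in>S. \<exists>u\<in>carrier (V\<lparr>carrier := H\<rparr>). s \<odot>\<^bsub>V\<^esub> w = u" using dense by auto
qed

text \<open>For a dense embedding \<open>p\<close> into a divisible module this is the localisation
  of H, realised inside \<open>W\<close>.\<close>

definition saturate ::
  "'a set \<Rightarrow> ('a, 'd, 'n) module_scheme \<Rightarrow> ('c \<Rightarrow> 'd) \<Rightarrow> 'c set \<Rightarrow> 'd set"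
  where "saturate S W p H = {w \<in> carrier W. \<exists>s\<in>S. \<exists>h\<in>H. s \<odot>\<^bsub>W\<^esub> w = p h}"

lemma saturate_submodule:
  assumes U: "module R U" and W: "module R W" and S: "mult_set R S" and p: "is_linear R U W p" and H: "submodule H R U"
  shows "submodule (saturate S W p H) R W"
    "\<And>s w. s \<in> S \<Longrightarrow> w \<in> carrier W \<Longrightarrow> s \<odot>\<^bsub>W\<^esub> w \<in> saturate S W p H \<Longrightarrow> w \<in> saturate S W p H"
    "p ` H \<subseteq> saturate S W p H"
proof -
  interpret U: module R U by fact
  interpret W: module R W by fact
  note H = submodD[OF U H] and Sc = mult_setD(1)[OF S]
  show "submodule (saturate S W p H) R W"
  proof (rule submodI[OF W])
    show "saturate S W p H \<subseteq> carrier W" by (auto simp: saturate_def)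
    show "\<zero>\<^bsub>W\<^esub> \<in> saturate S W p H"
      using mult_setD(2)[OF S] H(2) lin_zero[OF U W p] unfolding saturate_def
      by (auto intro!: bexI[of _ "\<one>\<^bsub>R\<^esub>"] bexI[of _ "\<zero>\<^bsub>U\<^esub>"])
  next
    fix a b assume "a \<in> saturate S W p H" "b \<in> saturate S W p H"
    then obtain s h t k where *: "a \<in> carrier W" "s \<in> S" "h \<in> H" "s \<odot>\<^bsub>W\<^esub> a = p h"
      "b \<in> carrier W" "t \<in> S" "k \<in> H" "t \<odot>\<^bsub>W\<^esub> b = p k" unfolding saturate_def by blast
    note c = Sc[OF *(2)] Sc[OF *(6)] H(1)[OF *(3)] H(1)[OF *(7)]
    have "(s \<otimes>\<^bsub>R\<^esub> t) \<odot>\<^bsub>W\<^esub> (a \<oplus>\<^bsub>W\<^esub> b) = t \<odot>\<^bsub>W\<^esub> (s \<odot>\<^bsub>W\<^esub> a) \<oplus>\<^bsub>W\<^esub> s \<odot>\<^bsub>W\<^esub> (t \<odot>\<^bsub>W\<^esub> b)"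
      using * c by (simp add: W.smult_assoc1 W.smult_r_distr W.smult_comm[of s t])
    also have "\<dots> = p (t \<odot>\<^bsub>U\<^esub> h \<oplus>\<^bsub>U\<^esub> s \<odot>\<^bsub>U\<^esub> k)"
      using c by (simp add: *(4,8) lin_smult[OF p] lin_add[OF p])
    finally have eq: "(s \<otimes>\<^bsub>R\<^esub> t) \<odot>\<^bsub>W\<^esub> (a \<oplus>\<^bsub>W\<^esub> b) = p (t \<odot>\<^bsub>U\<^esub> h \<oplus>\<^bsub>U\<^esub> s \<odot>\<^bsub>U\<^esub> k)" .
    have "t \<odot>\<^bsub>U\<^esub> h \<oplus>\<^bsub>U\<^esub> s \<odot>\<^bsub>U\<^esub> k \<in> H" by (intro H(3,4) c *(3,7))
    then show "a \<oplus>\<^bsub>W\<^esub> b \<in> saturate S W p H"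
      using eq mult_setD(3)[OF S *(2,6)] *(1,5) unfolding saturate_def by blast
  next
    fix r a assume r: "r \<in> carrier R" and "a \<in> saturate S W p H"
    then obtain s h where *: "a \<in> carrier W" "s \<in> S" "h \<in> H" "s \<odot>\<^bsub>W\<^esub> a = p h" unfolding saturate_def by blast
    have "s \<odot>\<^bsub>W\<^esub> (r \<odot>\<^bsub>W\<^esub> a) = p (r \<odot>\<^bsub>U\<^esub> h)"
      unfolding W.smult_comm[OF Sc[OF *(2)] r *(1)] *(4) lin_smult[OF p r H(1)[OF *(3)]] ..
    then show "r \<odot>\<^bsub>W\<^esub> a \<in> saturate S W p H"
      using H(4)[OF r *(3)] *(2) W.smult_closed[OF r *(1)] unfolding saturate_def by blast
  qed
  show "w \<in> saturate S W p H" if s: "s \<in> S" and w: "w \<in> carrier W" and sw: "s \<odot>\<^bsub>W\<^esub> w \<in> saturate S W p H" for s w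
  proof -
    obtain t h where t: "t \<in> S" "h \<in> H" "t \<odot>\<^bsub>W\<^esub> (s \<odot>\<^bsub>W\<^esub> w) = p h" using sw unfolding saturate_def by blast
    have "(t \<otimes>\<^bsub>R\<^esub> s) \<odot>\<^bsub>W\<^esub> w = p h" using t(3) W.smult_assoc1[OF Sc[OF t(1)] Sc[OF s] w] by simp
    then show ?thesis using w mult_setD(3)[OF S t(1) s] t(2) unfolding saturate_def by blast
  qed
  show "p ` H \<subseteq> saturate S W p H"
  proof
    fix w assume "w \<in> p ` H"
    then obtain h where h: "h \<in> H" "w = p h" by blast
    then have "\<one>\<^bsub>R\<^esub> \<odot>\<^bsub>W\<^esub> w = p h" "w \<in> carrier W" using lin_closed[OF p H(1)[OF h(1)]] by simp_all
    then show "w \<in> saturate S W p H" using mult_setD(2)[OF S] h(1) unfolding saturate_def by blast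
  qed
qed

section \<open>Lattices with prescribed localisations\<close>

text \<open>The scalar d is chosen so that d \<open>M\<close> lies in the localisation of R^r, and
  the embedding \<open>p\<close> is division by d. The delicate point is finite generation of the
  lattice: \<open>M\<close> is finitely generated only over the localisation, and it is the
  finiteness half of h-locality that reduces the remaining maximal ideals to a finite list.\<close>

lemma (in domain) lattice_exists:
  assumes h: "h_local R" and m: "maximalideal m R"
    and M: "module R M" "divisible R (carrier R - m) M" "tfree R M" "has_rk R M r"
    and fg: "\<exists>G. finite G \<and> G \<subseteq> carrier M \<and> (\<forall>H. submodule H R M \<and> G \<subseteq> H \<and>
     (\<forall>s\<in>carrier R - m. \<forall>x\<in>carrier M. s \<odot>\<^bsub>M\<^esub> x \<in> H \<longrightarrow> x \<in> H) \<longrightarrow> H = carrier M)"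
  shows "\<exists>L p. submodule L R (free_mod R r) \<and> loc_map R (carrier R - m) ((free_mod R r)\<lparr>carrier := L\<rparr>) M p \<and>
     fin_gen R ((free_mod R r)\<lparr>carrier := L\<rparr>) \<and>
     (\<forall>n. maximalideal n R \<and> n \<noteq> m \<longrightarrow> (\<exists>t\<in>carrier R - n. \<forall>x\<in>carrier (free_mod R r). t \<odot>\<^bsub>free_mod R r\<^esub> x \<in> L))"
proof -
  let ?S = "carrier R - m" and ?F = "free_mod R r"
  interpret M: module R M by (rule M)
  note F = module_free[of r]
  interpret F: module R ?F by (rule F)
  note S = mult_set_compl[OF m]
  have Sc: "s \<in> carrier R" if "s \<in> ?S" for s using that by simp
  obtain b where b: "loc_map R (nonzeros R) ?F M b" using M(4) by (auto simp: has_rk_def)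
  note b = loc_mapD[OF b]
  obtain G where G12: "finite G" "G \<subseteq> carrier M" and Gall: "\<forall>H. submodule H R M \<and> G \<subseteq> H \<and>
     (\<forall>s\<in>?S. \<forall>x\<in>carrier M. s \<odot>\<^bsub>M\<^esub> x \<in> H \<longrightarrow> x \<in> H) \<longrightarrow> H = carrier M"
    using fg by (elim exE conjE)
  have G3: "H = carrier M" if "submodule H R M" "G \<subseteq> H"
     "\<And>s x. s \<in> ?S \<Longrightarrow> x \<in> carrier M \<Longrightarrow> s \<odot>\<^bsub>M\<^esub> x \<in> H \<Longrightarrow> x \<in> H" for H
    by (rule Gall[rule_format], intro conjI ballI impI) (rule that; assumption)+
  note G = G12 G3
  have bF: "submodule (b ` carrier ?F) R M" by (rule lin_image_submodule[OF F M(1) b(1) F.carrier_is_submodule])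
  note bFD = submodD[OF M(1) bF]
  \<comment> \<open>The origin of d: a common denominator of the finitely many generators of
    \<open>M\<close> relative to the free submodule.\<close>
  have "\<exists>d\<in>nonzeros R. \<forall>g\<in>G. d \<odot>\<^bsub>M\<^esub> g \<in> b ` carrier ?F"
  proof (rule common_denominator[OF mult_set_nonzeros G(1)])
    show "\<exists>d\<in>nonzeros R. d \<odot>\<^bsub>M\<^esub> g \<in> b ` carrier ?F" if "g \<in> G" for g
    proof -
      have "g \<in> carrier M" using that G(2) by blast
      then show ?thesis using b(3)[of g] by auto
    qed
    have *: "(t \<otimes> s) \<odot>\<^bsub>M\<^esub> g \<in> b ` carrier ?F" if "s \<in> nonzeros R" "t \<in> nonzeros R" "g \<in> G" "s \<odot>\<^bsub>M\<^esub> g \<in> b ` carrier ?F" for s t g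
    proof -
      have c: "s \<in> carrier R" "t \<in> carrier R" "g \<in> carrier M" using that G(2) by auto
      show ?thesis unfolding M.smult_assoc1[OF c(2,1,3)] by (rule bFD(4)[OF c(2) that(4)])
    qed
    fix s t g assume a: "s \<in> nonzeros R" "t \<in> nonzeros R" "g \<in> G" "s \<odot>\<^bsub>M\<^esub> g \<in> b ` carrier ?F"
    show "(t \<otimes> s) \<odot>\<^bsub>M\<^esub> g \<in> b ` carrier ?F" by (rule *[OF a])
    moreover have "t \<otimes> s = s \<otimes> t" using a by (intro m_comm) auto
    ultimately show "(s \<otimes> t) \<odot>\<^bsub>M\<^esub> g \<in> b ` carrier ?F" by simp
  qed
  then obtain d where d: "d \<in> carrier R" "d \<noteq> \<zero>" "\<And>g. g \<in> G \<Longrightarrow> d \<odot>\<^bsub>M\<^esub> g \<in> b ` carrier ?F" by blast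
  have dlin: "is_linear R M M (\<lambda>y. d \<odot>\<^bsub>M\<^esub> y)" by (rule lin_scale[OF M(1) lin_id d(1)])
  have dcanc: "x = y" if "x \<in> carrier M" "y \<in> carrier M" "d \<odot>\<^bsub>M\<^esub> x = d \<odot>\<^bsub>M\<^esub> y" for x y
    by (rule tfree_cancel[OF M(1,3) d(1,2) that])
  \<comment> \<open>The y with d y in the localised free module form a submodule closed under
    division by S and containing \<open>G\<close>, hence all of \<open>M\<close>.\<close>
  have dense: "\<exists>s\<in>?S. \<exists>x\<in>carrier ?F. s \<odot>\<^bsub>M\<^esub> (d \<odot>\<^bsub>M\<^esub> y) = b x" if y: "y \<in> carrier M" for y
  proof -
    let ?H = "{y \<in> carrier M. d \<odot>\<^bsub>M\<^esub> y \<in> saturate ?S M b (carrier ?F)}"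
    note sat = saturate_submodule[OF F M(1) S(1) b(1) F.carrier_is_submodule]
    have "?H = carrier M"
    proof (rule G(3))
      show "submodule ?H R M" by (rule lin_vimage_submodule[OF M(1,1) dlin sat(1)])
      show "G \<subseteq> ?H" using d(3) G(2) sat(3) by blast
      fix s x assume s: "s \<in> ?S" and x: "x \<in> carrier M" and "s \<odot>\<^bsub>M\<^esub> x \<in> ?H"
      then have "s \<odot>\<^bsub>M\<^esub> (d \<odot>\<^bsub>M\<^esub> x) \<in> saturate ?S M b (carrier ?F)"
        using M.smult_comm[OF d(1) Sc[OF s] x] by simp
      then have "d \<odot>\<^bsub>M\<^esub> x \<in> saturate ?S M b (carrier ?F)"
        by (rule sat(2)[OF s M.smult_closed[OF d(1) x]])
      then show "x \<in> ?H" using x by simp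
    qed
    then have "d \<odot>\<^bsub>M\<^esub> y \<in> saturate ?S M b (carrier ?F)" using y by blast
    then show ?thesis unfolding saturate_def by blast
  qed
  \<comment> \<open>Asking that b x be divisible by d in \<open>M\<close> is the same as asking that
    x/d lie in \<open>M\<close>, with \<open>b\<close> as identification.\<close>
  define L where "L = {x \<in> carrier ?F. b x \<in> (\<lambda>y. d \<odot>\<^bsub>M\<^esub> y) ` carrier M}"
  have L: "submodule L R ?F" unfolding L_def
    by (rule lin_vimage_submodule[OF F M(1) b(1) lin_image_submodule[OF M(1,1) dlin M.carrier_is_submodule]])
  have LF: "L \<subseteq> carrier ?F" by (auto simp: L_def)
  let ?L = "?F\<lparr>carrier := L\<rparr>"
  note LM = submod_module[OF F L]
  have "\<forall>x\<in>L. \<exists>y. y \<in> carrier M \<and> b x = d \<odot>\<^bsub>M\<^esub> y" unfolding L_def by blast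
  from bchoice[OF this] obtain p where p: "\<And>x. x \<in> L \<Longrightarrow> p x \<in> carrier M" "\<And>x. x \<in> L \<Longrightarrow> b x = d \<odot>\<^bsub>M\<^esub> p x" by blast
  have pI: "p x = y" if "x \<in> L" "y \<in> carrier M" "b x = d \<odot>\<^bsub>M\<^esub> y" for x y
    by (rule dcanc[OF p(1)[OF that(1)] that(2)]) (simp only: p(2)[OF that(1), symmetric] that(3))
  have LI: "x \<in> L" if "x \<in> carrier ?F" "y \<in> carrier M" "b x = d \<odot>\<^bsub>M\<^esub> y" for x y
    unfolding L_def using that by blast
  have plin: "is_linear R ?L M p"
  proof (rule linI)
    show "p x \<in> carrier M" if "x \<in> carrier ?L" for x using p(1) that by simp
    fix x assume "x \<in> carrier ?L" then have x: "x \<in> L" by simp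
    then have xF: "x \<in> carrier ?F" using LF by blast
    show "p (x \<oplus>\<^bsub>?L\<^esub> y) = p x \<oplus>\<^bsub>M\<^esub> p y" if "y \<in> carrier ?L" for y
    proof -
      have y: "y \<in> L" using that by simp
      then have yF: "y \<in> carrier ?F" using LF by blast
      have "p (x \<oplus>\<^bsub>?F\<^esub> y) = p x \<oplus>\<^bsub>M\<^esub> p y"
      proof (rule pI[OF submodD(3)[OF F L x y] M.a_closed[OF p(1)[OF x] p(1)[OF y]]])
        show "b (x \<oplus>\<^bsub>?F\<^esub> y) = d \<odot>\<^bsub>M\<^esub> (p x \<oplus>\<^bsub>M\<^esub> p y)"
          unfolding lin_add[OF b(1) xF yF] p(2)[OF x] p(2)[OF y] by (rule M.smult_r_distr[OF d(1) p(1)[OF x] p(1)[OF y], symmetric])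
      qed
      then show ?thesis by simp
    qed
    show "p (a \<odot>\<^bsub>?L\<^esub> x) = a \<odot>\<^bsub>M\<^esub> p x" if a: "a \<in> carrier R" for a
    proof -
      have "p (a \<odot>\<^bsub>?F\<^esub> x) = a \<odot>\<^bsub>M\<^esub> p x"
      proof (rule pI[OF submodD(4)[OF F L a x] M.smult_closed[OF a p(1)[OF x]]])
        show "b (a \<odot>\<^bsub>?F\<^esub> x) = d \<odot>\<^bsub>M\<^esub> (a \<odot>\<^bsub>M\<^esub> p x)"
          unfolding lin_smult[OF b(1) a xF] p(2)[OF x] by (rule M.smult_comm[OF a d(1) p(1)[OF x]])
      qed
      then show ?thesis by simp
    qed
  qed
  have pdense: "\<exists>s\<in>?S. \<exists>x\<in>L. s \<odot>\<^bsub>M\<^esub> y = p x" if y: "y \<in> carrier M" for y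
  proof -
    obtain s x where s: "s \<in> ?S" "x \<in> carrier ?F" "s \<odot>\<^bsub>M\<^esub> (d \<odot>\<^bsub>M\<^esub> y) = b x" using dense[OF y] by blast
    have sy: "s \<odot>\<^bsub>M\<^esub> y \<in> carrier M" by (rule M.smult_closed[OF Sc[OF s(1)] y])
    have bx: "b x = d \<odot>\<^bsub>M\<^esub> (s \<odot>\<^bsub>M\<^esub> y)" unfolding s(3)[symmetric] by (rule M.smult_comm[OF Sc[OF s(1)] d(1) y])
    show ?thesis using s(1) LI[OF s(2) sy bx] pI[OF LI[OF s(2) sy bx] sy bx] by metis
  qed
  have pinj: "inj_on p L"
  proof (rule inj_onI)
    fix x y assume xy: "x \<in> L" "y \<in> L" "p x = p y"
    then have "b x = b y" using p(2) by simp
    then show "x = y" by (rule inj_onD[OF b(2)]) (use xy LF in blast)+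
  qed
  have lm: "loc_map R ?S ?L M p" unfolding loc_map_def using plin pinj pdense by simp
  \<comment> \<open>From s t = q d with s outside m: t b(x) = d (q/s) b(x), where q/s acts on
    \<open>M\<close>; so t moves the whole free module into \<open>L\<close>.\<close>
  have away: "\<exists>t\<in>carrier R - n. \<forall>x\<in>carrier ?F. t \<odot>\<^bsub>?F\<^esub> x \<in> L" if n: "maximalideal n R" "n \<noteq> m" for n
  proof -
    obtain s t q where st: "s \<in> ?S" "t \<in> carrier R - n" "q \<in> carrier R" "s \<otimes> t = q \<otimes> d"
      using h_local_comaximal[OF h m n(1) n(2)[symmetric] d(1,2)] by blast
    have tc: "t \<in> carrier R" using st(2) by simp
    have "t \<odot>\<^bsub>?F\<^esub> x \<in> L" if x: "x \<in> carrier ?F" for x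
    proof -
      note bx = lin_closed[OF b(1) x]
      obtain y where y: "y \<in> carrier M" "s \<odot>\<^bsub>M\<^esub> y = q \<odot>\<^bsub>M\<^esub> b x"
        using divisibleD(2)[OF M(2) st(1) M.smult_closed[OF st(3) bx]] by blast
      have "s \<odot>\<^bsub>M\<^esub> b (t \<odot>\<^bsub>?F\<^esub> x) = (s \<otimes> t) \<odot>\<^bsub>M\<^esub> b x"
        unfolding lin_smult[OF b(1) tc x] by (rule M.smult_assoc1[OF Sc[OF st(1)] tc bx, symmetric])
      also have "\<dots> = d \<odot>\<^bsub>M\<^esub> (q \<odot>\<^bsub>M\<^esub> b x)" unfolding st(4) using st(3) d(1) bx by (simp add: M.smult_assoc1 M.smult_comm)
      also have "\<dots> = s \<odot>\<^bsub>M\<^esub> (d \<odot>\<^bsub>M\<^esub> y)" unfolding y(2)[symmetric] by (rule M.smult_comm[OF d(1) Sc[OF st(1)] y(1)])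
      finally have "b (t \<odot>\<^bsub>?F\<^esub> x) = d \<odot>\<^bsub>M\<^esub> y"
        by (rule divisibleD(1)[OF M(2) st(1) lin_closed[OF b(1) F.smult_closed[OF tc x]] M.smult_closed[OF d(1) y(1)]])
      then show ?thesis by (rule LI[OF F.smult_closed[OF tc x] y(1)])
    qed
    then show ?thesis using st(2) by blast
  qed
  have dL: "d \<odot>\<^bsub>?F\<^esub> x \<in> L" if x: "x \<in> carrier ?F" for x
    by (rule LI[OF F.smult_closed[OF d(1) x] lin_closed[OF b(1) x] lin_smult[OF b(1) d(1) x]])
  have fgL: "fin_gen R ?L"
    unfolding fin_gen_iff[OF LM]
  proof -
    \<comment> \<open>The only maximal ideals needing separate treatment: those other than m that
      contain d. The list is finite by h-locality.\<close>
    define N where "N = {n. maximalideal n R \<and> d \<in> n \<and> n \<noteq> m}"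
    have "finite {n. maximalideal n R \<and> d \<in> n}" using h d(1,2) unfolding h_local_def by blast
    then have finN: "finite N" by (rule finite_subset[rotated]) (auto simp: N_def)
    have "\<forall>n\<in>N. \<exists>t. t \<in> carrier R - n \<and> (\<forall>x\<in>carrier ?F. t \<odot>\<^bsub>?F\<^esub> x \<in> L)" using away unfolding N_def by blast
    from bchoice[OF this] obtain t where t: "\<And>n. n \<in> N \<Longrightarrow> t n \<in> carrier R - n"
       "\<And>n x. n \<in> N \<Longrightarrow> x \<in> carrier ?F \<Longrightarrow> t n \<odot>\<^bsub>?F\<^esub> x \<in> L" by blast
    have "\<forall>g\<in>G. \<exists>x. x \<in> L \<and> (\<exists>s\<in>?S. s \<odot>\<^bsub>M\<^esub> g = p x)" using pdense G(2) by blast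
    from bchoice[OF this] obtain l where l: "\<And>g. g \<in> G \<Longrightarrow> l g \<in> L" "\<And>g. g \<in> G \<Longrightarrow> \<exists>s\<in>?S. s \<odot>\<^bsub>M\<^esub> g = p (l g)" by blast
    \<comment> \<open>Each scalar in c maps the free module into \<open>L\<close>. At a maximal
      ideal other than m at least one of them is a unit locally.\<close>
    define c where "c = insert d (t ` N)"
    have cL: "a \<odot>\<^bsub>?F\<^esub> x \<in> L" if "a \<in> c" "x \<in> carrier ?F" for a x
      using that dL t(2) unfolding c_def by blast
    have cR: "a \<in> carrier R" if "a \<in> c" for a using that d(1) t(1) unfolding c_def by blast
    \<comment> \<open>Lifts of the generators at m, together with the multiples of the unit vectors
      by the scalars in c, which generate at all other maximal ideals. That these generate
      \<open>L\<close> is checked one maximal ideal at a time.\<close>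
    define G' where "G' = l ` G \<union> (\<lambda>(a, i). a \<odot>\<^bsub>?F\<^esub> unit_vec R i) ` (c \<times> {..<r})"
    show "\<exists>G. finite G \<and> G \<subseteq> carrier ?L \<and> (\<forall>H. submodule H R ?L \<and> G \<subseteq> H \<longrightarrow> H = carrier ?L)"
    proof (intro exI[of _ G'] conjI allI impI)
      show "finite G'" unfolding G'_def c_def using G(1) finN by simp
      show "G' \<subseteq> carrier ?L" unfolding G'_def using l(1) cL unit_vec_in by auto
      fix H assume "submodule H R ?L \<and> G' \<subseteq> H"
      then have H: "submodule H R ?L" and GH: "G' \<subseteq> H" by blast+
      note HD = submodD[OF LM H, unfolded partial_object.simps]
      have HL: "H \<subseteq> L" using HD(1) by auto
      have HF: "submodule H R ?F"
      proof (rule submodI[OF F])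
        show "H \<subseteq> carrier ?F" using HL LF by blast
        show "\<zero>\<^bsub>?F\<^esub> \<in> H" using HD(2) by simp
        show "x \<oplus>\<^bsub>?F\<^esub> y \<in> H" if "x \<in> H" "y \<in> H" for x y using HD(3)[OF that] by simp
        show "a \<odot>\<^bsub>?F\<^esub> x \<in> H" if "a \<in> carrier R" "x \<in> H" for a x using HD(4)[OF that] by simp
      qed
      have cH: "a \<odot>\<^bsub>?F\<^esub> x \<in> H" if a: "a \<in> c" and x: "x \<in> carrier ?F" for a x
      proof -
        have al: "is_linear R ?F ?F (\<lambda>x. a \<odot>\<^bsub>?F\<^esub> x)" by (rule lin_scale[OF F lin_id cR[OF a]])
        have "{x \<in> carrier ?F. a \<odot>\<^bsub>?F\<^esub> x \<in> H} = carrier ?F"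
        proof (rule free_gen[OF lin_vimage_submodule[OF F F al HF]])
          fix i assume i: "i < r"
          have "a \<odot>\<^bsub>?F\<^esub> unit_vec R i \<in> G'" unfolding G'_def using a i by (intro UnI2 image_eqI[of _ _ "(a, i)"]) simp_all
          then show "unit_vec R i \<in> {x \<in> carrier ?F. a \<odot>\<^bsub>?F\<^esub> x \<in> H}" using GH unit_vec_in[OF i] by blast
        qed
        then show ?thesis using x by blast
      qed
      have "L \<subseteq> H"
      proof
        fix x assume x: "x \<in> L"
        then have xF: "x \<in> carrier ?F" using LF by blast
        show "x \<in> H"
        proof (rule mem_if_locally_mem[OF F HF xF])
          fix n assume n: "maximalideal n R"
          consider "n = m" | "n \<in> N" | "d \<notin> n" unfolding N_def using n by blast
          then show "\<exists>s\<in>carrier R - n. s \<odot>\<^bsub>?F\<^esub> x \<in> H"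
          proof cases
            case 1
            note sat = saturate_submodule[OF LM M(1) S(1) plin H]
            \<comment> \<open>At m the localisation of H contains the images of the lifted
              generators and therefore is all of \<open>M\<close>.\<close>
            have "saturate ?S M p H = carrier M"
            proof (rule G(3)[OF sat(1)])
              show "G \<subseteq> saturate ?S M p H"
              proof
                fix g assume g: "g \<in> G"
                obtain s where s: "s \<in> ?S" "s \<odot>\<^bsub>M\<^esub> g = p (l g)" using l(2)[OF g] by blast
                have "l g \<in> H" using g GH unfolding G'_def by blast
                then show "g \<in> saturate ?S M p H" unfolding saturate_def using s g G(2) by blast
              qed
              show "y \<in> saturate ?S M p H" if "s \<in> ?S" "y \<in> carrier M" "s \<odot>\<^bsub>M\<^esub> y \<in> saturate ?S M p H" for s y
                by (rule sat(2)[OF that])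
            qed
            then have "p x \<in> saturate ?S M p H" using p(1)[OF x] by simp
            then obtain s k where s: "s \<in> ?S" "k \<in> H" "s \<odot>\<^bsub>M\<^esub> p x = p k" unfolding saturate_def by blast
            have "p (s \<odot>\<^bsub>?L\<^esub> x) = p k" using lin_smult[OF plin Sc[OF s(1)], of x] x s(3) by simp
            moreover have "s \<odot>\<^bsub>?L\<^esub> x \<in> L" using submodD(4)[OF F L Sc[OF s(1)] x] by simp
            ultimately have "s \<odot>\<^bsub>?L\<^esub> x = k" using inj_onD[OF pinj] s(2) HL by blast
            then have "s \<odot>\<^bsub>?F\<^esub> x \<in> H" using s(2) by simp
            then show ?thesis using s(1) 1 by blast
          next
            case 2
            have "t n \<in> c" unfolding c_def using 2 by blast
            then show ?thesis using cH[OF _ xF] t(1)[OF 2] by blast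
          next
            case 3
            have "d \<in> c" unfolding c_def by blast
            then show ?thesis using cH[OF _ xF] d(1) 3 by blast
          qed
        qed
      qed
      then show "H = carrier ?L" using HL by simp
    qed
  qed
  show ?thesis using L lm fgL away by blast
qed

text \<open>Transport of structure along an injection \<open>e\<close> with left inverse
  \<open>f\<close>. It moves the lattice, whose elements are sequences in the base ring, to the
  carrier type prescribed for the lifts.\<close>

definition transport_mod :: "('c \<Rightarrow> 'd) \<Rightarrow> ('d \<Rightarrow> 'c) \<Rightarrow> ('a, 'c, 'm) module_scheme \<Rightarrow> ('a, 'd) module" where
  "transport_mod e f U = \<lparr>carrier = e ` carrier U, monoid.mult = (\<lambda>x y. undefined), one = undefined,
     ring.zero = e \<zero>\<^bsub>U\<^esub>, ring.add = (\<lambda>x y. e (f x \<oplus>\<^bsub>U\<^esub> f y)), smult = (\<lambda>a x. e (a \<odot>\<^bsub>U\<^esub> f x))\<rparr>"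

lemma transport_mod:
  assumes U: "module R U" and fe: "\<And>x. x \<in> carrier U \<Longrightarrow> f (e x) = x"
  shows "module R (transport_mod e f U)" "is_linear R (transport_mod e f U) U f"
    "bij_betw f (carrier (transport_mod e f U)) (carrier U)" "is_linear R U (transport_mod e f U) e"
    "e ` carrier U = carrier (transport_mod e f U)"
proof -
  interpret U: module R U by fact
  let ?T = "transport_mod e f U"
  have s: "carrier ?T = e ` carrier U" "\<zero>\<^bsub>?T\<^esub> = e \<zero>\<^bsub>U\<^esub>" "\<And>x y. x \<oplus>\<^bsub>?T\<^esub> y = e (f x \<oplus>\<^bsub>U\<^esub> f y)"
    "\<And>a x. a \<odot>\<^bsub>?T\<^esub> x = e (a \<odot>\<^bsub>U\<^esub> f x)" by (simp_all add: transport_mod_def)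
  show "module R ?T"
  proof (rule moduleI[OF U.is_cring])
    show "abelian_group ?T"
    proof (rule abelian_groupI)
      fix x assume "x \<in> carrier ?T"
      then obtain u where u: "u \<in> carrier U" "x = e u" unfolding s by blast
      show "\<zero>\<^bsub>?T\<^esub> \<oplus>\<^bsub>?T\<^esub> x = x" using u by (simp add: s fe)
      show "\<exists>y\<in>carrier ?T. y \<oplus>\<^bsub>?T\<^esub> x = \<zero>\<^bsub>?T\<^esub>"
        using u by (intro bexI[of _ "e (\<ominus>\<^bsub>U\<^esub> u)"]) (simp_all add: s fe U.M.l_neg)
      fix y assume "y \<in> carrier ?T"
      then obtain v where v: "v \<in> carrier U" "y = e v" unfolding s by blast
      show "x \<oplus>\<^bsub>?T\<^esub> y \<in> carrier ?T" using u v by (simp add: s fe)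
      show "x \<oplus>\<^bsub>?T\<^esub> y = y \<oplus>\<^bsub>?T\<^esub> x" using u v by (simp add: s fe U.M.a_comm)
      fix z assume "z \<in> carrier ?T"
      then obtain w where w: "w \<in> carrier U" "z = e w" unfolding s by blast
      show "x \<oplus>\<^bsub>?T\<^esub> y \<oplus>\<^bsub>?T\<^esub> z = x \<oplus>\<^bsub>?T\<^esub> (y \<oplus>\<^bsub>?T\<^esub> z)" using u v w by (simp add: s fe U.M.a_assoc)
    qed (simp add: s)
  next
    fix a x assume a: "a \<in> carrier R" and "x \<in> carrier ?T"
    then obtain u where u: "u \<in> carrier U" "x = e u" unfolding s by blast
    show "a \<odot>\<^bsub>?T\<^esub> x \<in> carrier ?T" using a u by (simp add: s fe)
    fix b assume b: "b \<in> carrier R"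
    show "(a \<oplus>\<^bsub>R\<^esub> b) \<odot>\<^bsub>?T\<^esub> x = a \<odot>\<^bsub>?T\<^esub> x \<oplus>\<^bsub>?T\<^esub> b \<odot>\<^bsub>?T\<^esub> x" using a b u by (simp add: s fe U.smult_l_distr)
    show "a \<otimes>\<^bsub>R\<^esub> b \<odot>\<^bsub>?T\<^esub> x = a \<odot>\<^bsub>?T\<^esub> (b \<odot>\<^bsub>?T\<^esub> x)" using a b u by (simp add: s fe U.smult_assoc1)
  next
    fix a x y assume a: "a \<in> carrier R" and "x \<in> carrier ?T" "y \<in> carrier ?T"
    then obtain u v where u: "u \<in> carrier U" "x = e u" "v \<in> carrier U" "y = e v" unfolding s by blast
    show "a \<odot>\<^bsub>?T\<^esub> (x \<oplus>\<^bsub>?T\<^esub> y) = a \<odot>\<^bsub>?T\<^esub> x \<oplus>\<^bsub>?T\<^esub> a \<odot>\<^bsub>?T\<^esub> y"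
      using a u by (simp add: s fe U.smult_r_distr)
  next
    fix x assume "x \<in> carrier ?T"
    then obtain u where u: "u \<in> carrier U" "x = e u" unfolding s by blast
    then show "\<one>\<^bsub>R\<^esub> \<odot>\<^bsub>?T\<^esub> x = x" by (simp add: s fe)
  qed
  show "is_linear R ?T U f" by (rule linI) (auto simp: s fe)
  show "bij_betw f (carrier ?T) (carrier U)" 
    unfolding s by (rule bij_betw_byWitness[where f' = e]) (auto simp: fe)
  show "is_linear R U ?T e" by (rule linI) (auto simp: s fe)
  show "e ` carrier U = carrier ?T" by (simp add: s)
qed

text \<open>A decomposition of \<open>U\<close> saturates to one of its localisation. There one of
  the parts is zero, and a submodule embeds into its saturation.\<close>

lemma (in loc_base) indecomposable_descends:
  assumes U: "module R U" and M: "module A M" and p: "loc_map R S U (res_mod R S M) p" and ind: "indecomposable A M"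
  shows "indecomposable R U"
  unfolding indecomposable_def
proof (intro conjI allI impI)
  interpret U: module R U by fact
  interpret M: module A M by fact
  let ?W = "res_mod R S M"
  note W = module_res[OF M] and div = res_divisible[OF M]
  interpret W: module R ?W by (rule W)
  note p = loc_mapD[OF p]
  have p0: "p \<zero>\<^bsub>U\<^esub> = \<zero>\<^bsub>?W\<^esub>" by (rule lin_zero[OF U W p(1)])
  have canc: "w = \<zero>\<^bsub>?W\<^esub>" if "s \<in> S" "w \<in> carrier ?W" "s \<odot>\<^bsub>?W\<^esub> w = \<zero>\<^bsub>?W\<^esub>" for s w
    by (rule divisibleD(1)[OF div that(1,2) W.M.zero_closed]) (simp only: that(3) W.smult_r_null[OF S_nz(1)[OF that(1)]])
  show "carrier U \<noteq> {\<zero>\<^bsub>U\<^esub>}"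
  proof
    assume U0: "carrier U = {\<zero>\<^bsub>U\<^esub>}"
    have "w = \<zero>\<^bsub>?W\<^esub>" if w: "w \<in> carrier ?W" for w
    proof -
      obtain s u where s: "s \<in> S" "u \<in> carrier U" "s \<odot>\<^bsub>?W\<^esub> w = p u" using p(3)[OF w] by blast
      then have "s \<odot>\<^bsub>?W\<^esub> w = \<zero>\<^bsub>?W\<^esub>" using U0 p0 by simp
      then show ?thesis by (rule canc[OF s(1) w])
    qed
    then have "carrier M = {\<zero>\<^bsub>M\<^esub>}" using M.M.zero_closed by auto
    then show False using ind by (simp add: indecomposable_def)
  qed
  fix B C assume BC: "submodule B R U \<and> submodule C R U \<and> B \<inter> C = {\<zero>\<^bsub>U\<^esub>} \<and> {a \<oplus>\<^bsub>U\<^esub> b | a b. a \<in> B \<and> b \<in> C} = carrier U"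
  then have B: "submodule B R U" and C: "submodule C R U" and int: "B \<inter> C = {\<zero>\<^bsub>U\<^esub>}"
    and sum: "{a \<oplus>\<^bsub>U\<^esub> b | a b. a \<in> B \<and> b \<in> C} = carrier U" by blast+
  note BD = submodD[OF U B] and CD = submodD[OF U C]
  let ?B = "saturate S ?W p B" and ?C = "saturate S ?W p C"
  note satB = saturate_submodule[OF U W S p(1) B] and satC = saturate_submodule[OF U W S p(1) C]
  have sB: "submodule ?B A M" by (rule res_submoduleI[OF M satB(1)]) (rule satB(2), simp_all)
  have sC: "submodule ?C A M" by (rule res_submoduleI[OF M satC(1)]) (rule satC(2), simp_all)
  have "?B \<inter> ?C = {\<zero>\<^bsub>M\<^esub>}"
  proof (intro subset_antisym subsetI)
    fix w assume "w \<in> ?B \<inter> ?C"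
    then obtain s b t c where *: "w \<in> carrier ?W" "s \<in> S" "b \<in> B" "s \<odot>\<^bsub>?W\<^esub> w = p b" "t \<in> S" "c \<in> C" "t \<odot>\<^bsub>?W\<^esub> w = p c"
      unfolding saturate_def by blast
    note sc = S_nz(1)[OF *(2)] and tc = S_nz(1)[OF *(5)]
    have "p (t \<odot>\<^bsub>U\<^esub> b) = t \<odot>\<^bsub>?W\<^esub> (s \<odot>\<^bsub>?W\<^esub> w)" unfolding *(4) by (rule lin_smult[OF p(1) tc BD(1)[OF *(3)]])
    also have "\<dots> = s \<odot>\<^bsub>?W\<^esub> (t \<odot>\<^bsub>?W\<^esub> w)" by (rule W.smult_comm[OF tc sc *(1)])
    also have "\<dots> = p (s \<odot>\<^bsub>U\<^esub> c)" unfolding *(7) by (rule lin_smult[OF p(1) sc CD(1)[OF *(6)], symmetric])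
    \<comment> \<open>An element of both saturations yields t b = s c, which lies in the
      intersection of B and C and so vanishes.\<close>
    finally have "t \<odot>\<^bsub>U\<^esub> b = s \<odot>\<^bsub>U\<^esub> c"
      by (rule inj_onD[OF p(2) _ U.smult_closed[OF tc BD(1)[OF *(3)]] U.smult_closed[OF sc CD(1)[OF *(6)]]])
    moreover have "t \<odot>\<^bsub>U\<^esub> b \<in> B" by (rule BD(4)[OF tc *(3)])
    moreover have "s \<odot>\<^bsub>U\<^esub> c \<in> C" by (rule CD(4)[OF sc *(6)])
    ultimately have "t \<odot>\<^bsub>U\<^esub> b = \<zero>\<^bsub>U\<^esub>" using int by auto
    then have "t \<odot>\<^bsub>?W\<^esub> (s \<odot>\<^bsub>?W\<^esub> w) = \<zero>\<^bsub>?W\<^esub>" unfolding *(4) lin_smult[OF p(1) tc BD(1)[OF *(3)], symmetric] using p0 by simp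
    then have "s \<odot>\<^bsub>?W\<^esub> w = \<zero>\<^bsub>?W\<^esub>" by (rule canc[OF *(5) W.smult_closed[OF sc *(1)]])
    then have "w = \<zero>\<^bsub>?W\<^esub>" by (rule canc[OF *(2,1)])
    then show "w \<in> {\<zero>\<^bsub>M\<^esub>}" by simp
  next
    fix w assume "w \<in> {\<zero>\<^bsub>M\<^esub>}"
    then show "w \<in> ?B \<inter> ?C" using submodD(2)[OF W satB(1)] submodD(2)[OF W satC(1)] by simp
  qed
  moreover have "{a \<oplus>\<^bsub>M\<^esub> b | a b. a \<in> ?B \<and> b \<in> ?C} = carrier M"
  proof (intro subset_antisym subsetI)
    fix w assume "w \<in> {a \<oplus>\<^bsub>M\<^esub> b | a b. a \<in> ?B \<and> b \<in> ?C}"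
    then obtain a b where "a \<in> ?B" "b \<in> ?C" "w = a \<oplus>\<^bsub>M\<^esub> b" by blast
    then show "w \<in> carrier M" using submodD(1)[OF W satB(1)] submodD(1)[OF W satC(1)] by simp
  next
    fix w assume "w \<in> carrier M"
    then have w: "w \<in> carrier ?W" by simp
    obtain s u where s: "s \<in> S" "u \<in> carrier U" "s \<odot>\<^bsub>?W\<^esub> w = p u" using p(3)[OF w] by blast
    obtain b c where bc: "b \<in> B" "c \<in> C" "u = b \<oplus>\<^bsub>U\<^esub> c" using s(2) unfolding sum[symmetric] by blast
    note sc = S_nz(1)[OF s(1)]
    \<comment> \<open>The decomposition of s w upstairs comes from dividing the two parts of u by
      s.\<close>
    obtain x y where x: "x \<in> carrier ?W" "s \<odot>\<^bsub>?W\<^esub> x = p b" and y: "y \<in> carrier ?W" "s \<odot>\<^bsub>?W\<^esub> y = p c"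
      using divisibleD(2)[OF div s(1) lin_closed[OF p(1) BD(1)[OF bc(1)]]] divisibleD(2)[OF div s(1) lin_closed[OF p(1) CD(1)[OF bc(2)]]]
      by blast
    have "s \<odot>\<^bsub>?W\<^esub> w = s \<odot>\<^bsub>?W\<^esub> (x \<oplus>\<^bsub>?W\<^esub> y)"
      unfolding s(3) bc(3) lin_add[OF p(1) BD(1)[OF bc(1)] CD(1)[OF bc(2)]] x(2)[symmetric] y(2)[symmetric]
      by (rule W.smult_r_distr[OF sc x(1) y(1), symmetric])
    then have "w = x \<oplus>\<^bsub>?W\<^esub> y" by (rule divisibleD(1)[OF div s(1) w W.M.a_closed[OF x(1) y(1)]])
    moreover have "x \<in> ?B" unfolding saturate_def using x s(1) bc(1) by blast
    moreover have "y \<in> ?C" unfolding saturate_def using y s(1) bc(2) by blast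
    ultimately show "w \<in> {a \<oplus>\<^bsub>M\<^esub> b | a b. a \<in> ?B \<and> b \<in> ?C}" by auto
  qed
  ultimately have "?B = {\<zero>\<^bsub>M\<^esub>} \<or> ?C = {\<zero>\<^bsub>M\<^esub>}"
    using ind sB sC unfolding indecomposable_def by blast
  moreover have "H = {\<zero>\<^bsub>U\<^esub>}" if H: "submodule H R U" and sat: "saturate S ?W p H = {\<zero>\<^bsub>M\<^esub>}" for H
  proof (intro subset_antisym subsetI)
    fix x assume x: "x \<in> H"
    have xU: "x \<in> carrier U" by (rule submodD(1)[OF U H x])
    have "p x = \<zero>\<^bsub>?W\<^esub>" using saturate_submodule(3)[OF U W S p(1) H] x sat by auto
    then have "x = \<zero>\<^bsub>U\<^esub>" using p(2) xU unfolding lin_inj_iff[OF U W p(1)] by blast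
    then show "x \<in> {\<zero>\<^bsub>U\<^esub>}" by simp
  qed (use submodD(2)[OF U H] in simp)
  ultimately show "B = {\<zero>\<^bsub>U\<^esub>} \<or> C = {\<zero>\<^bsub>U\<^esub>}" using B C by blast
qed

lemma (in domain) loc_base_maximal: "maximalideal m R \<Longrightarrow> loc_base R (carrier R - m)"
  by (intro loc_base.intro loc_base_axioms.intro domain_axioms mult_set_compl)

lemma (in domain) good_lift_exists:
  fixes M :: "(('a \<times> 'a) set, 'e, 'k) module_scheme"
  assumes h: "h_local R" and m: "maximalideal m R"
    and M: "module (loc_at R m) M" "fin_gen (loc_at R m) M" "indecomposable (loc_at R m) M" "torsion_free (loc_at R m) M"
    and rk: "has_rank (loc_at R m) M r"
  shows "\<exists>Z :: ('a, nat \<Rightarrow> ('a \<times> 'a) set) module. good_lift R m r M Z"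
proof -
  let ?S = "carrier R - m" and ?F = "free_mod R r"
  interpret B: loc_base R ?S by (rule loc_base_maximal[OF m])
  interpret A: domain "loc_at R m" by (rule B.domain_A)
  let ?W = "res_mod R ?S M"
  note F = module_free[of r]
  note W = B.module_res[OF M(1)]
  have tf: "tfree (loc_at R m) M" using A.torsion_free_iff[OF M(1)] M(4) by simp
  have rkW: "has_rk R ?W r" by (rule B.has_rk_res[OF M(1) A.has_rk_of_has_rank[OF M(1) tf rk]])
  obtain L p where L: "submodule L R ?F" "loc_map R ?S (?F\<lparr>carrier := L\<rparr>) ?W p" "fin_gen R (?F\<lparr>carrier := L\<rparr>)"
    and away: "\<And>n. maximalideal n R \<Longrightarrow> n \<noteq> m \<Longrightarrow> \<exists>t\<in>carrier R - n. \<forall>x\<in>carrier ?F. t \<odot>\<^bsub>?F\<^esub> x \<in> L"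
    using lattice_exists[OF h m W B.res_divisible[OF M(1)] B.tfree_res[OF M(1) tf] rkW]
      B.fin_gen_res[OF M(1,2)] by (auto simp del: free_mod_simps)
  let ?U = "?F\<lparr>carrier := L\<rparr>"
  note U = submod_module[OF F L(1)]
  \<comment> \<open>A ring element is encoded as a singleton of pairs, merely to match the carrier
    type; \<open>f\<close> reads it back.\<close>
  define e :: "(nat \<Rightarrow> 'a) \<Rightarrow> nat \<Rightarrow> ('a \<times> 'a) set" where "e = (\<lambda>x i. {(x i, x i)})"
  define f :: "(nat \<Rightarrow> ('a \<times> 'a) set) \<Rightarrow> nat \<Rightarrow> 'a" where "f = (\<lambda>u i. fst (the_elem (u i)))"
  have fe: "f (e x) = x" for x by (simp add: e_def f_def)
  let ?T = "transport_mod e f ?U"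
  note T = transport_mod[where e = e and f = f, OF U fe]
  have LF: "L \<subseteq> carrier ?F" using submodD(1)[OF F L(1)] by blast
  have lT: "loc_map R S' ?T ?U f" if "mult_set R S'" for S' by (rule loc_map_bij[OF U that T(2,3)])
  have lTW: "loc_map R ?S ?T ?W (\<lambda>x. p (f x))" by (rule loc_map_trans[OF U W B.S lT[OF B.S] L(2)])
  have "good_lift R m r M ?T" unfolding good_lift_def
  proof (intro conjI allI impI)
    show "module R ?T" by (rule T(1))
    show "fin_gen R ?T" by (rule fin_gen_image[OF U T(1,4,5) L(3)])
    show "indecomposable R ?T" by (rule B.indecomposable_descends[OF T(1) M(1) lTW M(3)])
    have "tfree R ?U" by (rule tfree_inj[OF U F lin_sub_dom[OF lin_id LF] _ free_tfree]) simp
    then have "tfree R ?T" by (rule tfree_inj[OF T(1) U T(2) bij_betw_imp_inj_on[OF T(3)]])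
    then show "torsion_free R ?T" using torsion_free_iff[OF T(1)] by simp
    show "mod_iso (loc_at R m) (mod_loc_at R ?T m) M" by (rule B.mod_iso_of_loc_map[OF T(1) M(1) lTW])
    fix n assume "maximalideal n R \<and> n \<noteq> m"
    then have n: "maximalideal n R" "n \<noteq> m" by blast+
    let ?S' = "carrier R - n"
    interpret C: loc_base R ?S' by (rule loc_base_maximal[OF n(1)])
    obtain t where t: "t \<in> ?S'" "\<And>x. x \<in> carrier ?F \<Longrightarrow> t \<odot>\<^bsub>?F\<^esub> x \<in> L" using away[OF n] by blast
    \<comment> \<open>Away from m some t outside n sends the free module into \<open>L\<close>, so
      \<open>L\<close> is dense in it and has the same localisation at n.\<close>
    have "loc_map R ?S' ?U ?F (\<lambda>x. x)"
      by (rule loc_map_dense_sub[OF F L(1)]) (use t in blast)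
    note l1 = loc_map_trans[OF U F C.S lT[OF C.S] this]
    note FA = cring.module_free[OF C.cring_A, of r]
    note l2 = loc_map_trans[OF F C.module_res[OF FA] C.S l1 C.frac_free_loc_map]
    show "mod_iso (loc_at R n) (mod_loc_at R ?T n) (free_mod (loc_at R n) r)"
      by (rule C.mod_iso_of_loc_map[OF T(1) FA l2])
  qed
  then show ?thesis ..
qed

section \<open>The localised ring as a module over the base ring\<close>

context loc_base
begin

definition K :: "('a, ('a \<times> 'a) set) module" where "K = res_mod R S (ring_as_mod A)"

lemma A_self_module: "module A (ring_as_mod A)" by (rule module_ring_as_mod[OF cring_A])

lemma K_simps: "carrier K = carrier A" "\<zero>\<^bsub>K\<^esub> = \<zero>\<^bsub>A\<^esub>" "x \<oplus>\<^bsub>K\<^esub> y = x \<oplus>\<^bsub>A\<^esub> y" "a \<odot>\<^bsub>K\<^esub> x = frac a \<one> \<otimes>\<^bsub>A\<^esub> x"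
  by (simp_all add: K_def)

lemma K_basic: "module R K" "divisible R S K" "tfree R K" "has_rk R K 1"
proof -
  interpret A: domain A by (rule domain_A)
  show "module R K" unfolding K_def by (rule module_res[OF A_self_module])
  show "divisible R S K" unfolding K_def by (rule res_divisible[OF A_self_module])
  have "tfree A (ring_as_mod A)" using A.integral by (auto simp: tfree_def)
  then show "tfree R K" unfolding K_def by (rule tfree_res[OF A_self_module])
  have lin: "is_linear A (free_mod A 1) (ring_as_mod A) (\<lambda>z. z 0)" by (rule linI) auto
  have "bij_betw (\<lambda>z. z 0) (carrier (free_mod A 1)) (carrier (ring_as_mod A))"
  proof (rule bij_betw_byWitness[where f' = "\<lambda>c i. if i = 0 then c else \<zero>\<^bsub>A\<^esub>"])
    show "\<forall>a\<in>carrier (free_mod A 1). (\<lambda>i. if i = 0 then a 0 else \<zero>\<^bsub>A\<^esub>) = a" by (auto simp: fun_eq_iff)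
  qed auto
  then have "loc_map A (nonzeros A) (free_mod A 1) (ring_as_mod A) (\<lambda>z. z 0)"
    by (rule loc_map_bij[OF A_self_module A.mult_set_nonzeros lin])
  then have "has_rk A (ring_as_mod A) 1" by (auto simp: has_rk_def)
  then show "has_rk R K 1" unfolding K_def by (rule has_rk_res[OF A_self_module])
qed

lemma K_gen: "frac \<one> \<one> \<in> carrier K" "c \<in> carrier K \<Longrightarrow> \<exists>s\<in>S. \<exists>a\<in>carrier R. s \<odot>\<^bsub>K\<^esub> c = a \<odot>\<^bsub>K\<^esub> frac \<one> \<one>"
proof -
  interpret A: domain A by (rule domain_A)
  have one: "\<one> \<in> S" by (rule mult_setD(2)[OF S])
  show "frac \<one> \<one> \<in> carrier K" using one by (simp add: K_simps)
  assume "c \<in> carrier K"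
  then obtain a s where "a \<in> carrier R" "s \<in> S" "c = frac a s" by (metis A_cases K_simps(1))
  then show "\<exists>s\<in>S. \<exists>a\<in>carrier R. s \<odot>\<^bsub>K\<^esub> c = a \<odot>\<^bsub>K\<^esub> frac \<one> \<one>"
    by (intro bexI[of _ s] bexI[of _ a]) (simp_all add: K_simps frac_cancel frac_mult1)
qed

end

text \<open>An endomorphism is multiplication by f(1) = a/s. If a lies outside m the inverse is s/a;
  otherwise s - a lies outside m and 1 - a/s = (s - a)/s is invertible.\<close>

lemma (in loc_base) K_local_end:
  assumes m: "maximalideal m R" and Sm: "S = carrier R - m"
  shows "local_end R K"
proof -
  interpret A: domain A by (rule domain_A)
  interpret m: primeideal m R by (rule maximalideal_prime[OF m])
  have one: "\<one> \<in> S" by (rule mult_setD(2)[OF S])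
  have "local_end A (ring_as_mod A)" unfolding local_end_def
  proof (intro allI impI)
    fix f assume f: "is_linear A (ring_as_mod A) (ring_as_mod A) f"
    interpret KA: module A "ring_as_mod A" by (rule A_self_module)
    have bij: "bij_betw g (carrier (ring_as_mod A)) (carrier (ring_as_mod A))"
      if u: "a \<in> S" "s \<in> S" and g: "\<And>c. c \<in> carrier A \<Longrightarrow> g c = c \<otimes>\<^bsub>A\<^esub> frac a s" for g a s
    proof (rule bij_betw_byWitness[where f' = "\<lambda>c. c \<otimes>\<^bsub>A\<^esub> frac s a"])
      have c: "a \<in> carrier R" "s \<in> carrier R" "frac a s \<in> carrier A" "frac s a \<in> carrier A" using u S_nz by simp_all
      have "frac a s \<otimes>\<^bsub>A\<^esub> frac s a = \<one>\<^bsub>A\<^esub>"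
        using c u one unfolding frac_one by (simp add: frac_mult frac_eq_iff m_comm)
      moreover have "frac s a \<otimes>\<^bsub>A\<^esub> frac a s = \<one>\<^bsub>A\<^esub>"
        using c u one unfolding frac_one by (simp add: frac_mult frac_eq_iff m_comm)
      ultimately show "\<forall>x\<in>carrier (ring_as_mod A). g x \<otimes>\<^bsub>A\<^esub> frac s a = x"
        "\<forall>x\<in>carrier (ring_as_mod A). g (x \<otimes>\<^bsub>A\<^esub> frac s a) = x"
        using c by (simp_all add: g A.m_assoc)
      show "g ` carrier (ring_as_mod A) \<subseteq> carrier (ring_as_mod A)"
        "(\<lambda>c. c \<otimes>\<^bsub>A\<^esub> frac s a) ` carrier (ring_as_mod A) \<subseteq> carrier (ring_as_mod A)"
        using c by (auto simp: g)
    qed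
    have f1: "f \<one>\<^bsub>A\<^esub> \<in> carrier A" using lin_closed[OF f, of "\<one>\<^bsub>A\<^esub>"] by simp
    then obtain a s where as: "a \<in> carrier R" "s \<in> S" "f \<one>\<^bsub>A\<^esub> = frac a s" by (metis A_cases)
    have fc: "f c = c \<otimes>\<^bsub>A\<^esub> frac a s" if "c \<in> carrier A" for c
      using lin_smult[OF f that, of "\<one>\<^bsub>A\<^esub>"] that as(3) by simp
    have sc: "s \<in> carrier R" by (rule S_nz(1)[OF as(2)])
    show "bij_betw f (carrier (ring_as_mod A)) (carrier (ring_as_mod A)) \<or>
      bij_betw (\<lambda>x. x \<ominus>\<^bsub>ring_as_mod A\<^esub> f x) (carrier (ring_as_mod A)) (carrier (ring_as_mod A))"
    proof (cases "a \<in> S")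
      case True
      show ?thesis by (rule disjI1, rule bij[OF True as(2) fc])
    next
      case False
      then have am: "a \<in> m" using as(1) Sm by simp
      \<comment> \<open>If s - a were in m, so would be s, since a is.\<close>
      have sa: "s \<ominus> a \<in> S"
      proof -
        have "s \<ominus> a \<notin> m"
        proof
          assume "s \<ominus> a \<in> m"
          then have "(s \<ominus> a) \<oplus> a \<in> m" using am m.a_closed by blast
          moreover have "(s \<ominus> a) \<oplus> a = s" using sc as(1) by (simp add: minus_eq a_assoc l_neg)
          ultimately show False using as(2) Sm by simp
        qed
        then show ?thesis using sc as(1) Sm by simp
      qed
      have "x \<ominus>\<^bsub>ring_as_mod A\<^esub> f x = x \<otimes>\<^bsub>A\<^esub> frac (s \<ominus> a) s" if x: "x \<in> carrier A" for x
      proof -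
        have c: "frac (s \<ominus> a) s \<in> carrier A" "frac a s \<in> carrier A" using sc as by simp_all
        have "frac (s \<ominus> a) s \<oplus>\<^bsub>A\<^esub> frac a s = \<one>\<^bsub>A\<^esub>"
        proof -
          have "frac (s \<ominus> a) s \<oplus>\<^bsub>A\<^esub> frac a s = frac (s \<otimes> (s \<ominus> a) \<oplus> s \<otimes> a) (s \<otimes> s)"
            using B.frac_add[of "s \<ominus> a" s a s] sc as by simp
          also have "s \<otimes> (s \<ominus> a) \<oplus> s \<otimes> a = s \<otimes> s"
            using sc as(1) by (simp add: r_distr[symmetric] minus_eq a_assoc l_neg)
          also have "frac (s \<otimes> s) (s \<otimes> s) = \<one>\<^bsub>A\<^esub>"
            unfolding frac_one using sc one mult_setD(3)[OF S as(2,2)] by (simp add: frac_eq_iff)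
          finally show ?thesis .
        qed
        then have "x = x \<otimes>\<^bsub>A\<^esub> frac (s \<ominus> a) s \<oplus>\<^bsub>A\<^esub> f x"
          using x c by (simp add: fc A.r_distr[symmetric])
        then have eq: "x = x \<otimes>\<^bsub>A\<^esub> frac (s \<ominus> a) s \<oplus>\<^bsub>ring_as_mod A\<^esub> f x" by simp
        have xc: "x \<otimes>\<^bsub>A\<^esub> frac (s \<ominus> a) s \<in> carrier (ring_as_mod A)" "f x \<in> carrier (ring_as_mod A)"
          using x c fc[OF x] by simp_all
        have "(x \<otimes>\<^bsub>A\<^esub> frac (s \<ominus> a) s \<oplus>\<^bsub>ring_as_mod A\<^esub> f x) \<ominus>\<^bsub>ring_as_mod A\<^esub> f x = x \<otimes>\<^bsub>A\<^esub> frac (s \<ominus> a) s"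
          using xc KA.M.r_zero[OF xc(1)] by (simp only: KA.M.minus_eq KA.M.a_assoc KA.M.a_inv_closed KA.M.r_neg)
        then show ?thesis using eq by simp
      qed
      then show ?thesis by (intro disjI2) (rule bij[OF sa as(2)])
    qed
  qed
  then show ?thesis unfolding K_def by (rule local_end_res[OF A_self_module])
qed

text \<open>Two finitely generated lattices with the same localisation map to each other after
  clearing denominators, and the composite is multiplication by an element of S. This replaces a
  local isomorphism by maps over R.\<close>

lemma local_factor:
  assumes U: "module R U" "fin_gen R U" and V: "module R V" "fin_gen R V" and W: "module R W" and S: "mult_set R S"
    and f: "loc_map R S U W f" and g: "loc_map R S V W g"
  shows "\<exists>s\<in>S. \<exists>a b. is_linear R U V a \<and> is_linear R V U b \<and> (\<forall>x\<in>carrier U. b (a x) = s \<odot>\<^bsub>U\<^esub> x)"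
proof -
  interpret U: module R U by (rule U)
  interpret V: module R V by (rule V)
  interpret W: module R W by (rule W)
  note f = loc_mapD[OF f] and g = loc_mapD[OF g]
  obtain s a where s: "s \<in> S" and a: "is_linear R U V a" "\<forall>x\<in>carrier U. g (a x) = s \<odot>\<^bsub>W\<^esub> f x"
    using lift_fin_gen[OF U(1) V(1) W S U(2) f(1) g(1,2) g(3)[OF lin_closed[OF f(1)]]] by blast
  obtain t b where t: "t \<in> S" and b: "is_linear R V U b" "\<forall>x\<in>carrier V. f (b x) = t \<odot>\<^bsub>W\<^esub> g x"
    using lift_fin_gen[OF V(1) U(1) W S V(2) g(1) f(1,2) f(3)[OF lin_closed[OF g(1)]]] by blast
  have sc: "s \<in> carrier R" "t \<in> carrier R" using mult_setD(1)[OF S] s t by blast+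
  have "b (a x) = (t \<otimes>\<^bsub>R\<^esub> s) \<odot>\<^bsub>U\<^esub> x" if x: "x \<in> carrier U" for x
  proof (rule inj_onD[OF f(2)])
    have ts: "t \<otimes>\<^bsub>R\<^esub> s \<in> carrier R" using sc by simp
    have "f (b (a x)) = t \<odot>\<^bsub>W\<^esub> (s \<odot>\<^bsub>W\<^esub> f x)" using a(2) b(2) x lin_closed[OF a(1) x] by simp
    also have "\<dots> = f ((t \<otimes>\<^bsub>R\<^esub> s) \<odot>\<^bsub>U\<^esub> x)"
      unfolding lin_smult[OF f(1) ts x] by (rule W.smult_assoc1[OF sc(2,1) lin_closed[OF f(1) x], symmetric])
    finally show "f (b (a x)) = f ((t \<otimes>\<^bsub>R\<^esub> s) \<odot>\<^bsub>U\<^esub> x)" .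
    show "b (a x) \<in> carrier U" by (rule lin_closed[OF b(1) lin_closed[OF a(1) x]])
    show "(t \<otimes>\<^bsub>R\<^esub> s) \<odot>\<^bsub>U\<^esub> x \<in> carrier U" by (rule U.smult_closed[OF ts x])
  qed
  then show ?thesis using mult_setD(3)[OF S t s] a(1) b(1) by blast
qed

section \<open>Splitting a module off an infinite direct sum\<close>

lemma telescope:
  assumes N: "abelian_group N" and G: "\<And>i. G i \<in> carrier N"
  shows "finsum N (\<lambda>i. case i of 0 \<Rightarrow> G 0 | Suc n \<Rightarrow> G (Suc n) \<ominus>\<^bsub>N\<^esub> G n) {..<Suc j} = G j"
proof -
  interpret N: abelian_group N by fact
  let ?s = "\<lambda>i. case i of 0 \<Rightarrow> G 0 | Suc n \<Rightarrow> G (Suc n) \<ominus>\<^bsub>N\<^esub> G n"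
  have sc: "?s i \<in> carrier N" for i using G by (cases i) simp_all
  show ?thesis
  proof (induction j)
    case 0
    then show ?case using G by (simp add: lessThan_Suc N.finsum_insert)
  next
    case (Suc j)
    have "finsum N ?s {..<Suc (Suc j)} = ?s (Suc j) \<oplus>\<^bsub>N\<^esub> finsum N ?s {..<Suc j}"
      unfolding lessThan_Suc[of "Suc j"] by (rule N.finsum_insert[OF _ _ Pi_I[OF sc] sc]) simp_all
    also have "\<dots> = G (Suc j)" unfolding Suc using G by (simp add: N.minus_eq N.a_assoc N.l_neg)
    finally show ?case .
  qed
qed

text \<open>Uniform target for all numbers of factors: the new factor goes to index 0 and the
  earlier ones are shifted up.\<close>

lemma facs_dsum_copies:
  assumes Z: "module R Z" and V: "module R V"
  shows "facs q R Z U V f \<Longrightarrow> \<exists>a b. is_linear R U (dsum_copies Z) a \<and> is_linear R (dsum_copies Z) V b \<and> (\<forall>x\<in>carrier U. f x = b (a x))"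
proof (induction q arbitrary: f)
  case 0
  have "is_linear R U (dsum_copies Z) (\<lambda>x. \<zero>\<^bsub>dsum_copies Z\<^esub>)" by (rule lin_const_zero[OF module_dsum_copies[OF Z]])
  moreover have "is_linear R (dsum_copies Z) V (\<lambda>x. \<zero>\<^bsub>V\<^esub>)" by (rule lin_const_zero[OF V])
  ultimately show ?case using 0 by auto
next
  case (Suc q)
  interpret Z: module R Z by fact
  obtain g u v where *: "facs q R Z U V g" "is_linear R U Z v" "is_linear R Z V u" "\<And>x. x \<in> carrier U \<Longrightarrow> f x = g x \<oplus>\<^bsub>V\<^esub> u (v x)"
    using Suc.prems by auto
  obtain a b where ab: "is_linear R U (dsum_copies Z) a" "is_linear R (dsum_copies Z) V b" "\<And>x. x \<in> carrier U \<Longrightarrow> g x = b (a x)"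
    using Suc.IH[OF *(1)] by blast
  let ?a = "\<lambda>x n. case n of 0 \<Rightarrow> v x | Suc n \<Rightarrow> a x n"
  let ?sh = "\<lambda>(w::nat \<Rightarrow> 'c) n. w (Suc n)"
  let ?b = "\<lambda>w. b (?sh w) \<oplus>\<^bsub>V\<^esub> u (w 0)"
  have a: "is_linear R U (dsum_copies Z) ?a"
  proof (rule linI)
    fix x assume x: "x \<in> carrier U"
    have "{n. ?a x n \<noteq> \<zero>\<^bsub>Z\<^esub>} \<subseteq> insert 0 (Suc ` {n. a x n \<noteq> \<zero>\<^bsub>Z\<^esub>})"
    proof
      fix n assume "n \<in> {n. ?a x n \<noteq> \<zero>\<^bsub>Z\<^esub>}"
      then show "n \<in> insert 0 (Suc ` {n. a x n \<noteq> \<zero>\<^bsub>Z\<^esub>})" by (cases n) simp_all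
    qed
    then have "finite {n. ?a x n \<noteq> \<zero>\<^bsub>Z\<^esub>}"
      by (rule finite_subset) (use lin_closed[OF ab(1) x] in simp)
    moreover have "?a x n \<in> carrier Z" for n
      using lin_closed[OF ab(1) x] lin_closed[OF *(2) x] by (cases n) simp_all
    ultimately show "?a x \<in> carrier (dsum_copies Z)" unfolding dsum_copies_simps(1)[of Z] by blast
    show "?a (x \<oplus>\<^bsub>U\<^esub> y) = ?a x \<oplus>\<^bsub>dsum_copies Z\<^esub> ?a y" if y: "y \<in> carrier U" for y
      using lin_add[OF ab(1) x y] lin_add[OF *(2) x y] by (simp add: fun_eq_iff split: nat.splits)
    show "?a (r \<odot>\<^bsub>U\<^esub> x) = r \<odot>\<^bsub>dsum_copies Z\<^esub> ?a x" if r: "r \<in> carrier R" for r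
      using lin_smult[OF ab(1) r x] lin_smult[OF *(2) r x] by (simp add: fun_eq_iff split: nat.splits)
  qed
  have sh: "is_linear R (dsum_copies Z) (dsum_copies Z) ?sh"
  proof (rule linI)
    fix w assume w: "w \<in> carrier (dsum_copies Z)"
    have "finite (Suc -` {n. w n \<noteq> \<zero>\<^bsub>Z\<^esub>})" by (rule finite_vimageI) (use w in simp_all)
    then have "finite {n. w (Suc n) \<noteq> \<zero>\<^bsub>Z\<^esub>}" by (simp add: vimage_def)
    then show "?sh w \<in> carrier (dsum_copies Z)" using w by simp
  qed (simp_all)
  have b: "is_linear R (dsum_copies Z) V ?b"
    by (intro lin_plus[OF V] lin_comp[OF sh ab(2)] lin_comp[OF coord_lin *(3)])
  have "f x = ?b (?a x)" if "x \<in> carrier U" for x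
    using *(4)[OF that] ab(3)[OF that] by simp
  then show ?case using a b by blast
qed

text \<open>The map out of a countable direct sum given by its components. Since the summation range
  depends on w, the second claim allows any larger finite range, which is how additivity is
  checked.\<close>

lemma dsum_copies_fold:
  assumes D: "module R D" and N: "module R N" and b: "\<And>i. is_linear R D N (b i)"
  shows "is_linear R (dsum_copies D) N (\<lambda>w. finsum N (\<lambda>i. b i (w i)) {i. w i \<noteq> \<zero>\<^bsub>D\<^esub>})"
    "\<And>w F. w \<in> carrier (dsum_copies D) \<Longrightarrow> finite F \<Longrightarrow> {i. w i \<noteq> \<zero>\<^bsub>D\<^esub>} \<subseteq> F \<Longrightarrow>
       finsum N (\<lambda>i. b i (w i)) {i. w i \<noteq> \<zero>\<^bsub>D\<^esub>} = finsum N (\<lambda>i. b i (w i)) F"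
proof -
  interpret D: module R D by fact
  interpret N: module R N by fact
  have bc: "b i (w i) \<in> carrier N" if "w \<in> carrier (dsum_copies D)" for w i using that by (intro lin_closed[OF b]) simp
  have b0: "b i \<zero>\<^bsub>D\<^esub> = \<zero>\<^bsub>N\<^esub>" for i by (rule lin_zero[OF D N b])
  show ext: "finsum N (\<lambda>i. b i (w i)) {i. w i \<noteq> \<zero>\<^bsub>D\<^esub>} = finsum N (\<lambda>i. b i (w i)) F"
    if "w \<in> carrier (dsum_copies D)" "finite F" "{i. w i \<noteq> \<zero>\<^bsub>D\<^esub>} \<subseteq> F" for w F
    by (rule N.add.finprod_mono_neutral_cong_left) (use that bc[OF that(1)] b0 in auto)
  note DD = module_dsum_copies[OF D]
  interpret DD: module R "dsum_copies D" by (rule DD)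
  show "is_linear R (dsum_copies D) N (\<lambda>w. finsum N (\<lambda>i. b i (w i)) {i. w i \<noteq> \<zero>\<^bsub>D\<^esub>})"
  proof (rule linI)
    fix w assume w: "w \<in> carrier (dsum_copies D)"
    show "finsum N (\<lambda>i. b i (w i)) {i. w i \<noteq> \<zero>\<^bsub>D\<^esub>} \<in> carrier N" using bc[OF w] by (intro N.finsum_closed) auto
    show "finsum N (\<lambda>i. b i ((w \<oplus>\<^bsub>dsum_copies D\<^esub> z) i)) {i. (w \<oplus>\<^bsub>dsum_copies D\<^esub> z) i \<noteq> \<zero>\<^bsub>D\<^esub>}
       = finsum N (\<lambda>i. b i (w i)) {i. w i \<noteq> \<zero>\<^bsub>D\<^esub>} \<oplus>\<^bsub>N\<^esub> finsum N (\<lambda>i. b i (z i)) {i. z i \<noteq> \<zero>\<^bsub>D\<^esub>}"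
      if z: "z \<in> carrier (dsum_copies D)" for z
    proof -
      let ?F = "{i. w i \<noteq> \<zero>\<^bsub>D\<^esub>} \<union> {i. z i \<noteq> \<zero>\<^bsub>D\<^esub>}"
      have fin: "finite ?F" using w z by simp
      have wz: "w i \<in> carrier D" "z i \<in> carrier D" for i using w z by simp_all
      have sub: "{i. (w \<oplus>\<^bsub>dsum_copies D\<^esub> z) i \<noteq> \<zero>\<^bsub>D\<^esub>} \<subseteq> ?F" by auto
      have "finsum N (\<lambda>i. b i ((w \<oplus>\<^bsub>dsum_copies D\<^esub> z) i)) {i. (w \<oplus>\<^bsub>dsum_copies D\<^esub> z) i \<noteq> \<zero>\<^bsub>D\<^esub>}
         = finsum N (\<lambda>i. b i ((w \<oplus>\<^bsub>dsum_copies D\<^esub> z) i)) ?F" by (rule ext[OF DD.a_closed[OF w z] fin sub])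
      also have "\<dots> = finsum N (\<lambda>i. b i (w i) \<oplus>\<^bsub>N\<^esub> b i (z i)) ?F"
        using bc[OF w] bc[OF z] by (intro N.finsum_cong') (auto simp: lin_add[OF b wz])
      also have "\<dots> = finsum N (\<lambda>i. b i (w i)) ?F \<oplus>\<^bsub>N\<^esub> finsum N (\<lambda>i. b i (z i)) ?F"
        using bc[OF w] bc[OF z] by (intro N.finsum_addf) auto
      also have "\<dots> = finsum N (\<lambda>i. b i (w i)) {i. w i \<noteq> \<zero>\<^bsub>D\<^esub>} \<oplus>\<^bsub>N\<^esub> finsum N (\<lambda>i. b i (z i)) {i. z i \<noteq> \<zero>\<^bsub>D\<^esub>}"
        using ext[OF w fin] ext[OF z fin] by simp
      finally show ?thesis .
    qed
    show "finsum N (\<lambda>i. b i ((a \<odot>\<^bsub>dsum_copies D\<^esub> w) i)) {i. (a \<odot>\<^bsub>dsum_copies D\<^esub> w) i \<noteq> \<zero>\<^bsub>D\<^esub>}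
       = a \<odot>\<^bsub>N\<^esub> finsum N (\<lambda>i. b i (w i)) {i. w i \<noteq> \<zero>\<^bsub>D\<^esub>}" if a: "a \<in> carrier R" for a
    proof -
      let ?F = "{i. w i \<noteq> \<zero>\<^bsub>D\<^esub>}"
      have fin: "finite ?F" using w by simp
      have wc: "w i \<in> carrier D" for i using w by simp
      have sub: "{i. (a \<odot>\<^bsub>dsum_copies D\<^esub> w) i \<noteq> \<zero>\<^bsub>D\<^esub>} \<subseteq> ?F" using a by auto
      have "finsum N (\<lambda>i. b i ((a \<odot>\<^bsub>dsum_copies D\<^esub> w) i)) {i. (a \<odot>\<^bsub>dsum_copies D\<^esub> w) i \<noteq> \<zero>\<^bsub>D\<^esub>}
         = finsum N (\<lambda>i. b i ((a \<odot>\<^bsub>dsum_copies D\<^esub> w) i)) ?F" by (rule ext[OF DD.smult_closed[OF a w] fin sub])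
      also have "\<dots> = finsum N (\<lambda>i. a \<odot>\<^bsub>N\<^esub> b i (w i)) ?F"
        using bc[OF w] a by (intro N.finsum_cong') (auto simp: lin_smult[OF b a wc])
      also have "\<dots> = a \<odot>\<^bsub>N\<^esub> finsum N (\<lambda>i. b i (w i)) ?F"
        using bc[OF w] a fin by (intro N.finsum_smult_ldistr[symmetric]) auto
      finally show ?thesis .
    qed
  qed
qed

text \<open>The pairing of natural numbers flattens a doubly indexed family; finite support in both
  indices is finite support after pairing.\<close>

lemma dsum_copies_collapse:
  fixes Z :: "('a, 'c, 'm) module_scheme"
  assumes Z: "module R Z"
  shows "\<exists>c d. is_linear R (dsum_copies (dsum_copies Z)) (dsum_copies Z) c \<and>
     is_linear R (dsum_copies Z) (dsum_copies (dsum_copies Z)) d \<and> (\<forall>w\<in>carrier (dsum_copies (dsum_copies Z)). d (c w) = w)"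
proof -
  interpret Z: module R Z by fact
  let ?D = "dsum_copies Z"
  let ?c = "\<lambda>w n. w (fst (prod_decode n)) (snd (prod_decode n))"
  let ?d = "\<lambda>(v :: nat \<Rightarrow> 'c) i j. v (prod_encode (i, j))"
  have c: "is_linear R (dsum_copies ?D) ?D ?c"
  proof (rule linI)
    fix w assume w: "w \<in> carrier (dsum_copies ?D)"
    have wi: "w i j \<in> carrier Z" "finite {j. w i j \<noteq> \<zero>\<^bsub>Z\<^esub>}" for i j using w by simp_all
    have "{n. ?c w n \<noteq> \<zero>\<^bsub>Z\<^esub>} \<subseteq> prod_encode ` (SIGMA i:{i. w i \<noteq> \<zero>\<^bsub>?D\<^esub>}. {j. w i j \<noteq> \<zero>\<^bsub>Z\<^esub>})"
    proof
      fix n assume n: "n \<in> {n. ?c w n \<noteq> \<zero>\<^bsub>Z\<^esub>}"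
      obtain i j where ij: "prod_decode n = (i, j)" by fastforce
      then have "n = prod_encode (i, j)" by (metis prod_decode_inverse)
      then show "n \<in> prod_encode ` (SIGMA i:{i. w i \<noteq> \<zero>\<^bsub>?D\<^esub>}. {j. w i j \<noteq> \<zero>\<^bsub>Z\<^esub>})"
        by (rule image_eqI) (use n ij in \<open>auto simp: fun_eq_iff\<close>)
    qed
    moreover have "finite (SIGMA i:{i. w i \<noteq> \<zero>\<^bsub>?D\<^esub>}. {j. w i j \<noteq> \<zero>\<^bsub>Z\<^esub>})"
      using w wi(2) by (intro finite_SigmaI) (auto simp del: dsum_copies_simps(2) simp: dsum_copies_simps(1))
    ultimately have "finite {n. ?c w n \<noteq> \<zero>\<^bsub>Z\<^esub>}" by (meson finite_imageI finite_subset)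
    then show "?c w \<in> carrier ?D" using wi by simp
  qed simp_all
  have d: "is_linear R ?D (dsum_copies ?D) ?d"
  proof (rule linI)
    fix v assume v: "v \<in> carrier ?D"
    let ?E = "prod_decode ` {n. v n \<noteq> \<zero>\<^bsub>Z\<^esub>}"
    have fin: "finite ?E" using v by simp
    have mem: "(i, j) \<in> ?E" if "v (prod_encode (i, j)) \<noteq> \<zero>\<^bsub>Z\<^esub>" for i j
      using that by (intro image_eqI[of _ _ "prod_encode (i, j)"]) simp_all
    have "{j. ?d v i j \<noteq> \<zero>\<^bsub>Z\<^esub>} \<subseteq> snd ` ?E" for i
    proof
      fix j assume "j \<in> {j. ?d v i j \<noteq> \<zero>\<^bsub>Z\<^esub>}"
      then have "(i, j) \<in> ?E" by (intro mem) simp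
      from imageI[OF this, of snd] show "j \<in> snd ` ?E" by simp
    qed
    from finite_subset[OF this finite_imageI[OF fin]] have 1: "finite {j. ?d v i j \<noteq> \<zero>\<^bsub>Z\<^esub>}" for i .
    have "{i. ?d v i \<noteq> \<zero>\<^bsub>?D\<^esub>} \<subseteq> fst ` ?E"
    proof
      fix i assume "i \<in> {i. ?d v i \<noteq> \<zero>\<^bsub>?D\<^esub>}"
      then obtain j where "v (prod_encode (i, j)) \<noteq> \<zero>\<^bsub>Z\<^esub>" by (auto simp: fun_eq_iff)
      from imageI[OF mem[OF this], of fst] show "i \<in> fst ` ?E" by simp
    qed
    from finite_subset[OF this finite_imageI[OF fin]] have 2: "finite {i. ?d v i \<noteq> \<zero>\<^bsub>?D\<^esub>}" .
    show "?d v \<in> carrier (dsum_copies ?D)" using v 1 2 by simp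
  qed simp_all
  show ?thesis using c d by (intro exI[of _ ?c] exI[of _ ?d]) simp
qed

text \<open>A split injection: the complement of the image of \<open>P\<close> is the kernel of
  \<open>Q\<close>, through y = P (Q y) + (y - P (Q y)).\<close>

lemma direct_summandI:
  assumes N: "module R N" and D: "module R D" and P: "is_linear R N D P" and Q: "is_linear R D N Q"
    and QP: "\<And>x. x \<in> carrier N \<Longrightarrow> Q (P x) = x"
  shows "direct_summand R D (P ` carrier N)"
    "is_linear R (D\<lparr>carrier := P ` carrier N\<rparr>) N Q"
    "bij_betw Q (carrier (D\<lparr>carrier := P ` carrier N\<rparr>)) (carrier N)"
proof -
  interpret N: module R N by fact
  interpret D: module R D by fact
  let ?A = "P ` carrier N" and ?B = "{y \<in> carrier D. Q y \<in> {\<zero>\<^bsub>N\<^esub>}}"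
  have A: "submodule ?A R D" by (rule lin_image_submodule[OF N D P N.carrier_is_submodule])
  have "submodule {\<zero>\<^bsub>N\<^esub>} R N" by (rule submodI[OF N]) auto
  then have B: "submodule ?B R D" by (rule lin_vimage_submodule[OF D N Q])
  have AD: "?A \<subseteq> carrier D" using lin_closed[OF P] by blast
  show "direct_summand R D ?A" unfolding direct_summand_def
  proof (intro conjI exI[of _ ?B] A B)
    show "?A \<inter> ?B = {\<zero>\<^bsub>D\<^esub>}"
    proof (intro subset_antisym subsetI)
      fix y assume y: "y \<in> ?A \<inter> ?B"
      then obtain x where x: "x \<in> carrier N" "y = P x" by blast
      have "x = \<zero>\<^bsub>N\<^esub>" using y x QP[OF x(1)] by simp
      then show "y \<in> {\<zero>\<^bsub>D\<^esub>}" using x(2) lin_zero[OF N D P] by simp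
    next
      fix y assume "y \<in> {\<zero>\<^bsub>D\<^esub>}"
      then show "y \<in> ?A \<inter> ?B" using submodD(2)[OF D A] submodD(2)[OF D B] by simp
    qed
    show "{a \<oplus>\<^bsub>D\<^esub> b | a b. a \<in> ?A \<and> b \<in> ?B} = carrier D"
    proof (intro subset_antisym subsetI)
      fix y assume "y \<in> {a \<oplus>\<^bsub>D\<^esub> b | a b. a \<in> ?A \<and> b \<in> ?B}"
      then obtain a b where "a \<in> ?A" "b \<in> ?B" "y = a \<oplus>\<^bsub>D\<^esub> b" by blast
      then show "y \<in> carrier D" using AD by blast
    next
      fix y assume y: "y \<in> carrier D"
      note Qy = lin_closed[OF Q y]
      note PQ = lin_closed[OF P Qy]
      have "Q (y \<ominus>\<^bsub>D\<^esub> P (Q y)) = Q y \<ominus>\<^bsub>N\<^esub> Q y"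
        using lin_minus[OF D N Q y PQ] QP[OF Qy] by simp
      then have "y \<ominus>\<^bsub>D\<^esub> P (Q y) \<in> ?B" using Qy y PQ by (simp add: N.minus_eq_zero_iff)
      moreover have "y = P (Q y) \<oplus>\<^bsub>D\<^esub> (y \<ominus>\<^bsub>D\<^esub> P (Q y))"
        using y PQ by (simp add: D.M.minus_eq D.M.a_lcomm D.M.r_neg)
      ultimately show "y \<in> {a \<oplus>\<^bsub>D\<^esub> b | a b. a \<in> ?A \<and> b \<in> ?B}" using Qy by blast
    qed
  qed
  show "is_linear R (D\<lparr>carrier := ?A\<rparr>) N Q" by (rule lin_sub_dom[OF Q AD])
  show "bij_betw Q (carrier (D\<lparr>carrier := ?A\<rparr>)) (carrier N)"
    by (rule bij_betw_byWitness[where f' = P]) (auto simp: QP)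
qed

text \<open>An increasing exhaustion of \<open>N\<close> by the sets \<open>{x. supp x k}\<close>: if each member can be fixed
  by an endomorphism with bounded image factoring through a power of \<open>Z\<close>, then the differences
  \<open>G (i + 1) - G i\<close> of successive such endomorphisms form a locally finite partition of the identity.\<close>

lemma summand_of_exhaustion:
  fixes supp :: "'n \<Rightarrow> nat \<Rightarrow> bool"
  assumes N: "module R N" and Z: "module R Z"
    and mono: "\<And>x k l. supp x k \<Longrightarrow> k \<le> l \<Longrightarrow> supp x l"
    and exh: "\<And>x. x \<in> carrier N \<Longrightarrow> \<exists>k. supp x k"
    and minus: "\<And>x y k. x \<in> carrier N \<Longrightarrow> y \<in> carrier N \<Longrightarrow> supp x k \<Longrightarrow> supp y k \<Longrightarrow> supp (x \<ominus>\<^bsub>N\<^esub> y) k"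
    and G: "\<And>k. \<exists>G q l. is_linear R N N G \<and> facs q R Z N N G \<and> (\<forall>x\<in>carrier N. supp x k \<longrightarrow> G x = x) \<and> (\<forall>x\<in>carrier N. supp (G x) l)"
  shows "\<exists>P Q. is_linear R N (dsum_copies Z) P \<and> is_linear R (dsum_copies Z) N Q \<and> (\<forall>x\<in>carrier N. Q (P x) = x)"
proof -
  interpret N: module R N by fact
  let ?D = "dsum_copies Z"
  note D = module_dsum_copies[OF Z]
  interpret D: module R ?D by (rule D)
  have "\<forall>k. \<exists>Gl. is_linear R N N (fst Gl) \<and> (\<exists>q. facs q R Z N N (fst Gl)) \<and> (\<forall>x\<in>carrier N. supp x k \<longrightarrow> fst Gl x = x)
     \<and> (\<forall>x\<in>carrier N. supp (fst Gl x) (snd Gl))"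
  proof
    fix k
    obtain G q l where "is_linear R N N G" "facs q R Z N N G" "\<forall>x\<in>carrier N. supp x k \<longrightarrow> G x = x" "\<forall>x\<in>carrier N. supp (G x) l"
      using G by blast
    then show "\<exists>Gl. is_linear R N N (fst Gl) \<and> (\<exists>q. facs q R Z N N (fst Gl)) \<and> (\<forall>x\<in>carrier N. supp x k \<longrightarrow> fst Gl x = x)
     \<and> (\<forall>x\<in>carrier N. supp (fst Gl x) (snd Gl))" by (intro exI[of _ "(G, l)"]) auto
  qed
  from choice[OF this] obtain H where H: "\<And>k. is_linear R N N (fst (H k))" "\<And>k. \<exists>q. facs q R Z N N (fst (H k))"
    "\<And>k x. x \<in> carrier N \<Longrightarrow> supp x k \<Longrightarrow> fst (H k) x = x" "\<And>k x. x \<in> carrier N \<Longrightarrow> supp (fst (H k) x) (snd (H k))" by blast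
  \<comment> \<open>The levels are chosen so that the next one exceeds the present one and bounds
    the image of the present endomorphism. Thus each endomorphism in the sequence fixes the image of
    its predecessor.\<close>
  define kk where "kk = rec_nat 0 (\<lambda>i k. max (Suc k) (snd (H k)))"
  have kS: "kk (Suc i) = max (Suc (kk i)) (snd (H (kk i)))" for i by (simp add: kk_def)
  have k_ge: "i \<le> kk i" for i by (induction i) (simp_all add: kS)
  define g where "g = (\<lambda>i. fst (H (kk i)))"
  have g: "is_linear R N N (g i)" for i unfolding g_def by (rule H(1))
  note gc = lin_closed[OF g]
  have g_fix: "g i x = x" if "x \<in> carrier N" "supp x (kk i)" for i x unfolding g_def by (rule H(3)[OF that])
  have g_supp: "supp (g i x) (kk (Suc i))" if "x \<in> carrier N" for i x
    unfolding g_def by (rule mono[OF H(4)[OF that]]) (simp add: kS)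
  have k_mono: "kk i \<le> kk (Suc i)" for i by (simp add: kS)
  have k_mono': "i \<le> j \<Longrightarrow> kk i \<le> kk j" for i j by (rule lift_Suc_mono_le[of kk, OF k_mono])
  define s where "s = (\<lambda>i x. case i of 0 \<Rightarrow> g 0 x | Suc n \<Rightarrow> g (Suc n) x \<ominus>\<^bsub>N\<^esub> g n x)"
  have s: "is_linear R N N (s i)" for i
    unfolding s_def by (cases i) (simp_all add: g lin_diff[OF N g g])
  note sc = lin_closed[OF s]
  have s_supp: "supp (s i x) (kk (Suc i))" if x: "x \<in> carrier N" for i x
  proof (cases i)
    case 0
    then show ?thesis using g_supp[OF x, of 0] by (simp add: s_def)
  next
    case (Suc n)
    have "supp (g n x) (kk (Suc (Suc n)))" by (rule mono[OF g_supp[OF x] k_mono])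
    then have "supp (g (Suc n) x \<ominus>\<^bsub>N\<^esub> g n x) (kk (Suc (Suc n)))"
      by (rule minus[OF gc[OF x] gc[OF x] g_supp[OF x]])
    then show ?thesis using Suc by (simp add: s_def)
  qed
  \<comment> \<open>The difference s_i has values at level i + 1, where g_(i+1) is the identity. So
    s_i = g_(i+1) s_i inherits the factorisation through \<open>Z\<close>, although g_i and g_(i+1)
    factor separately.\<close>
  have gs: "g (Suc i) (s i x) = s i x" if x: "x \<in> carrier N" for i x by (rule g_fix[OF sc[OF x] s_supp[OF x]])
  \<comment> \<open>Local finiteness: both endomorphisms in a later difference already fix x, so the
    difference kills it.\<close>
  have s0: "s i x = \<zero>\<^bsub>N\<^esub>" if x: "x \<in> carrier N" and "supp x (kk j)" "i > j" for i j x
  proof -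
    obtain n where n: "i = Suc n" "j \<le> n" using \<open>i > j\<close> by (cases i) auto
    have "supp x (kk n)" "supp x (kk (Suc n))" by (rule mono[OF \<open>supp x _\<close> k_mono'], use n in simp)+
    then show ?thesis using n x by (simp add: s_def g_fix N.minus_eq_zero_iff)
  qed
  have "\<forall>i. \<exists>ab. is_linear R N ?D (fst ab) \<and> is_linear R ?D N (snd ab) \<and> (\<forall>x\<in>carrier N. g (Suc i) x = snd ab (fst ab x))"
  proof
    fix i
    obtain q where "facs q R Z N N (g (Suc i))" using H(2) unfolding g_def by blast
    from facs_dsum_copies[OF Z N this]
    show "\<exists>ab. is_linear R N ?D (fst ab) \<and> is_linear R ?D N (snd ab) \<and> (\<forall>x\<in>carrier N. g (Suc i) x = snd ab (fst ab x))"
      by auto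
  qed
  from choice[OF this] obtain ab where ab: "\<And>i. is_linear R N ?D (fst (ab i))" "\<And>i. is_linear R ?D N (snd (ab i))"
    "\<And>i x. x \<in> carrier N \<Longrightarrow> g (Suc i) x = snd (ab i) (fst (ab i) x)" by blast
  \<comment> \<open>With g_(i+1) = b_i a_i, the i-th component of the embedding is a_i s_i, and the
    retraction sums the b_i; the composite is the telescoping sum of the s_i.\<close>
  let ?P = "\<lambda>x i. fst (ab i) (s i x)"
  let ?Q = "\<lambda>w. finsum N (\<lambda>i. snd (ab i) (w i)) {i. w i \<noteq> \<zero>\<^bsub>?D\<^esub>}"
  have Pz: "{i. ?P x i \<noteq> \<zero>\<^bsub>?D\<^esub>} \<subseteq> {..<Suc j}" if x: "x \<in> carrier N" "supp x (kk j)" for x j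
  proof
    fix i assume i: "i \<in> {i. ?P x i \<noteq> \<zero>\<^bsub>?D\<^esub>}"
    show "i \<in> {..<Suc j}"
    proof (rule ccontr)
      assume "i \<notin> {..<Suc j}"
      then have "s i x = \<zero>\<^bsub>N\<^esub>" using s0[OF x, of i] by simp
      then have "?P x i = \<zero>\<^bsub>?D\<^esub>" using lin_zero[OF N D ab(1)[of i]] by simp
      then show False using i by simp
    qed
  qed
  have ex: "\<exists>j. supp x (kk j)" if x: "x \<in> carrier N" for x
  proof -
    obtain k where "supp x k" using exh[OF x] by blast
    then show ?thesis using mono[OF _ k_ge] by blast
  qed
  have P: "is_linear R N (dsum_copies ?D) ?P"
  proof (rule linI)
    fix x assume x: "x \<in> carrier N"
    obtain j where "supp x (kk j)" using ex[OF x] by blast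
    have "finite {i. ?P x i \<noteq> \<zero>\<^bsub>?D\<^esub>}" by (rule finite_subset[OF Pz[OF x \<open>supp x _\<close>]]) simp
    moreover have "?P x i \<in> carrier ?D" for i by (rule lin_closed[OF ab(1) sc[OF x]])
    ultimately show "?P x \<in> carrier (dsum_copies ?D)" unfolding dsum_copies_simps(1)[of ?D] by blast
    show "?P (x \<oplus>\<^bsub>N\<^esub> y) = ?P x \<oplus>\<^bsub>dsum_copies ?D\<^esub> ?P y" if y: "y \<in> carrier N" for y
      unfolding dsum_copies_simps(3)[of ?D] lin_add[OF s x y] lin_add[OF ab(1) sc[OF x] sc[OF y]] ..
    show "?P (a \<odot>\<^bsub>N\<^esub> x) = a \<odot>\<^bsub>dsum_copies ?D\<^esub> ?P x" if a: "a \<in> carrier R" for a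
      unfolding dsum_copies_simps(4)[of ?D] lin_smult[OF s a x] lin_smult[OF ab(1) a sc[OF x]] ..
  qed
  note fold = dsum_copies_fold[OF D N ab(2)]
  have QP: "?Q (?P x) = x" if x: "x \<in> carrier N" for x
  proof -
    obtain j where j: "supp x (kk j)" using ex[OF x] by blast
    have "?Q (?P x) = finsum N (\<lambda>i. snd (ab i) (?P x i)) {..<Suc j}"
      by (rule fold(2)[OF lin_closed[OF P x] _ Pz[OF x j]]) simp
    also have "\<dots> = finsum N (\<lambda>i. s i x) {..<Suc j}"
      using sc[OF x] by (intro N.finsum_cong') (auto simp: ab(3)[OF sc[OF x], symmetric] gs[OF x])
    also have "\<dots> = g j x" unfolding s_def by (rule telescope[OF N.M.abelian_group_axioms gc[OF x]])
    also have "\<dots> = x" by (rule g_fix[OF x j])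
    finally show ?thesis .
  qed
  obtain c d where cd: "is_linear R (dsum_copies ?D) ?D c" "is_linear R ?D (dsum_copies ?D) d"
     "\<And>w. w \<in> carrier (dsum_copies ?D) \<Longrightarrow> d (c w) = w"
    using dsum_copies_collapse[OF Z] by blast
  show ?thesis
  proof (intro exI conjI ballI)
    show "is_linear R N ?D (\<lambda>x. c (?P x))" by (rule lin_comp[OF P cd(1)])
    show "is_linear R ?D N (\<lambda>v. ?Q (d v))" by (rule lin_comp[OF cd(2) fold(1)])
    fix x assume x: "x \<in> carrier N"
    show "?Q (d (c (?P x))) = x" unfolding cd(3)[OF lin_closed[OF P x]] by (rule QP[OF x])
  qed
qed

section \<open>Interleaving two lattices in a countable free module\<close>

text \<open>Coordinates from \<open>c\<close> on are grouped into consecutive blocks of length \<open>r\<close>.\<close>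

definition block :: "('a, 'r) ring_scheme \<Rightarrow> nat \<Rightarrow> nat \<Rightarrow> nat \<Rightarrow> (nat \<Rightarrow> 'a) \<Rightarrow> nat \<Rightarrow> 'a" where
  "block R c r j x = (\<lambda>i. if i < r then x (c + j * r + i) else \<zero>\<^bsub>R\<^esub>)"

definition place :: "('a, 'r) ring_scheme \<Rightarrow> nat \<Rightarrow> nat \<Rightarrow> nat \<Rightarrow> (nat \<Rightarrow> 'a) \<Rightarrow> nat \<Rightarrow> 'a" where
  "place R c r j y = (\<lambda>i. if c + j * r \<le> i \<and> i < c + j * r + r then y (i - (c + j * r)) else \<zero>\<^bsub>R\<^esub>)"

definition single :: "('a, 'r) ring_scheme \<Rightarrow> nat \<Rightarrow> 'a \<Rightarrow> nat \<Rightarrow> 'a" where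
  "single R i a = (\<lambda>k. if k = i then a else \<zero>\<^bsub>R\<^esub>)"

definition cut :: "('a, 'r) ring_scheme \<Rightarrow> nat \<Rightarrow> (nat \<Rightarrow> 'a) \<Rightarrow> nat \<Rightarrow> 'a" where
  "cut R k x = (\<lambda>i. if i < k then x i else \<zero>\<^bsub>R\<^esub>)"

text \<open>Coordinates below c are left free. With c = 1 this produces the extra rank-one summand
  next to the blocks.\<close>

definition blockwise :: "('a, 'r) ring_scheme \<Rightarrow> nat \<Rightarrow> nat \<Rightarrow> (nat \<Rightarrow> 'a) set \<Rightarrow> (nat \<Rightarrow> 'a) set" where
  "blockwise R c r L = {x \<in> carrier (dsum_copies (ring_as_mod R)). \<forall>j. block R c r j x \<in> L}"

context domain
begin

abbreviation (input) E where "E \<equiv> dsum_copies (ring_as_mod R)"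

lemma ring_module: "module R (ring_as_mod R)" by (rule module_ring_as_mod[OF is_cring])
lemma E_module: "module R E" by (rule module_dsum_copies[OF ring_module])

lemma block_lin: "is_linear R E (free_mod R r) (block R c r j)"
  by (rule linI) (auto simp: block_def fun_eq_iff)

lemma place_lin: "is_linear R (free_mod R r) E (place R c r j)"
proof (rule linI)
  fix y assume y: "y \<in> carrier (free_mod R r)"
  note yc = free_memD[OF y]
  have "finite {i. place R c r j y i \<noteq> \<zero>}"
    by (rule finite_subset[of _ "{..<c + j * r + r}"]) (auto simp: place_def)
  moreover have "place R c r j y i \<in> carrier R" for i using yc by (simp add: place_def)
  ultimately show "place R c r j y \<in> carrier E" by simp
qed (auto simp: place_def fun_eq_iff)

lemma single_lin: "is_linear R (ring_as_mod R) E (single R i)"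
proof (rule linI)
  fix a assume a: "a \<in> carrier (ring_as_mod R)"
  have "finite {k. single R i a k \<noteq> \<zero>}"
    by (rule finite_subset[of _ "{i}"]) (auto simp: single_def)
  then show "single R i a \<in> carrier E" using a by (simp add: single_def)
qed (auto simp: single_def fun_eq_iff)

lemma block_place:
  assumes y: "y \<in> carrier (free_mod R r)"
  shows "block R c r j' (place R c r j y) = (if j' = j then y else \<zero>\<^bsub>free_mod R r\<^esub>)"
proof (cases "j' = j")
  case True
  then show ?thesis using y by (auto simp: block_def place_def fun_eq_iff)
next
  case False
  have "block R c r j' (place R c r j y) i = \<zero>" for i
  proof (cases "i < r")
    case i: True
    \<comment> \<open>Blocks with different indices occupy disjoint ranges of coordinates.\<close>
    have "\<not> (c + j * r \<le> c + j' * r + i \<and> c + j' * r + i < c + j * r + r)"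
    proof (cases "j' < j")
      case True
      then have "Suc j' * r \<le> j * r" by (intro mult_le_mono1) simp
      then show ?thesis using i by simp
    next
      case f: False
      then have "Suc j * r \<le> j' * r" using False by (intro mult_le_mono1) simp
      then show ?thesis by simp
    qed
    then have "place R c r j y (c + j' * r + i) = \<zero>" unfolding place_def by (rule if_not_P)
    then show ?thesis by (simp add: block_def)
  qed (simp add: block_def)
  then show ?thesis using False by (simp add: fun_eq_iff)
qed

lemma block_single: "i < c \<Longrightarrow> block R c r j (single R i a) = \<zero>\<^bsub>free_mod R r\<^esub>"
  by (auto simp: block_def single_def fun_eq_iff)

lemma blockwise_submodule:
  assumes "submodule L R (free_mod R r)"
  shows "submodule (blockwise R c r L) R E"
proof (rule submodI[OF E_module])
  interpret E: module R E by (rule E_module)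
  note L = submodD[OF module_free assms]
  show "blockwise R c r L \<subseteq> carrier E" by (auto simp: blockwise_def)
  show "\<zero>\<^bsub>E\<^esub> \<in> blockwise R c r L"
    unfolding blockwise_def using L(2) lin_zero[OF E_module module_free block_lin] E.M.zero_closed by simp
  show "x \<oplus>\<^bsub>E\<^esub> y \<in> blockwise R c r L" if "x \<in> blockwise R c r L" "y \<in> blockwise R c r L" for x y
  proof -
    have xy: "x \<in> carrier E" "y \<in> carrier E" "\<And>j. block R c r j x \<in> L" "\<And>j. block R c r j y \<in> L"
      using that by (simp_all add: blockwise_def)
    show ?thesis unfolding blockwise_def using E.M.a_closed[OF xy(1,2)] L(3)[OF xy(3,4)] lin_add[OF block_lin xy(1,2)] by simp
  qed
  show "a \<odot>\<^bsub>E\<^esub> x \<in> blockwise R c r L" if a: "a \<in> carrier R" and x: "x \<in> blockwise R c r L" for a x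
  proof -
    have x: "x \<in> carrier E" "\<And>j. block R c r j x \<in> L" using x by (simp_all add: blockwise_def)
    show ?thesis unfolding blockwise_def using E.smult_closed[OF a x(1)] L(4)[OF a x(2)] lin_smult[OF block_lin a x(1)] by simp
  qed
qed

lemma scale_blockwise:
  assumes t: "t \<in> carrier R" and tL: "\<And>y. y \<in> carrier (free_mod R r) \<Longrightarrow> t \<odot>\<^bsub>free_mod R r\<^esub> y \<in> L" and x: "x \<in> carrier E"
  shows "t \<odot>\<^bsub>E\<^esub> x \<in> blockwise R c r L"
  unfolding blockwise_def
  using module.smult_closed[OF E_module t x] tL[OF lin_closed[OF block_lin x]] lin_smult[OF block_lin t x] by simp

lemma submodule_Int:
  assumes "module R V" "submodule H R V" "submodule H' R V"
  shows "submodule (H \<inter> H') R V"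
proof (rule submodI[OF assms(1)])
  note H = submodD[OF assms(1,2)] and H' = submodD[OF assms(1,3)]
  show "H \<inter> H' \<subseteq> carrier V" using H(1) by blast
  show "\<zero>\<^bsub>V\<^esub> \<in> H \<inter> H'" using H(2) H'(2) by blast
  show "x \<oplus>\<^bsub>V\<^esub> y \<in> H \<inter> H'" if "x \<in> H \<inter> H'" "y \<in> H \<inter> H'" for x y using that H(3) H'(3) by blast
  show "a \<odot>\<^bsub>V\<^esub> x \<in> H \<inter> H'" if "a \<in> carrier R" "x \<in> H \<inter> H'" for a x using that H(4) H'(4) by blast
qed

text \<open>Coordinate k is read off, sent through \<open>Z\<close> by b a = s, and placed back; the
  scalar t is needed because a single coordinate vector need not lie in H.\<close>

lemma cut_facs_coordinates:
  assumes H: "submodule H R E" and Z: "module R Z"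
    and a: "is_linear R (ring_as_mod R) Z a" and b: "is_linear R Z (ring_as_mod R) b"
    and ba: "\<And>x. x \<in> carrier R \<Longrightarrow> b (a x) = s \<otimes> x" and s: "s \<in> carrier R" and t: "t \<in> carrier R"
  shows "(\<And>i x. i < k \<Longrightarrow> x \<in> carrier R \<Longrightarrow> t \<odot>\<^bsub>E\<^esub> single R i x \<in> H) \<Longrightarrow>
    \<exists>q. facs q R Z (E\<lparr>carrier := H\<rparr>) (E\<lparr>carrier := H\<rparr>) (\<lambda>x. (s \<otimes> t) \<odot>\<^bsub>E\<^esub> cut R k x)"
proof (induction k)
  case 0
  have "facs 0 R Z (E\<lparr>carrier := H\<rparr>) (E\<lparr>carrier := H\<rparr>) (\<lambda>x. (s \<otimes> t) \<odot>\<^bsub>E\<^esub> cut R 0 x)"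
    using s t by (simp add: cut_def)
  then show ?case by blast
next
  case (Suc k)
  let ?N = "E\<lparr>carrier := H\<rparr>"
  have HE: "H \<subseteq> carrier E" using submodD(1)[OF E_module H] by blast
  note N = submod_module[OF E_module H]
  obtain q where q: "facs q R Z ?N ?N (\<lambda>x. (s \<otimes> t) \<odot>\<^bsub>E\<^esub> cut R k x)"
    using Suc.IH Suc.prems by (meson less_SucI)
  have v: "is_linear R ?N Z (\<lambda>x. a (x k))"
    by (rule lin_comp[OF lin_sub_dom[OF coord_lin HE] a])
  have u: "is_linear R Z ?N (\<lambda>z. t \<odot>\<^bsub>E\<^esub> single R k (b z))"
    by (rule lin_sub_cod[OF lin_scale[OF E_module lin_comp[OF b single_lin] t]])
      (use Suc.prems[of k] lin_closed[OF b] in simp)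
  have "facs (q + 1) R Z ?N ?N (\<lambda>x. (s \<otimes> t) \<odot>\<^bsub>E\<^esub> cut R (Suc k) x)"
  proof (rule facs_cong[OF facs_add[OF N q facs_single[OF N v u]]])
    fix x assume "x \<in> carrier ?N"
    then have "x \<in> carrier E" using HE by auto
    then have xc: "x i \<in> carrier R" for i by simp
    show "(s \<otimes> t) \<odot>\<^bsub>E\<^esub> cut R (Suc k) x = (s \<otimes> t) \<odot>\<^bsub>E\<^esub> cut R k x \<oplus>\<^bsub>?N\<^esub> t \<odot>\<^bsub>E\<^esub> single R k (b (a (x k)))"
      using xc s t by (auto simp: fun_eq_iff cut_def single_def ba less_Suc_eq m_ac)
  qed
  then show ?case by blast
qed

text \<open>The same with whole blocks, for a lattice through which single coordinates may not be
  sent. The hypothesis \<open>start\<close> handles the coordinates before the first block with the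
  same scalar s t, so that the cuts can be added.\<close>

lemma cut_facs_blocks:
  assumes H: "submodule H R E" and Z: "module R Z" and L: "submodule L R (free_mod R r)"
    and HL: "\<And>x j. x \<in> H \<Longrightarrow> block R c r j x \<in> L"
    and a: "is_linear R ((free_mod R r)\<lparr>carrier := L\<rparr>) Z a" and b: "is_linear R Z ((free_mod R r)\<lparr>carrier := L\<rparr>) b"
    and ba: "\<And>x. x \<in> L \<Longrightarrow> b (a x) = s \<odot>\<^bsub>free_mod R r\<^esub> x" and s: "s \<in> carrier R" and t: "t \<in> carrier R"
    and start: "\<exists>q. facs q R Z (E\<lparr>carrier := H\<rparr>) (E\<lparr>carrier := H\<rparr>) (\<lambda>x. (s \<otimes> t) \<odot>\<^bsub>E\<^esub> cut R c x)"
    and tH: "\<And>y j. y \<in> L \<Longrightarrow> t \<odot>\<^bsub>E\<^esub> place R c r j y \<in> H"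
  shows "\<exists>q. facs q R Z (E\<lparr>carrier := H\<rparr>) (E\<lparr>carrier := H\<rparr>) (\<lambda>x. (s \<otimes> t) \<odot>\<^bsub>E\<^esub> cut R (c + j * r) x)"
proof (induction j)
  case 0
  then show ?case using start by simp
next
  case (Suc j)
  let ?N = "E\<lparr>carrier := H\<rparr>" and ?U = "(free_mod R r)\<lparr>carrier := L\<rparr>"
  have HE: "H \<subseteq> carrier E" using submodD(1)[OF E_module H] by blast
  have LF: "L \<subseteq> carrier (free_mod R r)" using submodD(1)[OF module_free L] by blast
  note N = submod_module[OF E_module H]
  obtain q where q: "facs q R Z ?N ?N (\<lambda>x. (s \<otimes> t) \<odot>\<^bsub>E\<^esub> cut R (c + j * r) x)" using Suc.IH by blast
  have v0: "is_linear R ?N ?U (block R c r j)"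
    by (rule lin_sub_cod[OF lin_sub_dom[OF block_lin HE]]) (use HL in simp)
  have v: "is_linear R ?N Z (\<lambda>x. a (block R c r j x))" by (rule lin_comp[OF v0 a])
  have u: "is_linear R Z ?N (\<lambda>z. t \<odot>\<^bsub>E\<^esub> place R c r j (b z))"
    by (rule lin_sub_cod[OF lin_scale[OF E_module lin_comp[OF lin_sub_codD[OF b LF] place_lin] t]])
      (use tH lin_closed[OF b] in simp)
  have "facs (q + 1) R Z ?N ?N (\<lambda>x. (s \<otimes> t) \<odot>\<^bsub>E\<^esub> cut R (c + Suc j * r) x)"
  proof (rule facs_cong[OF facs_add[OF N q facs_single[OF N v u]]])
    fix x assume "x \<in> carrier ?N"
    then have xH: "x \<in> H" by simp
    then have "x \<in> carrier E" using HE by auto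
    then have xc: "x i \<in> carrier R" for i by simp
    have "(s \<otimes> t) \<otimes> cut R (c + Suc j * r) x i = (s \<otimes> t) \<otimes> cut R (c + j * r) x i \<oplus> t \<otimes> place R c r j (s \<odot>\<^bsub>free_mod R r\<^esub> block R c r j x) i" for i
    proof -
      consider "i < c + j * r" | "c + j * r \<le> i" "i < c + j * r + r" | "c + j * r + r \<le> i" by linarith
      then show ?thesis
      proof cases
        case 2
        then have "i - (c + j * r) < r" by linarith
        then show ?thesis using 2 xc s t by (simp add: cut_def place_def block_def m_ac)
      qed (use xc s t in \<open>simp_all add: cut_def place_def block_def m_ac\<close>)
    qed
    then show "(s \<otimes> t) \<odot>\<^bsub>E\<^esub> cut R (c + Suc j * r) x = (s \<otimes> t) \<odot>\<^bsub>E\<^esub> cut R (c + j * r) x \<oplus>\<^bsub>?N\<^esub> t \<odot>\<^bsub>E\<^esub> place R c r j (b (a (block R c r j x)))"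
      unfolding ba[OF HL[OF xH]] by (simp add: fun_eq_iff)
  qed
  then show ?case by blast
qed

lemma facs_lin:
  assumes V: "module R V"
  shows "facs k R Z U V f \<Longrightarrow> module R U \<Longrightarrow> is_linear R U V f"
proof (induction k arbitrary: f)
  case 0
  then show ?case by (intro lin_cong[OF 0(2) lin_const_zero[OF V]]) simp
next
  case (Suc k)
  obtain g u v where *: "facs k R Z U V g" "is_linear R U Z v" "is_linear R Z V u" "\<And>x. x \<in> carrier U \<Longrightarrow> f x = g x \<oplus>\<^bsub>V\<^esub> u (v x)"
    using Suc.prems by auto
  show ?case
    by (rule lin_cong[OF Suc.prems(2) lin_plus[OF V Suc.IH[OF *(1) Suc.prems(2)] lin_comp[OF *(2,3)]] *(4)])
qed

text \<open>Passage from local to global. Different maximal ideals may use different cut positions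
  k', which is harmless because only a bound on the support of the image matters, not its
  value.\<close>

lemma summand_of_local_cuts:
  assumes H: "submodule H R E" and Z: "module R Z"
    and loc: "\<And>m k. maximalideal m R \<Longrightarrow> \<exists>s\<in>carrier R - m. \<exists>k'\<ge>k. \<exists>q.
       facs q R Z (E\<lparr>carrier := H\<rparr>) (E\<lparr>carrier := H\<rparr>) (\<lambda>x. s \<odot>\<^bsub>E\<^esub> cut R k' x)"
  shows "\<exists>P Q. is_linear R (E\<lparr>carrier := H\<rparr>) (dsum_copies Z) P \<and> is_linear R (dsum_copies Z) (E\<lparr>carrier := H\<rparr>) Q \<and>
    (\<forall>x\<in>H. Q (P x) = x)"
proof -
  let ?N = "E\<lparr>carrier := H\<rparr>"
  interpret E: module R E by (rule E_module)
  have HE: "x \<in> carrier E" if "x \<in> H" for x using submodD(1)[OF E_module H that] .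
  note N = submod_module[OF E_module H] and HD = submodD[OF E_module H]
  interpret N: module R ?N by (rule N)
  define supp where "supp = (\<lambda>(x :: nat \<Rightarrow> 'a) k. \<forall>i\<ge>k. x i = \<zero>)"
  have xR: "x i \<in> carrier R" if "x \<in> H" for x i using HE[OF that] by simp
  have glob: "\<exists>q G l. facs q R Z ?N ?N G \<and> (\<forall>x\<in>H. supp x k \<longrightarrow> G x = x) \<and> (\<forall>x\<in>H. supp (G x) l)" for k
  proof -
    \<comment> \<open>The scalars realised on vectors supported below k; an ideal, since maps
      factoring through powers of \<open>Z\<close> can be added and scaled while their supports stay
      bounded.\<close>
    define J where "J = {a \<in> carrier R. \<exists>q G l. facs q R Z ?N ?N G \<and> (\<forall>x\<in>H. supp x k \<longrightarrow> G x = a \<odot>\<^bsub>E\<^esub> x) \<and> (\<forall>x\<in>H. supp (G x) l)}"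
    have JI: "a \<in> J" if a: "a \<in> carrier R" and f: "facs q R Z ?N ?N G"
      and 1: "\<And>x. x \<in> H \<Longrightarrow> supp x k \<Longrightarrow> G x = a \<odot>\<^bsub>E\<^esub> x" and 2: "\<And>x. x \<in> H \<Longrightarrow> supp (G x) l" for a q G l
    proof -
      have "\<forall>x\<in>H. supp x k \<longrightarrow> G x = a \<odot>\<^bsub>E\<^esub> x" "\<forall>x\<in>H. supp (G x) l" using 1 2 by blast+
      then show ?thesis unfolding J_def using a f by blast
    qed
    have J: "submodule J R (ring_as_mod R)"
    proof (rule submodI[OF ring_module])
      show "J \<subseteq> carrier (ring_as_mod R)" by (auto simp: J_def)
      have "facs 0 R Z ?N ?N (\<lambda>x. \<zero>\<^bsub>E\<^esub>)" by simp
      moreover have "\<zero>\<^bsub>E\<^esub> = \<zero> \<odot>\<^bsub>E\<^esub> x" if "x \<in> H" for x using E.smult_l_null[OF HE[OF that]] by simp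
      moreover have "supp \<zero>\<^bsub>E\<^esub> 0" by (simp add: supp_def)
      ultimately have "\<zero> \<in> J" by (intro JI[of \<zero> 0 "\<lambda>x. \<zero>\<^bsub>E\<^esub>" 0]) simp_all
      then show "\<zero>\<^bsub>ring_as_mod R\<^esub> \<in> J" by simp
    next
      fix a b assume "a \<in> J" "b \<in> J"
      then obtain q G l q' G' l' where *: "a \<in> carrier R" "facs q R Z ?N ?N G" "\<forall>x\<in>H. supp x k \<longrightarrow> G x = a \<odot>\<^bsub>E\<^esub> x" "\<forall>x\<in>H. supp (G x) l"
        "b \<in> carrier R" "facs q' R Z ?N ?N G'" "\<forall>x\<in>H. supp x k \<longrightarrow> G' x = b \<odot>\<^bsub>E\<^esub> x" "\<forall>x\<in>H. supp (G' x) l'"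
        unfolding J_def by blast
      have "facs (q + q') R Z ?N ?N (\<lambda>x. G x \<oplus>\<^bsub>?N\<^esub> G' x)" by (rule facs_add[OF N *(2,6)])
      moreover have "G x \<oplus>\<^bsub>?N\<^esub> G' x = (a \<oplus> b) \<odot>\<^bsub>E\<^esub> x" if "x \<in> H" "supp x k" for x
        using *(3,7) that E.smult_l_distr[OF *(1,5) HE[OF that(1)]] by simp
      moreover have "supp (G x \<oplus>\<^bsub>?N\<^esub> G' x) (max l l')" if "x \<in> H" for x
        using *(4,8) that by (simp add: supp_def)
      ultimately have "a \<oplus> b \<in> J" using *(1,5) by (intro JI[of "a \<oplus> b" "q + q'" "\<lambda>x. G x \<oplus>\<^bsub>?N\<^esub> G' x" "max l l'"]) blast+
      then show "a \<oplus>\<^bsub>ring_as_mod R\<^esub> b \<in> J" by simp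
    next
      fix c a assume c: "c \<in> carrier R" and "a \<in> J"
      then obtain q G l where *: "a \<in> carrier R" "facs q R Z ?N ?N G" "\<forall>x\<in>H. supp x k \<longrightarrow> G x = a \<odot>\<^bsub>E\<^esub> x" "\<forall>x\<in>H. supp (G x) l"
        unfolding J_def by blast
      have "facs q R Z ?N ?N (\<lambda>x. c \<odot>\<^bsub>?N\<^esub> G x)"
        by (rule facs_comp[OF N N lin_scale[OF N lin_id c] lin_id *(2)])
      moreover have "c \<odot>\<^bsub>?N\<^esub> G x = (c \<otimes> a) \<odot>\<^bsub>E\<^esub> x" if "x \<in> H" "supp x k" for x
        using *(3) that E.smult_assoc1[OF c *(1) HE[OF that(1)]] by simp
      moreover have "supp (c \<odot>\<^bsub>?N\<^esub> G x) l" if "x \<in> H" for x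
        using *(4) that c by (simp add: supp_def)
      ultimately have "c \<otimes> a \<in> J" using *(1) c by (intro JI[of "c \<otimes> a" q "\<lambda>x. c \<odot>\<^bsub>?N\<^esub> G x" l]) blast+
      then show "c \<odot>\<^bsub>ring_as_mod R\<^esub> a \<in> J" by simp
    qed
    have "\<one> \<in> J"
    proof (rule mem_if_locally_mem[OF ring_module J])
      fix m assume m: "maximalideal m R"
      obtain s k' q where s: "s \<in> carrier R - m" "k' \<ge> k" "facs q R Z ?N ?N (\<lambda>x. s \<odot>\<^bsub>E\<^esub> cut R k' x)"
        using loc[OF m, of k] by blast
      have sc: "s \<in> carrier R" using s(1) by simp
      \<comment> \<open>As k' is at least k, the cut does not alter vectors supported below k, so s
        itself belongs to J.\<close>
      have "cut R k' x = x" if "supp x k" for x using that s(2) by (auto simp: supp_def cut_def fun_eq_iff)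
      moreover have "supp (s \<odot>\<^bsub>E\<^esub> cut R k' x) k'" for x using sc by (simp add: supp_def cut_def)
      ultimately have "s \<in> J" by (intro JI[OF sc s(3)]) simp_all
      then show "\<exists>s\<in>carrier R - m. s \<odot>\<^bsub>ring_as_mod R\<^esub> \<one> \<in> J" using s(1) sc by (intro bexI[of _ s]) simp_all
    qed simp
    then obtain q G l where *: "facs q R Z ?N ?N G" "\<forall>x\<in>H. supp x k \<longrightarrow> G x = \<one> \<odot>\<^bsub>E\<^esub> x" "\<forall>x\<in>H. supp (G x) l"
      unfolding J_def by blast
    have "G x = x" if "x \<in> H" "supp x k" for x using *(2) that E.smult_one[OF HE[OF that(1)]] by simp
    then show ?thesis using *(1,3) by blast
  qed
  have "\<exists>P Q. is_linear R ?N (dsum_copies Z) P \<and> is_linear R (dsum_copies Z) ?N Q \<and> (\<forall>x\<in>carrier ?N. Q (P x) = x)"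
  proof (rule summand_of_exhaustion[OF N Z, where supp = supp])
    show "supp x l" if "supp x k" "k \<le> l" for x k l using that by (auto simp: supp_def)
    show "\<exists>k. supp x k" if "x \<in> carrier ?N" for x
    proof -
      have "x \<in> carrier E" using HE that by simp
      then have "finite {i. x i \<noteq> \<zero>}" by simp
      then obtain k where "\<forall>i\<in>{i. x i \<noteq> \<zero>}. i < k" using finite_nat_set_iff_bounded by blast
      then have "supp x k" unfolding supp_def by (metis mem_Collect_eq not_le)
      then show ?thesis ..
    qed
    show "supp (x \<ominus>\<^bsub>?N\<^esub> y) k" if "x \<in> carrier ?N" "y \<in> carrier ?N" "supp x k" "supp y k" for x y k
    proof -
      have "x \<ominus>\<^bsub>?N\<^esub> y = x \<oplus>\<^bsub>?N\<^esub> (\<ominus> \<one>) \<odot>\<^bsub>?N\<^esub> y" using that by (simp only: N.minus_eq N.neg_smult)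
      then have "x \<ominus>\<^bsub>?N\<^esub> y = x \<oplus>\<^bsub>E\<^esub> (\<ominus> \<one>) \<odot>\<^bsub>E\<^esub> y" by simp
      then show ?thesis using that(3,4) by (simp add: supp_def)
    qed
    fix k
    obtain q G l where *: "facs q R Z ?N ?N G" "\<forall>x\<in>H. supp x k \<longrightarrow> G x = x" "\<forall>x\<in>H. supp (G x) l" using glob by blast
    show "\<exists>G q l. is_linear R ?N ?N G \<and> facs q R Z ?N ?N G \<and> (\<forall>x\<in>carrier ?N. supp x k \<longrightarrow> G x = x) \<and> (\<forall>x\<in>carrier ?N. supp (G x) l)"
      using * facs_lin[OF N *(1) N] by (intro exI[of _ G] exI[of _ q] exI[of _ l]) simp
  qed
  then show ?thesis by simp
qed

text \<open>Positive r is essential: the block with index j starts no earlier than coordinate j, so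
  a vector of finite support meets finitely many nonzero blocks.\<close>

lemma blocks_lin:
  assumes L: "submodule L R (free_mod R r)" and W: "module R W" and p: "is_linear R ((free_mod R r)\<lparr>carrier := L\<rparr>) W p"
    and r: "r > 0" and H: "submodule H R E" and HL: "\<And>x j. x \<in> H \<Longrightarrow> block R c r j x \<in> L"
  shows "is_linear R (E\<lparr>carrier := H\<rparr>) (dsum_copies W) (\<lambda>x j. p (block R c r j x))"
proof -
  let ?N = "E\<lparr>carrier := H\<rparr>" and ?U = "(free_mod R r)\<lparr>carrier := L\<rparr>"
  note U = submod_module[OF module_free L]
  have HE: "H \<subseteq> carrier E" using submodD(1)[OF E_module H] by blast
  have bl: "is_linear R ?N W (\<lambda>x. p (block R c r j x))" for j
    by (rule lin_comp[OF lin_sub_cod[OF lin_sub_dom[OF block_lin HE]] p]) (use HL in simp)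
  show ?thesis
  proof (rule linI)
    fix x assume x: "x \<in> carrier ?N"
    have "finite {i. x i \<noteq> \<zero>}" using x HE by auto
    then obtain k where k: "\<forall>i\<in>{i. x i \<noteq> \<zero>}. i < k" using finite_nat_set_iff_bounded by blast
    have "p (block R c r j x) = \<zero>\<^bsub>W\<^esub>" if "j \<ge> k" for j
    proof -
      have "x (c + j * r + i) = \<zero>" for i
      proof -
        have "j \<le> j * r" using r by simp
        then have "\<not> c + j * r + i < k" using that by linarith
        then show ?thesis using k by blast
      qed
      then have "block R c r j x = \<zero>\<^bsub>?U\<^esub>" by (simp add: block_def fun_eq_iff)
      then show ?thesis using lin_zero[OF U W p] by simp
    qed
    then have "{j. p (block R c r j x) \<noteq> \<zero>\<^bsub>W\<^esub>} \<subseteq> {..<k}" by (auto simp: not_less[symmetric])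
    then have "finite {j. p (block R c r j x) \<noteq> \<zero>\<^bsub>W\<^esub>}" by (rule finite_subset) simp
    then show "(\<lambda>j. p (block R c r j x)) \<in> carrier (dsum_copies W)" using lin_closed[OF bl x] by simp
    show "(\<lambda>j. p (block R c r j (x \<oplus>\<^bsub>?N\<^esub> y))) = (\<lambda>j. p (block R c r j x)) \<oplus>\<^bsub>dsum_copies W\<^esub> (\<lambda>j. p (block R c r j y))"
      if y: "y \<in> carrier ?N" for y
      unfolding lin_add[OF bl x y] dsum_copies_simps(3)[of W] ..
    show "(\<lambda>j. p (block R c r j (a \<odot>\<^bsub>?N\<^esub> x))) = a \<odot>\<^bsub>dsum_copies W\<^esub> (\<lambda>j. p (block R c r j x))"
      if a: "a \<in> carrier R" for a
      unfolding lin_smult[OF bl a x] dsum_copies_simps(4)[of W] ..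
  qed
qed

text \<open>A family in W^(omega) has finite support, so one s clears all its entries at once. The
  numerators are assembled into a vector block by block, and t then moves that vector into the
  second condition \<open>D\<close>.\<close>

lemma blocks_dense:
  assumes L: "submodule L R (free_mod R r)" and W: "module R W" and S: "mult_set R S"
    and p: "loc_map R S ((free_mod R r)\<lparr>carrier := L\<rparr>) W p"
    and r: "r > 0" and t: "t \<in> S" and tD: "\<And>x. x \<in> carrier E \<Longrightarrow> t \<odot>\<^bsub>E\<^esub> x \<in> D" and y: "y \<in> carrier (dsum_copies W)"
  shows "\<exists>s\<in>S. \<exists>x\<in>blockwise R c r L \<inter> D. (\<forall>i<c. x i = \<zero>) \<and> (\<forall>j. p (block R c r j x) = s \<odot>\<^bsub>W\<^esub> y j)"
proof -
  let ?U = "(free_mod R r)\<lparr>carrier := L\<rparr>"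
  interpret W: module R W by (rule W)
  note U = submod_module[OF module_free L] and p = loc_mapD[OF p, unfolded partial_object.simps] and LD = submodD[OF module_free L]
  have p': "\<exists>s\<in>S. \<exists>u\<in>L. s \<odot>\<^bsub>W\<^esub> w = p u" if "w \<in> carrier W" for w using p(3)[OF that] by simp
  have p0: "p \<zero>\<^bsub>free_mod R r\<^esub> = \<zero>\<^bsub>W\<^esub>" using lin_zero[OF U W p(1)] by simp
  have psm: "p (a \<odot>\<^bsub>free_mod R r\<^esub> u) = a \<odot>\<^bsub>W\<^esub> p u" if "a \<in> carrier R" "u \<in> L" for a u
    using lin_smult[OF p(1) that(1), of u] that(2) by simp
  have yW: "y j \<in> carrier W" for j using y by simp
  have fin: "finite {j. y j \<noteq> \<zero>\<^bsub>W\<^esub>}" using y by simp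
  have mul: "\<exists>u\<in>L. (t \<otimes> s) \<odot>\<^bsub>W\<^esub> y j = p u" if h: "s \<in> S" "t \<in> S" "\<exists>u\<in>L. s \<odot>\<^bsub>W\<^esub> y j = p u" for s t j
  proof -
    obtain u where u: "u \<in> L" "s \<odot>\<^bsub>W\<^esub> y j = p u" using h(3) by (elim bexE)
    note sc = mult_setD(1)[OF S h(1)] mult_setD(1)[OF S h(2)]
    have "(t \<otimes> s) \<odot>\<^bsub>W\<^esub> y j = p (t \<odot>\<^bsub>free_mod R r\<^esub> u)" unfolding W.smult_assoc1[OF sc(2,1) yW] u(2) psm[OF sc(2) u(1)] ..
    then show ?thesis using LD(4)[OF sc(2) u(1)] by blast
  qed
  have "\<exists>s\<in>S. \<forall>j\<in>{j. y j \<noteq> \<zero>\<^bsub>W\<^esub>}. \<exists>u\<in>L. s \<odot>\<^bsub>W\<^esub> y j = p u"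
  proof (rule common_denominator[OF S fin])
    show "\<exists>s\<in>S. \<exists>u\<in>L. s \<odot>\<^bsub>W\<^esub> y j = p u" for j by (rule p'[OF yW])
    fix s t j assume *: "s \<in> S" "t \<in> S" "\<exists>u\<in>L. s \<odot>\<^bsub>W\<^esub> y j = p u"
    show "\<exists>u\<in>L. (t \<otimes> s) \<odot>\<^bsub>W\<^esub> y j = p u" by (rule mul[OF *])
    moreover have "t \<otimes> s = s \<otimes> t" by (rule m_comm[OF mult_setD(1)[OF S *(2)] mult_setD(1)[OF S *(1)]])
    ultimately show "\<exists>u\<in>L. (s \<otimes> t) \<odot>\<^bsub>W\<^esub> y j = p u" by simp
  qed
  then obtain s where s: "s \<in> S" "\<And>j. y j \<noteq> \<zero>\<^bsub>W\<^esub> \<Longrightarrow> \<exists>u\<in>L. s \<odot>\<^bsub>W\<^esub> y j = p u" by blast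
  note sc = mult_setD(1)[OF S s(1)] and tc = mult_setD(1)[OF S t]
  \<comment> \<open>Zero entries must be given the zero lift, so that the assembled vector has
    finite support.\<close>
  have "\<forall>j. \<exists>u. u \<in> L \<and> p u = s \<odot>\<^bsub>W\<^esub> y j \<and> (y j = \<zero>\<^bsub>W\<^esub> \<longrightarrow> u = \<zero>\<^bsub>free_mod R r\<^esub>)"
  proof
    fix j
    show "\<exists>u. u \<in> L \<and> p u = s \<odot>\<^bsub>W\<^esub> y j \<and> (y j = \<zero>\<^bsub>W\<^esub> \<longrightarrow> u = \<zero>\<^bsub>free_mod R r\<^esub>)"
    proof (cases "y j = \<zero>\<^bsub>W\<^esub>")
      case True
      then show ?thesis using LD(2) p0 sc by (intro exI[of _ "\<zero>\<^bsub>free_mod R r\<^esub>"]) simp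
    next
      case False
      then obtain u where "u \<in> L" "s \<odot>\<^bsub>W\<^esub> y j = p u" using s(2) by blast
      then show ?thesis using False by (intro exI[of _ u]) simp
    qed
  qed
  from choice[OF this] obtain u where u: "\<And>j. u j \<in> L" "\<And>j. p (u j) = s \<odot>\<^bsub>W\<^esub> y j"
    "\<And>j. y j = \<zero>\<^bsub>W\<^esub> \<Longrightarrow> u j = \<zero>\<^bsub>free_mod R r\<^esub>" by blast
  \<comment> \<open>Quotient and remainder of i - c by r give the block and the position inside it;
    the coordinates before c are set to zero.\<close>
  define z where "z = (\<lambda>i. if i < c then \<zero> else u ((i - c) div r) ((i - c) mod r))"
  have uF: "u j \<in> carrier (free_mod R r)" for j by (rule LD(1)[OF u(1)])
  have bz: "block R c r j z = u j" for j
  proof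
    fix i
    show "block R c r j z i = u j i" using uF[of j] r by (simp add: block_def z_def)
  qed
  have zE: "z \<in> carrier E"
  proof -
    have zc: "z i \<in> carrier R" for i using free_memD[OF uF] by (simp add: z_def)
    obtain B where B: "\<forall>j\<in>{j. y j \<noteq> \<zero>\<^bsub>W\<^esub>}. j < B" using fin finite_nat_set_iff_bounded by blast
    have "i < c + B * r" if "z i \<noteq> \<zero>" for i
    proof (rule ccontr)
      assume "\<not> i < c + B * r"
      then have ge: "B * r \<le> i - c" "\<not> i < c" by linarith+
      have "B \<le> (i - c) div r" using div_le_mono[OF ge(1), of r] r by simp
      then have "y ((i - c) div r) = \<zero>\<^bsub>W\<^esub>" using B by (meson mem_Collect_eq not_le)
      then have "z i = \<zero>" using u(3) ge(2) by (simp add: z_def)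
      then show False using that by simp
    qed
    then have "{i. z i \<noteq> \<zero>} \<subseteq> {..<c + B * r}" by blast
    then have "finite {i. z i \<noteq> \<zero>}" by (rule finite_subset) simp
    then show ?thesis using zc by simp
  qed
  have zC: "z \<in> blockwise R c r L" unfolding blockwise_def using zE u(1) bz by simp
  let ?x = "t \<odot>\<^bsub>E\<^esub> z"
  have "?x \<in> blockwise R c r L \<inter> D"
    using submodD(4)[OF E_module blockwise_submodule[OF L] tc zC] tD[OF zE] by blast
  moreover have "?x i = \<zero>" if "i < c" for i using that tc by (simp add: z_def)
  moreover have "p (block R c r j ?x) = (t \<otimes> s) \<odot>\<^bsub>W\<^esub> y j" for j
    unfolding lin_smult[OF block_lin tc zE] bz psm[OF tc u(1)] u(2) W.smult_assoc1[OF tc sc yW] ..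
  ultimately show ?thesis using mult_setD(3)[OF S t s(1)] by blast
qed

end

section \<open>Summands that are not direct sums of finitely generated modules\<close>

lemma rk_zeroD:
  assumes W: "module R W" and tf: "tfree R W" and rk: "has_rk R W 0"
  shows "carrier W = {\<zero>\<^bsub>W\<^esub>}"
proof -
  interpret W: module R W by (rule W)
  obtain b where b: "loc_map R (nonzeros R) (free_mod R 0) W b" using rk by (auto simp: has_rk_def)
  note b = loc_mapD[OF b]
  have "w = \<zero>\<^bsub>W\<^esub>" if w: "w \<in> carrier W" for w
  proof -
    obtain s x where s: "s \<in> nonzeros R" "x \<in> carrier (free_mod R 0)" "s \<odot>\<^bsub>W\<^esub> w = b x" using b(3)[OF w] by blast
    have "x = \<zero>\<^bsub>free_mod R 0\<^esub>" using s(2) by (simp add: fun_eq_iff)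
    then have "s \<odot>\<^bsub>W\<^esub> w = \<zero>\<^bsub>W\<^esub>" using s(3) lin_zero[OF W.module_free W b(1)] by simp
    then show ?thesis using tfreeD[OF tf _ _ w] s(1) by blast
  qed
  then show ?thesis by blast
qed

text \<open>Away from m the lift is locally R^r, and because r is positive the base ring is a
  coordinate of R^r. So a multiple of the identity of R factors through the lift.\<close>

lemma (in domain) good_lift_factor_ring:
  assumes L: "good_lift R m r M L" and n: "maximalideal n R" "n \<noteq> m" and r: "r > 0"
  shows "\<exists>s\<in>carrier R - n. \<exists>a b. is_linear R (ring_as_mod R) L a \<and> is_linear R L (ring_as_mod R) b \<and>
    (\<forall>x\<in>carrier R. b (a x) = s \<otimes> x)"
proof -
  interpret C: loc_base R "carrier R - n" by (rule loc_base_maximal[OF n(1)])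
  have LM: "module R L" and fg: "fin_gen R L" and tf: "tfree R L"
    and iso: "mod_iso (loc_at R n) (mod_loc_at R L n) (free_mod (loc_at R n) r)"
    using L n torsion_free_iff[of L] unfolding good_lift_def by blast+
  note FA = cring.module_free[OF C.cring_A, of r]
  obtain p where p: "loc_map R (carrier R - n) L (res_mod R (carrier R - n) (free_mod (loc_at R n) r)) p"
    using C.loc_map_of_mod_iso[OF LM FA tf iso] by blast
  obtain s a b where s: "s \<in> carrier R - n" and ab: "is_linear R (free_mod R r) L a" "is_linear R L (free_mod R r) b"
    "\<forall>x\<in>carrier (free_mod R r). b (a x) = s \<odot>\<^bsub>free_mod R r\<^esub> x"
    using local_factor[OF module_free free_fin_gen LM fg C.module_res[OF FA] C.S C.frac_free_loc_map p] by blast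
  define i where "i = (\<lambda>x::'a. \<lambda>k::nat. if k = 0 then x else \<zero>)"
  have i: "is_linear R (ring_as_mod R) (free_mod R r) i"
    by (rule linI) (use r in \<open>auto simp: i_def fun_eq_iff\<close>)
  have q: "is_linear R (free_mod R r) (ring_as_mod R) (\<lambda>z. z 0)" by (rule linI) (use r in auto)
  have "b (a (i x)) 0 = s \<otimes> x" if "x \<in> carrier R" for x
    using ab(3) lin_closed[OF i, of x] that by (simp add: i_def)
  then show ?thesis using s lin_comp[OF i ab(1)] lin_comp[OF ab(2) q] by blast
qed

lemma factor_dsum2:
  assumes A: "module R A" and B: "module R B"
  shows "is_linear R A (dsum2 A B) (\<lambda>x. (x, \<zero>\<^bsub>B\<^esub>))" "is_linear R B (dsum2 A B) (\<lambda>x. (\<zero>\<^bsub>A\<^esub>, x))"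
    "is_linear R (dsum2 A B) A fst" "is_linear R (dsum2 A B) B snd"
proof -
  interpret A: module R A by (rule A)
  interpret B: module R B by (rule B)
  show "is_linear R A (dsum2 A B) (\<lambda>x. (x, \<zero>\<^bsub>B\<^esub>))" "is_linear R B (dsum2 A B) (\<lambda>x. (\<zero>\<^bsub>A\<^esub>, x))"
    "is_linear R (dsum2 A B) A fst" "is_linear R (dsum2 A B) B snd"
    by (rule linI; auto)+
qed

text \<open>At the distinguished maximal ideal \<open>m\<close> of the lattice \<open>L\<close>, truncation after a full block
  factors through \<open>Z\<close>, because both the base ring and \<open>L\<close> do so locally.\<close>

lemma (in domain) local_cuts_at:
  assumes m: "maximalideal m R" and L: "submodule L R (free_mod R r)" and r: "r > 0"
    and D: "submodule D R E" and H: "H = blockwise R c r L \<inter> D" and Z: "module R Z"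
    and tD: "\<exists>t\<in>carrier R - m. \<forall>x\<in>carrier E. t \<odot>\<^bsub>E\<^esub> x \<in> D"
    and fR: "\<exists>s\<in>carrier R - m. \<exists>a b. is_linear R (ring_as_mod R) Z a \<and> is_linear R Z (ring_as_mod R) b \<and>
      (\<forall>x\<in>carrier R. b (a x) = s \<otimes> x)"
    and fL: "\<exists>s\<in>carrier R - m. \<exists>a b. is_linear R ((free_mod R r)\<lparr>carrier := L\<rparr>) Z a \<and>
      is_linear R Z ((free_mod R r)\<lparr>carrier := L\<rparr>) b \<and> (\<forall>x\<in>L. b (a x) = s \<odot>\<^bsub>free_mod R r\<^esub> x)"
  shows "\<exists>s\<in>carrier R - m. \<exists>k'\<ge>k. \<exists>q. facs q R Z (E\<lparr>carrier := H\<rparr>) (E\<lparr>carrier := H\<rparr>) (\<lambda>x. s \<odot>\<^bsub>E\<^esub> cut R k' x)"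
proof -
  interpret E: module R E by (rule E_module)
  note S = mult_set_compl(1)[OF m]
  obtain t where t: "t \<in> carrier R - m" "\<And>x. x \<in> carrier E \<Longrightarrow> t \<odot>\<^bsub>E\<^esub> x \<in> D" using tD by blast
  obtain s a b where s: "s \<in> carrier R - m" and ab: "is_linear R (ring_as_mod R) Z a" "is_linear R Z (ring_as_mod R) b"
      "\<And>x. x \<in> carrier R \<Longrightarrow> b (a x) = s \<otimes> x" using fR by blast
  obtain s' a' b' where s': "s' \<in> carrier R - m" and ab': "is_linear R ((free_mod R r)\<lparr>carrier := L\<rparr>) Z a'"
      "is_linear R Z ((free_mod R r)\<lparr>carrier := L\<rparr>) b'" "\<And>x. x \<in> L \<Longrightarrow> b' (a' x) = s' \<odot>\<^bsub>free_mod R r\<^esub> x" using fL by blast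
  note B = blockwise_submodule[OF L, of c]
  have Hsub: "submodule H R E" unfolding H by (rule submodule_Int[OF E_module B D])
  note BD = submodD[OF E_module B] and DD = submodD[OF E_module D] and LD = submodD[OF module_free L]
  have c: "s \<in> carrier R" "s' \<in> carrier R" "t \<in> carrier R" using s s' t by simp_all
  \<comment> \<open>The factor t alone secures the second condition \<open>D\<close>; the first
    condition holds because vectors and blocks are taken from the lattice.\<close>
  have scaleD: "(u \<otimes> t) \<odot>\<^bsub>E\<^esub> x \<in> D" if "u \<in> carrier R" "x \<in> carrier E" for u x
    unfolding E.smult_assoc1[OF that(1) c(3) that(2)] by (rule DD(4)[OF that(1) t(2)[OF that(2)]])
  have "\<exists>q. facs q R Z (E\<lparr>carrier := H\<rparr>) (E\<lparr>carrier := H\<rparr>) (\<lambda>x. (s \<otimes> (s' \<otimes> t)) \<odot>\<^bsub>E\<^esub> cut R c x)"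
  proof (rule cut_facs_coordinates[OF Hsub Z ab c(1)])
    show "s' \<otimes> t \<in> carrier R" using c by simp
    fix i x assume i: "i < c" and x: "x \<in> carrier R"
    have sE: "single R i x \<in> carrier E" using lin_closed[OF single_lin, of x i] x by simp
    have "single R i x \<in> blockwise R c r L"
      unfolding blockwise_def using sE LD(2) block_single[OF i] by simp
    then have "(s' \<otimes> t) \<odot>\<^bsub>E\<^esub> single R i x \<in> blockwise R c r L" using c by (intro BD(4)) simp_all
    then show "(s' \<otimes> t) \<odot>\<^bsub>E\<^esub> single R i x \<in> H" unfolding H using scaleD[OF c(2) sE] by blast
  qed
  \<comment> \<open>The scalar is reordered: for the initial coordinates s is the factorisation
    constant, for the blocks it is s', and both cuts must carry the same product.\<close>
  then have start: "\<exists>q. facs q R Z (E\<lparr>carrier := H\<rparr>) (E\<lparr>carrier := H\<rparr>) (\<lambda>x. (s' \<otimes> (s \<otimes> t)) \<odot>\<^bsub>E\<^esub> cut R c x)"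
    unfolding m_lcomm[OF c(2,1,3)] .
  have "\<exists>q. facs q R Z (E\<lparr>carrier := H\<rparr>) (E\<lparr>carrier := H\<rparr>) (\<lambda>x. (s' \<otimes> (s \<otimes> t)) \<odot>\<^bsub>E\<^esub> cut R (c + k * r) x)"
  proof (rule cut_facs_blocks[OF Hsub Z L _ ab' c(2) _ start])
    show "s \<otimes> t \<in> carrier R" using c by simp
    show "block R c r j x \<in> L" if "x \<in> H" for x j using that unfolding H blockwise_def by blast
    fix y j assume y: "y \<in> L"
    have yF: "y \<in> carrier (free_mod R r)" by (rule LD(1)[OF y])
    have pE: "place R c r j y \<in> carrier E" by (rule lin_closed[OF place_lin yF])
    have "place R c r j y \<in> blockwise R c r L"
      unfolding blockwise_def using pE y LD(2) block_place[OF yF] by simp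
    then have "(s \<otimes> t) \<odot>\<^bsub>E\<^esub> place R c r j y \<in> blockwise R c r L" using c by (intro BD(4)) simp_all
    then show "(s \<otimes> t) \<odot>\<^bsub>E\<^esub> place R c r j y \<in> H" unfolding H using scaleD[OF c(1) pE] by blast
  qed
  \<comment> \<open>Cutting after k full blocks keeps at least k coordinates.\<close>
  moreover have "k \<le> c + k * r" using r by (simp add: trans_le_add2)
  moreover have "s' \<otimes> (s \<otimes> t) \<in> carrier R - m" by (intro mult_setD(3)[OF S] s s' t)
  ultimately show ?thesis by blast
qed

text \<open>The lifts \<open>Z1\<close>, \<open>Z2\<close> are arbitrary, whereas the interleaved
  submodule is built from lattices obtained anew. The two are compared only at each maximal ideal,
  by \<open>local_factor\<close>, so no global isomorphism between lifts is required.\<close>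

lemma (in domain) exists_bad_summand:
  assumes h: "h_local R" and m1: "maximalideal m1 R" and m2: "maximalideal m2 R" and ne: "m1 \<noteq> m2"
    and M1: "module (loc_at R m1) M1" "fin_gen (loc_at R m1) M1" "indecomposable (loc_at R m1) M1" "torsion_free (loc_at R m1) M1"
      "local_ring (end_ring (loc_at R m1) M1)" "has_rank (loc_at R m1) M1 r1"
    and M2: "module (loc_at R m2) M2" "fin_gen (loc_at R m2) M2" "indecomposable (loc_at R m2) M2" "torsion_free (loc_at R m2) M2"
      "local_ring (end_ring (loc_at R m2) M2)" "has_rank (loc_at R m2) M2 r2"
    and Z1: "good_lift R m1 r1 M1 Z1" and Z2: "good_lift R m2 r2 M2 Z2" and cop: "\<not> coprime r1 r2"
  shows "\<exists>A. direct_summand R (dsum_copies (dsum2 Z1 Z2)) A \<and> \<not> dsum_of_fg R ((dsum_copies (dsum2 Z1 Z2))\<lparr>carrier := A\<rparr>)"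
proof -
  let ?S1 = "carrier R - m1" and ?S2 = "carrier R - m2"
  interpret B1: loc_base R ?S1 by (rule loc_base_maximal[OF m1])
  interpret B2: loc_base R ?S2 by (rule loc_base_maximal[OF m2])
  interpret A1: domain "loc_at R m1" by (rule B1.domain_A)
  interpret A2: domain "loc_at R m2" by (rule B2.domain_A)
  \<comment> \<open>With two localisations in scope these rules make the simplifier search exponentially.\<close>
  note B1.B.S_simps [simp del] B2.B.S_simps [simp del]
  interpret E: module R E by (rule E_module)

  \<comment> \<open>The localised modules, regarded over the base ring\<close>
  let ?W1 = "res_mod R ?S1 M1" and ?W2 = "res_mod R ?S2 M2"
  note W1 = B1.module_res[OF M1(1)] and W2 = B2.module_res[OF M2(1)]
  note d1 = B1.res_divisible[OF M1(1)] and d2 = B2.res_divisible[OF M2(1)]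
  have tfM: "tfree (loc_at R m1) M1" "tfree (loc_at R m2) M2"
    using A1.torsion_free_iff[OF M1(1)] A2.torsion_free_iff[OF M2(1)] M1(4) M2(4) by simp_all
  note tf1 = B1.tfree_res[OF M1(1) tfM(1)] and tf2 = B2.tfree_res[OF M2(1) tfM(2)]
  note rk1 = B1.has_rk_res[OF M1(1) A1.has_rk_of_has_rank[OF M1(1) tfM(1) M1(6)]]
  note rk2 = B2.has_rk_res[OF M2(1) A2.has_rk_of_has_rank[OF M2(1) tfM(2) M2(6)]]
  note le1 = B1.local_end_res[OF M1(1) local_end_of_local_ring[OF M1(1,5)]]
  note le2 = B2.local_end_res[OF M2(1) local_end_of_local_ring[OF M2(1,5)]]
  \<comment> \<open>A torsion-free module of rank zero is zero, while an indecomposable module is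
    nonzero.\<close>
  have r1: "r1 > 0"
  proof (rule ccontr)
    assume "\<not> r1 > 0"
    then have "carrier M1 = {\<zero>\<^bsub>M1\<^esub>}" using rk_zeroD[OF W1 tf1] rk1 by simp
    then show False using M1(3) unfolding indecomposable_def by blast
  qed
  have r2: "r2 > 0"
  proof (rule ccontr)
    assume "\<not> r2 > 0"
    then have "carrier M2 = {\<zero>\<^bsub>M2\<^esub>}" using rk_zeroD[OF W2 tf2] rk2 by simp
    then show False using M2(3) unfolding indecomposable_def by blast
  qed

  \<comment> \<open>The lattices and the interleaved submodule\<close>
  obtain L1 p1 where L1: "submodule L1 R (free_mod R r1)" "loc_map R ?S1 ((free_mod R r1)\<lparr>carrier := L1\<rparr>) ?W1 p1"
      "fin_gen R ((free_mod R r1)\<lparr>carrier := L1\<rparr>)"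
    and aw1: "\<forall>n. maximalideal n R \<and> n \<noteq> m1 \<longrightarrow> (\<exists>t\<in>carrier R - n. \<forall>x\<in>carrier (free_mod R r1). t \<odot>\<^bsub>free_mod R r1\<^esub> x \<in> L1)"
    using lattice_exists[OF h m1 W1 d1 tf1 rk1] B1.fin_gen_res[OF M1(1,2)] unfolding res_mod_simps(1) by (elim exE conjE impE) blast
  obtain L2 p2 where L2: "submodule L2 R (free_mod R r2)" "loc_map R ?S2 ((free_mod R r2)\<lparr>carrier := L2\<rparr>) ?W2 p2"
      "fin_gen R ((free_mod R r2)\<lparr>carrier := L2\<rparr>)"
    and aw2: "\<forall>n. maximalideal n R \<and> n \<noteq> m2 \<longrightarrow> (\<exists>t\<in>carrier R - n. \<forall>x\<in>carrier (free_mod R r2). t \<odot>\<^bsub>free_mod R r2\<^esub> x \<in> L2)"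
    using lattice_exists[OF h m2 W2 d2 tf2 rk2] B2.fin_gen_res[OF M2(1,2)] unfolding res_mod_simps(1) by (elim exE conjE impE) blast
  let ?U1 = "(free_mod R r1)\<lparr>carrier := L1\<rparr>" and ?U2 = "(free_mod R r2)\<lparr>carrier := L2\<rparr>"
  note U1 = submod_module[OF module_free L1(1)] and U2 = submod_module[OF module_free L2(1)]
  \<comment> \<open>The offsets 1 and 0 differ on purpose: coordinate 0 is free at m1 and belongs to
    a block at m2.\<close>
  let ?C1 = "blockwise R 1 r1 L1" and ?C2 = "blockwise R 0 r2 L2"
  note C1 = blockwise_submodule[OF L1(1), of 1] and C2 = blockwise_submodule[OF L2(1), of 0]
  let ?H = "?C1 \<inter> ?C2"
  let ?N = "E\<lparr>carrier := ?H\<rparr>"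
  have H: "submodule ?H R E" by (rule submodule_Int[OF E_module C1 C2])
  note N = submod_module[OF E_module H] and HD = submodD[OF E_module H]
  \<comment> \<open>Away from m1 the first condition costs only a scalar that is locally a unit,
    uniformly in all blocks. Thus at each maximal ideal at most one of the two conditions is
    effective.\<close>
  have sc1: "\<exists>t\<in>carrier R - n. \<forall>x\<in>carrier E. t \<odot>\<^bsub>E\<^esub> x \<in> ?C1" if n: "maximalideal n R" "n \<noteq> m1" for n
  proof -
    obtain t where t: "t \<in> carrier R - n" "\<And>x. x \<in> carrier (free_mod R r1) \<Longrightarrow> t \<odot>\<^bsub>free_mod R r1\<^esub> x \<in> L1"
      using aw1 n by blast
    have tc: "t \<in> carrier R" using t(1) by simp
    have "t \<odot>\<^bsub>E\<^esub> x \<in> ?C1" if "x \<in> carrier E" for x by (rule scale_blockwise[OF tc t(2) that])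
    then show ?thesis using t(1) by blast
  qed
  have sc2: "\<exists>t\<in>carrier R - n. \<forall>x\<in>carrier E. t \<odot>\<^bsub>E\<^esub> x \<in> ?C2" if n: "maximalideal n R" "n \<noteq> m2" for n
  proof -
    obtain t where t: "t \<in> carrier R - n" "\<And>x. x \<in> carrier (free_mod R r2) \<Longrightarrow> t \<odot>\<^bsub>free_mod R r2\<^esub> x \<in> L2"
      using aw2 n by blast
    have tc: "t \<in> carrier R" using t(1) by simp
    have "t \<odot>\<^bsub>E\<^esub> x \<in> ?C2" if "x \<in> carrier E" for x by (rule scale_blockwise[OF tc t(2) that])
    then show ?thesis using t(1) by blast
  qed

  \<comment> \<open>Factorisations through the given lifts\<close>
  have Zm: "module R Z1" "module R Z2" "fin_gen R Z1" "fin_gen R Z2" "torsion_free R Z1" "torsion_free R Z2"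
    "mod_iso (loc_at R m1) (mod_loc_at R Z1 m1) M1" "mod_iso (loc_at R m2) (mod_loc_at R Z2 m2) M2"
    using Z1 Z2 unfolding good_lift_def by blast+
  have tfZ: "tfree R Z1" "tfree R Z2" using torsion_free_iff Zm by blast+
  let ?Z = "dsum2 Z1 Z2"
  have Z: "module R ?Z" by (rule module_dsum2[OF Zm(1,2)])
  note fz = factor_dsum2[OF Zm(1,2)]
  \<comment> \<open>Since n cannot equal both m1 and m2, at least one of the lifts is free at n and
    has the base ring as a local summand.\<close>
  have fR: "\<exists>s\<in>carrier R - n. \<exists>a b. is_linear R (ring_as_mod R) ?Z a \<and> is_linear R ?Z (ring_as_mod R) b \<and>
      (\<forall>x\<in>carrier R. b (a x) = s \<otimes> x)" if n: "maximalideal n R" for n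
  proof (cases "n = m1")
    case False
    obtain s a b where s: "s \<in> carrier R - n" "is_linear R (ring_as_mod R) Z1 a" "is_linear R Z1 (ring_as_mod R) b"
      "\<forall>x\<in>carrier R. b (a x) = s \<otimes> x" using good_lift_factor_ring[OF Z1 n False r1] by blast
    have "\<forall>x\<in>carrier R. b (fst (a x, \<zero>\<^bsub>Z2\<^esub>)) = s \<otimes> x" using s(4) by simp
    then show ?thesis using s(1) lin_comp[OF s(2) fz(1)] lin_comp[OF fz(3) s(3)] by blast
  next
    case True
    then have "n \<noteq> m2" using ne by simp
    then obtain s a b where s: "s \<in> carrier R - n" "is_linear R (ring_as_mod R) Z2 a" "is_linear R Z2 (ring_as_mod R) b"
      "\<forall>x\<in>carrier R. b (a x) = s \<otimes> x" using good_lift_factor_ring[OF Z2 n _ r2] by blast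
    have "\<forall>x\<in>carrier R. b (snd (\<zero>\<^bsub>Z1\<^esub>, a x)) = s \<otimes> x" using s(4) by simp
    then show ?thesis using s(1) lin_comp[OF s(2) fz(2)] lin_comp[OF fz(4) s(3)] by blast
  qed
  have fL1: "\<exists>s\<in>?S1. \<exists>a b. is_linear R ?U1 ?Z a \<and> is_linear R ?Z ?U1 b \<and> (\<forall>x\<in>L1. b (a x) = s \<odot>\<^bsub>free_mod R r1\<^esub> x)"
  proof -
    obtain p where p: "loc_map R ?S1 Z1 ?W1 p" using B1.loc_map_of_mod_iso[OF Zm(1) M1(1) tfZ(1) Zm(7)] by blast
    obtain s a b where s: "s \<in> ?S1" "is_linear R ?U1 Z1 a" "is_linear R Z1 ?U1 b" "\<forall>x\<in>carrier ?U1. b (a x) = s \<odot>\<^bsub>?U1\<^esub> x"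
      using local_factor[OF U1 L1(3) Zm(1,3) W1 B1.S L1(2) p] by blast
    have "\<forall>x\<in>L1. b (fst (a x, \<zero>\<^bsub>Z2\<^esub>)) = s \<odot>\<^bsub>free_mod R r1\<^esub> x" using s(4) by simp
    then show ?thesis using s(1) lin_comp[OF s(2) fz(1)] lin_comp[OF fz(3) s(3)] by blast
  qed
  have fL2: "\<exists>s\<in>?S2. \<exists>a b. is_linear R ?U2 ?Z a \<and> is_linear R ?Z ?U2 b \<and> (\<forall>x\<in>L2. b (a x) = s \<odot>\<^bsub>free_mod R r2\<^esub> x)"
  proof -
    obtain p where p: "loc_map R ?S2 Z2 ?W2 p" using B2.loc_map_of_mod_iso[OF Zm(2) M2(1) tfZ(2) Zm(8)] by blast
    obtain s a b where s: "s \<in> ?S2" "is_linear R ?U2 Z2 a" "is_linear R Z2 ?U2 b" "\<forall>x\<in>carrier ?U2. b (a x) = s \<odot>\<^bsub>?U2\<^esub> x"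
      using local_factor[OF U2 L2(3) Zm(2,4) W2 B2.S L2(2) p] by blast
    have "\<forall>x\<in>L2. b (snd (\<zero>\<^bsub>Z1\<^esub>, a x)) = s \<odot>\<^bsub>free_mod R r2\<^esub> x" using s(4) by simp
    then show ?thesis using s(1) lin_comp[OF s(2) fz(2)] lin_comp[OF fz(4) s(3)] by blast
  qed

  \<comment> \<open>The interleaved submodule as a direct summand\<close>
  have "\<exists>P Q. is_linear R ?N (dsum_copies ?Z) P \<and> is_linear R (dsum_copies ?Z) ?N Q \<and> (\<forall>x\<in>?H. Q (P x) = x)"
  proof (rule summand_of_local_cuts[OF H Z])
    fix n k assume n: "maximalideal n R"
    consider "n = m1" | "n = m2" | "n \<noteq> m1" "n \<noteq> m2" by blast
    then show "\<exists>s\<in>carrier R - n. \<exists>k'\<ge>k. \<exists>q. facs q R ?Z ?N ?N (\<lambda>x. s \<odot>\<^bsub>E\<^esub> cut R k' x)"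
    proof cases
      case 1
      show ?thesis unfolding 1
        by (rule local_cuts_at[OF m1 L1(1) r1 C2 refl Z sc2[OF m1 ne] fR[OF m1] fL1])
    next
      case 2
      show ?thesis unfolding 2
        by (rule local_cuts_at[OF m2 L2(1) r2 C1 Int_commute Z sc1[OF m2 ne[symmetric]] fR[OF m2] fL2])
    next
      \<comment> \<open>Here both conditions become vacuous up to scalars, so single coordinates
        suffice and the cut can be made at k itself.\<close>
      case 3
      obtain t1 where t1: "t1 \<in> carrier R - n" "\<forall>x\<in>carrier E. t1 \<odot>\<^bsub>E\<^esub> x \<in> ?C1" using sc1[OF n 3(1)] by blast
      obtain t2 where t2: "t2 \<in> carrier R - n" "\<forall>x\<in>carrier E. t2 \<odot>\<^bsub>E\<^esub> x \<in> ?C2" using sc2[OF n 3(2)] by blast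
      obtain s a b where s: "s \<in> carrier R - n" "is_linear R (ring_as_mod R) ?Z a" "is_linear R ?Z (ring_as_mod R) b"
         "\<And>x. x \<in> carrier R \<Longrightarrow> b (a x) = s \<otimes> x" using fR[OF n] by blast
      have c: "t1 \<in> carrier R" "t2 \<in> carrier R" "s \<in> carrier R" using t1 t2 s by simp_all
      note S = mult_set_compl(1)[OF n]
      have "\<exists>q. facs q R ?Z ?N ?N (\<lambda>x. (s \<otimes> (t1 \<otimes> t2)) \<odot>\<^bsub>E\<^esub> cut R k x)"
      proof (rule cut_facs_coordinates[OF H Z s(2-4) c(3)])
        show "t1 \<otimes> t2 \<in> carrier R" using c by simp
        fix i x assume "x \<in> carrier R"
        then have sE: "single R i x \<in> carrier E" using lin_closed[OF single_lin, of x i] by simp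
        have "t1 \<odot>\<^bsub>E\<^esub> (t2 \<odot>\<^bsub>E\<^esub> single R i x) \<in> ?C1" using t1(2) E.smult_closed[OF c(2) sE] by blast
        moreover have "t1 \<odot>\<^bsub>E\<^esub> (t2 \<odot>\<^bsub>E\<^esub> single R i x) \<in> ?C2"
          using submodD(4)[OF E_module C2 c(1)] t2(2) sE by blast
        ultimately show "(t1 \<otimes> t2) \<odot>\<^bsub>E\<^esub> single R i x \<in> ?H" unfolding E.smult_assoc1[OF c(1,2) sE] by blast
      qed
      moreover have "s \<otimes> (t1 \<otimes> t2) \<in> carrier R - n" by (intro mult_setD(3)[OF S] s t1 t2)
      ultimately show ?thesis by blast
    qed
  qed
  then obtain P Q where P: "is_linear R ?N (dsum_copies ?Z) P" and Q: "is_linear R (dsum_copies ?Z) ?N Q"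
    and QP: "\<And>x. x \<in> carrier ?N \<Longrightarrow> Q (P x) = x" by auto
  note D = module_dsum_copies[OF Z]
  let ?A = "P ` carrier ?N"
  let ?AM = "(dsum_copies ?Z)\<lparr>carrier := ?A\<rparr>"
  note ds = direct_summandI[where P = P and Q = Q, OF N D P Q QP]
  have "submodule ?A R (dsum_copies ?Z)" using ds(1) unfolding direct_summand_def by blast
  then have AM: "module R ?AM" by (rule submod_module[OF D])
  have HE: "?H \<subseteq> carrier E" using HD(1) by blast
  have tfE: "tfree R E"
  proof (rule tfree_dsum_copies)
    show "tfree R (ring_as_mod R)" unfolding tfree_def using integral by simp
  qed
  have tfN: "tfree R ?N" by (rule tfree_inj[OF N E_module lin_sub_dom[OF lin_id HE] _ tfE]) simp
  have tfA: "tfree R ?AM" by (rule tfree_inj[OF AM N ds(2) bij_betw_imp_inj_on[OF ds(3)] tfN])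
  have b1: "block R 1 r1 j x \<in> L1" and b2: "block R 0 r2 j x \<in> L2" if "x \<in> ?H" for x j
    using that unfolding blockwise_def by blast+
  note p1 = loc_mapD[OF L1(2)] and p2 = loc_mapD[OF L2(2)]
  have p1z: "u = \<zero>\<^bsub>free_mod R r1\<^esub>" if "u \<in> L1" "p1 u = \<zero>\<^bsub>?W1\<^esub>" for u
    using p1(2) that unfolding lin_inj_iff[OF U1 W1 p1(1)] by simp
  have p2z: "u = \<zero>\<^bsub>free_mod R r2\<^esub>" if "u \<in> L2" "p2 u = \<zero>\<^bsub>?W2\<^esub>" for u
    using p2(2) that unfolding lin_inj_iff[OF U2 W2 p2(1)] by simp
  \<comment> \<open>Every coordinate from c on belongs to some block, so vanishing blocks force
    vanishing coordinates there.\<close>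
  have coord0: "x i = \<zero>" if "\<And>j. block R c r j x = \<zero>\<^bsub>free_mod R r\<^esub>" "i \<ge> c" "r > 0" for x :: "nat \<Rightarrow> 'a" and i c r
  proof -
    have "block R c r ((i - c) div r) x ((i - c) mod r) = \<zero>" using that(1) by simp
    moreover have "c + (i - c) div r * r + (i - c) mod r = i" using that(2) by simp
    ultimately show ?thesis using that(3) by (simp add: block_def)
  qed

  \<comment> \<open>Localisation at the second maximal ideal\<close>
  have lm2: "loc_map R ?S2 ?N (dsum_copies ?W2) (\<lambda>x j. p2 (block R 0 r2 j x))"
    unfolding loc_map_def
  proof (intro conjI ballI)
    show lin: "is_linear R ?N (dsum_copies ?W2) (\<lambda>x j. p2 (block R 0 r2 j x))"
      by (rule blocks_lin[OF L2(1) W2 p2(1) r2 H b2])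
    show "inj_on (\<lambda>x j. p2 (block R 0 r2 j x)) (carrier ?N)"
      unfolding lin_inj_iff[OF N module_dsum_copies[OF W2] lin]
    proof (intro ballI impI)
      fix x assume x: "x \<in> carrier ?N" and 0: "(\<lambda>j. p2 (block R 0 r2 j x)) = \<zero>\<^bsub>dsum_copies ?W2\<^esub>"
      have xH: "x \<in> ?H" using x by simp
      have "block R 0 r2 j x = \<zero>\<^bsub>free_mod R r2\<^esub>" for j
        using fun_cong[OF 0, of j] by (intro p2z[OF b2[OF xH]]) simp
      then have "x i = \<zero>" for i using coord0[of 0 r2 x i] r2 by simp
      then show "x = \<zero>\<^bsub>?N\<^esub>" by (simp add: fun_eq_iff)
    qed
    fix y assume y: "y \<in> carrier (dsum_copies ?W2)"
    obtain t where t: "t \<in> ?S2" "\<And>x. x \<in> carrier E \<Longrightarrow> t \<odot>\<^bsub>E\<^esub> x \<in> ?C1" using sc1[OF m2 ne[symmetric]] by blast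
    obtain s x where s: "s \<in> ?S2" "x \<in> ?C2 \<inter> ?C1" "\<forall>j. p2 (block R 0 r2 j x) = s \<odot>\<^bsub>?W2\<^esub> y j"
      using blocks_dense[OF L2(1) W2 B2.S L2(2) r2 t y] by blast
    have "s \<odot>\<^bsub>dsum_copies ?W2\<^esub> y = (\<lambda>j. p2 (block R 0 r2 j x))" unfolding dsum_copies_simps(4)[of ?W2] using s(3) by simp
    moreover have "x \<in> carrier ?N" using s(2) by simp
    ultimately show "\<exists>s\<in>?S2. \<exists>u\<in>carrier ?N. s \<odot>\<^bsub>dsum_copies ?W2\<^esub> y = (\<lambda>j. p2 (block R 0 r2 j u))" using s(1) by blast
  qed

  \<comment> \<open>Localisation at the first maximal ideal\<close>
  let ?K = "B1.K" and ?f = "\<lambda>x. (loc_class (ring_as_mod R) ?S1 (x 0) \<one>, \<lambda>j. p1 (block R 1 r1 j x))"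
  have one: "\<one> \<in> ?S1" by (rule mult_setD(2)[OF B1.S])
  have lin1: "is_linear R ?N (dsum_copies ?W1) (\<lambda>x j. p1 (block R 1 r1 j x))"
    by (rule blocks_lin[OF L1(1) W1 p1(1) r1 H b1])
  have lin0: "is_linear R ?N ?K (\<lambda>x. loc_class (ring_as_mod R) ?S1 (x 0) \<one>)"
  proof -
    have "is_linear R (ring_as_mod R) ?K (\<lambda>a. loc_class (ring_as_mod R) ?S1 a \<one>)"
    proof (rule linI)
      fix a assume a: "a \<in> carrier (ring_as_mod R)"
      show "loc_class (ring_as_mod R) ?S1 a \<one> \<in> carrier ?K"
        unfolding B1.K_simps using a one by simp
      show "loc_class (ring_as_mod R) ?S1 (a \<oplus>\<^bsub>ring_as_mod R\<^esub> b) \<one> = loc_class (ring_as_mod R) ?S1 a \<one> \<oplus>\<^bsub>?K\<^esub> loc_class (ring_as_mod R) ?S1 b \<one>"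
        if "b \<in> carrier (ring_as_mod R)" for b
        unfolding B1.K_simps using a that by (simp add: B1.frac_add1)
      show "loc_class (ring_as_mod R) ?S1 (c \<odot>\<^bsub>ring_as_mod R\<^esub> a) \<one> = c \<odot>\<^bsub>?K\<^esub> loc_class (ring_as_mod R) ?S1 a \<one>"
        if "c \<in> carrier R" for c
        unfolding B1.K_simps using a that by (simp add: B1.frac_mult1)
    qed
    from lin_comp[OF lin_sub_dom[OF coord_lin HE] this] show ?thesis .
  qed
  have linf: "is_linear R ?N (dsum2 ?K (dsum_copies ?W1)) ?f"
  proof (rule linI)
    fix x assume x: "x \<in> carrier ?N"
    show "?f x \<in> carrier (dsum2 ?K (dsum_copies ?W1))"
      unfolding dsum2_simps(1) using lin_closed[OF lin0 x] lin_closed[OF lin1 x] by blast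
    show "?f (x \<oplus>\<^bsub>?N\<^esub> y) = ?f x \<oplus>\<^bsub>dsum2 ?K (dsum_copies ?W1)\<^esub> ?f y" if y: "y \<in> carrier ?N" for y
      unfolding dsum2_simps(3) lin_add[OF lin0 x y] lin_add[OF lin1 x y] fst_conv snd_conv ..
    show "?f (a \<odot>\<^bsub>?N\<^esub> x) = a \<odot>\<^bsub>dsum2 ?K (dsum_copies ?W1)\<^esub> ?f x" if a: "a \<in> carrier R" for a
      unfolding dsum2_simps(4) lin_smult[OF lin0 a x] lin_smult[OF lin1 a x] fst_conv snd_conv ..
  qed
  have KW: "module R (dsum2 ?K (dsum_copies ?W1))" by (rule module_dsum2[OF B1.K_basic(1) module_dsum_copies[OF W1]])
  have lm1: "loc_map R ?S1 ?N (dsum2 ?K (dsum_copies ?W1)) ?f"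
    unfolding loc_map_def
  proof (intro conjI ballI linf)
    show "inj_on ?f (carrier ?N)" unfolding lin_inj_iff[OF N KW linf]
    proof (intro ballI impI)
      fix x assume x: "x \<in> carrier ?N" and 0: "?f x = \<zero>\<^bsub>dsum2 ?K (dsum_copies ?W1)\<^esub>"
      have xH: "x \<in> ?H" using x by simp
      have x0c: "x 0 \<in> carrier R" using HD(1)[OF xH] by simp
      have 01: "loc_class (ring_as_mod R) ?S1 (x 0) \<one> = \<zero>\<^bsub>loc_at R m1\<^esub>" "(\<lambda>j. p1 (block R 1 r1 j x)) = \<zero>\<^bsub>dsum_copies ?W1\<^esub>"
        using 0 unfolding dsum2_simps(2) prod.inject B1.K_simps by blast+
      have x0: "x 0 = \<zero>" using 01(1) B1.frac_zero_iff[OF x0c one] by simp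
      have "block R 1 r1 j x = \<zero>\<^bsub>free_mod R r1\<^esub>" for j
        using fun_cong[OF 01(2), of j] by (intro p1z[OF b1[OF xH]]) simp
      then have "x i = \<zero>" if "i \<ge> 1" for i using coord0[of 1 r1 x i] r1 that by simp
      \<comment> \<open>Coordinate 0 lies in no block here and is controlled by the component in
        \<open>K\<close>.\<close>
      then have "x i = \<zero>" for i using x0 by (cases i) simp_all
      then show "x = \<zero>\<^bsub>?N\<^esub>" by (simp add: fun_eq_iff)
    qed
    fix w assume "w \<in> carrier (dsum2 ?K (dsum_copies ?W1))"
    then obtain k y where w: "w = (k, y)" "k \<in> carrier ?K" "y \<in> carrier (dsum_copies ?W1)" unfolding dsum2_simps(1) by blast
    obtain t where t: "t \<in> ?S1" "\<And>x. x \<in> carrier E \<Longrightarrow> t \<odot>\<^bsub>E\<^esub> x \<in> ?C2" using sc2[OF m1 ne] by blast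
    obtain s x where s: "s \<in> ?S1" "x \<in> ?H" "\<forall>i<1. x i = \<zero>" "\<forall>j. p1 (block R 1 r1 j x) = s \<odot>\<^bsub>?W1\<^esub> y j"
      using blocks_dense[OF L1(1) W1 B1.S L1(2) r1 t w(3)] by blast
    obtain s' a where s': "s' \<in> ?S1" "a \<in> carrier R" "s' \<odot>\<^bsub>?K\<^esub> k = a \<odot>\<^bsub>?K\<^esub> loc_class (ring_as_mod R) ?S1 \<one> \<one>"
      using B1.K_gen(2)[OF w(2)] by blast
    have c: "s \<in> carrier R" "s' \<in> carrier R" "t \<in> carrier R" using s(1) s'(1) t(1) by simp_all
    have xE: "x \<in> carrier E" by (rule HD(1)[OF s(2)])
    \<comment> \<open>The vector carrying the \<open>K\<close>-component. It satisfies the first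
      condition, being zero in all blocks, and t is used to enforce the second.\<close>
    define e where "e = single R 0 a"
    have eE: "e \<in> carrier E" unfolding e_def using lin_closed[OF single_lin, of a 0] s'(2) by simp
    have eC: "e \<in> ?C1" unfolding blockwise_def e_def
      using eE submodD(2)[OF module_free L1(1)] block_single[of 0 1 r1 _ a] unfolding e_def by simp
    \<comment> \<open>With s' k = a and blocks of x equal to s y, the coefficients are balanced so
      that both components of the image are t s' s times those of w: coordinate 0 is s t a, and the
      blocks are t s' s y.\<close>
    let ?z = "(t \<otimes> s') \<odot>\<^bsub>E\<^esub> x \<oplus>\<^bsub>E\<^esub> s \<odot>\<^bsub>E\<^esub> (t \<odot>\<^bsub>E\<^esub> e)"
    have te: "t \<odot>\<^bsub>E\<^esub> e \<in> ?H" using submodD(4)[OF E_module C1 c(3) eC] t(2)[OF eE] by blast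
    have ts: "t \<otimes> s' \<in> carrier R" using c by simp
    have z: "?z \<in> ?H" by (intro HD(3) HD(4) c ts s(2) te)
    have x0: "x 0 = \<zero>" using s(3) by simp
    have z0: "?z 0 = s \<otimes> (t \<otimes> a)" using x0 ts c s'(2) by (simp add: e_def single_def)
    have bz: "block R 1 r1 j ?z = (t \<otimes> s') \<odot>\<^bsub>free_mod R r1\<^esub> block R 1 r1 j x" for j
    proof -
      have be: "block R 1 r1 j e = \<zero>\<^bsub>free_mod R r1\<^esub>" unfolding e_def by (rule block_single) simp
      have "block R 1 r1 j ?z = (t \<otimes> s') \<odot>\<^bsub>free_mod R r1\<^esub> block R 1 r1 j x \<oplus>\<^bsub>free_mod R r1\<^esub> s \<odot>\<^bsub>free_mod R r1\<^esub> (t \<odot>\<^bsub>free_mod R r1\<^esub> \<zero>\<^bsub>free_mod R r1\<^esub>)"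
        unfolding lin_add[OF block_lin E.smult_closed[OF ts xE] E.smult_closed[OF c(1) E.smult_closed[OF c(3) eE]]]
          lin_smult[OF block_lin ts xE] lin_smult[OF block_lin c(1) E.smult_closed[OF c(3) eE]] lin_smult[OF block_lin c(3) eE] be ..
      then show ?thesis using c ts free_memD[OF lin_closed[OF block_lin xE]] by (simp add: fun_eq_iff)
    qed
    let ?q = "t \<otimes> (s' \<otimes> s)"
    have qc: "?q \<in> carrier R" using c by simp
    interpret K: module R ?K by (rule B1.K_basic(1))
    interpret W1: module R ?W1 by (rule W1)
    have "?q \<odot>\<^bsub>?K\<^esub> k = (s \<otimes> t) \<odot>\<^bsub>?K\<^esub> (s' \<odot>\<^bsub>?K\<^esub> k)"
    proof -
      have "?q = (s \<otimes> t) \<otimes> s'" using c by (simp add: m_ac)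
      then show ?thesis using K.smult_assoc1[of "s \<otimes> t" s' k] c w(2) by simp
    qed
    also have "\<dots> = loc_class (ring_as_mod R) ?S1 (?z 0) \<one>"
      unfolding s'(3) unfolding z0 B1.K_simps using c s'(2) by (simp add: B1.frac_mult1 m_assoc)
    finally have 1: "?q \<odot>\<^bsub>?K\<^esub> k = loc_class (ring_as_mod R) ?S1 (?z 0) \<one>" .
    have 2: "?q \<odot>\<^bsub>?W1\<^esub> y j = p1 (block R 1 r1 j ?z)" for j
    proof -
      have yj: "y j \<in> carrier ?W1" using w(3) unfolding dsum_copies_simps(1)[of ?W1] by blast
      have "p1 (block R 1 r1 j ?z) = (t \<otimes> s') \<odot>\<^bsub>?W1\<^esub> p1 (block R 1 r1 j x)"
        unfolding bz using lin_smult[OF p1(1) ts, of "block R 1 r1 j x"] b1[OF s(2)] by simp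
      also have "\<dots> = (t \<otimes> s') \<odot>\<^bsub>?W1\<^esub> (s \<odot>\<^bsub>?W1\<^esub> y j)" using s(4) by simp
      also have "\<dots> = ((t \<otimes> s') \<otimes> s) \<odot>\<^bsub>?W1\<^esub> y j" by (rule W1.smult_assoc1[OF ts c(1) yj, symmetric])
      also have "(t \<otimes> s') \<otimes> s = ?q" using c by (simp add: m_assoc)
      finally show ?thesis ..
    qed
    have "?q \<odot>\<^bsub>dsum2 ?K (dsum_copies ?W1)\<^esub> w = ?f ?z"
      unfolding w(1) dsum2_simps(4) fst_conv snd_conv 1 dsum_copies_simps(4)[of ?W1] 2 ..
    moreover have "?q \<in> ?S1" by (intro mult_setD(3)[OF B1.S] t s s')
    moreover have "?z \<in> carrier ?N" using z by simp
    ultimately show "\<exists>s\<in>?S1. \<exists>u\<in>carrier ?N. s \<odot>\<^bsub>dsum2 ?K (dsum_copies ?W1)\<^esub> w = ?f u" by blast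
  qed
  \<comment> \<open>The obstruction concerns the image of the splitting inside the direct sum;
    composing with its isomorphism onto the interleaved submodule supplies the two dense
    embeddings.\<close>
  have "\<not> dsum_of_fg R ?AM"
    by (rule not_dsum_of_fg[OF AM tfA B1.S B1.zero_notin B2.S B2.zero_notin W1 d1 tf1 le1 rk1
      B1.K_basic(1,2,3) B1.K_local_end[OF m1 refl] B1.K_basic(4) B1.K_gen W2 d2 tf2 le2 rk2
      loc_map_trans[OF N KW B1.S loc_map_bij[OF N B1.S ds(2,3)] lm1]
      loc_map_trans[OF N module_dsum_copies[OF W2] B2.S loc_map_bij[OF N B2.S ds(2,3)] lm2] cop])
  then show ?thesis using ds(1) by blast
qed

text \<open>The second part is obtained for every pair of lifts with the properties of the first
  part, on arbitrary carrier types, and the bad module is found as a summand of a countable direct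
  sum of copies.\<close>

theorem mainTheorem6:
  fixes R :: "('a, 'r) ring_scheme"
    and m1 m2 :: "'a set"
    and M1 :: "(('a \<times> 'a) set, 'c1, 'k1) module_scheme"
    and M2 :: "(('a \<times> 'a) set, 'c2, 'k2) module_scheme"
    and r1 r2 :: nat
  assumes hloc: "h_local R"
    and max1: "maximalideal m1 R" and max2: "maximalideal m2 R" and dist: "m1 \<noteq> m2"
    and mod1: "module (loc_at R m1) M1" and fg1: "fin_gen (loc_at R m1) M1"
    and ind1: "indecomposable (loc_at R m1) M1" and tf1: "torsion_free (loc_at R m1) M1"
    and loc1: "local_ring (end_ring (loc_at R m1) M1)" and rk1: "has_rank (loc_at R m1) M1 r1"
    and mod2: "module (loc_at R m2) M2" and fg2: "fin_gen (loc_at R m2) M2"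
    and ind2: "indecomposable (loc_at R m2) M2" and tf2: "torsion_free (loc_at R m2) M2"
    and loc2: "local_ring (end_ring (loc_at R m2) M2)" and rk2: "has_rank (loc_at R m2) M2 r2"
  shows "(\<exists>X1 :: ('a, nat \<Rightarrow> ('a \<times> 'a) set) module. good_lift R m1 r1 M1 X1)
       \<and> (\<exists>X2 :: ('a, nat \<Rightarrow> ('a \<times> 'a) set) module. good_lift R m2 r2 M2 X2)
       \<and> (\<forall>(X1 :: ('a, 'x1, 'n1) module_scheme) (X2 :: ('a, 'x2, 'n2) module_scheme).
            good_lift R m1 r1 M1 X1 \<and> good_lift R m2 r2 M2 X2 \<and> \<not> coprime r1 r2 \<longrightarrow>
            (\<exists>A. direct_summand R (dsum_copies (dsum2 X1 X2)) A
                 \<and> \<not> dsum_of_fg R ((dsum_copies (dsum2 X1 X2))\<lparr>carrier := A\<rparr>)))"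
proof -
  interpret domain R using hloc by (simp add: h_local_def)
  show ?thesis
  proof (intro conjI allI impI)
    show "\<exists>X1 :: ('a, nat \<Rightarrow> ('a \<times> 'a) set) module. good_lift R m1 r1 M1 X1"
      by (rule good_lift_exists[OF hloc max1 mod1 fg1 ind1 tf1 rk1])
    show "\<exists>X2 :: ('a, nat \<Rightarrow> ('a \<times> 'a) set) module. good_lift R m2 r2 M2 X2"
      by (rule good_lift_exists[OF hloc max2 mod2 fg2 ind2 tf2 rk2])
    fix X1 :: "('a, 'x1, 'n1) module_scheme" and X2 :: "('a, 'x2, 'n2) module_scheme"
    assume "good_lift R m1 r1 M1 X1 \<and> good_lift R m2 r2 M2 X2 \<and> \<not> coprime r1 r2"
    then show "\<exists>A. direct_summand R (dsum_copies (dsum2 X1 X2)) A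
                 \<and> \<not> dsum_of_fg R ((dsum_copies (dsum2 X1 X2))\<lparr>carrier := A\<rparr>)"
      by (intro exists_bad_summand[OF hloc max1 max2 dist mod1 fg1 ind1 tf1 loc1 rk1 mod2 fg2 ind2 tf2 loc2 rk2]) blast+
  qed
qed

end
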